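(* Let $\ell$ be a prime and $n \geq 1$. Let $\sigma$ be an irreducible smooth admissible unramified representation of $G_0 = \mathrm{GL}_{2n}(\mathbb{Q}_\ell)$ admitting a Shalika model, and let $\pi = \mathbf{1}\boxtimes\sigma$ be the representation of $G = \mathrm{GL}_1(\mathbb{Q}_\ell)\times\mathrm{GL}_{2n}(\mathbb{Q}_\ell)$. Then there exists a locally constant compactly supported function $\phi: \tilde G \to \mathbb{Z}$ such that: (1) for every finite-order unramified character $\chi: \mathbb{Q}_\ell^\times \to \mathbb{C}^\times$, every $\xi \in \mathrm{Hom}_H(\pi\boxtimes\chi^{-1}, \mathbb{C})$ and every spherical vector $\varphi \in \pi\boxtimes\chi^{-1}$, \[ \xi(\phi\cdot\varphi) = \frac{\ell^{n^2}}{\ell-1} L(\sigma\otimes\chi, 1/2)^{-1}\,\xi(\varphi); \] (2) $\phi = \sum_{r=0}^n b_r\, \mathrm{ch}((g_r,1)K)$ with $b_r \in \mathbb{Z}$, where $g_r = 1\times\begin{pmatrix}1 & \ell^{-1}X_r\\ 0 & 1\end{pmatrix} \in G$, $X_r = \mathrm{diag}(1,\dots,1,0,\dots,0)$ is the $n\times n$ diagonal matrix with $1$ in its first $r$ entries ($X_0 = 0$), and $K = \mathrm{GL}_1(\mathbb{Z}_\ell)\times\mathrm{GL}_{2n}(\mathbb{Z}_\ell)\times\mathrm{GL}_1(\mathbb{Z}_\ell)$; (3) with $K_1 = \mathrm{GL}_1(\mathbb{Z}_\ell)\times\mathrm{GL}_{2n}(\mathbb{Z}_\ell)\times(1+\ell\mathbb{Z}_\ell)$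 and $V_{1,r} = (g_r,1)K_1(g_r,1)^{-1}\cap H$, the group $V_{1,r}$ is contained in $\mathrm{GL}_1(\mathbb{Z}_\ell)\times\mathrm{GL}_n(\mathbb{Z}_\ell)\times\mathrm{GL}_n(\mathbb{Z}_\ell)$, and \[ (\ell-1)\cdot b_r \cdot [\mathrm{GL}_1(\mathbb{Z}_\ell)\times\mathrm{GL}_n(\mathbb{Z}_\ell)\times\mathrm{GL}_n(\mathbb{Z}_\ell) : V_{1,r}]^{-1} \in \mathbb{Z} \] for all $0\le r\le n$.
   Context: $H = \mathrm{GL}_1(\mathbb{Q}_\ell)\times\mathrm{GL}_n(\mathbb{Q}_\ell)\times\mathrm{GL}_n(\mathbb{Q}_\ell)$, $\tilde G = G\times\mathrm{GL}_1(\mathbb{Q}_\ell)$, and $H$ is embedded in $\tilde G$ by $(\alpha,h_1,h_2)\mapsto(\alpha, \mathrm{diag}(h_1,h_2), \det h_2/\det h_1)$. For a character $\chi$ of $\mathbb{Q}_\ell^\times$, $\pi\boxtimes\chi^{-1}$ is the representation of $\tilde G$ on the space of $\sigma$ with $(\alpha,g,t)$ acting by $\chi(t)^{-1}\sigma(g)$; $\mathrm{Hom}_H$ refers to the restriction to $H$. A spherical vector is one fixed by $K$. A compactly supported locally constant function $f$ on $\tilde G$ acts by $f\cdot v = \int_{\tilde G} f(g)\, g v\, dg$, the Haar measure normalised so that $K$ has volume $1$. Shalika model: let $S_0 \subset G_0$ be the subgroup of matrices $\begin{pmatrix}h & hX\\0&h\end{pmatrix}$ ($h\in\mathrm{GL}_n$,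 $X \in M_n$), $\psi_0$ the standard additive character of $\mathbb{Q}_\ell$ trivial on $\mathbb{Z}_\ell$, $\psi\begin{pmatrix}h&hX\\0&h\end{pmatrix} = \psi_0(\mathrm{tr}X)$; $\sigma$ has a Shalika model if there is a nonzero $G_0$-equivariant map $\sigma\to\mathrm{Ind}_{S_0}^{G_0}\psi$. $L(\sigma\otimes\chi,s)$ is the standard local $L$-factor of $\sigma\otimes(\chi\circ\det)$. *)

theory Defs
  imports
    "HOL-Analysis.Analysis"
    "HOL-Library.Function_Algebras"
    "HOL-Algebra.Coset"
    "Jordan_Normal_Form.Determinant"
begin

section \<open>The field of \<open>\<ell>\<close>-adic numbers\<close>

text \<open>\<open>\<rat>\<^sub>\<ell>\<close> is the completion of \<open>\<rat>\<close> for the \<open>\<ell>\<close>-adic absolute value: a complete field in which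
  \<open>\<rat>\<close> is dense, with \<open>|x| = dist x 0\<close> multiplicative and equal to \<open>\<ell>\<close> to the power \<open>-v(m)\<close> at
  nonzero integers \<open>m\<close>.  This determines the field and its metric up to a unique isometric
  isomorphism; the ultrametric inequality follows from density.\<close>

locale padic_field =
  fixes Q :: "'a::{field_char_0, complete_space} itself" and l :: nat
  assumes prime_l: "prime l"
    and dist_translate: "dist x y = dist (x - y) (0::'a)"
    and dist_mult: "dist (x * y) 0 = dist x 0 * dist y (0::'a)"
    and dist_of_int: "m \<noteq> 0 \<Longrightarrow> dist (of_int m) (0::'a) = (1 / real l) ^ multiplicity (int l) m"
    and dense_rat: "closure (range of_rat) = (UNIV :: 'a set)"

abbreviation Zl :: "'a::{zero, metric_space} set"
  where "Zl \<equiv> cball 0 1"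

definition std_char :: "nat \<Rightarrow> 'a::{field_char_0, metric_space} \<Rightarrow> complex"
  \<comment> \<open>\<open>x \<mapsto> exp (2 \<pi> i {x})\<close>, where the \<open>\<ell>\<close>-adic fractional part \<open>{x} \<in> \<int>[1/\<ell>]\<close> is unique modulo \<open>\<int>\<close>\<close>
  where "std_char l x = cis (2 * pi * of_rat
    (SOME q. (\<exists>a k. q = of_int a / of_nat l ^ k) \<and> x - of_rat q \<in> Zl))"


section \<open>The groups\<close>

definition GL1 :: "'a::field monoid"
  where "GL1 = \<lparr>carrier = UNIV - {0}, monoid.mult = (*), one = 1\<rparr>"

definition GL :: "nat \<Rightarrow> 'a::field mat monoid"
  where "GL m = units_of (ring_mat TYPE('a) m ())"

definition GL1_int :: "'a::{field, metric_space} set"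
  where "GL1_int = {x \<in> carrier GL1. x \<in> Zl \<and> inv\<^bsub>GL1\<^esub> x \<in> Zl}"

definition GL_int :: "nat \<Rightarrow> 'a::{field, metric_space} mat set"
  where "GL_int m = {A \<in> carrier (GL m). elements_mat A \<subseteq> Zl \<and> elements_mat (inv\<^bsub>GL m\<^esub> A) \<subseteq> Zl}"

definition GL1_top :: "'a::{field, metric_space} topology"
  where "GL1_top = top_of_set (carrier GL1)"

definition GL_top :: "nat \<Rightarrow> 'a::{field, metric_space} mat topology"
  \<comment> \<open>the topology of entrywise convergence; inversion is continuous for it\<close>
  where "GL_top m = pullback_topology (carrier (GL m))
    (\<lambda>A. restrict (\<lambda>ij. A $$ ij) ({..<m} \<times> {..<m}))
    (product_topology (\<lambda>_. euclidean) ({..<m} \<times> {..<m}))"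

definition Gt :: "nat \<Rightarrow> (('a::field \<times> 'a mat) \<times> 'a) monoid"
  where "Gt n = (GL1 \<times>\<times> GL (2 * n)) \<times>\<times> GL1"

definition Gt_top :: "nat \<Rightarrow> (('a::{field, metric_space} \<times> 'a mat) \<times> 'a) topology"
  where "Gt_top n = prod_topology (prod_topology GL1_top (GL_top (2 * n))) GL1_top"

definition K_int :: "nat \<Rightarrow> (('a::{field, metric_space} \<times> 'a mat) \<times> 'a) set"
  where "K_int n = (GL1_int \<times> GL_int (2 * n)) \<times> GL1_int"

definition K1_int :: "nat \<Rightarrow> nat \<Rightarrow> (('a::{field, metric_space} \<times> 'a mat) \<times> 'a) set"
  where "K1_int l n = (GL1_int \<times> GL_int (2 * n)) \<times> (\<lambda>x. 1 + of_nat l * x) ` Zl"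

definition H_grp :: "nat \<Rightarrow> ('a::field \<times> 'a mat \<times> 'a mat) monoid"
  where "H_grp n = GL1 \<times>\<times> GL n \<times>\<times> GL n"

definition H_int :: "nat \<Rightarrow> ('a::{field, metric_space} \<times> 'a mat \<times> 'a mat) set"
  where "H_int n = GL1_int \<times> GL_int n \<times> GL_int n"

definition H_emb :: "nat \<Rightarrow> 'a::field \<times> 'a mat \<times> 'a mat \<Rightarrow> ('a \<times> 'a mat) \<times> 'a"
  where "H_emb n = (\<lambda>(a, h1, h2).
    ((a, four_block_mat h1 (0\<^sub>m n n) (0\<^sub>m n n) h2), Determinant.det h2 / Determinant.det h1))"

definition g_elt :: "nat \<Rightarrow> nat \<Rightarrow> nat \<Rightarrow> 'a::field \<times> 'a mat"
  where "g_elt l n r = (1, four_block_mat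
    (1\<^sub>m n) (inverse (of_nat l) \<cdot>\<^sub>m Matrix.mat n n (\<lambda>(i, j). if i = j \<and> i < r then 1 else 0))
    (0\<^sub>m n n) (1\<^sub>m n))"

definition V1 :: "nat \<Rightarrow> nat \<Rightarrow> nat \<Rightarrow> ('a::{field, metric_space} \<times> 'a mat \<times> 'a mat) set"
  \<comment> \<open>the intersection with \<open>H\<close>, as a subset of \<open>H\<close> itself rather than of its image under \<open>H_emb\<close>\<close>
  where "V1 l n r = {h \<in> carrier (H_grp n). H_emb n h \<in>
    ((g_elt l n r, 1) <#\<^bsub>Gt n\<^esub> K1_int l n) #>\<^bsub>Gt n\<^esub> inv\<^bsub>Gt n\<^esub> (g_elt l n r, 1)}"


section \<open>Smooth representations\<close>

text \<open>A complex vector space is given by its type \<open>'v\<close> of vectors and its scalar multiplication.\<close>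

definition group_rep ::
    "(complex \<Rightarrow> 'v::ab_group_add \<Rightarrow> 'v) \<Rightarrow> 'g monoid \<Rightarrow> ('g \<Rightarrow> 'v \<Rightarrow> 'v) \<Rightarrow> bool"
  where "group_rep smul G \<rho> \<longleftrightarrow>
    vector_space smul \<and>
    (\<forall>g\<in>carrier G. Vector_Spaces.linear smul smul (\<rho> g)) \<and>
    (\<forall>v. \<rho> \<one>\<^bsub>G\<^esub> v = v) \<and>
    (\<forall>g\<in>carrier G. \<forall>h\<in>carrier G. \<forall>v. \<rho> (g \<otimes>\<^bsub>G\<^esub> h) v = \<rho> g (\<rho> h v))"

definition fixed_vectors :: "('g \<Rightarrow> 'v \<Rightarrow> 'v) \<Rightarrow> 'g set \<Rightarrow> 'v set"
  where "fixed_vectors \<rho> U = {v. \<forall>u\<in>U. \<rho> u v = v}"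

definition open_subgroup :: "'g monoid \<Rightarrow> 'g topology \<Rightarrow> 'g set \<Rightarrow> bool"
  where "open_subgroup G T U \<longleftrightarrow> subgroup U G \<and> openin T U"

definition smooth_rep :: "'g monoid \<Rightarrow> 'g topology \<Rightarrow> ('g \<Rightarrow> 'v \<Rightarrow> 'v) \<Rightarrow> bool"
  where "smooth_rep G T \<rho> \<longleftrightarrow> (\<forall>v. \<exists>U. open_subgroup G T U \<and> v \<in> fixed_vectors \<rho> U)"

definition admissible_rep ::
    "(complex \<Rightarrow> 'v::ab_group_add \<Rightarrow> 'v) \<Rightarrow> 'g monoid \<Rightarrow> 'g topology \<Rightarrow> ('g \<Rightarrow> 'v \<Rightarrow> 'v) \<Rightarrow> bool"
  where "admissible_rep smul G T \<rho> \<longleftrightarrow>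
    (\<forall>U. open_subgroup G T U \<and> compactin T U \<longrightarrow>
      (\<exists>B. finite B \<and> fixed_vectors \<rho> U \<subseteq> module.span smul B))"

definition irreducible_rep ::
    "(complex \<Rightarrow> 'v::ab_group_add \<Rightarrow> 'v) \<Rightarrow> 'g monoid \<Rightarrow> ('g \<Rightarrow> 'v \<Rightarrow> 'v) \<Rightarrow> bool"
  where "irreducible_rep smul G \<rho> \<longleftrightarrow>
    (\<exists>v::'v. v \<noteq> 0) \<and>
    (\<forall>W. module.subspace smul W \<and> (\<forall>g\<in>carrier G. \<rho> g ` W \<subseteq> W) \<longrightarrow> W = {0} \<or> W = UNIV)"

definition unramified_rep :: "nat \<Rightarrow> ('a::{field, metric_space} mat \<Rightarrow> 'v::zero \<Rightarrow> 'v) \<Rightarrow> bool"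
  where "unramified_rep m \<rho> \<longleftrightarrow> (\<exists>v \<in> fixed_vectors \<rho> (GL_int m). v \<noteq> 0)"

text \<open>Functions on a group \<open>G\<close> are represented by functions vanishing off \<open>carrier G\<close>;
  \<open>smooth_ind G T S \<psi>\<close> is the (unnormalised) smooth induction of the character \<open>\<psi>\<close> of \<open>S\<close>,
  on which \<open>G\<close> acts by right translation.\<close>

definition fun_scale :: "complex \<Rightarrow> ('g \<Rightarrow> complex) \<Rightarrow> 'g \<Rightarrow> complex"
  where "fun_scale c f = (\<lambda>x. c * f x)"

definition right_translate :: "'g monoid \<Rightarrow> 'g \<Rightarrow> ('g \<Rightarrow> complex) \<Rightarrow> 'g \<Rightarrow> complex"
  where "right_translate G y f = (\<lambda>x. if x \<in> carrier G then f (x \<otimes>\<^bsub>G\<^esub> y) else 0)"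

definition smooth_ind ::
    "'g monoid \<Rightarrow> 'g topology \<Rightarrow> 'g set \<Rightarrow> ('g \<Rightarrow> complex) \<Rightarrow> ('g \<Rightarrow> complex) set"
  where "smooth_ind G T S \<psi> = {f.
    (\<forall>x. x \<notin> carrier G \<longrightarrow> f x = 0) \<and>
    (\<forall>s\<in>S. \<forall>x\<in>carrier G. f (s \<otimes>\<^bsub>G\<^esub> x) = \<psi> s * f x) \<and>
    (\<exists>U. open_subgroup G T U \<and> (\<forall>u\<in>U. right_translate G u f = f))}"


section \<open>Shalika models\<close>

definition shalika_elt :: "nat \<Rightarrow> 'a::field mat \<Rightarrow> 'a mat \<Rightarrow> 'a mat"
  where "shalika_elt n h X = four_block_mat h (h * X) (0\<^sub>m n n) h"

definition shalika_group :: "nat \<Rightarrow> 'a::field mat set"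
  where "shalika_group n = {shalika_elt n h X | h X. h \<in> carrier (GL n) \<and> X \<in> carrier_mat n n}"

definition shalika_char :: "nat \<Rightarrow> nat \<Rightarrow> 'a::{field_char_0, metric_space} mat \<Rightarrow> complex"
  where "shalika_char l n s = (THE c. \<exists>h\<in>carrier (GL n). \<exists>X\<in>carrier_mat n n.
    s = shalika_elt n h X \<and> c = std_char l (\<Sum>i<n. X $$ (i, i)))"

definition has_shalika_model ::
    "nat \<Rightarrow> nat \<Rightarrow> (complex \<Rightarrow> 'v::ab_group_add \<Rightarrow> 'v) \<Rightarrow>
     ('a::{field_char_0, metric_space} mat \<Rightarrow> 'v \<Rightarrow> 'v) \<Rightarrow> bool"
  where "has_shalika_model l n smul \<sigma> \<longleftrightarrow> (\<exists>\<Theta>.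
    Vector_Spaces.linear smul fun_scale \<Theta> \<and>
    range \<Theta> \<subseteq> smooth_ind (GL (2 * n)) (GL_top (2 * n)) (shalika_group n) (shalika_char l n) \<and>
    (\<forall>g\<in>carrier (GL (2 * n)). \<forall>v. \<Theta> (\<sigma> g v) = right_translate (GL (2 * n)) g (\<Theta> v)) \<and>
    (\<exists>v. \<Theta> v \<noteq> 0))"


section \<open>The standard \<open>L\<close>-factor\<close>

definition unramified_char :: "('a::{field, metric_space} \<Rightarrow> complex) \<Rightarrow> bool"
  \<comment> \<open>smoothness is automatic: \<open>GL1_int\<close> is open\<close>
  where "unramified_char \<omega> \<longleftrightarrow> \<omega> \<in> hom GL1 GL1 \<and> (\<forall>u\<in>GL1_int. \<omega> u = 1)"

definition finite_order_char :: "('a::field \<Rightarrow> complex) \<Rightarrow> bool"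
  where "finite_order_char \<omega> \<longleftrightarrow> (\<exists>k>0. \<forall>x\<in>carrier GL1. \<omega> x ^ k = 1)"

definition borel_subgroup :: "nat \<Rightarrow> 'a::field mat set"
  where "borel_subgroup m = {b \<in> carrier (GL m). upper_triangular b}"

text \<open>Normalised induction of \<open>\<mu>\<^sub>0 \<otimes> \<dots> \<otimes> \<mu>\<^sub>m\<^sub>-\<^sub>1\<close>: the absolute values form the square root of the
  modulus character of the Borel subgroup (the rows are numbered from \<open>0\<close>).\<close>

definition principal_series ::
    "nat \<Rightarrow> (nat \<Rightarrow> 'a::{field, metric_space} \<Rightarrow> complex) \<Rightarrow> ('a mat \<Rightarrow> complex) set"
  where "principal_series m \<mu> = smooth_ind (GL m) (GL_top m) (borel_subgroup m)
    (\<lambda>b. \<Prod>i<m. \<mu> i (b $$ (i, i)) *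
      of_real (dist (b $$ (i, i)) 0 powr ((real m - 1 - 2 * real i) / 2)))"

definition subquotient_of_principal_series ::
    "nat \<Rightarrow> (complex \<Rightarrow> 'v::ab_group_add \<Rightarrow> 'v) \<Rightarrow> ('a::{field, metric_space} mat \<Rightarrow> 'v \<Rightarrow> 'v) \<Rightarrow>
     (nat \<Rightarrow> 'a \<Rightarrow> complex) \<Rightarrow> bool"
  \<comment> \<open>\<open>\<rho>\<close> is the image of a subrepresentation \<open>W\<close>; only the values of \<open>\<Theta>\<close> on \<open>W\<close> matter\<close>
  where "subquotient_of_principal_series m smul \<rho> \<mu> \<longleftrightarrow> (\<exists>W \<Theta>.
    W \<subseteq> principal_series m \<mu> \<and> module.subspace fun_scale W \<and>
    (\<forall>g\<in>carrier (GL m). right_translate (GL m) g ` W \<subseteq> W) \<and>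
    Vector_Spaces.linear fun_scale smul \<Theta> \<and> \<Theta> ` W = UNIV \<and>
    (\<forall>g\<in>carrier (GL m). \<forall>f\<in>W. \<Theta> (right_translate (GL m) g f) = \<rho> g (\<Theta> f)))"

text \<open>An irreducible unramified \<open>\<rho>\<close> is a subquotient of the principal series of unramified characters
  \<open>\<mu>\<^sub>i\<close>, unique up to permutation, and its \<open>L\<close>-factor is the product of the \<open>L(\<mu>\<^sub>i, s)\<close>.
  The definition is meant for such \<open>\<rho>\<close> only.  As \<open>inverse 0 = 0\<close>, the value at a pole is \<open>0\<close>,
  so that \<open>inverse (L_factor \<dots>)\<close> is the polynomial in \<open>\<ell>\<close> to the power \<open>-s\<close> everywhere.\<close>

definition L_factor ::
    "nat \<Rightarrow> nat \<Rightarrow> (complex \<Rightarrow> 'v::ab_group_add \<Rightarrow> 'v) \<Rightarrow>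
     ('a::{field, metric_space} mat \<Rightarrow> 'v \<Rightarrow> 'v) \<Rightarrow> complex \<Rightarrow> complex"
  where "L_factor l m smul \<rho> s =
    (let \<mu> = (SOME \<mu>. (\<forall>i<m. unramified_char (\<mu> i)) \<and> subquotient_of_principal_series m smul \<rho> \<mu>)
     in \<Prod>i<m. inverse (1 - \<mu> i (of_nat l) * of_nat l powr (- s)))"

definition twist ::
    "(complex \<Rightarrow> 'v \<Rightarrow> 'v) \<Rightarrow> ('a::field mat \<Rightarrow> 'v \<Rightarrow> 'v) \<Rightarrow> ('a \<Rightarrow> complex) \<Rightarrow> 'a mat \<Rightarrow> 'v \<Rightarrow> 'v"
  where "twist smul \<sigma> \<omega> g v = smul (\<omega> (Determinant.det g)) (\<sigma> g v)"


section \<open>Representations of \<open>GL\<^sub>1 \<times> GL\<^sub>2\<^sub>n \<times> GL\<^sub>1\<close>\<close>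

definition triv_box :: "('a mat \<Rightarrow> 'v \<Rightarrow> 'v) \<Rightarrow> 'a \<times> 'a mat \<Rightarrow> 'v \<Rightarrow> 'v"
  where "triv_box \<sigma> = (\<lambda>(a, g). \<sigma> g)"

definition box_inv_char ::
    "(complex \<Rightarrow> 'v \<Rightarrow> 'v) \<Rightarrow> ('g \<Rightarrow> 'v \<Rightarrow> 'v) \<Rightarrow> ('a \<Rightarrow> complex) \<Rightarrow> 'g \<times> 'a \<Rightarrow> 'v \<Rightarrow> 'v"
  where "box_inv_char smul \<pi> \<omega> = (\<lambda>(g, t) v. smul (inverse (\<omega> t)) (\<pi> g v))"

definition Hom_H ::
    "nat \<Rightarrow> (complex \<Rightarrow> 'v::ab_group_add \<Rightarrow> 'v) \<Rightarrow> (('a::field \<times> 'a mat) \<times> 'a \<Rightarrow> 'v \<Rightarrow> 'v) \<Rightarrow>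
     ('v \<Rightarrow> complex) set"
  where "Hom_H n smul \<tau> = {\<xi>. Vector_Spaces.linear smul (*) \<xi> \<and>
    (\<forall>h\<in>carrier (H_grp n). \<forall>v. \<xi> (\<tau> (H_emb n h) v) = \<xi> v)}"

definition haar_measure :: "'g monoid \<Rightarrow> 'g topology \<Rightarrow> 'g set \<Rightarrow> 'g measure \<Rightarrow> bool"
  \<comment> \<open>for a compact open subgroup \<open>C\<close>: finiteness on compact sets follows from the normalisation\<close>
  where "haar_measure G T C \<mu> \<longleftrightarrow>
    space \<mu> = carrier G \<and> sets \<mu> = sigma_sets (carrier G) {U. openin T U} \<and>
    (\<forall>g\<in>carrier G. \<forall>A\<in>sets \<mu>. emeasure \<mu> (g <#\<^bsub>G\<^esub> A) = emeasure \<mu> A) \<and>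
    emeasure \<mu> C = 1"

text \<open>The integral over the group of the locally constant, compactly supported function
  \<open>g \<mapsto> f g \<cdot> \<tau> g v\<close>, which takes only finitely many values \<open>w\<close>.\<close>

definition hecke_act ::
    "(complex \<Rightarrow> 'v::ab_group_add \<Rightarrow> 'v) \<Rightarrow> 'g measure \<Rightarrow> ('g \<Rightarrow> 'v \<Rightarrow> 'v) \<Rightarrow> ('g \<Rightarrow> int) \<Rightarrow> 'v \<Rightarrow> 'v"
  where "hecke_act smul \<mu> \<tau> f v = (let F = (\<lambda>g. smul (of_int (f g)) (\<tau> g v)) in
    \<Sum>w \<in> F ` space \<mu> - {0}. smul (of_real (measure \<mu> {g \<in> space \<mu>. F g = w})) w)"

definition loc_const_compact_supp :: "'g topology \<Rightarrow> ('g \<Rightarrow> int) \<Rightarrow> bool"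
  where "loc_const_compact_supp T f \<longleftrightarrow>
    continuous_map T (discrete_topology UNIV) f \<and>
    compactin T (T closure_of {g \<in> topspace T. f g \<noteq> 0})"

end

theory Submission
 imports Defs "HOL-Computational_Algebra.Fundamental_Theorem_Algebra"
begin

text \<open>Let \<open>q = \<ell>\<close>, let \<open>\<sigma>'\<close> be the twist of \<open>\<sigma>\<close> by \<open>\<chi>\<close>, and let \<open>T\<^sub>k\<close> be the sum over the Hermite normal forms \<open>g\<close> with
 \<open>k\<close> diagonal entries \<open>\<ell>\<close>, the others being \<open>1\<close>.  Computing \<open>T\<^sub>k\<close> in the principal series shows that the alternating sum of
 the \<open>T\<^sub>k\<close> with weights \<open>q\<close> to the power \<open>-k/2 - k (2n - k) / 2\<close> multiplies a spherical vector of \<open>\<sigma>'\<close> by the inverse of the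
 \<open>L\<close>-value.  A Hermite normal form is \<open>diag(A, D) u(C/\<ell>)\<close> with \<open>u(X)\<close> upper unipotent, so an invariant functional sees only
 \<open>det D\<close> and the rank of \<open>C\<close> modulo \<open>\<ell>\<close>.  Counting the \<open>C\<close> of each rank, the terms with \<open>D\<close> of given determinant
 sum to \<open>0\<close> unless \<open>det D = 1\<close>, and what is left is a combination of the translates by \<open>g\<^sub>r\<close> whose coefficients are multiples of
 the number \<open>N\<^sub>r\<close> of \<open>n\<close> by \<open>n\<close> matrices of rank \<open>r\<close> over the residue field.  The cosets of \<open>V1\<close> are classified by
 \<open>h\<^sub>1\<^sup>-\<^sup>1 X\<^sub>r h\<^sub>2\<close> and \<open>det h\<^sub>2 / det h\<^sub>1\<close> modulo \<open>\<ell>\<close>, so that the index is \<open>N\<^sub>r (\<ell> - 1)\<close> for \<open>r < n\<close> and \<open>N\<^sub>n\<close> for \<open>r = n\<close>.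

 The Satake parameters of \<open>\<sigma>'\<close> exist because the commuting \<open>T\<^sub>k\<close> have a common eigenvector in the finite-dimensional space of
 spherical vectors, and a bi-invariant function is determined by its \<open>T\<^sub>k\<close>-eigenvalues.\<close>

text \<open>A functional invariant for \<open>\<sigma>\<close> picks up
  \<open>\<omega>(det h2) / \<omega>(det h1)\<close> under \<open>diag(h1, h2)\<close>; the twist
  multiplies this by \<open>\<omega>(det h1) \<omega>(det h2)\<close>, so only \<open>det h2\<close>
  is seen. If \<open>det D = q^b\<close> with \<open>b\<close> positive, \<open>C\<close> has at
  most \<open>n - b\<close> nonzero columns, while the weighted sum over the row sets of
  \<open>C\<close> produces for rank \<open>r\<close> the product of the
  \<open>1 - q^(b - 1 - i)\<close> with \<open>i < n - r\<close>: one factor is 0 for every rank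
  that occurs. For \<open>b = 0\<close> the factors are \<open>1 - q^(-1 - i)\<close>; their
  denominators are the reason for \<open>q^(n^2)\<close> in the constant. The denominator
  \<open>q - 1\<close> is met by the factor at \<open>i = 0\<close> if \<open>r < n\<close>, and by
  the number of invertible matrices if \<open>r = n\<close>. As \<open>L_factor\<close> chooses its
  characters arbitrarily, the Hecke eigenvalues are computed from any principal series that has
  \<open>\<sigma>'\<close> as a subquotient. The projection to spherical vectors is an average over
  orbits of the integral group, which are finite by smoothness. Commutativity of the Hecke operators
  is Gelfand's transposition argument, carried out by counting cosets.\<close>

abbreviation mdet :: "'b::comm_ring_1 mat => 'b" where "mdet \<equiv> Determinant.det"

abbreviation GLc :: "nat => 'b::field mat set" where "GLc m \<equiv> carrier (GL m)"

section \<open>The absolute value and its residue field\<close>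

context padic_field
begin

abbreviation vn :: "'a => real" where "vn x \<equiv> dist x 0"

lemma vn_0 [simp]: "vn 0 = 0" by simp

lemma vn_eq_0 [simp]: "vn x = 0 \<longleftrightarrow> x = 0" by simp

lemma dist_vn: "dist x y = vn (x - y)" using dist_translate by blast

lemma l_gt_1: "l > 1" using prime_l prime_gt_1_nat by blast

lemma l_pos: "real l > 0" using l_gt_1 by simp

lemma vn_1 [simp]: "vn 1 = 1"
 using dist_of_int[of 1] by simp

lemma vn_mult: "vn (x * y) = vn x * vn y" by (rule dist_mult)

lemma vn_neg_1: "vn (- 1) = 1"
proof -
 have "vn (-1) * vn (-1) = 1" using vn_mult[of "-1" "-1"] by simp
 moreover have "vn (-1) \<ge> 0" by simp
 ultimately show ?thesis by (metis abs_of_nonneg power2_eq_square real_sqrt_abs real_sqrt_one)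
qed

lemma vn_minus [simp]: "vn (- x) = vn x"
 using vn_mult[of "-1" x] vn_neg_1 by simp

lemma vn_diff_commute: "vn (x - y) = vn (y - x)"
 by (metis minus_diff_eq vn_minus)

lemma vn_inverse: "vn (inverse x) = inverse (vn x)"
proof (cases "x = 0")
 case False
 then have "vn x * vn (inverse x) = 1" using vn_mult[of x "inverse x"] by simp
 then show ?thesis using inverse_unique by metis
qed simp

lemma vn_divide: "vn (x / y) = vn x / vn y"
 by (simp add: field_class.field_divide_inverse vn_mult vn_inverse)

lemma vn_power: "vn (x ^ k) = vn x ^ k"
 by (induction k) (auto simp: vn_mult)

lemma vn_prod: "vn (prod f A) = (\<Prod>i\<in>A. vn (f i))"
 by (induction A rule: infinite_finite_induct) (auto simp: vn_mult)

lemma vn_triangle: "vn (x + y) \<le> vn x + vn y"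
proof -
 have "dist (x + y) 0 \<le> dist (x + y) y + dist y 0" by (rule dist_triangle)
 then show ?thesis using dist_vn[of "x+y" y] by simp
qed

lemma vn_of_int_le: "vn (of_int m) \<le> 1"
proof (cases "m = 0")
 case False
 have "(1 / real l) ^ multiplicity (int l) m \<le> 1" by (rule power_le_one) (use l_gt_1 in auto)
 then show ?thesis using dist_of_int[OF False] by simp
qed simp

lemma prime_int_l: "prime (int l)" using prime_l by simp

lemma vn_of_int_less_1: "vn (of_int m) < 1 \<longleftrightarrow> int l dvd m"
proof (cases "m = 0")
 case False
 have nu: "\<not> is_unit (int l)" using prime_int_l not_prime_unit by blast
 have "multiplicity (int l) m > 0 \<longleftrightarrow> int l dvd m"
  using False nu by (metis multiplicity_eq_zero_iff neq0_conv)
 moreover have "(1 / real l) ^ k < 1 \<longleftrightarrow> k > 0" for k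
  using l_gt_1 power_Suc_less_one[of "1 / real l" "k - 1"] by (cases k) auto
 ultimately show ?thesis using dist_of_int[OF False] by simp
qed simp

text \<open>The ultrametric inequality starts here from divisibility, extends to fractions over a
  common denominator, and reaches the whole field by density. The degenerate cases are split off
  because \<open>dist_of_int\<close> speaks of nonzero integers only.\<close>

lemma vn_of_int_add: "vn (of_int a + of_int b) \<le> max (vn (of_int a)) (vn (of_int b))"
proof (cases "a = 0 \<or> b = 0 \<or> a + b = 0")
 case False
 let ?m = "multiplicity (int l)"
 have nu: "\<not> is_unit (int l)" using prime_int_l not_prime_unit by blast
 have "int l ^ min (?m a) (?m b) dvd a + b"
  by (intro dvd_add) (metis min.cobounded1 min.cobounded2 multiplicity_dvd')+
 then have "min (?m a) (?m b) \<le> ?m (a + b)"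
  using False nu by (intro multiplicity_geI) auto
 then have "(1 / real l) ^ ?m (a + b) \<le> (1 / real l) ^ min (?m a) (?m b)"
  using l_gt_1 by (intro power_decreasing) auto
 also have "\<dots> \<le> max ((1 / real l) ^ ?m a) ((1 / real l) ^ ?m b)"
  by (cases "?m a \<le> ?m b") (auto simp: min_def)
 finally show ?thesis using False dist_of_int[of a] dist_of_int[of b] dist_of_int[of "a + b"]
  by simp
qed (auto simp: max_def simp flip: of_int_add)

lemma vn_of_rat_add: "vn (of_rat p + of_rat q) \<le> max (vn (of_rat p)) (vn (of_rat q))"
proof -
 obtain a b where p: "p = of_int a / of_int b" "b \<noteq> 0"
  by (metis quotient_of_div less_irrefl quotient_of_denom_pos surj_pair)
 obtain c d where q: "q = of_int c / of_int d" "d \<noteq> 0"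
  by (metis quotient_of_div less_irrefl quotient_of_denom_pos surj_pair)
 have P: "(of_rat p :: 'a) = of_int (a * d) / of_int (b * d)" using p q by (simp add: of_rat_divide)
 have Q: "(of_rat q :: 'a) = of_int (c * b) / of_int (b * d)" using p q by (simp add: of_rat_divide)
 have "(of_rat p + of_rat q :: 'a) = (of_int (a * d) + of_int (c * b)) / of_int (b * d)"
  unfolding P Q by (simp add: add_divide_distrib)
 then have "vn (of_rat p + of_rat q) = vn (of_int (a * d) + of_int (c * b)) / vn (of_int (b * d))"
  by (simp add: vn_divide)
 also have "\<dots> \<le> max (vn (of_int (a * d))) (vn (of_int (c * b))) / vn (of_int (b * d))"
  by (intro divide_right_mono vn_of_int_add) auto
 also have "\<dots> = max (vn (of_rat p)) (vn (of_rat q))"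
  unfolding P Q vn_divide by (simp add: max_def divide_le_cancel not_le)
 finally show ?thesis .
qed

lemma rat_approx: "e > 0 ==> \<exists>q. vn (x - of_rat q) < e"
proof -
 assume e: "e > 0"
 have "x \<in> closure (range of_rat)" using dense_rat by simp
 then obtain y where "y \<in> range of_rat" "dist y x < e" using e closure_approachable by blast
 then show ?thesis using dist_vn[of x y] dist_commute by (metis image_iff)
qed

text \<open>Density: replacing \<open>x\<close> and \<open>y\<close> by rationals at distance below
  \<open>e / 4\<close> costs at most \<open>e / 2\<close> on the left and \<open>e / 4\<close> on
  the right.\<close>

lemma vn_add: "vn (x + y) \<le> max (vn x) (vn y)"
proof (rule field_le_epsilon)
 fix e :: real assume e: "e > 0"
 obtain p where p: "vn (x - of_rat p) < e / 4" using rat_approx[of "e/4" x] e by auto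
 obtain q where q: "vn (y - of_rat q) < e / 4" using rat_approx[of "e/4" y] e by auto
 have "vn (x + y) \<le> vn (of_rat p + of_rat q) + vn ((x - of_rat p) + (y - of_rat q))"
  using vn_triangle[of "of_rat p + of_rat q" "(x - of_rat p) + (y - of_rat q)"] by (simp add: algebra_simps)
 moreover have "vn ((x - of_rat p) + (y - of_rat q)) \<le> e / 2"
  using vn_triangle[of "x - of_rat p" "y - of_rat q"] p q by simp
 moreover have "vn (of_rat p) \<le> vn x + e / 4"
  using vn_triangle[of x "of_rat p - x"] p vn_diff_commute[of x "of_rat p"] by simp
 moreover have "vn (of_rat q) \<le> vn y + e / 4"
  using vn_triangle[of y "of_rat q - y"] q vn_diff_commute[of y "of_rat q"] by simp
 moreover note vn_of_rat_add[of p q]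
 ultimately show "vn (x + y) \<le> max (vn x) (vn y) + e"
  using e by linarith
qed

lemma vn_diff: "vn (x - y) \<le> max (vn x) (vn y)"
 using vn_add[of x "- y"] by simp

lemma vn_sum_le: "(\<And>i. i \<in> A ==> vn (f i) \<le> r) ==> 0 \<le> r ==> vn (sum f A) \<le> r"
proof (induction A rule: infinite_finite_induct)
 case (insert x F)
 then show ?case using vn_add[of "f x" "sum f F"] by fastforce
qed auto

lemma vn_sum_less: "(\<And>i. i \<in> A ==> vn (f i) < r) ==> 0 < r ==> vn (sum f A) < r"
proof (induction A rule: infinite_finite_induct)
 case (insert x F)
 then show ?case using vn_add[of "f x" "sum f F"] by fastforce
qed auto

lemma vn_add_eq: "vn y < vn x ==> vn (x + y) = vn x"
 using vn_add[of x y] vn_add[of "x + y" "- y"] by (auto simp: max_def split: if_splits)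

lemma vn_l: "vn (of_nat l) = 1 / l"
proof -
 have "multiplicity (int l) (int l) = 1"
  using prime_int_l by (simp add: multiplicity_self prime_gt_0_int)
 then show ?thesis using dist_of_int[of "int l"] l_gt_1 by simp
qed

lemma of_nat_l_nonzero [simp]: "(of_nat l :: 'a) \<noteq> 0" using l_gt_1 by simp

section \<open>Congruence modulo the maximal ideal, digits and residues\<close>

definition cong_l :: "'a => 'a => bool" where "cong_l x y \<longleftrightarrow> vn (x - y) < 1"

lemma vn_of_nat_le: "vn (of_nat m) \<le> 1"
 using vn_of_int_le[of "int m"] by simp

text \<open>In lowest terms \<open>l\<close> cannot divide the denominator, as the fraction would
  then have absolute value above 1. A Bezout inverse \<open>u\<close> of the denominator modulo
  \<open>l\<close> gives the residue \<open>a * u\<close>.\<close>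

lemma residue_rat:
 assumes "vn (of_rat q) \<le> 1" shows "\<exists>c<l. cong_l (of_rat q) (of_nat c)"
proof -
 obtain a b where q: "q = of_int a / of_int b" "b > 0" "coprime a b"
  by (metis quotient_of_coprime quotient_of_denom_pos quotient_of_div surj_pair)
 have Q: "(of_rat q :: 'a) = of_int a / of_int b" using q by (simp add: of_rat_divide)
 have nb: "\<not> int l dvd b"
 proof
  assume d: "int l dvd b"
  then have na: "\<not> int l dvd a" using q(3) prime_int_l by (metis coprime_common_divisor not_prime_unit)
  have "vn (of_int b) < 1" "vn (of_int a) = 1"
   using d na vn_of_int_less_1 vn_of_int_le[of a] by (auto simp: less_le)
  moreover have "vn (of_int b) > 0" using q by simp
  ultimately have "vn (of_rat q) > 1" unfolding Q vn_divide by simp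
  then show False using assms by simp
 qed
 have vb: "vn (of_int b) = 1" using nb vn_of_int_less_1[of b] vn_of_int_le[of b] by simp
 have "coprime b (int l)" using nb prime_int_l by (metis prime_imp_coprime coprime_commute)
 then obtain u v where uv: "u * b + v * int l = 1" using bezout_int[of b "int l"] by auto
 define c where "c = (a * u) mod int l"
 have c: "0 \<le> c" "c < int l" using l_gt_1 by (auto simp: c_def)
 have "a - c * b = b * (a * u - c) + a * (1 - u * b)" by (simp add: algebra_simps)
 also have "1 - u * b = v * int l" using uv by simp
 finally have d: "int l dvd a - c * b"
  unfolding c_def by (simp add: dvd_minus_mod)
 have "of_rat q - of_nat (nat c) = (of_int (a - c * b) / of_int b :: 'a)"
  using c q(2) unfolding Q by (simp add: field_simps)
 then have "vn (of_rat q - of_nat (nat c)) = vn (of_int (a - c * b))" using vb by (simp add: vn_divide)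
 also have "\<dots> < 1" using d vn_of_int_less_1 by blast
 finally show ?thesis using c unfolding cong_l_def by (intro exI[of _ "nat c"]) (auto simp: nat_less_iff)
qed

lemma cong_l_refl [simp]: "cong_l x x" by (simp add: cong_l_def)
lemma cong_l_sym: "cong_l x y ==> cong_l y x" by (simp add: cong_l_def vn_diff_commute)
lemma cong_l_trans: "cong_l x y ==> cong_l y z ==> cong_l x z"
 unfolding cong_l_def using vn_add[of "x - y" "y - z"] by simp
lemma cong_l_add: "cong_l x y ==> cong_l x' y' ==> cong_l (x + x') (y + y')"
 unfolding cong_l_def using vn_add[of "x - y" "x' - y'"] by (simp add: add_diff_add)
lemma cong_l_minus: "cong_l x y ==> cong_l (- x) (- y)"
 unfolding cong_l_def by (metis minus_diff_minus vn_minus)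
lemma cong_l_diff: "cong_l x y ==> cong_l x' y' ==> cong_l (x - x') (y - y')"
 using cong_l_add[of x y "- x'" "- y'"] cong_l_minus by simp

text \<open>The bounds on \<open>y\<close> and \<open>x'\<close> are those that the splitting of the
  difference as \<open>(x - y) x' + y (x' - y')\<close> calls for.\<close>

lemma cong_l_mult:
 assumes "cong_l x y" "cong_l x' y'" "vn y \<le> 1" "vn x' \<le> 1"
 shows "cong_l (x * x') (y * y')"
proof -
 have "x * x' - y * y' = (x - y) * x' + y * (x' - y')" by (simp add: algebra_simps)
 moreover have "vn ((x - y) * x') < 1" "vn (y * (x' - y')) < 1"
  using assms mult_left_le[of "vn x'" "vn (x - y)"] mult_left_le[of "vn y" "vn (x' - y')"]
  unfolding cong_l_def vn_mult by (auto simp: mult.commute)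
 ultimately show ?thesis unfolding cong_l_def using vn_add[of "(x - y) * x'" "y * (x' - y')"] by simp
qed

lemma cong_l_vn_le: "cong_l x y ==> vn y \<le> 1 ==> vn x \<le> 1"
 unfolding cong_l_def using vn_add[of "x - y" y] by simp

lemma cong_l_vn_eq_1: "cong_l x y ==> vn y = 1 ==> vn x = 1"
 unfolding cong_l_def using vn_add_eq[of "x - y" y] by simp

lemma cong_l_sum: "(\<And>i. i \<in> A ==> cong_l (f i) (g i)) ==> cong_l (sum f A) (sum g A)"
 by (induction A rule: infinite_finite_induct) (auto intro: cong_l_add)

lemma vn_prod_le: "(\<And>i. i \<in> A ==> vn (f i) \<le> 1) ==> vn (prod f A) \<le> 1"
 unfolding vn_prod by (intro prod_le_1) auto

lemma cong_l_prod:
 "(\<And>i. i \<in> A ==> cong_l (f i) (g i) \<and> vn (g i) \<le> 1) ==> cong_l (prod f A) (prod g A)"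
proof (induction A rule: infinite_finite_induct)
 case (insert x F)
 then show ?case using vn_prod_le[of F f]
  by (auto intro!: cong_l_mult vn_prod_le intro: cong_l_vn_le)
qed auto

lemma residue_ex:
 assumes "vn x \<le> 1" shows "\<exists>c<l. cong_l x (of_nat c)"
proof -
 obtain q where q: "cong_l x (of_rat q)" using rat_approx[of 1 x] by (auto simp: cong_l_def)
 then have "vn (of_rat q) \<le> 1" using assms cong_l_sym cong_l_vn_le by blast
 then obtain c where "c < l" "cong_l (of_rat q) (of_nat c)" using residue_rat by blast
 then show ?thesis using q cong_l_trans by blast
qed

lemma residue_unique:
 assumes "c < l" "d < l" "cong_l (of_nat c) (of_nat d)" shows "c = d"
proof -
 have "vn (of_int (int c - int d)) < 1" using assms(3) by (simp add: cong_l_def)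
 then have "int l dvd int c - int d" using vn_of_int_less_1 by blast
 then have "int c mod int l = int d mod int l" by (simp add: mod_eq_dvd_iff)
 then show ?thesis using assms by simp
qed

text \<open>A fixed system of representatives stands in for the residue field, so that everything
  stays inside the field itself: counting over the residue field becomes counting with digits, and
  equality there becomes \<open>cong_l\<close>.\<close>

definition digits :: "'a set" where "digits = of_nat ` {..<l}"

lemma card_digits: "card digits = l"
 unfolding digits_def by (subst card_image) (auto intro: inj_onI)

lemma finite_digits [simp]: "finite digits" by (simp add: digits_def)

lemma digits_vn: "d \<in> digits ==> vn d \<le> 1"
 by (auto simp: digits_def vn_of_nat_le)

lemma zero_digit [simp]: "0 \<in> digits"
 unfolding digits_def using l_gt_1 by (intro image_eqI[of _ _ 0]) auto

lemma one_digit [simp]: "1 \<in> digits"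
 unfolding digits_def using l_gt_1 by (intro image_eqI[of _ _ 1]) auto

lemma digit_cong_eq: "c \<in> digits ==> d \<in> digits ==> cong_l c d ==> c = d"
 by (auto simp: digits_def dest: residue_unique)

definition res :: "'a => 'a" where "res x = (THE d. d \<in> digits \<and> cong_l x d)"

lemma res: assumes "vn x \<le> 1" shows "res x \<in> digits" "cong_l x (res x)"
proof -
 obtain c where c: "c < l" "cong_l x (of_nat c)" using residue_ex[OF assms] by blast
 have "\<exists>!d. d \<in> digits \<and> cong_l x d"
 proof (rule ex1I[of _ "of_nat c"])
  show "of_nat c \<in> digits \<and> cong_l x (of_nat c)" using c by (auto simp: digits_def)
 next
  fix d assume "d \<in> digits \<and> cong_l x d"
  then show "d = of_nat c" using c by (intro digit_cong_eq) (auto simp: digits_def intro: cong_l_trans cong_l_sym)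
 qed
 from theI'[OF this] show "res x \<in> digits" "cong_l x (res x)" by (auto simp: res_def)
qed

lemma res_eqI: "vn x \<le> 1 ==> d \<in> digits ==> cong_l x d ==> res x = d"
 by (meson res cong_l_sym cong_l_trans digit_cong_eq)

lemma res_cong: "vn x \<le> 1 ==> cong_l x y ==> res x = res y"
 by (meson cong_l_sym cong_l_trans cong_l_vn_le res res_eqI)

lemma res_eq_iff: "vn x \<le> 1 ==> vn y \<le> 1 ==> res x = res y \<longleftrightarrow> cong_l x y"
 by (metis res cong_l_sym cong_l_trans res_cong)

section \<open>The valuation\<close>

definition uval :: "'a => int" where "uval x = (THE k. vn x = real l powi (- k))"

lemma vn_rat_powi: assumes "of_rat q \<noteq> (0::'a)" shows "\<exists>k. vn (of_rat q) = real l powi (- k)"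
proof -
 obtain a b where q: "q = of_int a / of_int b" "b \<noteq> 0"
  by (metis quotient_of_div less_irrefl quotient_of_denom_pos surj_pair)
 have Q: "(of_rat q :: 'a) = of_int a / of_int b" using q by (simp add: of_rat_divide)
 have a: "a \<noteq> 0" using assms Q by auto
 let ?m = "multiplicity (int l)"
 have "vn (of_rat q) = (1 / real l) ^ ?m a / (1 / real l) ^ ?m b"
  unfolding Q vn_divide using a q dist_of_int by simp
 also have "\<dots> = real l powi (- (int (?m a) - int (?m b)))"
  using l_pos by (simp add: power_int_diff power_int_minus field_simps power_one_over)
 finally show ?thesis by blast
qed

text \<open>A rational close enough to \<open>x\<close> has the same absolute value by the
  ultrametric inequality, so the value group is the one of the rationals.\<close>

lemma vn_powi_ex: assumes "x \<noteq> 0" shows "\<exists>k. vn x = real l powi (- k)"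
proof -
 obtain q where q: "vn (x - of_rat q) < vn x" using rat_approx[of "vn x" x] assms by auto
 then have "vn (of_rat q) = vn x"
  using vn_add_eq[of "of_rat q - x" x] vn_diff_commute[of x "of_rat q"] by simp
 then show ?thesis using vn_rat_powi[of q] assms by (metis vn_eq_0)
qed

lemma powi_l_inj: "real l powi j = real l powi k ==> j = k"
proof (rule ccontr)
 assume eq: "real l powi j = real l powi k" and ne: "j \<noteq> k"
 have "real l powi j < real l powi k" if "j < k" for j k
  using that l_gt_1 by (intro power_int_strict_increasing) auto
 then show False using eq ne by (metis less_irrefl linorder_neqE_linordered_idom)
qed

lemma vn_uval: assumes "x \<noteq> 0" shows "vn x = real l powi (- uval x)"
proof -
 have "\<exists>!k. vn x = real l powi (- k)"
  using vn_powi_ex[OF assms] powi_l_inj by (metis neg_equal_iff_equal)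
 from theI'[OF this] show ?thesis by (simp add: uval_def)
qed

lemma uval_eqI: "vn x = real l powi (- k) ==> uval x = k"
proof -
 assume a: "vn x = real l powi (- k)"
 then have "x \<noteq> 0" using l_pos by (metis power_int_eq_0_iff vn_eq_0 less_irrefl)
 then show ?thesis using a vn_uval[of x] powi_l_inj[of "- uval x" "- k"] by simp
qed

lemma uval_mult: "x \<noteq> 0 ==> y \<noteq> 0 ==> uval (x * y) = uval x + uval y"
 by (rule uval_eqI) (use l_pos in \<open>simp add: vn_mult vn_uval power_int_add[symmetric]\<close>)

lemma uval_unit: "vn x = 1 ==> uval x = 0" by (rule uval_eqI) simp

lemma uval_l: "uval (of_nat l) = 1"
 by (rule uval_eqI) (simp add: vn_l power_int_minus field_simps)

text \<open>All absolute values of nonzero elements are integral powers of \<open>l\<close>, so none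
  lies strictly between \<open>1 / l\<close> and 1. This is what turns \<open>cong_l\<close> into
  divisibility of the difference by \<open>l\<close>.\<close>

lemma vn_less_1_le: assumes "vn x < 1" shows "vn x \<le> 1 / l"
proof (cases "x = 0")
 case False
 have "real l powi (- uval x) < 1" using assms vn_uval[OF False] by simp
 then have "uval x > 0" using l_gt_1 by (metis linorder_not_less neg_0_le_iff_le one_le_power_int less_imp_le of_nat_1 of_nat_less_iff)
 then have "real l powi (- uval x) \<le> real l powi (- 1)"
  using l_gt_1 by (intro power_int_increasing) auto
 then show ?thesis using vn_uval[OF False] by (simp add: power_int_minus field_simps)
qed (use l_pos in simp)

lemma vn_le_iff_less: "vn x < 1 \<longleftrightarrow> vn x \<le> 1 / l"
 using vn_less_1_le[of x] l_gt_1 by (auto intro: le_less_trans)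

lemma vn_l_powi: "vn (of_nat l powi k) = real l powi (- k)"
proof (cases "k \<ge> 0")
 case True
 then show ?thesis using l_pos by (simp add: power_int_def vn_power vn_l power_one_over field_simps)
next
 case False
 then show ?thesis using l_pos by (simp add: power_int_def vn_power vn_l vn_inverse vn_divide power_one_over field_simps)
qed

lemma Zl_iff: "x \<in> (Zl :: 'a set) \<longleftrightarrow> vn x \<le> 1"
 by (simp add: dist_commute)

text \<open>Brings the last component of \<open>K1_int\<close> into the language of
  congruences.\<close>

lemma one_plus_l_Zl: "x \<in> (\<lambda>y. 1 + of_nat l * y) ` (Zl :: 'a set) \<longleftrightarrow> cong_l x 1"
proof
 assume "x \<in> (\<lambda>y. 1 + of_nat l * y) ` (Zl :: 'a set)"
 then obtain y where "x = 1 + of_nat l * y" "y \<in> (Zl :: 'a set)" by blast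
 then have "x = 1 + of_nat l * y" "vn y \<le> 1" by (auto simp: dist_commute)
 then have "vn (x - 1) \<le> 1 / l" using l_pos by (simp add: vn_mult vn_l divide_right_mono)
 then show "cong_l x 1" by (simp add: cong_l_def vn_le_iff_less)
next
 assume "cong_l x 1"
 then have "vn (x - 1) \<le> 1 / l" using vn_less_1_le by (simp add: cong_l_def)
 then have "vn ((x - 1) / of_nat l) \<le> 1" using l_pos by (simp add: vn_divide vn_l field_simps)
 then show "x \<in> (\<lambda>y. 1 + of_nat l * y) ` (Zl :: 'a set)"
  using of_nat_l_nonzero by (intro image_eqI[of _ _ "(x - 1) / of_nat l"]) (auto simp: dist_commute)
qed

end

section \<open>Integral matrices\<close>

lemma mat_mult_index:
 assumes "A \<in> carrier_mat a b" "B \<in> carrier_mat b c" "i < a" "j < c"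
 shows "(A * B) $$ (i, j) = (\<Sum>p<b. A $$ (i, p) * B $$ (p, j))"
 using assms by (auto simp: scalar_prod_def atLeast0LessThan intro!: sum.cong)

lemma GL_group: "group (GL m :: 'a::field mat monoid)"
proof -
 interpret ring "ring_mat TYPE('a) m ()" by (rule ring_mat)
 show ?thesis unfolding GL_def by (rule units_group)
qed

lemma GL_carrier: "carrier (GL m :: 'a::field mat monoid) = {A \<in> carrier_mat m m. mdet A \<noteq> 0}"
proof -
 have "A \<in> carrier_mat m m" if "A \<in> Units (ring_mat TYPE('a) m ())" for A
  using that by (auto simp: Units_def ring_mat_simps)
 then show ?thesis unfolding GL_def units_of_def
  using unit_imp_det_non_zero[where 'a='a and n=m and b="()"] det_non_zero_imp_unit[where 'a='a and n=m and b="()"]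
  by auto
qed

lemma GL_simps [simp]: "x \<otimes>\<^bsub>GL m\<^esub> y = x * y" "\<one>\<^bsub>GL m\<^esub> = 1\<^sub>m m"
 by (auto simp: GL_def units_of_def ring_mat_simps)

lemma GL_carrier_mat: "A \<in> GLc m ==> A \<in> carrier_mat m m"
 by (simp add: GL_carrier)

abbreviation minv :: "nat => 'a::field mat => 'a mat" where "minv m A \<equiv> inv\<^bsub>GL m\<^esub> A"

lemma minv:
 assumes "A \<in> GLc m"
 shows "minv m A \<in> GLc m" "A * minv m A = 1\<^sub>m m" "minv m A * A = 1\<^sub>m m"
  "minv m A \<in> carrier_mat m m"
 using group.inv_closed[OF GL_group assms] group.r_inv[OF GL_group assms] group.l_inv[OF GL_group assms]
 by (auto simp: GL_carrier_mat)

lemma minv_eqI: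
 assumes "A \<in> carrier_mat m m" "B \<in> carrier_mat m m" "A * B = 1\<^sub>m m"
 shows "A \<in> GLc m" "minv m A = B"
proof -
 have "mdet A * mdet B = 1" using assms det_mult[of A m B] by simp
 then have d: "mdet A \<noteq> 0" "mdet B \<noteq> 0" by auto
 then show A: "A \<in> GLc m" using assms by (simp add: GL_carrier)
 show "minv m A = B"
  using A d assms mat_mult_left_right_inverse[OF assms]
  by (intro group.inv_equality[OF GL_group]) (auto simp: GL_carrier)
qed

lemma GL_mult_closed: "A \<in> GLc m ==> B \<in> GLc m ==> A * B \<in> GLc m"
 by (auto simp: GL_carrier det_mult)

lemma GL_one_closed: "1\<^sub>m m \<in> GLc m" by (simp add: GL_carrier)

lemma minv_mult:
 assumes "A \<in> GLc m" "B \<in> GLc m" shows "minv m (A * B) = minv m B * minv m A"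
 using group.inv_mult_group[OF GL_group assms] by simp

lemma minv_minv: "A \<in> GLc m ==> minv m (minv m A) = A"
 using group.inv_inv[OF GL_group] by blast

lemma det_minv:
 assumes "A \<in> GLc m"
 shows "mdet (minv m A) = inverse (mdet A)"
proof -
 have "mdet A * mdet (minv m A) = 1"
  using minv[OF assms] det_mult[of A m "minv m A"] assms by (simp add: GL_carrier)
 then show ?thesis using inverse_unique by metis
qed

lemma GL_cancel:
 assumes "A \<in> GLc m" "B \<in> carrier_mat m k"
 shows "minv m A * (A * B) = B" "A * (minv m A * B) = B"
proof -
 have "minv m A * (A * B) = (minv m A * A) * B"
  using minv(4)[OF assms(1)] assms GL_carrier_mat by (intro assoc_mult_mat[symmetric]) blast+
 then show "minv m A * (A * B) = B" using minv[OF assms(1)] assms by simp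
 have "A * (minv m A * B) = (A * minv m A) * B"
  using minv(4)[OF assms(1)] assms GL_carrier_mat by (intro assoc_mult_mat[symmetric]) blast+
 then show "A * (minv m A * B) = B" using minv[OF assms(1)] assms by simp
qed

lemma GL_cancel_right:
 assumes "A \<in> GLc m" "B \<in> carrier_mat k m"
 shows "(B * A) * minv m A = B" "(B * minv m A) * A = B"
proof -
 have "(B * A) * minv m A = B * (A * minv m A)"
  using minv(4)[OF assms(1)] assms GL_carrier_mat by (intro assoc_mult_mat) blast+
 then show "(B * A) * minv m A = B" using minv[OF assms(1)] assms by simp
 have "(B * minv m A) * A = B * (minv m A * A)"
  using minv(4)[OF assms(1)] assms GL_carrier_mat by (intro assoc_mult_mat) blast+
 then show "(B * minv m A) * A = B" using minv[OF assms(1)] assms by simp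
qed

lemma GL_transpose: "A \<in> GLc m ==> transpose_mat A \<in> GLc m"
 by (auto simp: GL_carrier det_transpose)

lemma det_prod_diag:
 assumes "A \<in> carrier_mat m m" "upper_triangular A"
 shows "mdet A = (\<Prod>i<m. A $$ (i, i))"
 using det_upper_triangular[OF assms(2,1)] prod_list_diag_prod[of A] assms(1)
 by (simp add: atLeast0LessThan)

lemma det_mat_diag: "mdet (mat_diag m d) = (\<Prod>i<m. d i)"
 by (subst det_prod_diag[of _ m]) (auto simp: mat_diag_def)

context padic_field
begin

definition int_mat :: "nat => 'a mat set"
 where "int_mat m = {A \<in> carrier_mat m m. \<forall>i<m. \<forall>j<m. vn (A $$ (i, j)) \<le> 1}"

lemma int_mat_carrier: "A \<in> int_mat m ==> A \<in> carrier_mat m m" by (simp add: int_mat_def)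

lemma vn_mat_mult_le:
 assumes "A \<in> carrier_mat a b" "B \<in> carrier_mat b c" "i < a" "j < c" "0 \<le> r"
  "\<And>p. p < b ==> vn (A $$ (i, p)) * vn (B $$ (p, j)) \<le> r"
 shows "vn ((A * B) $$ (i, j)) \<le> r"
 unfolding mat_mult_index[OF assms(1-4)] using assms(5,6)
 by (intro vn_sum_le) (auto simp: vn_mult)

lemma int_mat_mult_bound:
 assumes "P \<in> int_mat m" "A \<in> carrier_mat m c" "0 \<le> r" "\<And>i j. i < m ==> j < c ==> vn (A $$ (i, j)) \<le> r"
  "i < m" "j < c"
 shows "vn ((P * A) $$ (i, j)) \<le> r"
proof (rule vn_mat_mult_le[of _ m m _ c])
 fix p assume "p < m"
 then have "vn (P $$ (i, p)) * vn (A $$ (p, j)) \<le> 1 * r"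
  using assms by (intro mult_mono) (auto simp: int_mat_def)
 then show "vn (P $$ (i, p)) * vn (A $$ (p, j)) \<le> r" by simp
qed (use assms in \<open>auto simp: int_mat_def\<close>)

lemma int_mat_mult: "A \<in> int_mat m ==> B \<in> int_mat m ==> A * B \<in> int_mat m"
 using int_mat_mult_bound[of A m B m 1] by (auto simp: int_mat_def)

lemma int_mat_one: "1\<^sub>m m \<in> int_mat m" by (auto simp: int_mat_def)

lemma int_mat_transpose: "A \<in> int_mat m ==> transpose_mat A \<in> int_mat m" by (auto simp: int_mat_def)

lemma det_int_mat: assumes "A \<in> int_mat m" shows "vn (mdet A) \<le> 1"
proof -
 have A: "A \<in> carrier_mat m m" using assms int_mat_carrier by blast
 show ?thesis unfolding det_def'[OF A]
 proof (rule vn_sum_le)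
  fix p assume p: "p \<in> {p. p permutes {0..<m}}"
  have "vn (signof p) = 1" by (simp add: sign_def vn_neg_1)
  moreover have "vn (\<Prod>i = 0..<m. A $$ (i, p i)) \<le> 1"
   using assms p permutes_in_image[of p "{0..<m}"] by (intro vn_prod_le) (auto simp: int_mat_def)
  ultimately show "vn (signof p * (\<Prod>i = 0..<m. A $$ (i, p i))) \<le> 1" by (simp add: vn_mult)
 qed simp
qed

definition cong_mat :: "nat => 'a mat => 'a mat => bool"
 where "cong_mat m A B \<longleftrightarrow> (\<forall>i<m. \<forall>j<m. cong_l (A $$ (i, j)) (B $$ (i, j)))"

lemma cong_mat_refl [simp]: "cong_mat m A A" by (simp add: cong_mat_def)
lemma cong_mat_sym: "cong_mat m A B ==> cong_mat m B A" by (auto simp: cong_mat_def intro: cong_l_sym)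
lemma cong_mat_mult:
 assumes "cong_mat m A A'" "cong_mat m B B'" "A' \<in> int_mat m" "B \<in> int_mat m"
  "A \<in> carrier_mat m m" "B' \<in> carrier_mat m m"
 shows "cong_mat m (A * B) (A' * B')"
proof -
 have "cong_l ((A * B) $$ (i, j)) ((A' * B') $$ (i, j))" if "i < m" "j < m" for i j
 proof -
  have "(A * B) $$ (i, j) = (\<Sum>p<m. A $$ (i, p) * B $$ (p, j))"
   "(A' * B') $$ (i, j) = (\<Sum>p<m. A' $$ (i, p) * B' $$ (p, j))"
   using assms that by (auto simp: int_mat_def intro!: mat_mult_index)
  moreover have "cong_l (A $$ (i, p) * B $$ (p, j)) (A' $$ (i, p) * B' $$ (p, j))" if "p < m" for p
   using assms that \<open>i < m\<close> \<open>j < m\<close> by (intro cong_l_mult) (auto simp: int_mat_def cong_mat_def)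
  ultimately show ?thesis by (auto intro: cong_l_sum)
 qed
 then show ?thesis by (simp add: cong_mat_def)
qed

lemma cong_mat_int: "cong_mat m A B ==> B \<in> int_mat m ==> A \<in> carrier_mat m m ==> A \<in> int_mat m"
 
 unfolding int_mat_def cong_mat_def
 by (simp, intro allI impI, rule_tac y = "B $$ (i, j)" in cong_l_vn_le) auto

lemma cong_det:
 assumes "cong_mat m A B" "B \<in> int_mat m" "A \<in> carrier_mat m m"
 shows "cong_l (mdet A) (mdet B)"
proof -
 have A: "A \<in> int_mat m" using assms cong_mat_int by blast
 show ?thesis unfolding det_def'[OF assms(3)] det_def'[OF int_mat_carrier[OF assms(2)]]
 proof (rule cong_l_sum)
  fix p assume p: "p \<in> {p. p permutes {0..<m}}"
  have 1: "cong_l (\<Prod>i = 0..<m. A $$ (i, p i)) (\<Prod>i = 0..<m. B $$ (i, p i))"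
   using assms p permutes_in_image[of p "{0..<m}"]
   by (intro cong_l_prod) (auto simp: int_mat_def cong_mat_def)
  have "vn (\<Prod>i = 0..<m. A $$ (i, p i)) \<le> 1"
   using A p permutes_in_image[of p "{0..<m}"] by (intro vn_prod_le) (auto simp: int_mat_def)
  then show "cong_l (signof p * (\<Prod>i = 0..<m. A $$ (i, p i))) (signof p * (\<Prod>i = 0..<m. B $$ (i, p i)))"
   by (intro cong_l_mult 1) (auto simp: sign_def vn_neg_1)
 qed
qed

lemma elements_mat_Zl:
 "A \<in> carrier_mat m m ==> elements_mat A \<subseteq> Zl \<longleftrightarrow> A \<in> int_mat m"
proof
 assume A: "A \<in> carrier_mat m m" and "elements_mat A \<subseteq> Zl"
 then show "A \<in> int_mat m" unfolding int_mat_def using elements_matI[OF A] Zl_iff by blast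
next
 assume "A \<in> carrier_mat m m" "A \<in> int_mat m"
 then show "elements_mat A \<subseteq> Zl" using Zl_iff by (fastforce simp: int_mat_def dest!: elements_matD)
qed

lemma adj_int_mat: assumes "A \<in> int_mat m" shows "adj_mat A \<in> int_mat m"
proof -
 have A: "A \<in> carrier_mat m m" using assms int_mat_carrier by blast
 have "vn (cofactor A j i) \<le> 1" if "i < m" "j < m" for i j
 proof -
  have "mat_delete A j i \<in> int_mat (m - 1)"
   using assms that A by (auto simp: int_mat_def mat_delete_def)
  then have "vn (mdet (mat_delete A j i)) \<le> 1" by (rule det_int_mat)
  then show ?thesis by (simp add: cofactor_def vn_mult vn_power vn_neg_1)
 qed
 then show ?thesis using A adj_mat(1)[OF A] by (auto simp: int_mat_def adj_mat_def)
qed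

abbreviation KG :: "nat => 'a mat set" where "KG \<equiv> GL_int"

text \<open>Forwards, the determinants of \<open>A\<close> and of its inverse are integral with
  product 1. Backwards, the adjugate divided by the determinant, a unit, is an integral
  inverse.\<close>

lemma GL_int_iff: "A \<in> KG m \<longleftrightarrow> A \<in> int_mat m \<and> vn (mdet A) = 1"
proof
 assume "A \<in> KG m"
 then have A: "A \<in> GLc m" "elements_mat A \<subseteq> Zl" "elements_mat (minv m A) \<subseteq> Zl"
  by (auto simp: GL_int_def)
 then have i: "A \<in> int_mat m" "minv m A \<in> int_mat m"
  using elements_mat_Zl minv(4)[OF A(1)] GL_carrier_mat[OF A(1)] by auto
 have "vn (mdet A) * vn (mdet (minv m A)) = 1"
  unfolding det_minv[OF A(1)] vn_inverse using A by (simp add: GL_carrier)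
 moreover note det_int_mat[OF i(1)] det_int_mat[OF i(2)]
 ultimately have "vn (mdet A) = 1"
  using mult_left_le[of "vn (mdet (minv m A))" "vn (mdet A)"] by simp
 then show "A \<in> int_mat m \<and> vn (mdet A) = 1" using i by simp
next
 assume a: "A \<in> int_mat m \<and> vn (mdet A) = 1"
 then have A: "A \<in> carrier_mat m m" using int_mat_carrier by blast
 define B where "B = inverse (mdet A) \<cdot>\<^sub>m adj_mat A"
 have d: "mdet A \<noteq> 0" using a by auto
 have B: "B \<in> carrier_mat m m" using adj_mat(1)[OF A] by (simp add: B_def)
 have "A * B = inverse (mdet A) \<cdot>\<^sub>m (A * adj_mat A)"
  unfolding B_def by (rule mult_smult_distrib[OF A adj_mat(1)[OF A]])
 also have "\<dots> = 1\<^sub>m m" unfolding adj_mat(2)[OF A] using d by (auto intro!: eq_matI)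
 finally have AB: "A * B = 1\<^sub>m m" .
 have "B \<in> int_mat m"
  using adj_int_mat[of A m] a B by (auto simp: int_mat_def B_def vn_mult vn_inverse)
 then show "A \<in> KG m"
  using minv_eqI[OF A B AB] a elements_mat_Zl[OF A] elements_mat_Zl[OF B] by (auto simp: GL_int_def)
qed

lemma GL_int_GL: "A \<in> KG m ==> A \<in> GLc m" by (simp add: GL_int_def)

lemma GL_int_carrier: "A \<in> KG m ==> A \<in> carrier_mat m m" using GL_int_GL GL_carrier_mat by blast

lemma GL_int_int: "A \<in> KG m ==> A \<in> int_mat m" by (simp add: GL_int_iff)

lemma GL_int_mult: "A \<in> KG m ==> B \<in> KG m ==> A * B \<in> KG m"
 using det_mult[of A m B] int_mat_mult int_mat_carrier by (auto simp: GL_int_iff vn_mult)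

lemma GL_int_one [simp]: "1\<^sub>m m \<in> KG m" by (simp add: GL_int_iff int_mat_one)

lemma GL_int_minv: "A \<in> KG m ==> minv m A \<in> KG m"
 unfolding GL_int_def using minv(1)[of A m] minv_minv[of A m] by auto

lemma GL_int_subgroup: "subgroup (KG m) (GL m)"
 by (rule subgroup.intro) (auto simp: GL_int_GL GL_int_mult GL_int_minv)

lemma GL_int_transpose: "A \<in> KG m ==> transpose_mat A \<in> KG m"
 using int_mat_transpose det_transpose int_mat_carrier by (fastforce simp: GL_int_iff)

text \<open>Whether the determinant is a unit depends only on its residue; this is why cosets of the
  integral group are open.\<close>

lemma GL_int_cong: "A \<in> carrier_mat m m ==> cong_mat m A B ==> B \<in> KG m ==> A \<in> KG m"
 unfolding GL_int_iff using cong_mat_int cong_det cong_l_vn_eq_1 by blast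

lemma int_mat_four_block:
 assumes "A \<in> int_mat p" "D \<in> int_mat q" "B \<in> carrier_mat p q" "C \<in> carrier_mat q p"
  "\<And>i j. i < p ==> j < q ==> vn (B $$ (i, j)) \<le> 1" "\<And>i j. i < q ==> j < p ==> vn (C $$ (i, j)) \<le> 1"
 shows "four_block_mat A B C D \<in> int_mat (p + q)"
 using assms by (auto simp: int_mat_def)

lemma GL_int_diag_block:
 assumes "A \<in> KG p" "D \<in> KG q"
 shows "four_block_mat A (0\<^sub>m p q) (0\<^sub>m q p) D \<in> KG (p + q)"
 using assms det_four_block_mat_lower_left_zero[of A p "0\<^sub>m p q" q "0\<^sub>m q p" D]
 by (auto simp: GL_int_iff vn_mult int_mat_carrier intro!: int_mat_four_block)

lemma swaprows_mat_GL_int: "k < m ==> i < m ==> swaprows_mat m k i \<in> KG m"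
proof (cases "k = i")
 case True
 then have "swaprows_mat m k i = (1\<^sub>m m :: 'a mat)" by (auto intro!: eq_matI)
 then show ?thesis by simp
next
 case False
 assume "k < m" "i < m"
 then show ?thesis using det_swaprows_mat[of k m i, where 'a='a] False
  by (auto simp: GL_int_iff int_mat_def vn_neg_1)
qed

end

section \<open>Smith form and Iwasawa decomposition\<close>

lemma mult_carrier_square [simp]:
 "A \<in> carrier_mat m m ==> B \<in> carrier_mat m k ==> A * B \<in> carrier_mat m k"
 by (rule mult_carrier_mat)

context padic_field
begin

definition K_equiv :: "nat => 'a mat => 'a mat => bool"
 where "K_equiv m A B \<longleftrightarrow> (\<exists>P\<in>KG m. \<exists>Q\<in>KG m. B = P * A * Q)"

lemma K_equiv_refl: "A \<in> carrier_mat m m ==> K_equiv m A A"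
 unfolding K_equiv_def by (intro bexI[of _ "1\<^sub>m m"]) auto

lemma K_equiv_trans:
 assumes "A \<in> carrier_mat m m" "K_equiv m A B" "K_equiv m B C" shows "K_equiv m A C"
proof -
 obtain P Q where 1: "P \<in> KG m" "Q \<in> KG m" "B = P * A * Q" using assms by (auto simp: K_equiv_def)
 obtain P' Q' where 2: "P' \<in> KG m" "Q' \<in> KG m" "C = P' * B * Q'" using assms by (auto simp: K_equiv_def)
 have c: "P \<in> carrier_mat m m" "Q \<in> carrier_mat m m" "P' \<in> carrier_mat m m" "Q' \<in> carrier_mat m m"
  using 1 2 GL_int_carrier by auto
 have "C = (P' * P) * A * (Q * Q')" unfolding 2(3) 1(3) using c assms(1)
  by (simp add: assoc_mult_mat[of _ m m _ m _ m])
 then show ?thesis unfolding K_equiv_def using 1 2 GL_int_mult by blast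
qed

lemma K_equiv_left: "A \<in> carrier_mat m m ==> P \<in> KG m ==> K_equiv m A (P * A)"
 unfolding K_equiv_def using GL_int_carrier[of P m]
 by (intro bexI[of _ P] bexI[of _ "1\<^sub>m m"]) (auto simp: right_mult_one_mat[of _ m m])

lemma K_equiv_right: "A \<in> carrier_mat m m ==> P \<in> KG m ==> K_equiv m A (A * P)"
 unfolding K_equiv_def
 by (intro bexI[of _ P] bexI[of _ "1\<^sub>m m"]) (auto simp: left_mult_one_mat[of _ m m])

lemma K_equiv_carrier: "A \<in> carrier_mat m m ==> K_equiv m A B ==> B \<in> carrier_mat m m"
 unfolding K_equiv_def using GL_int_carrier[of _ m] by auto

lemma mult_int_mat_bound:
 assumes "P \<in> int_mat m" "A \<in> carrier_mat c m" "0 \<le> r" "\<And>i j. i < c ==> j < m ==> vn (A $$ (i, j)) \<le> r"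
  "i < c" "j < m"
 shows "vn ((A * P) $$ (i, j)) \<le> r"
proof (rule vn_mat_mult_le[of _ c m _ m])
 fix p assume "p < m"
 then have "vn (A $$ (i, p)) * vn (P $$ (p, j)) \<le> r * 1"
  using assms by (intro mult_mono) (auto simp: int_mat_def)
 then show "vn (A $$ (i, p)) * vn (P $$ (p, j)) \<le> r" by simp
qed (use assms in \<open>auto simp: int_mat_def\<close>)

text \<open>By the ultrametric inequality, integral matrices cannot enlarge the largest entry. In
  the Smith form this shows that a pivot of maximal absolute value dominates all that is left after
  elimination, which orders the elementary divisors.\<close>

lemma K_equiv_bound:
 assumes "A \<in> carrier_mat m m" "K_equiv m A B" "0 \<le> r" "\<And>i j. i < m ==> j < m ==> vn (A $$ (i, j)) \<le> r"
  "i < m" "j < m"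
 shows "vn (B $$ (i, j)) \<le> r"
proof -
 obtain P Q where 1: "P \<in> KG m" "Q \<in> KG m" "B = P * A * Q" using assms by (auto simp: K_equiv_def)
 show ?thesis unfolding 1(3)
  by (rule mult_int_mat_bound[of _ m _ m], use 1 GL_int_int in blast, use 1 assms GL_int_carrier in auto)
   (rule int_mat_mult_bound[of _ m _ m], use 1 assms GL_int_int in auto)
qed

lemma GL_int_block_lower:
 assumes "A \<in> KG p" "D \<in> KG q" "C \<in> carrier_mat q p" "\<And>i j. i < q ==> j < p ==> vn (C $$ (i, j)) \<le> 1"
 shows "four_block_mat A (0\<^sub>m p q) C D \<in> KG (p + q)"
 using assms det_four_block_mat_upper_right_zero[of A p "0\<^sub>m p q" q C D]
 by (auto simp: GL_int_iff vn_mult int_mat_carrier intro!: int_mat_four_block)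

lemma GL_int_block_upper:
 assumes "A \<in> KG p" "D \<in> KG q" "B \<in> carrier_mat p q" "\<And>i j. i < p ==> j < q ==> vn (B $$ (i, j)) \<le> 1"
 shows "four_block_mat A B (0\<^sub>m q p) D \<in> KG (p + q)"
 using assms det_four_block_mat_lower_left_zero[of A p B q "0\<^sub>m q p" D]
 by (auto simp: GL_int_iff vn_mult int_mat_carrier intro!: int_mat_four_block)

lemma mat11_KG: "vn u = 1 ==> Matrix.mat 1 1 (\<lambda>_. u) \<in> KG 1"
 by (auto simp: GL_int_iff int_mat_def det_single)

lemma unit_decomp:
 assumes "a \<noteq> 0" obtains u where "vn u = 1" "a = u * of_nat l powi (uval a)"
proof
 show "vn (a / of_nat l powi (uval a)) = 1"
  using assms l_pos by (simp add: vn_divide vn_l_powi flip: vn_uval)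
 show "a = a / of_nat l powi uval a * of_nat l powi uval a" using l_gt_1 by simp
qed

lemma pivot_top_left:
 assumes A: "A \<in> carrier_mat m m" and ij: "i0 < m" "j0 < m"
 shows "\<exists>B. K_equiv m A B \<and> B $$ (0, 0) = A $$ (i0, j0)"
proof -
 define B where "B = swaprows_mat m 0 i0 * A"
 have Bc: "B \<in> carrier_mat m m" using A by (simp add: B_def)
 have B: "B = swaprows 0 i0 A" unfolding B_def using swaprows_mat[OF A, of 0 i0] ij by simp
 define S where "S = (swaprows_mat m 0 j0 :: 'a mat)"
 \<comment> \<open>A column exchange, written as a row exchange of the transpose.\<close>
 define C where "C = transpose_mat (S * transpose_mat B)"
 have Sc: "S \<in> carrier_mat m m" by (simp add: S_def)
 have "C = B * transpose_mat S" unfolding C_def using transpose_mult[OF Sc, of "transpose_mat B" m] Bc by simp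
 moreover have "transpose_mat S \<in> KG m"
  unfolding S_def using ij by (intro GL_int_transpose swaprows_mat_GL_int) auto
 ultimately have "K_equiv m B C" using K_equiv_right[OF Bc] by simp
 moreover have "K_equiv m A B" unfolding B_def
  using ij by (intro K_equiv_left[OF A] swaprows_mat_GL_int) auto
 moreover have "C $$ (0, 0) = (swaprows 0 j0 (transpose_mat B)) $$ (0, 0)"
  unfolding C_def S_def using swaprows_mat[of "transpose_mat B" m m 0 j0] Bc ij by simp
 then have "C $$ (0, 0) = A $$ (i0, j0)" using ij A B by simp
 ultimately show ?thesis using K_equiv_trans[OF A] by blast
qed

text \<open>As the pivot has maximal absolute value, the quotients of its row and column by it are
  integral, and the elimination uses integral matrices of unit determinant. The unit part
  \<open>u\<close> of the pivot is divided out, leaving a power of \<open>l\<close>.\<close>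

lemma smith_step:
 assumes C: "C \<in> carrier_mat (Suc m) (Suc m)" and a: "C $$ (0, 0) \<noteq> 0"
  and mx: "\<And>i j. i < Suc m ==> j < Suc m ==> vn (C $$ (i, j)) \<le> vn (C $$ (0, 0))"
 shows "\<exists>A' k. A' \<in> carrier_mat m m \<and> vn (of_nat l powi k) = vn (C $$ (0, 0)) \<and>
  K_equiv (Suc m) C (four_block_mat (Matrix.mat 1 1 (\<lambda>_. of_nat l powi k)) (0\<^sub>m 1 m) (0\<^sub>m m 1) A')"
proof -
 let ?a = "C $$ (0, 0)"
 obtain u where u: "vn u = 1" "?a = u * of_nat l powi (uval ?a)" using unit_decomp[OF a] .
 then have u0: "u \<noteq> 0" by auto
 obtain c00 c01 c10 c11 where sp: "split_block C 1 1 = (c00, c01, c10, c11)" by (cases "split_block C 1 1") auto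
 have c: "c00 \<in> carrier_mat 1 1" "c01 \<in> carrier_mat 1 m" "c10 \<in> carrier_mat m 1" "c11 \<in> carrier_mat m m"
  "C = four_block_mat c00 c01 c10 c11"
  using split_block[OF sp, of m m] C by auto
 have e: "c00 $$ (0, 0) = ?a" using c by simp
 have e01: "vn (c01 $$ (0, j)) \<le> vn ?a" if "j < m" for j
  using mx[of 0 "Suc j"] that c by simp
 have e10: "vn (c10 $$ (i, 0)) \<le> vn ?a" if "i < m" for i
  using mx[of "Suc i" 0] that c by simp
 have ua: "inverse u * ?a = of_nat l powi (uval ?a)" using u(2) u0 by (metis field_class.field_inverse mult.assoc mult_1)
 define x where "x = Matrix.mat 1 1 (\<lambda>_. inverse u)"
 define y where "y = Matrix.mat m 1 (\<lambda>(i, j). - c10 $$ (i, 0) / ?a)"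
 define z where "z = Matrix.mat 1 m (\<lambda>(i, j). - c01 $$ (0, j) / ?a)"
 define P where "P = four_block_mat x (0\<^sub>m 1 m) y (1\<^sub>m m)"
 define Q where "Q = four_block_mat (1\<^sub>m 1) z (0\<^sub>m m 1) (1\<^sub>m m)"
 have xyz: "x \<in> carrier_mat 1 1" "y \<in> carrier_mat m 1" "z \<in> carrier_mat 1 m" by (auto simp: x_def y_def z_def)
 have "P \<in> KG (1 + m)"
  using GL_int_block_lower[of x 1 "1\<^sub>m m" m y] xyz u(1) u0 e10 a unfolding P_def
  by (auto simp: x_def vn_inverse y_def vn_divide mat11_KG simp del: One_nat_def)
 then have P: "P \<in> KG (Suc m)" by simp
 have Q: "Q \<in> KG (Suc m)"
  using GL_int_block_upper[of "1\<^sub>m 1" 1 "1\<^sub>m m" m z] xyz e01 a unfolding Q_def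
  by (auto simp: z_def vn_divide)
 define A' where "A' = y * c01 + c11"
 have A': "A' \<in> carrier_mat m m" using xyz c by (auto simp: A'_def)
 have 1: "y * c00 + 1\<^sub>m m * c10 = 0\<^sub>m m 1"
  using c(1-4) xyz a by (intro eq_matI) (auto simp: scalar_prod_def y_def e)
 have "P * C = four_block_mat (x * c00 + 0\<^sub>m 1 m * c10) (x * c01 + 0\<^sub>m 1 m * c11) (y * c00 + 1\<^sub>m m * c10) (y * c01 + 1\<^sub>m m * c11)"
  unfolding P_def c(5) by (rule mult_four_block_mat) (use c(1-4) xyz in auto)
 also have "\<dots> = four_block_mat (x * c00) (x * c01) (0\<^sub>m m 1) A'"
  unfolding 1 A'_def using c(1-4) xyz by simp
 finally have PC: "P * C = four_block_mat (x * c00) (x * c01) (0\<^sub>m m 1) A'" .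
 have "P * C * Q = four_block_mat (x * c00 * 1\<^sub>m 1 + x * c01 * 0\<^sub>m m 1) (x * c00 * z + x * c01 * 1\<^sub>m m)
  (0\<^sub>m m 1 * 1\<^sub>m 1 + A' * 0\<^sub>m m 1) (0\<^sub>m m 1 * z + A' * 1\<^sub>m m)"
  unfolding PC Q_def by (rule mult_four_block_mat) (use c(1-4) xyz A' in auto)
 also have "x * c00 * 1\<^sub>m 1 + x * c01 * 0\<^sub>m m 1 = Matrix.mat 1 1 (\<lambda>_. of_nat l powi (uval ?a))"
  using c(1-4) xyz e ua by (intro eq_matI) (auto simp: scalar_prod_def x_def)
 also have "x * c00 * z + x * c01 * 1\<^sub>m m = 0\<^sub>m 1 m"
  using c(1-4) xyz u0 e a by (intro eq_matI) (auto simp: scalar_prod_def x_def z_def)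
 also have "0\<^sub>m m 1 * 1\<^sub>m 1 + A' * 0\<^sub>m m 1 = 0\<^sub>m m 1" using A' by simp
 also have "0\<^sub>m m 1 * z + A' * 1\<^sub>m m = A'" using A' xyz by simp
 finally have "P * C * Q = four_block_mat (Matrix.mat 1 1 (\<lambda>_. of_nat l powi (uval ?a))) (0\<^sub>m 1 m) (0\<^sub>m m 1) A'" .
 moreover have "vn (of_nat l powi (uval ?a)) = vn ?a"
  using vn_uval[OF a] by (simp add: vn_l_powi)
 ultimately show ?thesis unfolding K_equiv_def using P Q A' by metis
qed

lemma smith:
 "A \<in> carrier_mat m m ==> \<exists>d. K_equiv m A (mat_diag m d) \<and>
  (\<forall>i j. i \<le> j \<and> j < m \<longrightarrow> vn (d j) \<le> vn (d i)) \<and> (\<forall>i<m. d i = 0 \<or> (\<exists>k. d i = of_nat l powi k))"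
proof (induction m arbitrary: A)
 case 0
 then have "A = mat_diag 0 (\<lambda>_. 0)" by (intro eq_matI) (auto simp: mat_diag_def)
 then show ?case using K_equiv_refl[of A 0] 0 by (intro exI[of _ "\<lambda>_. 0"]) auto
next
 case (Suc m)
 note A = Suc.prems
 show ?case
 proof (cases "\<forall>i<Suc m. \<forall>j<Suc m. A $$ (i, j) = 0")
  case True
  then have "A = mat_diag (Suc m) (\<lambda>_. 0)" using A by (intro eq_matI) (auto simp: mat_diag_def)
  then show ?thesis using K_equiv_refl[OF A] by (intro exI[of _ "\<lambda>_. 0"]) auto
 next
  case False
  let ?E = "(\<lambda>(i, j). vn (A $$ (i, j))) ` ({..<Suc m} \<times> {..<Suc m})"
  have fin: "finite ?E" "?E \<noteq> {}" by auto
  then have "Max ?E \<in> ?E" by (rule Max_in)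
  then obtain i0 j0 where ij: "i0 < Suc m" "j0 < Suc m" "vn (A $$ (i0, j0)) = Max ?E" by auto
  have mx: "vn (A $$ (i, j)) \<le> vn (A $$ (i0, j0))" if "i < Suc m" "j < Suc m" for i j
   unfolding ij(3) using fin(1) that by (intro Max_ge) auto
  obtain C where C: "K_equiv (Suc m) A C" "C $$ (0, 0) = A $$ (i0, j0)"
   using pivot_top_left[OF A ij(1,2)] by blast
  have Cc: "C \<in> carrier_mat (Suc m) (Suc m)" using K_equiv_carrier A C by blast
  have mxC: "vn (C $$ (i, j)) \<le> vn (C $$ (0, 0))" if "i < Suc m" "j < Suc m" for i j
   using K_equiv_bound[OF A C(1) _ mx, of i j] that C(2) by simp
  have a: "C $$ (0, 0) \<noteq> 0"
  proof
   assume "C $$ (0, 0) = 0"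
   then have "vn (A $$ (i, j)) \<le> 0" if "i < Suc m" "j < Suc m" for i j using mx[OF that] C(2) by simp
   then show False using False by force
  qed
  obtain A' k where A': "A' \<in> carrier_mat m m" "vn (of_nat l powi k) = vn (C $$ (0, 0))"
   and eq: "K_equiv (Suc m) C (four_block_mat (Matrix.mat 1 1 (\<lambda>_. of_nat l powi k)) (0\<^sub>m 1 m) (0\<^sub>m m 1) A')"
   using smith_step[OF Cc a mxC] by blast
  let ?a = "Matrix.mat 1 1 (\<lambda>_. of_nat l powi k :: 'a)"
  let ?D = "four_block_mat ?a (0\<^sub>m 1 m) (0\<^sub>m m 1) A'"
  have A'b: "vn (A' $$ (i, j)) \<le> vn (C $$ (0, 0))" if "i < m" "j < m" for i j
   using K_equiv_bound[OF Cc eq _ mxC, of "Suc i" "Suc j"] that A' by simp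
  obtain d where d: "K_equiv m A' (mat_diag m d)"
   "\<forall>i j. i \<le> j \<and> j < m \<longrightarrow> vn (d j) \<le> vn (d i)" "\<forall>i<m. d i = 0 \<or> (\<exists>k. d i = of_nat l powi k)"
   using Suc.IH[OF A'(1)] by blast
  have db: "vn (d i) \<le> vn (C $$ (0, 0))" if "i < m" for i
   using K_equiv_bound[OF A'(1) d(1) _ A'b, of i i] that by (simp add: mat_diag_def)
  define d' where "d' = case_nat (of_nat l powi k) d"
  obtain P Q where PQ: "P \<in> KG m" "Q \<in> KG m" "mat_diag m d = P * A' * Q" using d(1) by (auto simp: K_equiv_def)
  note PQc = GL_int_carrier[OF PQ(1)] GL_int_carrier[OF PQ(2)]
  let ?P = "four_block_mat (1\<^sub>m 1) (0\<^sub>m 1 m) (0\<^sub>m m 1) P" and ?Q = "four_block_mat (1\<^sub>m 1) (0\<^sub>m 1 m) (0\<^sub>m m 1) Q"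
  have "?P * ?D = four_block_mat (1\<^sub>m 1 * ?a + 0\<^sub>m 1 m * 0\<^sub>m m 1) (1\<^sub>m 1 * 0\<^sub>m 1 m + 0\<^sub>m 1 m * A')
    (0\<^sub>m m 1 * ?a + P * 0\<^sub>m m 1) (0\<^sub>m m 1 * 0\<^sub>m 1 m + P * A')"
   by (rule mult_four_block_mat) (use PQc A' in auto)
  also have "\<dots> = four_block_mat ?a (0\<^sub>m 1 m) (0\<^sub>m m 1) (P * A')" using PQc A' by simp
  finally have 1: "?P * ?D = \<dots>" .
  have "?P * ?D * ?Q = four_block_mat (?a * 1\<^sub>m 1 + 0\<^sub>m 1 m * 0\<^sub>m m 1) (?a * 0\<^sub>m 1 m + 0\<^sub>m 1 m * Q)
    (0\<^sub>m m 1 * 1\<^sub>m 1 + P * A' * 0\<^sub>m m 1) (0\<^sub>m m 1 * 0\<^sub>m 1 m + P * A' * Q)"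
   unfolding 1 by (rule mult_four_block_mat) (use PQc A' in auto)
  also have "\<dots> = four_block_mat ?a (0\<^sub>m 1 m) (0\<^sub>m m 1) (mat_diag m d)" using PQc A' PQ(3) by simp
  also have "\<dots> = mat_diag (Suc m) d'"
   by (intro eq_matI) (auto simp: mat_diag_def d'_def split: nat.split)
  finally have "?P * ?D * ?Q = mat_diag (Suc m) d'" .
  moreover have "?P \<in> KG (Suc m)" "?Q \<in> KG (Suc m)"
   using GL_int_diag_block[OF GL_int_one PQ(1), of 1] GL_int_diag_block[OF GL_int_one PQ(2), of 1] by auto
  ultimately have "K_equiv (Suc m) ?D (mat_diag (Suc m) d')" unfolding K_equiv_def by metis
  then have "K_equiv (Suc m) A (mat_diag (Suc m) d')"
   using K_equiv_trans[OF A C(1)] K_equiv_trans[OF Cc eq] by blast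
  moreover have "vn (d' j) \<le> vn (d' i)" if "i \<le> j" "j < Suc m" for i j
   using that d(2) db A'(2) by (auto simp: d'_def split: nat.split)
  moreover have "\<forall>i<Suc m. d' i = 0 \<or> (\<exists>k. d' i = of_nat l powi k)"
   using d(3) by (auto simp: d'_def split: nat.split)
  ultimately show ?thesis by blast
 qed
qed

text \<open>Column operations with a pivot of maximal absolute value in the last row. This is the
  common induction step of the Iwasawa decomposition and of the Hermite normal form.\<close>

lemma last_row_step:
 assumes g: "g \<in> carrier (GL (Suc m) :: 'a mat monoid)"
 shows "\<exists>k\<in>KG (Suc m). \<exists>A b e. A \<in> GLc m \<and> b \<in> carrier_mat m 1 \<and>
  g * k = four_block_mat A b (0\<^sub>m 1 m) (Matrix.mat 1 1 (\<lambda>_. of_nat l powi e))"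
proof -
 have gc: "g \<in> carrier_mat (Suc m) (Suc m)" using g GL_carrier_mat by blast
 let ?E = "(\<lambda>j. vn (g $$ (m, j))) ` {..<Suc m}"
 have "Max ?E \<in> ?E" by (rule Max_in) auto
 then obtain j0 where j0: "j0 < Suc m" "vn (g $$ (m, j0)) = Max ?E" by auto
 have mx: "vn (g $$ (m, j)) \<le> vn (g $$ (m, j0))" if "j < Suc m" for j
  unfolding j0(2) using that by (intro Max_ge) auto
 have nz: "g $$ (m, j0) \<noteq> 0"
 proof
  assume "g $$ (m, j0) = 0"
  then have z: "g $$ (m, j) = 0" if "j < Suc m" for j using mx[OF that] by simp
  have "(g * minv (Suc m) g) $$ (m, m) = 0"
   using minv(4)[OF g] gc by (subst mat_mult_index[of _ "Suc m" "Suc m" _ "Suc m"]) (auto simp: z simp del: sum.lessThan_Suc)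
  then show False using minv(2)[OF g] by simp
 qed
 define S where "S = transpose_mat (swaprows_mat (Suc m) m j0 :: 'a mat)"
 define C where "C = g * S"
 have S: "S \<in> KG (Suc m)" unfolding S_def using j0 by (intro GL_int_transpose swaprows_mat_GL_int) auto
 note Sc = GL_int_carrier[OF S]
 have Cc: "C \<in> carrier_mat (Suc m) (Suc m)" using gc Sc by (simp add: C_def)
 have "C = transpose_mat (swaprows_mat (Suc m) m j0 * transpose_mat g)"
  unfolding C_def S_def using gc transpose_mult[of "swaprows_mat (Suc m) m j0" "Suc m" "Suc m" "transpose_mat g" "Suc m"] by simp
 also have "\<dots> = transpose_mat (swaprows m j0 (transpose_mat g))"
  using swaprows_mat[of "transpose_mat g" "Suc m" "Suc m" m j0] gc j0 by simp
 finally have C_eq: "C = \<dots>" .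
 have Cm: "C $$ (m, j) = (if j = m then g $$ (m, j0) else if j = j0 then g $$ (m, m) else g $$ (m, j))" if "j < Suc m" for j
  unfolding C_eq using gc j0 that by auto
 let ?a = "C $$ (m, m)"
 have a0: "?a \<noteq> 0" using Cm[of m] nz by simp
 obtain u where u: "vn u = 1" "?a = u * of_nat l powi (uval ?a)" using unit_decomp[OF a0] .
 then have u0: "u \<noteq> 0" by auto
 obtain c00 c01 c10 c11 where sp: "split_block C m m = (c00, c01, c10, c11)" by (cases "split_block C m m") auto
 have c: "c00 \<in> carrier_mat m m" "c01 \<in> carrier_mat m 1" "c10 \<in> carrier_mat 1 m" "c11 \<in> carrier_mat 1 1"
  "C = four_block_mat c00 c01 c10 c11"
  using split_block[OF sp, of 1 1] Cc by auto
 have e: "c11 $$ (0, 0) = ?a" using c by simp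
 have e10: "vn (c10 $$ (0, j)) \<le> vn ?a" if "j < m" for j
 proof -
  have "c10 $$ (0, j) = C $$ (m, j)" using that c by simp
  then show ?thesis using Cm[of j] Cm[of m] mx[of m] mx[of j] that by auto
 qed
 define y where "y = Matrix.mat 1 m (\<lambda>(i, j). - c10 $$ (0, j) / ?a)"
 have ua: "inverse u * ?a = of_nat l powi (uval ?a)" using u(2) u0 by (metis field_class.field_inverse mult.assoc mult_1)
 define x where "x = Matrix.mat 1 1 (\<lambda>_. inverse u)"
 have xy: "y \<in> carrier_mat 1 m" "x \<in> carrier_mat 1 1" by (auto simp: x_def y_def)
 define Q where "Q = four_block_mat (1\<^sub>m m) (0\<^sub>m m 1) y x"
 have "Q \<in> KG (m + 1)"
  using GL_int_block_lower[of "1\<^sub>m m" m x 1 y] xy e10 a0 u(1) u0 unfolding Q_def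
  by (auto simp: y_def x_def vn_divide vn_inverse mat11_KG simp del: One_nat_def)
 then have Q: "Q \<in> KG (Suc m)" by simp
 define A where "A = c00 + c01 * y"
 have Ac: "A \<in> carrier_mat m m" using c xy by (simp add: A_def)
 have "C * Q = four_block_mat (c00 * 1\<^sub>m m + c01 * y) (c00 * 0\<^sub>m m 1 + c01 * x) (c10 * 1\<^sub>m m + c11 * y) (c10 * 0\<^sub>m m 1 + c11 * x)"
  unfolding c(5) Q_def by (rule mult_four_block_mat) (use c(1-4) xy in auto)
 also have "c00 * 1\<^sub>m m + c01 * y = A" using c by (simp add: A_def)
 also have "c10 * 1\<^sub>m m + c11 * y = 0\<^sub>m 1 m"
  using c(1-4) xy e a0 by (intro eq_matI) (auto simp: scalar_prod_def y_def)
 also have "c10 * 0\<^sub>m m 1 + c11 * x = Matrix.mat 1 1 (\<lambda>_. of_nat l powi (uval ?a))"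
  using c(1-4) xy ua e by (intro eq_matI) (auto simp: scalar_prod_def x_def mult.commute)
 also have "c00 * 0\<^sub>m m 1 + c01 * x = c01 * x" using c xy by simp
 finally have CQ: "C * Q = four_block_mat A (c01 * x) (0\<^sub>m 1 m) (Matrix.mat 1 1 (\<lambda>_. of_nat l powi (uval ?a)))" .
 have gSQ: "g * (S * Q) = C * Q" unfolding C_def using gc Sc GL_int_carrier[OF Q]
  by (simp add: assoc_mult_mat[of _ "Suc m" "Suc m" _ "Suc m" _ "Suc m"])
 have SQ: "S * Q \<in> KG (Suc m)" using S Q GL_int_mult by blast
 have "mdet (C * Q) \<noteq> 0"
  using GL_mult_closed[OF g GL_int_GL[OF SQ]] gSQ by (simp add: GL_carrier)
 then have "mdet A \<noteq> 0" unfolding CQ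
  using det_four_block_mat_lower_left_zero[OF Ac, of "c01 * x" 1 "0\<^sub>m 1 m"] c xy by auto
 then have "A \<in> GLc m" using Ac by (simp add: GL_carrier)
 moreover have "c01 * x \<in> carrier_mat m 1" using c xy by simp
 ultimately show ?thesis using SQ CQ gSQ by metis
qed

lemma block_mult_diag:
 fixes A :: "'a mat"
 assumes "A \<in> carrier_mat m m" "b \<in> carrier_mat m 1" "a \<in> carrier_mat 1 1" "k \<in> carrier_mat m m"
 shows "four_block_mat A b (0\<^sub>m 1 m) a * four_block_mat k (0\<^sub>m m 1) (0\<^sub>m 1 m) (1\<^sub>m 1) = four_block_mat (A * k) b (0\<^sub>m 1 m) a"
proof -
 have "four_block_mat A b (0\<^sub>m 1 m) a * four_block_mat k (0\<^sub>m m 1) (0\<^sub>m 1 m) (1\<^sub>m 1) =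
  four_block_mat (A * k + b * 0\<^sub>m 1 m) (A * 0\<^sub>m m 1 + b * 1\<^sub>m 1) (0\<^sub>m 1 m * k + a * 0\<^sub>m 1 m) (0\<^sub>m 1 m * 0\<^sub>m m 1 + a * 1\<^sub>m 1)"
  by (rule mult_four_block_mat) (use assms in auto)
 then show ?thesis
  using assms right_mult_one_mat[OF assms(2)] right_mult_one_mat[OF assms(3)] by (simp del: One_nat_def)
qed

lemma iwasawa:
 "g \<in> carrier (GL m :: 'a mat monoid) ==>
  \<exists>k\<in>KG m. upper_triangular (g * k) \<and> (\<forall>i<m. \<exists>e. (g * k) $$ (i, i) = of_nat l powi e)"
proof (induction m arbitrary: g)
 case 0
 then show ?case by (intro bexI[of _ "1\<^sub>m 0"]) (auto simp: GL_carrier)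
next
 case (Suc m)
 obtain k A b e where k: "k \<in> KG (Suc m)" and A: "A \<in> GLc m" and b: "b \<in> carrier_mat m 1"
  and gk: "g * k = four_block_mat A b (0\<^sub>m 1 m) (Matrix.mat 1 1 (\<lambda>_. of_nat l powi e))" (is "_ = four_block_mat _ _ _ ?a")
  using last_row_step[OF Suc.prems] by blast
 obtain k' where k': "k' \<in> KG m" "upper_triangular (A * k')" "\<forall>i<m. \<exists>e. (A * k') $$ (i, i) = of_nat l powi e"
  using Suc.IH[OF A] by blast
 note c = GL_carrier_mat[OF A] GL_int_carrier[OF k'(1)] GL_int_carrier[OF k] GL_carrier_mat[OF Suc.prems]
 let ?k' = "four_block_mat k' (0\<^sub>m m 1) (0\<^sub>m 1 m) (1\<^sub>m 1)"
 have K': "?k' \<in> KG (Suc m)" using GL_int_diag_block[OF k'(1) GL_int_one, of 1] by simp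
 have "g * (k * ?k') = (g * k) * ?k'"
  using c GL_int_carrier[OF K'] by (simp add: assoc_mult_mat[of _ "Suc m" "Suc m" _ "Suc m" _ "Suc m"])
 also have "\<dots> = four_block_mat (A * k') b (0\<^sub>m 1 m) ?a"
  unfolding gk by (rule block_mult_diag) (use c b in auto)
 finally have eq: "g * (k * ?k') = \<dots>" .
 have "upper_triangular (g * (k * ?k'))" unfolding eq
  using k' c by (intro upper_triangular_four_block[of _ m _ 1]) auto
 moreover have "\<exists>e. (g * (k * ?k')) $$ (i, i) = of_nat l powi e" if "i < Suc m" for i
  unfolding eq using k'(3) c that by (cases "i < m") auto
 ultimately show ?case using GL_int_mult[OF k K'] by blast
qed

end

section \<open>Hermite normal forms\<close>

lemma sum_only:
 assumes "finite A" "i \<in> A" "\<And>p. p \<in> A ==> p \<noteq> i ==> f p = (0 :: 'b::comm_monoid_add)"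
 shows "sum f A = f i"
 using assms by (subst sum.remove[of _ i]) (auto simp: sum.neutral)

context padic_field
begin

lemma l_neq_0 [simp]: "l \<noteq> 0" using l_gt_1 by simp

abbreviation lq :: 'a where "lq \<equiv> of_nat l"

text \<open>Representatives of the cosets \<open>g K\<close> for the integral \<open>g\<close> that
  divide \<open>l\<close>. Entries to the right of a diagonal 1 can be cleared by column operations;
  entries above a diagonal \<open>l\<close> in a row that also has \<open>l\<close> are excluded by
  divisibility of \<open>l\<close>. So nonzero digits occur only in rows of \<open>S\<close> and
  columns outside \<open>S\<close>.\<close>

definition HN :: "nat => nat set => 'a mat set"
 where "HN m S = {A \<in> carrier_mat m m. (\<forall>i<m. A $$ (i, i) = (if i \<in> S then lq else 1)) \<and>
  (\<forall>i<m. \<forall>j<m. i \<noteq> j \<longrightarrow> (if i < j \<and> i \<in> S \<and> j \<notin> S then A $$ (i, j) \<in> digits else A $$ (i, j) = 0))}"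

lemma HN_D:
 assumes "A \<in> HN m S"
 shows "A \<in> carrier_mat m m" "i < m ==> A $$ (i, i) = (if i \<in> S then lq else 1)"
  "i < m ==> j < m ==> i < j ==> i \<in> S ==> j \<notin> S ==> A $$ (i, j) \<in> digits"
  "i < m ==> j < m ==> i \<noteq> j ==> \<not> (i < j \<and> i \<in> S \<and> j \<notin> S) ==> A $$ (i, j) = 0"
 using assms unfolding HN_def by (auto dest!: spec[of _ i] spec[of _ j])

lemma HN_upper: "A \<in> HN m S ==> upper_triangular A"
 using HN_D(1,4) by (fastforce intro!: upper_triangularI)

lemma HN_int: assumes "A \<in> HN m S" shows "A \<in> int_mat m"
proof -
 have "vn (A $$ (i, j)) \<le> 1" if "i < m" "j < m" for i j
  using HN_D(3,4)[OF assms, of i j] HN_D(2)[OF assms, of i] that l_gt_1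
  by (cases "i = j"; cases "i < j \<and> i \<in> S \<and> j \<notin> S") (auto simp: digits_vn vn_l)
 then show ?thesis using HN_D(1)[OF assms] by (simp add: int_mat_def)
qed

lemma HN_det: assumes "A \<in> HN m S" "S \<subseteq> {..<m}" shows "mdet A = lq ^ card S"
proof -
 have "mdet A = (\<Prod>i<m. if i \<in> S then lq else 1)"
  unfolding det_prod_diag[OF HN_D(1)[OF assms(1)] HN_upper[OF assms(1)]]
  using HN_D(2)[OF assms(1)] by (intro prod.cong) auto
 also have "\<dots> = (\<Prod>i\<in>S. lq)"
  using assms(2) by (subst prod.If_cases) (auto simp: Int_absorb1)
 finally show ?thesis by simp
qed

text \<open>The complement exchanges 1 and \<open>l\<close> on the diagonal and negates the other
  entries. Products of two off-diagonal entries vanish, since the common index would have to lie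
  both outside and inside \<open>S\<close>.\<close>

lemma HN_comp:
 assumes "A \<in> HN m S" shows "\<exists>h\<in>int_mat m. A * h = lq \<cdot>\<^sub>m 1\<^sub>m m"
proof -
 define h where "h = Matrix.mat m m (\<lambda>(i, j). if i = j then (if i \<in> S then 1 else lq) else - A $$ (i, j))"
 note D = HN_D[OF assms]
 have h: "h \<in> int_mat m"
  using HN_int[OF assms] l_gt_1 by (auto simp: int_mat_def h_def vn_l)
 have hc: "h \<in> carrier_mat m m" using h int_mat_carrier by blast
 have "(A * h) $$ (i, j) = (if i = j then lq else 0)" if ij: "i < m" "j < m" for i j
 proof -
  have "(A * h) $$ (i, j) = (\<Sum>p<m. A $$ (i, p) * h $$ (p, j))"
   using mat_mult_index[OF D(1) hc ij] .
  also have "\<dots> = (\<Sum>p\<in>{i, j}. A $$ (i, p) * h $$ (p, j))"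
  proof (rule sum.mono_neutral_right)
   show "\<forall>p\<in>{..<m} - {i, j}. A $$ (i, p) * h $$ (p, j) = 0"
   proof
    fix p assume p: "p \<in> {..<m} - {i, j}"
    then show "A $$ (i, p) * h $$ (p, j) = 0"
     using D(4)[of i p] D(4)[of p j] ij by (cases "p \<in> S") (auto simp: h_def)
   qed
  qed (use ij in auto)
  also have "\<dots> = (if i = j then lq else 0)"
  proof (cases "i = j")
   case True
   then show ?thesis using ij D(2)[of i] by (simp add: h_def)
  next
   case False
   then show ?thesis using ij D(2)[of i] D(2)[of j] D(4)[of i j] by (auto simp: h_def)
  qed
  finally show ?thesis .
 qed
 then have "A * h = lq \<cdot>\<^sub>m 1\<^sub>m m" using D(1) hc by (intro eq_matI) auto
 then show ?thesis using h by blast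
qed

text \<open>Passes the relation \<open>g * h = c\<close> on to the upper left block, for the
  induction in \<open>hnf_exists\<close>; the part about the last column is the condition that
  decides its shape there.\<close>

lemma upper_block_eq:
 assumes A: "A \<in> carrier_mat m m" and b: "b \<in> carrier_mat m 1" and h: "h \<in> carrier_mat (Suc m) (Suc m)"
  and a: "a \<noteq> (0 :: 'a)"
  and eq: "four_block_mat A b (0\<^sub>m 1 m) (Matrix.mat 1 1 (\<lambda>_. a)) * h = c \<cdot>\<^sub>m 1\<^sub>m (Suc m)"
 shows "\<forall>j<m. h $$ (m, j) = 0" "a * h $$ (m, m) = c"
  "\<forall>i<m. (\<Sum>p<m. A $$ (i, p) * h $$ (p, m)) + b $$ (i, 0) * h $$ (m, m) = 0"
  "A * Matrix.mat m m (\<lambda>(i, j). h $$ (i, j)) = c \<cdot>\<^sub>m 1\<^sub>m m"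
proof -
 let ?F = "four_block_mat A b (0\<^sub>m 1 m) (Matrix.mat 1 1 (\<lambda>_. a))"
 have F: "?F \<in> carrier_mat (Suc m) (Suc m)" using four_block_carrier_mat[OF A, of _ 1 1] by simp
 have e: "(\<Sum>p<Suc m. ?F $$ (i, p) * h $$ (p, j)) = (if i = j then c else 0)" if "i < Suc m" "j < Suc m" for i j
 proof -
  have "(?F * h) $$ (i, j) = (\<Sum>p<Suc m. ?F $$ (i, p) * h $$ (p, j))" using mat_mult_index[OF F h that] .
  then show ?thesis unfolding eq using that by (cases "i = j") (simp_all del: sum.lessThan_Suc)
 qed
 have e1: "a * h $$ (m, j) = (if m = j then c else 0)" if "j < Suc m" for j
  using e[of m j] that A b by simp
 have e2: "(\<Sum>p<m. A $$ (i, p) * h $$ (p, j)) + b $$ (i, 0) * h $$ (m, j) = (if i = j then c else 0)"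
  if "i < m" "j < Suc m" for i j
  using e[of i j] that A b by simp
 show 1: "\<forall>j<m. h $$ (m, j) = 0" using e1 a by (metis less_SucI less_irrefl mult_eq_0_iff)
 show "a * h $$ (m, m) = c" using e1 by simp
 show "\<forall>i<m. (\<Sum>p<m. A $$ (i, p) * h $$ (p, m)) + b $$ (i, 0) * h $$ (m, m) = 0" using e2 by force
 have "(A * Matrix.mat m m (\<lambda>(i, j). h $$ (i, j))) $$ (i, j) = (if i = j then c else 0)" if "i < m" "j < m" for i j
  using e2[of i j] 1 that mat_mult_index[OF A, of "Matrix.mat m m (\<lambda>(i, j). h $$ (i, j))" m i j] by simp
 then show "A * Matrix.mat m m (\<lambda>(i, j). h $$ (i, j)) = c \<cdot>\<^sub>m 1\<^sub>m m"
  using A by (intro eq_matI) auto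
qed

lemma cong_l_div: "cong_l x y ==> vn ((x - y) / lq) \<le> 1"
 using vn_less_1_le[of "x - y"] l_pos by (simp add: cong_l_def vn_divide vn_l field_simps)

lemma HN_reduce_column:
 assumes A: "A \<in> HN m S" and b: "\<And>i. i < m ==> vn (b i) \<le> 1"
 shows "\<exists>y. (\<forall>i<m. vn (y i) \<le> 1) \<and>
  (\<forall>i<m. if i \<in> S then (\<Sum>p<m. A $$ (i, p) * y p) + b i \<in> digits else (\<Sum>p<m. A $$ (i, p) * y p) + b i = 0)"
proof -
 \<comment> \<open>What row \<open>i\<close> still contains after the choice
   \<open>y j = - b j\<close> at all \<open>j\<close> outside \<open>S\<close>; for \<open>i\<close>
   in \<open>S\<close> the multiples of \<open>l\<close> available from the diagonal reduce it to
   its digit.\<close>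
 define w where "w i = b i - (\<Sum>j\<in>{..<m} - {i}. A $$ (i, j) * b j)" for i
 define y where "y i = (if i \<in> S then (res (w i) - w i) / lq else - b i)" for i
 note D = HN_D[OF A]
 have w: "vn (w i) \<le> 1" if "i < m" for i
 proof -
  have "vn (A $$ (i, j) * b j) \<le> 1" if "j < m" for j
   using HN_int[OF A] b[OF that] \<open>i < m\<close> that by (auto simp: vn_mult int_mat_def intro!: mult_le_one)
  then have "vn (\<Sum>j\<in>{..<m} - {i}. A $$ (i, j) * b j) \<le> 1" by (intro vn_sum_le) auto
  then show ?thesis unfolding w_def using vn_diff[of "b i"] b[OF that] by (meson max.bounded_iff order_trans)
 qed
 have "vn (y i) \<le> 1" if "i < m" for i
  using cong_l_div[OF cong_l_sym[OF res(2)[OF w[OF that]]]] b[OF that] by (simp add: y_def)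
 moreover have "(\<Sum>p<m. A $$ (i, p) * y p) + b i = (if i \<in> S then res (w i) else 0)" if i: "i < m" for i
 proof -
  have "(\<Sum>p<m. A $$ (i, p) * y p) = A $$ (i, i) * y i + (\<Sum>p\<in>{..<m} - {i}. A $$ (i, p) * y p)"
   using i by (subst sum.remove[of _ i]) auto
  also have "(\<Sum>p\<in>{..<m} - {i}. A $$ (i, p) * y p) = - (\<Sum>p\<in>{..<m} - {i}. A $$ (i, p) * b p)"
   unfolding sum_negf[symmetric]
  proof (rule sum.cong)
   fix p assume p: "p \<in> {..<m} - {i}"
   show "A $$ (i, p) * y p = - (A $$ (i, p) * b p)"
    using D(4)[of i p] p i by (cases "p \<in> S") (auto simp: y_def)
  qed simp
  finally have s: "(\<Sum>p<m. A $$ (i, p) * y p) = A $$ (i, i) * y i - (\<Sum>p\<in>{..<m} - {i}. A $$ (i, p) * b p)" by simp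
  show ?thesis
  proof (cases "i \<in> S")
   case True
   then show ?thesis unfolding s using D(2)[OF i] by (simp add: y_def w_def)
  next
   case False
   then have "(\<Sum>p\<in>{..<m} - {i}. A $$ (i, p) * b p) = 0" using D(4)[of i] i by (intro sum.neutral) auto
   then show ?thesis unfolding s using D(2)[OF i] False by (simp add: y_def)
  qed
 qed
 ultimately show ?thesis using res(1)[OF w] by (intro exI[of _ y]) simp
qed

lemma HN_extend:
 assumes A: "A \<in> HN m S" "S \<subseteq> {..<m}" and b: "b \<in> carrier_mat m 1"
  and e: "(a = lq \<and> (\<forall>i<m. b $$ (i, 0) = 0)) \<or>
   (a = 1 \<and> (\<forall>i<m. if i \<in> S then b $$ (i, 0) \<in> digits else b $$ (i, 0) = 0))"
 shows "four_block_mat A b (0\<^sub>m 1 m) (Matrix.mat 1 1 (\<lambda>_. a)) \<in> HN (Suc m) (if a = lq then insert m S else S)"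
proof -
 note D = HN_D[OF A(1)]
 have c: "four_block_mat A b (0\<^sub>m 1 m) (Matrix.mat 1 1 (\<lambda>_. a)) \<in> carrier_mat (Suc m) (Suc m)"
  using four_block_carrier_mat[OF D(1), of _ 1 1] by simp
 have l1: "lq \<noteq> 1" using l_gt_1 by auto
 have m: "m \<notin> S" using A(2) by auto
 show ?thesis unfolding HN_def using c D(1)
  by (auto simp: less_Suc_eq_le le_less D(2-4) m l1 dest: e[THEN disjE] split: if_splits)
   (use e l1 D m in \<open>auto split: if_splits\<close>)
qed

text \<open>Induction on the size. After \<open>last_row_step\<close>, integrality and the relation
  \<open>g * h = l\<close> leave only 1 and \<open>l\<close> for the last diagonal entry. The last
  column is reduced by the earlier ones, and if the entry is \<open>l\<close>, the relation forces
  the reduced column to vanish.\<close>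

lemma hnf_exists:
 "g \<in> int_mat m ==> h \<in> int_mat m ==> g * h = lq \<cdot>\<^sub>m 1\<^sub>m m ==>
  \<exists>S A k. S \<subseteq> {..<m} \<and> A \<in> HN m S \<and> k \<in> KG m \<and> g * k = A"
proof (induction m arbitrary: g h)
 case 0
 then have "g * 1\<^sub>m 0 \<in> HN 0 {}" by (auto simp: HN_def int_mat_def)
 then show ?case using GL_int_one by blast
next
 case (Suc m)
 note gc = int_mat_carrier[OF Suc.prems(1)] and hc = int_mat_carrier[OF Suc.prems(2)]
 have "mdet g * mdet h = lq ^ Suc m"
  using det_mult[OF gc hc] Suc.prems(3) by simp
 then have "mdet g \<noteq> 0" using of_nat_l_nonzero by (metis mult_zero_left power_not_zero)
 then have "g \<in> GLc (Suc m)" using gc by (simp add: GL_carrier)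
 then obtain k A b e where k: "k \<in> KG (Suc m)" and A: "A \<in> GLc m" and b: "b \<in> carrier_mat m 1"
  and gk: "g * k = four_block_mat A b (0\<^sub>m 1 m) (Matrix.mat 1 1 (\<lambda>_. of_nat l powi e))"
  using last_row_step by blast
 let ?a = "Matrix.mat 1 1 (\<lambda>_. lq powi e :: 'a)"
 have a0: "lq powi e \<noteq> 0" using of_nat_l_nonzero by simp
 have Ac: "A \<in> carrier_mat m m" using A GL_carrier_mat by blast
 note kc = GL_int_carrier[OF k]
 have h'eq: "(g * k') * (minv (Suc m) k' * h) = lq \<cdot>\<^sub>m 1\<^sub>m (Suc m)" "minv (Suc m) k' * h \<in> int_mat (Suc m)"
  if "k' \<in> KG (Suc m)" for k'
 proof -
  have "(g * k') * (minv (Suc m) k' * h) = g * (k' * (minv (Suc m) k' * h))"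
   using gc hc GL_int_carrier[OF that] minv(4)[OF GL_int_GL[OF that]] by (intro assoc_mult_mat) auto
  also have "\<dots> = g * h" using GL_cancel(2)[OF GL_int_GL[OF that] hc] by simp
  finally show "(g * k') * (minv (Suc m) k' * h) = lq \<cdot>\<^sub>m 1\<^sub>m (Suc m)" using Suc.prems(3) by simp
  show "minv (Suc m) k' * h \<in> int_mat (Suc m)"
   using int_mat_mult GL_int_int[OF GL_int_minv[OF that]] Suc.prems(2) by blast
 qed
 define h' where "h' = minv (Suc m) k * h"
 note h' = h'eq[OF k, folded h'_def]
 note ub = upper_block_eq[OF Ac b int_mat_carrier[OF h'(2)] a0 h'(1)[unfolded gk]]
 have gki: "g * k \<in> int_mat (Suc m)" using int_mat_mult Suc.prems(1) GL_int_int[OF k] by blast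
 then have Fi: "vn (four_block_mat A b (0\<^sub>m 1 m) ?a $$ (i, j)) \<le> 1" if "i < Suc m" "j < Suc m" for i j
  using that unfolding gk int_mat_def by blast
 have "vn (A $$ (i, j)) \<le> 1" if "i < m" "j < m" for i j using Fi[of i j] that Ac by simp
 then have Ai: "A \<in> int_mat m" unfolding int_mat_def using Ac by blast
 have bi: "vn (b $$ (i, 0)) \<le> 1" if "i < m" for i using Fi[of i m] that Ac b by simp
 have ai: "vn (lq powi e) \<le> 1" using Fi[of m m] Ac by simp
 have "real l powi (- e) \<le> 1" using ai by (simp add: vn_l_powi)
 then have e0: "0 \<le> e" using l_gt_1
  by (metis linorder_not_less neg_0_less_iff_less one_less_power_int of_nat_1 of_nat_less_iff)
 have "vn (lq powi e) * vn (h' $$ (m, m)) = 1 / l" using ub(2) vn_mult vn_l by metis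
 moreover have "vn (lq powi e) * vn (h' $$ (m, m)) \<le> vn (lq powi e)"
  using h'(2) by (intro mult_left_le) (auto simp: int_mat_def)
 ultimately have "1 / l \<le> vn (lq powi e)" by linarith
 then have "real l powi (- 1) \<le> real l powi (- e)" unfolding vn_l_powi by (simp add: power_int_minus inverse_eq_divide)
 then have e1: "e \<le> 1" using l_gt_1 power_int_strict_increasing[of "- e" "- 1" "real l"] by force
 have "Matrix.mat m m (\<lambda>(i, j). h' $$ (i, j)) \<in> int_mat m" using h'(2) by (auto simp: int_mat_def)
 from Suc.IH[OF Ai this ub(4)] obtain S A0 k' where IH: "S \<subseteq> {..<m}" "A0 \<in> HN m S" "k' \<in> KG m" "A * k' = A0"
  by blast
 note A0c = HN_D(1)[OF IH(2)]
 obtain y where y: "\<forall>i<m. vn (y i) \<le> 1"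
  "\<forall>i<m. if i \<in> S then (\<Sum>p<m. A0 $$ (i, p) * y p) + b $$ (i, 0) \<in> digits else (\<Sum>p<m. A0 $$ (i, p) * y p) + b $$ (i, 0) = 0"
  using HN_reduce_column[OF IH(2), of "\<lambda>i. b $$ (i, 0)"] bi by blast
 define Y where "Y = Matrix.mat m 1 (\<lambda>(i, _). y i)"
 have Yc: "Y \<in> carrier_mat m 1" by (simp add: Y_def)
 define b' where "b' = A0 * Y + b"
 have b'c: "b' \<in> carrier_mat m 1" using A0c Yc b by (simp add: b'_def)
 have b'i: "b' $$ (i, 0) = (\<Sum>p<m. A0 $$ (i, p) * y p) + b $$ (i, 0)" if "i < m" for i
  unfolding b'_def using that b A0c Yc mat_mult_index[OF A0c Yc that, of 0] by (simp add: Y_def)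
 let ?k1 = "four_block_mat k' (0\<^sub>m m 1) (0\<^sub>m 1 m) (1\<^sub>m 1)" and ?k2 = "four_block_mat (1\<^sub>m m) Y (0\<^sub>m 1 m) (1\<^sub>m 1)"
 have "?k1 \<in> KG (m + 1)" using IH(3) by (intro GL_int_diag_block) auto
 moreover have "?k2 \<in> KG (m + 1)" using y Yc by (intro GL_int_block_upper) (auto simp: Y_def)
 ultimately have k1: "?k1 \<in> KG (Suc m)" and k2: "?k2 \<in> KG (Suc m)" by auto
 define K where "K = k * (?k1 * ?k2)"
 have K: "K \<in> KG (Suc m)" unfolding K_def using k k1 k2 GL_int_mult by blast
 note cs = gc kc GL_int_carrier[OF k1] GL_int_carrier[OF k2]
 have "g * K = (g * k) * (?k1 * ?k2)"
  unfolding K_def using cs by (intro assoc_mult_mat[symmetric, of _ "Suc m" "Suc m" _ "Suc m" _ "Suc m"]) auto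
 also have "\<dots> = ((g * k) * ?k1) * ?k2"
  using cs by (intro assoc_mult_mat[symmetric, of _ "Suc m" "Suc m" _ "Suc m" _ "Suc m"]) auto
 also have "(g * k) * ?k1 = four_block_mat A0 b (0\<^sub>m 1 m) ?a"
  unfolding gk using block_mult_diag[OF Ac b _ GL_int_carrier[OF IH(3)]] IH(4) by simp
 also have "four_block_mat A0 b (0\<^sub>m 1 m) ?a * ?k2 = four_block_mat (A0 * 1\<^sub>m m + b * 0\<^sub>m 1 m) (A0 * Y + b * 1\<^sub>m 1)
   (0\<^sub>m 1 m * 1\<^sub>m m + ?a * 0\<^sub>m 1 m) (0\<^sub>m 1 m * Y + ?a * 1\<^sub>m 1)"
  by (rule mult_four_block_mat) (use A0c b Yc in auto)
 also have "\<dots> = four_block_mat A0 b' (0\<^sub>m 1 m) ?a"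
  using A0c b Yc right_mult_one_mat[OF b] right_mult_one_mat[of ?a 1 1] by (simp add: b'_def del: One_nat_def)
 finally have gK: "g * K = four_block_mat A0 b' (0\<^sub>m 1 m) ?a" .
 define h2 where "h2 = minv (Suc m) K * h"
 note h2 = h'eq[OF K, folded h2_def]
 note ub2 = upper_block_eq[OF A0c b'c int_mat_carrier[OF h2(2)] a0 h2(1)[unfolded gK]]
 have "(lq powi e = lq \<and> (\<forall>i<m. b' $$ (i, 0) = 0)) \<or>
   (lq powi e = 1 \<and> (\<forall>i<m. if i \<in> S then b' $$ (i, 0) \<in> digits else b' $$ (i, 0) = 0))"
 proof (cases "e = 0")
  case True
  then show ?thesis using y(2) b'i by simp
 next
  case False
  then have e: "e = 1" using e0 e1 by simp
  \<comment> \<open>With \<open>l\<close> in the last place of the form, the complement has 1 there.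
    Row \<open>i\<close> of the relation then says that \<open>b'\<close> at \<open>i\<close> is
    divisible by \<open>l\<close>, and a digit divisible by \<open>l\<close> is 0.\<close>
  have hm: "h2 $$ (m, m) = 1" using ub2(2) e of_nat_l_nonzero by simp
  note D = HN_D[OF IH(2)]
  have h0: "h2 $$ (i, m) = 0" if "i < m" "i \<notin> S" for i
  proof -
   have "(\<Sum>p<m. A0 $$ (i, p) * h2 $$ (p, m)) = A0 $$ (i, i) * h2 $$ (i, m)"
    using that D(4)[of i] by (intro sum_only) auto
   then show ?thesis using ub2(3)[rule_format, of i] that b'i[of i] y(2) hm D(2)[of i] by simp
  qed
  have "b' $$ (i, 0) = 0" if i: "i < m" for i
  proof (cases "i \<in> S")
   case True
   have "A0 $$ (i, p) * h2 $$ (p, m) = 0" if "p < m" "p \<noteq> i" for p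
    using h0[of p] D(4)[of i p] that i by (cases "p \<in> S") auto
   then have "(\<Sum>p<m. A0 $$ (i, p) * h2 $$ (p, m)) = A0 $$ (i, i) * h2 $$ (i, m)"
    using i by (intro sum_only) auto
   then have "b' $$ (i, 0) = - (lq * h2 $$ (i, m))"
    using ub2(3)[rule_format, of i] i hm D(2)[of i] True by (simp add: add_eq_0_iff)
   then have "vn (b' $$ (i, 0)) \<le> 1 / l"
    using h2(2) i l_pos by (simp add: vn_mult vn_l int_mat_def divide_right_mono)
   then have "cong_l (b' $$ (i, 0)) 0" using vn_le_iff_less[of "b' $$ (i, 0)"] by (simp add: cong_l_def)
   then show ?thesis using y(2) b'i[OF i] i True by (intro digit_cong_eq) auto
  qed (use y(2) b'i i in simp)
  then show ?thesis using e by simp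
 qed
 from HN_extend[OF IH(2,1) b'c this] obtain S' where "S' \<subseteq> {..<Suc m}" "g * K \<in> HN (Suc m) S'"
  unfolding gK using IH(1) by (metis (full_types) insert_subset lessThan_Suc subset_insertI2 lessThan_iff lessI insertI1)
 then show ?case using K by blast
qed

text \<open>Both forms are upper triangular, so \<open>k\<close> is too, with units on the diagonal.
  Comparing absolute values of the diagonals gives \<open>S = S'\<close>, hence \<open>k\<close> is
  unipotent; its entries above the diagonal vanish because digits that are congruent modulo
  \<open>l\<close> are equal.\<close>

lemma HN_unique:
 assumes A: "A \<in> HN m S" and B: "B \<in> HN m S'" and k: "k \<in> KG m" and eq: "B = A * k"
  and S: "S \<subseteq> {..<m}" "S' \<subseteq> {..<m}"
 shows "S = S' \<and> A = B"
proof -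
 note DA = HN_D[OF A] and DB = HN_D[OF B]
 note kc = GL_int_carrier[OF k]
 have e: "B $$ (i, j) = (\<Sum>p<m. A $$ (i, p) * k $$ (p, j))" if "i < m" "j < m" for i j
  unfolding eq using mat_mult_index[OF DA(1) kc that] .
 have Aii: "A $$ (i, i) \<noteq> 0" if "i < m" for i using DA(2)[OF that] of_nat_l_nonzero by simp
 have low: "k $$ (i, j) = 0" if "j < i" "i < m" for i j
  using that
 proof (induction "m - i" arbitrary: i rule: less_induct)
  case less
  have "A $$ (i, p) * k $$ (p, j) = 0" if "p < m" "p \<noteq> i" for p
  proof (cases "p < i")
   case True then show ?thesis using DA(4)[of i p] less.prems that by simp
  next
   case False then show ?thesis using less.hyps[of p] less.prems that by simp
  qed
  then have "B $$ (i, j) = A $$ (i, i) * k $$ (i, j)"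
   using e[of i j] less.prems sum_only[of "{..<m}" i "\<lambda>p. A $$ (i, p) * k $$ (p, j)"] by simp
  moreover have "B $$ (i, j) = 0" using DB(4)[of i j] less.prems by simp
  ultimately show ?case using Aii less.prems by simp
 qed
 have "upper_triangular k" using low kc by (intro upper_triangularI) auto
 then have "mdet k = (\<Prod>i<m. k $$ (i, i))" using det_prod_diag kc by blast
 then have dk: "(\<Prod>i<m. vn (k $$ (i, i))) = 1" using k by (simp add: GL_int_iff vn_prod)
 have kdiag: "vn (k $$ (i, i)) = 1" if "i < m" for i
 proof -
  have le: "vn (k $$ (p, q)) \<le> 1" if "p < m" "q < m" for p q using k that by (auto simp: GL_int_iff int_mat_def)
  have "vn (k $$ (i, i)) * (\<Prod>p\<in>{..<m} - {i}. vn (k $$ (p, p))) = 1"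
   using dk that by (subst (asm) prod.remove[of _ i]) auto
  moreover have "(\<Prod>p\<in>{..<m} - {i}. vn (k $$ (p, p))) \<le> 1" using le by (intro prod_le_1) auto
  ultimately show ?thesis using le[OF that that] mult_left_le[of "\<Prod>p\<in>{..<m} - {i}. vn (k $$ (p, p))" "vn (k $$ (i, i))"] by simp
 qed
 have diag: "B $$ (i, i) = A $$ (i, i) * k $$ (i, i)" if "i < m" for i
 proof -
  have "A $$ (i, p) * k $$ (p, i) = 0" if "p < m" "p \<noteq> i" for p
   using low[of i p] DA(4)[of i p] that \<open>i < m\<close> by (cases "p < i") auto
  then show ?thesis using e[OF that that] that sum_only[of "{..<m}" i "\<lambda>p. A $$ (i, p) * k $$ (p, i)"] by simp
 qed
 have SS: "i \<in> S \<longleftrightarrow> i \<in> S'" if "i < m" for i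
 proof -
  have "vn (B $$ (i, i)) = vn (A $$ (i, i))" using diag[OF that] kdiag[OF that] by (simp add: vn_mult)
  then show ?thesis using DA(2)[OF that] DB(2)[OF that] l_gt_1 by (auto simp: vn_l split: if_splits)
 qed
 then have S_eq: "S = S'" using S by blast
 have k1: "k $$ (i, i) = 1" if "i < m" for i
  using diag[OF that] DA(2)[OF that] DB(2)[OF that] SS[OF that] Aii[OF that] by (auto split: if_splits)
 have up: "k $$ (i, j) = 0" if "i < j" "j < m" for i j
  using that
 proof (induction "m - i" arbitrary: i rule: less_induct)
  case less
  have "A $$ (i, p) * k $$ (p, j) = 0" if p: "p \<in> {..<m} - {i, j}" for p
  proof -
   have "p < i \<or> i < p \<and> p < j \<or> j < p" using p by auto
   then consider "p < i" | "i < p" "p < j" | "j < p" by blast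
   then show ?thesis using DA(4)[of i p] less.hyps[of p] low[of j p] less.prems p by cases auto
  qed
  then have "(\<Sum>p<m. A $$ (i, p) * k $$ (p, j)) = (\<Sum>p\<in>{i, j}. A $$ (i, p) * k $$ (p, j))"
   using less.prems by (intro sum.mono_neutral_right) auto
  then have "B $$ (i, j) = A $$ (i, i) * k $$ (i, j) + A $$ (i, j)"
   using e[of i j] less.prems k1[of j] by simp
  then have 1: "B $$ (i, j) - A $$ (i, j) = A $$ (i, i) * k $$ (i, j)" by simp
  have ij: "i < m" using less.prems by simp
  show ?case
  proof (cases "i \<in> S \<and> j \<notin> S")
   case True
   have "vn (k $$ (i, j)) \<le> 1" using k ij less.prems by (auto simp: GL_int_iff int_mat_def)
   then have "vn (B $$ (i, j) - A $$ (i, j)) \<le> 1 / l"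
    unfolding 1 using DA(2)[OF ij] True l_pos by (simp add: vn_mult vn_l divide_right_mono)
   then have "cong_l (B $$ (i, j)) (A $$ (i, j))" using vn_le_iff_less by (simp add: cong_l_def)
   then have "B $$ (i, j) = A $$ (i, j)"
    using DA(3)[of i j] DB(3)[of i j] True less.prems ij S_eq by (intro digit_cong_eq) auto
   then show ?thesis using 1 Aii[OF ij] by simp
  next
   case False
   then have "A $$ (i, j) = 0" "B $$ (i, j) = 0" using DA(4)[of i j] DB(4)[of i j] S_eq less.prems ij by auto
   then show ?thesis using 1 Aii[OF ij] by simp
  qed
 qed
 have "k = 1\<^sub>m m"
 proof (rule eq_matI)
  fix i j assume "i < dim_row (1\<^sub>m m :: 'a mat)" "j < dim_col (1\<^sub>m m :: 'a mat)"
  then show "k $$ (i, j) = 1\<^sub>m m $$ (i, j)"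
   using low[of j i] up[of i j] k1[of i] by (cases i j rule: linorder_cases) auto
 qed (use kc in auto)
 then show ?thesis using eq DA(1) S_eq by simp
qed

section \<open>Hecke double cosets and their structure constants\<close>

text \<open>The double coset of the diagonal matrix with \<open>k\<close> entries \<open>l\<close>
  and the others 1, described by conditions that are visibly stable under multiplication by integral
  matrices: integral, a divisor of \<open>l\<close>, and determinant of valuation
  \<open>k\<close>.\<close>

definition Xk :: "nat => nat => 'a mat set"
 where "Xk m k = {g \<in> int_mat m. (\<exists>h\<in>int_mat m. g * h = lq \<cdot>\<^sub>m 1\<^sub>m m) \<and> vn (mdet g) = (1 / l) ^ k}"

definition HNk :: "nat => nat => 'a mat set"
 where "HNk m k = (\<Union>S\<in>{S. S \<subseteq> {..<m} \<and> card S = k}. HN m S)"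

lemma vn_lq_power: "vn (lq ^ j) = (1 / l) ^ j" by (simp add: vn_power vn_l)

lemma inv_l_power_inj: "(1 / real l) ^ j = (1 / real l) ^ k ==> j = k"
 using l_gt_1 by (simp add: power_one_over)

lemma HNk_Xk: "HNk m k \<subseteq> Xk m k"
 unfolding HNk_def Xk_def using HN_int HN_comp HN_det vn_lq_power by fastforce

text \<open>Together with \<open>HNk_unique\<close> this makes \<open>HNk m k\<close> a set of
  representatives of the cosets \<open>g K\<close> in \<open>Xk m k\<close>.\<close>

lemma Xk_rep:
 assumes "g \<in> Xk m k" shows "\<exists>x\<in>HNk m k. \<exists>u\<in>KG m. g = x * u"
proof -
 obtain h where h: "g \<in> int_mat m" "h \<in> int_mat m" "g * h = lq \<cdot>\<^sub>m 1\<^sub>m m" "vn (mdet g) = (1 / l) ^ k"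
  using assms by (auto simp: Xk_def)
 obtain S A u where A: "S \<subseteq> {..<m}" "A \<in> HN m S" "u \<in> KG m" "g * u = A" using hnf_exists[OF h(1-3)] by blast
 have "vn (mdet A) = (1 / l) ^ k"
  using A(3,4) h(4) det_mult[OF int_mat_carrier[OF h(1)] GL_int_carrier[OF A(3)]] by (simp add: vn_mult GL_int_iff)
 then have "card S = k" using HN_det[OF A(2,1)] vn_lq_power inv_l_power_inj by metis
 then have "A \<in> HNk m k" using A by (auto simp: HNk_def)
 moreover have "g = A * minv m u"
  using GL_cancel_right(1)[OF GL_int_GL[OF A(3)] int_mat_carrier[OF h(1)]] A(4) by simp
 ultimately show ?thesis using GL_int_minv[OF A(3)] by blast
qed

lemma HNk_unique:
 assumes "x \<in> HNk m k" "y \<in> HNk m k'" "u \<in> KG m" "y = x * u" shows "x = y"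
 using assms HN_unique unfolding HNk_def by blast


lemma smult_one_GL: "lq \<cdot>\<^sub>m 1\<^sub>m m \<in> GLc m"
 by (simp add: GL_carrier)

lemma l_complement_commute:
 assumes "g \<in> carrier_mat m m" "h \<in> carrier_mat m m" "g * h = lq \<cdot>\<^sub>m 1\<^sub>m m"
 shows "h * g = lq \<cdot>\<^sub>m 1\<^sub>m m"
proof -
 define h' where "h' = inverse lq \<cdot>\<^sub>m h"
 have h': "h' \<in> carrier_mat m m" using assms by (simp add: h'_def)
 have "g * h' = inverse lq \<cdot>\<^sub>m (g * h)" unfolding h'_def using mult_smult_distrib[OF assms(1,2)] .
 also have "\<dots> = 1\<^sub>m m" unfolding assms(3) by (auto intro!: eq_matI)
 finally have "h' * g = 1\<^sub>m m" using mat_mult_left_right_inverse[OF assms(1) h'] by blast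
 moreover have "h = lq \<cdot>\<^sub>m h'" using assms(2) by (auto simp: h'_def intro!: eq_matI)
 ultimately show ?thesis using mult_smult_assoc_mat[OF h' assms(1)] by simp
qed

lemma Xk_int: "g \<in> Xk m k ==> g \<in> int_mat m" by (simp add: Xk_def)

lemma Xk_GL: assumes "g \<in> Xk m k" shows "g \<in> GLc m"
proof -
 have "vn (mdet g) \<noteq> 0" using assms by (simp add: Xk_def)
 then show ?thesis using Xk_int[OF assms] int_mat_carrier by (auto simp: GL_carrier)
qed

lemma Xk_carrier: "g \<in> Xk m k ==> g \<in> carrier_mat m m" using Xk_int int_mat_carrier by blast

lemma Xk_mult_right:
 assumes "g \<in> Xk m k" "u \<in> KG m" shows "g * u \<in> Xk m k"
proof -
 obtain h where h: "h \<in> int_mat m" "g * h = lq \<cdot>\<^sub>m 1\<^sub>m m" using assms by (auto simp: Xk_def)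
 note c = Xk_carrier[OF assms(1)] GL_int_carrier[OF assms(2)] int_mat_carrier[OF h(1)] minv(4)[OF GL_int_GL[OF assms(2)]]
 have "(g * u) * (minv m u * h) = g * (u * (minv m u * h))"
  using c by (intro assoc_mult_mat[of _ m m _ m _ m]) auto
 also have "\<dots> = lq \<cdot>\<^sub>m 1\<^sub>m m" using GL_cancel(2)[OF GL_int_GL[OF assms(2)] c(3)] h(2) by simp
 finally have "(g * u) * (minv m u * h) = lq \<cdot>\<^sub>m 1\<^sub>m m" .
 moreover have "minv m u * h \<in> int_mat m" using int_mat_mult GL_int_int GL_int_minv assms(2) h(1) by blast
 moreover have "vn (mdet (g * u)) = vn (mdet g)"
  using det_mult[OF c(1,2)] assms(2) by (simp add: vn_mult GL_int_iff)
 moreover have "g * u \<in> int_mat m" using int_mat_mult Xk_int GL_int_int assms by blast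
 ultimately show ?thesis using assms(1) unfolding Xk_def by auto
qed

lemma Xk_transpose:
 assumes "g \<in> Xk m k" shows "transpose_mat g \<in> Xk m k"
proof -
 obtain h where h: "h \<in> int_mat m" "g * h = lq \<cdot>\<^sub>m 1\<^sub>m m" using assms by (auto simp: Xk_def)
 note c = Xk_carrier[OF assms] int_mat_carrier[OF h(1)]
 have "transpose_mat g * transpose_mat h = transpose_mat (h * g)" using transpose_mult[OF c(2,1)] by simp
 also have "h * g = lq \<cdot>\<^sub>m 1\<^sub>m m" using l_complement_commute c h(2) by blast
 also have "transpose_mat (lq \<cdot>\<^sub>m 1\<^sub>m m) = lq \<cdot>\<^sub>m 1\<^sub>m m" by (auto intro!: eq_matI)
 finally show ?thesis using assms h(1) int_mat_transpose[of g m] int_mat_transpose[of h m] det_transpose[OF c(1)]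
  unfolding Xk_def by auto
qed

lemma Xk_mult_left:
 assumes "g \<in> Xk m k" "u \<in> KG m" shows "u * g \<in> Xk m k"
proof -
 have "transpose_mat g * transpose_mat u \<in> Xk m k"
  using assms by (intro Xk_mult_right Xk_transpose GL_int_transpose)
 then have "transpose_mat (u * g) \<in> Xk m k"
  using transpose_mult[OF GL_int_carrier[OF assms(2)] Xk_carrier[OF assms(1)]] by simp
 from Xk_transpose[OF this] show ?thesis by simp
qed

lemma HNk_GL: "x \<in> HNk m k ==> x \<in> GLc m" using HNk_Xk Xk_GL by blast

lemma finite_HN: "finite (HN m S)"
proof -
 let ?E = "digits \<union> {lq}"
 let ?f = "\<lambda>A. restrict (\<lambda>p. A $$ p) ({..<m} \<times> {..<m})"
 have "HN m S \<subseteq> (\<lambda>f. Matrix.mat m m f) ` (PiE ({..<m} \<times> {..<m}) (\<lambda>_. ?E))"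
 proof
  fix A assume A: "A \<in> HN m S"
  have "A $$ (i, j) \<in> ?E" if "i < m" "j < m" for i j
   using HN_D(2)[OF A that(1)] HN_D(3,4)[OF A that] by (cases "i = j"; cases "i < j \<and> i \<in> S \<and> j \<notin> S") auto
  then have "?f A \<in> PiE ({..<m} \<times> {..<m}) (\<lambda>_. ?E)" by auto
  moreover have "A = Matrix.mat m m (?f A)" using HN_D(1)[OF A] by (intro eq_matI) auto
  ultimately show "A \<in> (\<lambda>f. Matrix.mat m m f) ` (PiE ({..<m} \<times> {..<m}) (\<lambda>_. ?E))" by blast
 qed
 then show ?thesis by (rule finite_subset) (intro finite_imageI finite_PiE, auto)
qed

lemma finite_HNk: "finite (HNk m k)"
 unfolding HNk_def using finite_HN finite_subset[of "{S. S \<subseteq> {..<m} \<and> card S = k}" "Pow {..<m}"] by auto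

definition rp :: "nat => nat => 'a mat => 'a mat"
 where "rp m k g = (SOME x. x \<in> HNk m k \<and> (\<exists>u\<in>KG m. x = g * u))"

lemma rp:
 assumes "g \<in> Xk m k" shows "rp m k g \<in> HNk m k" "\<exists>u\<in>KG m. rp m k g = g * u"
proof -
 obtain x u where x: "x \<in> HNk m k" "u \<in> KG m" "g = x * u" using Xk_rep[OF assms] by blast
 then have "x = g * minv m u" using GL_cancel_right(1)[OF GL_int_GL[OF x(2)] GL_carrier_mat[OF HNk_GL[OF x(1)]]] by simp
 then have "\<exists>x. x \<in> HNk m k \<and> (\<exists>u\<in>KG m. x = g * u)" using x GL_int_minv by blast
 from someI_ex[OF this] show "rp m k g \<in> HNk m k" "\<exists>u\<in>KG m. rp m k g = g * u" by (auto simp: rp_def)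
qed

text \<open>Left multiplication by \<open>c\<close> permutes the cosets in \<open>Xk m k\<close>,
  and a right invariant \<open>\<phi>\<close> does not see which representatives are taken. Every
  invariance of a Hecke sum rests on this.\<close>

lemma HNk_reindex:
 fixes \<phi> :: "'a mat => 'b::comm_monoid_add"
 assumes \<phi>: "\<And>x u. x \<in> Xk m k ==> u \<in> KG m ==> \<phi> (x * u) = \<phi> x" and c: "c \<in> KG m"
 shows "(\<Sum>x\<in>HNk m k. \<phi> (c * x)) = (\<Sum>x\<in>HNk m k. \<phi> x)"
proof -
 have X: "c * x \<in> Xk m k" if "x \<in> HNk m k" for x using that HNk_Xk Xk_mult_left c by blast
 have eq: "\<phi> (c * x) = \<phi> (rp m k (c * x))" if "x \<in> HNk m k" for x
  using rp(2)[OF X[OF that]] \<phi>[OF X[OF that]] by force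
 have inj: "inj_on (\<lambda>x. rp m k (c * x)) (HNk m k)"
 proof (rule inj_onI)
  fix x y assume xy: "x \<in> HNk m k" "y \<in> HNk m k" "rp m k (c * x) = rp m k (c * y)"
  obtain u v where u: "u \<in> KG m" "rp m k (c * x) = (c * x) * u" and v: "v \<in> KG m" "rp m k (c * y) = (c * y) * v"
   using rp(2)[OF X[OF xy(1)]] rp(2)[OF X[OF xy(2)]] by blast
  note cs = GL_int_carrier[OF u(1)] GL_int_carrier[OF v(1)] GL_int_carrier[OF c]
   GL_carrier_mat[OF HNk_GL[OF xy(1)]] GL_carrier_mat[OF HNk_GL[OF xy(2)]] minv(4)[OF GL_int_GL[OF v(1)]]
  have "c * (x * u) = c * (y * v)" using u v xy(3) cs by (simp add: assoc_mult_mat[of _ m m _ m _ m])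
  then have "x * u = y * v" using GL_cancel(1)[OF GL_int_GL[OF c]] cs by (metis mult_carrier_square)
  then have "y = (x * u) * minv m v" using GL_cancel_right(1)[OF GL_int_GL[OF v(1)] cs(5)] by simp
  also have "\<dots> = x * (u * minv m v)" using cs by (intro assoc_mult_mat) auto
  finally show "x = y" using HNk_unique[OF xy(1,2)] GL_int_mult GL_int_minv u v by blast
 qed
 have "(\<lambda>x. rp m k (c * x)) ` HNk m k = HNk m k"
  using inj rp(1)[OF X] by (intro endo_inj_surj finite_HNk) auto
 then have "(\<Sum>x\<in>HNk m k. \<phi> x) = (\<Sum>x\<in>HNk m k. \<phi> (rp m k (c * x)))"
  using sum.reindex[OF inj, of \<phi>] by simp
 then show ?thesis using eq by simp
qed

text \<open>A structure constant of the Hecke algebra: the multiplicity of the coset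
  \<open>z K\<close> in the product of the double cosets \<open>Xk m i\<close> and
  \<open>Xk m j\<close>.\<close>

definition nij :: "nat => nat => nat => 'a mat => nat"
 where "nij m i j z = card {x \<in> HNk m i. minv m x * z \<in> Xk m j}"

text \<open>The injection sends \<open>x\<close> to the representative of \<open>c^-1 x\<close>.
  Equality follows in \<open>nij_left\<close> by applying the inequality to the inverse of
  \<open>c\<close>.\<close>

lemma nij_left_le:
 assumes z: "z \<in> GLc m" and c: "c \<in> KG m" shows "nij m i j (c * z) \<le> nij m i j z"
 unfolding nij_def
proof (rule card_inj_on_le)
 let ?f = "\<lambda>x. rp m i (minv m c * x)"
 note ci = GL_int_minv[OF c]
 have X: "minv m c * x \<in> Xk m i" if "x \<in> HNk m i" for x using that HNk_Xk Xk_mult_left ci by blast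
 show "?f ` {x \<in> HNk m i. minv m x * (c * z) \<in> Xk m j} \<subseteq> {x \<in> HNk m i. minv m x * z \<in> Xk m j}"
 proof clarify
  fix x assume x: "x \<in> HNk m i" "minv m x * (c * z) \<in> Xk m j"
  obtain u where u: "u \<in> KG m" "?f x = (minv m c * x) * u" using rp(2)[OF X[OF x(1)]] by blast
  note g = HNk_GL[OF x(1)] GL_int_GL[OF u(1)] GL_int_GL[OF c] GL_int_GL[OF ci] z
  have "minv m (?f x) = minv m u * (minv m x * c)"
   unfolding u(2) using g by (simp add: minv_mult GL_mult_closed minv_minv)
  then have "minv m (?f x) * z = minv m u * (minv m x * (c * z))"
   using g minv(4)[OF g(1)] minv(4)[OF g(2)] GL_carrier_mat[OF g(3)] GL_carrier_mat[OF z]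
   by (simp add: assoc_mult_mat[of _ m m _ m _ m])
  then have "minv m (?f x) * z \<in> Xk m j" using Xk_mult_left[OF x(2) GL_int_minv[OF u(1)]] by simp
  then show "?f x \<in> HNk m i \<and> minv m (?f x) * z \<in> Xk m j" using rp(1)[OF X[OF x(1)]] by simp
 qed
 show "inj_on ?f {x \<in> HNk m i. minv m x * (c * z) \<in> Xk m j}"
 proof (rule inj_onI)
  fix x y assume "x \<in> {x \<in> HNk m i. minv m x * (c * z) \<in> Xk m j}" "y \<in> {x \<in> HNk m i. minv m x * (c * z) \<in> Xk m j}"
   and e: "?f x = ?f y"
  then have xy: "x \<in> HNk m i" "y \<in> HNk m i" by auto
  obtain u v where u: "u \<in> KG m" "?f x = (minv m c * x) * u" and v: "v \<in> KG m" "?f y = (minv m c * y) * v"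
   using rp(2)[OF X[OF xy(1)]] rp(2)[OF X[OF xy(2)]] by blast
  note cs = GL_int_carrier[OF u(1)] GL_int_carrier[OF v(1)] GL_int_carrier[OF ci]
   GL_carrier_mat[OF HNk_GL[OF xy(1)]] GL_carrier_mat[OF HNk_GL[OF xy(2)]] minv(4)[OF GL_int_GL[OF v(1)]]
  have "minv m c * (x * u) = minv m c * (y * v)" using u v e cs by (simp add: assoc_mult_mat[of _ m m _ m _ m])
  then have "x * u = y * v" using GL_cancel(1)[OF GL_int_GL[OF ci]] cs by (metis mult_carrier_square)
  then have "y = (x * u) * minv m v" using GL_cancel_right(1)[OF GL_int_GL[OF v(1)] cs(5)] by simp
  also have "\<dots> = x * (u * minv m v)" using cs by (intro assoc_mult_mat) auto
  finally show "x = y" using HNk_unique[OF xy(1,2)] GL_int_mult GL_int_minv u v by blast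
 qed
qed (simp add: finite_HNk)

lemma nij_left:
 assumes z: "z \<in> GLc m" and c: "c \<in> KG m" shows "nij m i j (c * z) = nij m i j z"
proof (rule antisym)
 have "nij m i j (minv m c * (c * z)) \<le> nij m i j (c * z)"
  by (rule nij_left_le[OF GL_mult_closed[OF GL_int_GL[OF c] z] GL_int_minv[OF c]])
 then show "nij m i j z \<le> nij m i j (c * z)" using GL_cancel(1)[OF GL_int_GL[OF c] GL_carrier_mat[OF z]] by simp
qed (rule nij_left_le[OF assms])

lemma nij_right:
 assumes z: "z \<in> GLc m" and c: "c \<in> KG m" shows "nij m i j (z * c) = nij m i j z"
proof -
 have 1: "minv m x * (z * c) \<in> Xk m j" if "minv m x * z \<in> Xk m j" "x \<in> HNk m i" "z \<in> GLc m" "c \<in> KG m" for x z c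
  using Xk_mult_right[OF that(1,4)] minv(4)[OF HNk_GL[OF that(2)]] GL_carrier_mat[OF that(3)] GL_int_carrier[OF that(4)]
  by (simp add: assoc_mult_mat[of _ m m _ m _ m])
 have "minv m x * (z * c) \<in> Xk m j \<longleftrightarrow> minv m x * z \<in> Xk m j" if "x \<in> HNk m i" for x
  using 1[of x z c] 1[of x "z * c" "minv m c"] that z c GL_cancel_right(1)[OF GL_int_GL[OF c] GL_carrier_mat[OF z]]
   GL_int_minv[OF c] GL_mult_closed[OF z GL_int_GL[OF c]] by auto
 then show ?thesis unfolding nij_def by (metis (mono_tags, lifting) mem_Collect_eq)
qed

text \<open>A factorization \<open>z = x w\<close> transposes to a factorization with the factors in
  the opposite order; the injection sends \<open>x\<close> to the representative of the transpose of
  \<open>w\<close>.\<close>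

lemma nij_transpose_le:
 assumes z: "z \<in> GLc m" shows "nij m i j z \<le> nij m j i (transpose_mat z)"
 unfolding nij_def
proof (rule card_inj_on_le)
 let ?f = "\<lambda>x. rp m j (transpose_mat (minv m x * z))"
 note zc = GL_carrier_mat[OF z]
 have X: "transpose_mat (minv m x * z) \<in> Xk m j" if "minv m x * z \<in> Xk m j" for x using that Xk_transpose by blast
 show "?f ` {x \<in> HNk m i. minv m x * z \<in> Xk m j} \<subseteq> {x \<in> HNk m j. minv m x * transpose_mat z \<in> Xk m i}"
 proof clarify
  fix x assume x: "x \<in> HNk m i" "minv m x * z \<in> Xk m j"
  obtain u where u: "u \<in> KG m" "?f x = transpose_mat (minv m x * z) * u" using rp(2)[OF X[OF x(2)]] by blast
  define w where "w = minv m x * z"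
  have w: "w \<in> GLc m" "w \<in> Xk m j" using x(2) Xk_GL by (auto simp: w_def)
  note wt = GL_transpose[OF w(1)]
  have zw: "z = x * w" unfolding w_def using GL_cancel(2)[OF HNk_GL[OF x(1)] zc] by simp
  have "transpose_mat z = transpose_mat w * transpose_mat x"
   unfolding zw using transpose_mult[OF GL_carrier_mat[OF HNk_GL[OF x(1)]] GL_carrier_mat[OF w(1)]] .
  moreover have "minv m (?f x) = minv m u * minv m (transpose_mat w)"
   using u(2)[folded w_def] minv_mult[OF wt GL_int_GL[OF u(1)]] by (simp add: w_def)
  ultimately have "minv m (?f x) * transpose_mat z = minv m u * (minv m (transpose_mat w) * (transpose_mat w * transpose_mat x))"
   using minv(4)[OF wt] minv(4)[OF GL_int_GL[OF u(1)]] GL_carrier_mat[OF wt] GL_carrier_mat[OF GL_transpose[OF HNk_GL[OF x(1)]]]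
   by (simp add: assoc_mult_mat[of _ m m _ m _ m])
  also have "\<dots> = minv m u * transpose_mat x"
   using GL_cancel(1)[OF wt GL_carrier_mat[OF GL_transpose[OF HNk_GL[OF x(1)]]]] by simp
  finally have "minv m (?f x) * transpose_mat z \<in> Xk m i"
   using x(1) HNk_Xk Xk_transpose Xk_mult_left GL_int_minv[OF u(1)] by (metis subsetD)
  then show "?f x \<in> HNk m j \<and> minv m (?f x) * transpose_mat z \<in> Xk m i" using rp(1)[OF X[OF x(2)]] by simp
 qed
 show "inj_on ?f {x \<in> HNk m i. minv m x * z \<in> Xk m j}"
 proof (rule inj_onI)
  fix x y assume a: "x \<in> {x \<in> HNk m i. minv m x * z \<in> Xk m j}" "y \<in> {x \<in> HNk m i. minv m x * z \<in> Xk m j}"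
   and e: "?f x = ?f y"
  then have xy: "x \<in> HNk m i" "y \<in> HNk m i" by auto
  define w where "w = minv m x * z"
  define w' where "w' = minv m y * z"
  have wX: "w \<in> Xk m j" "w' \<in> Xk m j" using a by (auto simp: w_def w'_def)
  note wc = Xk_carrier[OF wX(1)] Xk_carrier[OF wX(2)]
  obtain u v where u: "u \<in> KG m" "?f x = transpose_mat w * u" and v: "v \<in> KG m" "?f y = transpose_mat w' * v"
   using rp(2)[OF Xk_transpose[OF wX(1)]] rp(2)[OF Xk_transpose[OF wX(2)]] unfolding w_def w'_def by blast
  note uc = GL_int_carrier[OF u(1)] and vc = GL_int_carrier[OF v(1)]
  have "transpose_mat (transpose_mat w * u) = transpose_mat (transpose_mat w' * v)" using u v e by simp
  then have 1: "transpose_mat u * w = transpose_mat v * w'"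
   using transpose_mult[of "transpose_mat w" m m u m] transpose_mult[of "transpose_mat w'" m m v m] uc vc wc by simp
  define p where "p = transpose_mat u"
  define q where "q = transpose_mat v"
  have pq: "p \<in> KG m" "q \<in> KG m" using u v GL_int_transpose by (auto simp: p_def q_def)
  have w'eq: "w' = (minv m q * p) * w"
   using 1 GL_cancel(1)[OF GL_int_GL[OF pq(2)] wc(2)] wc GL_int_carrier[OF pq(1)] minv(4)[OF GL_int_GL[OF pq(2)]]
   unfolding p_def[symmetric] q_def[symmetric] by (metis assoc_mult_mat)
  define t where "t = minv m q * p"
  have t: "t \<in> KG m" unfolding t_def using pq GL_int_mult GL_int_minv by blast
  note xc = GL_carrier_mat[OF HNk_GL[OF xy(1)]] GL_carrier_mat[OF HNk_GL[OF xy(2)]] GL_int_carrier[OF t]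
  have "x * w = z" "y * w' = z" using GL_cancel(2)[OF HNk_GL[OF xy(1)] zc] GL_cancel(2)[OF HNk_GL[OF xy(2)] zc]
   by (auto simp: w_def w'_def)
  then have "x * w = (y * t) * w" unfolding w'eq t_def[symmetric] using xc wc by (simp add: assoc_mult_mat[of _ m m _ m _ m])
  then have "x = y * t" using GL_cancel_right(1)[OF Xk_GL[OF wX(1)]] xc by (metis mult_carrier_square)
  then show "x = y" using HNk_unique[OF xy(2,1) t] by simp
 qed
qed (simp add: finite_HNk)

text \<open>The Smith form of \<open>z\<close> is diagonal, hence equal to its own
  transpose.\<close>

lemma transpose_double_coset:
 assumes z: "z \<in> GLc m" shows "\<exists>P\<in>KG m. \<exists>Q\<in>KG m. transpose_mat z = P * z * Q"
proof -
 note zc = GL_carrier_mat[OF z]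
 obtain d P Q where PQ: "P \<in> KG m" "Q \<in> KG m" "mat_diag m d = P * z * Q"
  using smith[OF zc] unfolding K_equiv_def by blast
 note c = GL_int_carrier[OF PQ(1)] GL_int_carrier[OF PQ(2)]
 have "transpose_mat (mat_diag m d) = mat_diag m d" by (auto simp: mat_diag_def intro!: eq_matI)
 then have "transpose_mat (P * z * Q) = P * z * Q" using PQ(3) by simp
 then have e: "transpose_mat Q * (transpose_mat z * transpose_mat P) = P * z * Q"
  using c zc transpose_mult[of "P * z" m m Q m] transpose_mult[of P m m z m] by simp
 define Pt where "Pt = transpose_mat P"
 define Qt where "Qt = transpose_mat Q"
 have K: "Pt \<in> KG m" "Qt \<in> KG m" using PQ GL_int_transpose by (auto simp: Pt_def Qt_def)
 note Kc = GL_int_carrier[OF K(1)] GL_int_carrier[OF K(2)] minv(4)[OF GL_int_GL[OF K(1)]] minv(4)[OF GL_int_GL[OF K(2)]]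
 have zt: "transpose_mat z \<in> carrier_mat m m" using zc by simp
 have e': "Qt * (transpose_mat z * Pt) = P * z * Q" using e by (simp add: Pt_def Qt_def)
 then have "transpose_mat z * Pt = minv m Qt * (P * z * Q)"
  using GL_cancel(1)[OF GL_int_GL[OF K(2)], of "transpose_mat z * Pt" m] zt Kc by simp
 then have "transpose_mat z = (minv m Qt * (P * z * Q)) * minv m Pt"
  using GL_cancel_right(1)[OF GL_int_GL[OF K(1)] zt] by simp
 also have "\<dots> = (minv m Qt * P) * z * (Q * minv m Pt)"
  using Kc c zc by (simp add: assoc_mult_mat[of _ m m _ m _ m])
 finally show ?thesis using K PQ GL_int_mult GL_int_minv by blast
qed

text \<open>Gelfand's argument: transposition reverses products and preserves every double coset, so
  the structure constants are symmetric.\<close>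

lemma nij_commute: assumes z: "z \<in> GLc m" shows "nij m i j z = nij m j i z"
proof -
 obtain P Q where PQ: "P \<in> KG m" "Q \<in> KG m" "transpose_mat z = P * z * Q" using transpose_double_coset[OF z] by blast
 have inv: "nij m i j (transpose_mat z) = nij m i j z" for i j
  unfolding PQ(3) using PQ z GL_int_GL GL_mult_closed nij_left nij_right by metis
 have "nij m i j z \<le> nij m j i z" "nij m j i z \<le> nij m i j z"
  using nij_transpose_le[OF z] inv by metis+
 then show ?thesis by simp
qed

end

section \<open>Common eigenvectors\<close>

context vector_space
begin

text \<open>Among the nonzero polynomials \<open>p\<close> with \<open>p(T) w = 0\<close> for some
  nonzero \<open>w\<close> in \<open>W\<close>, one of least degree is taken. If \<open>z\<close> is
  a root and \<open>p = (X - z) q\<close>, then \<open>q(T) w\<close> is nonzero by minimality and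
  is an eigenvector.\<close>

lemma eigenvector_exists:
 assumes W: "subspace W" and B: "finite B" "W \<subseteq> span B" and w0: "w0 \<in> W" "w0 \<noteq> 0"
  and T: "\<And>w. w \<in> W ==> T w \<in> W" "\<And>v w. v \<in> W ==> w \<in> W ==> T (v + w) = T v + T w"
   "\<And>c w. w \<in> W ==> T (scale c w) = scale c (T w)"
  and closed: "\<And>p :: 'a poly. degree p > 0 ==> \<exists>z. poly p z = 0"
 shows "\<exists>c w. w \<in> W \<and> w \<noteq> 0 \<and> T w = scale c w"
proof -
 have Tp: "(T ^^ i) w \<in> W" if "w \<in> W" for i w using that T(1) by (induction i) auto
 have T0: "T 0 = 0" using T(3)[of w0 0] w0 by simp
 have Tsum: "T (\<Sum>i\<in>A. f i) = (\<Sum>i\<in>A. T (f i)) \<and> (\<Sum>i\<in>A. f i) \<in> W" if "finite A" "\<And>i. i \<in> A ==> f i \<in> W" for A and f :: "nat => 'b"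
  using that by (induction A rule: finite_induct) (auto simp: T0 T(2) subspace_0[OF W] subspace_add[OF W])
 \<comment> \<open>This is \<open>p(T) w\<close>. Since \<open>T\<close> is linear on
   \<open>W\<close> only, it is moved through sums by \<open>Tsum\<close>.\<close>
 define ev where "ev p w = (\<Sum>i\<le>degree p. scale (coeff p i) ((T ^^ i) w))" for p w
 have ev_N: "ev p w = (\<Sum>i\<le>N. scale (coeff p i) ((T ^^ i) w))" if "degree p \<le> N" for p w N
  unfolding ev_def using that by (intro sum.mono_neutral_left) (auto simp: coeff_eq_0)
 have ev_W: "ev p w \<in> W" if "w \<in> W" for p w
  unfolding ev_def using that Tsum[of "{..degree p}"] subspace_scale[OF W] Tp by auto
 have ev_mult: "ev ([:-z, 1:] * q) w = T (ev q w) - scale z (ev q w)" if "w \<in> W" for z q w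
 proof -
  let ?n = "degree q"
  let ?f = "\<lambda>i. (T ^^ i) w"
  have d: "degree ([:-z, 1:] * q) \<le> Suc ?n" using degree_mult_le[of "[:-z, 1:]" q] by simp
  have "ev ([:-z, 1:] * q) w = (\<Sum>i\<le>Suc ?n. scale (coeff ([:-z, 1:] * q) i) (?f i))" by (rule ev_N[OF d])
  also have "\<dots> = (\<Sum>i\<le>Suc ?n. scale (case i of 0 => 0 | Suc j => coeff q j) (?f i) - scale (z * coeff q i) (?f i))"
   by (intro sum.cong) (auto simp: coeff_pCons scale_left_diff_distrib algebra_simps split: nat.split)
  also have "\<dots> = (\<Sum>i\<le>Suc ?n. scale (case i of 0 => 0 | Suc j => coeff q j) (?f i)) - (\<Sum>i\<le>Suc ?n. scale (z * coeff q i) (?f i))"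
   by (rule sum_subtractf)
  also have "(\<Sum>i\<le>Suc ?n. scale (z * coeff q i) (?f i)) = scale z (ev q w)"
   unfolding ev_N[of q "Suc ?n", OF le_SucI[OF order_refl]] by (simp only: scale_sum_right scale_scale)
  also have "(\<Sum>i\<le>Suc ?n. scale (case i of 0 => 0 | Suc j => coeff q j) (?f i)) = (\<Sum>i\<le>?n. T (scale (coeff q i) (?f i)))"
   using T(3) Tp[OF that] by (simp add: sum.atMost_Suc_shift del: sum.atMost_Suc)
  also have "\<dots> = T (ev q w)"
   unfolding ev_def using Tsum[of "{..?n}" "\<lambda>i. scale (coeff q i) (?f i)"] subspace_scale[OF W] Tp[OF that] by simp
  finally show ?thesis .
 qed
 have "\<exists>p. p \<noteq> 0 \<and> ev p w0 = 0"
 proof -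
  let ?f = "\<lambda>i. (T ^^ i) w0"
  \<comment> \<open>The first \<open>card B + 1\<close> iterates of \<open>w0\<close> either repeat
    or are too many distinct vectors in the span of \<open>B\<close>; both give a linear
    relation.\<close>
  have "\<exists>N (a :: nat => 'a). (\<Sum>i\<le>N. scale (a i) (?f i)) = 0 \<and> (\<exists>i\<le>N. a i \<noteq> 0)"
  proof (cases "inj_on ?f {..card B}")
   case False
   then obtain i j where ij: "i \<le> card B" "j \<le> card B" "i \<noteq> j" "?f i = ?f j" by (auto simp: inj_on_def)
   let ?a = "\<lambda>k. if k = i then 1 else if k = j then - 1 else (0 :: 'a)"
   have "(\<Sum>k\<le>card B. scale (?a k) (?f k)) = (\<Sum>k\<in>{i, j}. scale (?a k) (?f k))"
    using ij by (intro sum.mono_neutral_right) auto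
   also have "\<dots> = 0" using ij by simp
   finally show ?thesis using ij by (intro exI[of _ "card B"] exI[of _ ?a]) auto
  next
   case True
   let ?S = "?f ` {..card B}"
   have "card ?S = Suc (card B)" using True by (simp add: card_image)
   moreover have "?S \<subseteq> span B" using Tp[OF w0(1)] B(2) by auto
   ultimately have "dependent ?S" using independent_span_bound[OF B(1), of ?S] by force
   then obtain u v where u: "v \<in> ?S" "u v \<noteq> 0" "(\<Sum>v\<in>?S. scale (u v) v) = 0"
    using dependent_finite[of ?S] by auto
   have "(\<Sum>i\<le>card B. scale (u (?f i)) (?f i)) = 0" using u(3) True by (simp add: sum.reindex)
   then show ?thesis using u(1,2) by (intro exI[of _ "card B"] exI[of _ "\<lambda>i. u (?f i)"]) auto
  qed
  then obtain N and a :: "nat => 'a" where a: "(\<Sum>i\<le>N. scale (a i) (?f i)) = 0" "\<exists>i\<le>N. a i \<noteq> 0" by blast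
  define p where "p = (\<Sum>i\<le>N. monom (a i) i)"
  have c: "coeff p i = (if i \<le> N then a i else 0)" for i
   unfolding p_def coeff_sum by simp
  have "degree p \<le> N" using c by (intro degree_le) auto
  then have "ev p w0 = 0" using ev_N[of p N] a(1) c by simp
  moreover have "p \<noteq> 0" using a(2) c by (metis coeff_0)
  ultimately show ?thesis by blast
 qed
 then have ex: "\<exists>d p w. p \<noteq> 0 \<and> degree p = d \<and> w \<in> W \<and> w \<noteq> 0 \<and> ev p w = 0" using w0 by blast
 define P where "P d \<longleftrightarrow> (\<exists>p w. p \<noteq> 0 \<and> degree p = d \<and> w \<in> W \<and> w \<noteq> 0 \<and> ev p w = 0)" for d
 have "\<exists>d. P d" using ex by (simp add: P_def)
 then have "P (LEAST d. P d)" by (rule LeastI_ex)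
 then obtain p w where p: "p \<noteq> 0" "degree p = (LEAST d. P d)" "w \<in> W" "w \<noteq> 0" "ev p w = 0" by (auto simp: P_def)
 have "degree p > 0"
 proof (rule ccontr)
  assume "\<not> degree p > 0"
  then have "scale (coeff p 0) w = 0" "coeff p 0 \<noteq> 0"
   using p(1,5) leading_coeff_neq_0[of p] by (auto simp: ev_def)
  then show False using p(4) by simp
 qed
 then obtain z where "poly p z = 0" using closed by blast
 then obtain q where q: "p = [:-z, 1:] * q" using poly_eq_0_iff_dvd by blast
 then have q0: "q \<noteq> 0" using p(1) by auto
 then have "degree p = Suc (degree q)" unfolding q by (subst degree_mult_eq) auto
 then have "\<not> P (degree q)" using p(2) not_less_Least[of "degree q" P] by simp
 then have "ev q w \<noteq> 0" using q0 p(3,4) by (auto simp: P_def)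
 moreover have "T (ev q w) = scale z (ev q w)" using ev_mult[OF p(3), of z q] p(5) q by simp
 ultimately show ?thesis using ev_W[OF p(3)] by blast
qed

end

lemma (in padic_field) KG_nonempty [simp]: "KG m \<noteq> {}"
 using GL_int_one by (metis empty_iff)

section \<open>Hecke operators on representations with finite orbits\<close>

text \<open>The representation lives on a subspace \<open>V\<close> of its type, so that both
  \<open>\<sigma>\<close>, with \<open>V = UNIV\<close>, and spaces of functions inside an induced
  representation are instances. Smoothness is present only as finiteness of the orbits of the
  integral group.\<close>

locale hecke_module = padic_field Q l + vector_space smul
 for Q :: "'a::{field_char_0, complete_space} itself" and l :: nat
  and smul :: "complex => 'v::ab_group_add => 'v" +
 fixes m :: nat and V :: "'v set" and \<rho> :: "'a mat => 'v => 'v"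
 assumes V: "subspace V"
  and \<rho>_closed: "g \<in> GLc m ==> v \<in> V ==> \<rho> g v \<in> V"
  and \<rho>_add: "g \<in> GLc m ==> v \<in> V ==> w \<in> V ==> \<rho> g (v + w) = \<rho> g v + \<rho> g w"
  and \<rho>_smul: "g \<in> GLc m ==> v \<in> V ==> \<rho> g (smul c v) = smul c (\<rho> g v)"
  and \<rho>_one: "v \<in> V ==> \<rho> (1\<^sub>m m) v = v"
  and \<rho>_mult: "g \<in> GLc m ==> h \<in> GLc m ==> v \<in> V ==> \<rho> (g * h) v = \<rho> g (\<rho> h v)"
  and orbit_finite: "v \<in> V ==> finite ((\<lambda>k. \<rho> k v) ` KG m)"
begin

definition VK :: "'v set" where "VK = {v \<in> V. \<forall>k\<in>KG m. \<rho> k v = v}"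

definition hecke_T :: "nat => 'v => 'v" where "hecke_T k v = (\<Sum>x\<in>HNk m k. \<rho> x v)"

lemma VK_V: "v \<in> VK ==> v \<in> V" by (simp add: VK_def)

lemma VK_fix: "v \<in> VK ==> k \<in> KG m ==> \<rho> k v = v" by (simp add: VK_def)

lemma \<rho>_0: "g \<in> GLc m ==> \<rho> g 0 = 0"
 using \<rho>_smul[of g 0 0] subspace_0[OF V] by simp

lemma \<rho>_sum: "g \<in> GLc m ==> (\<And>i. i \<in> A ==> f i \<in> V) ==> \<rho> g (sum f A) = (\<Sum>i\<in>A. \<rho> g (f i))"
proof (induction A rule: infinite_finite_induct)
 case (insert x F)
 then show ?case using \<rho>_add[of g "f x" "sum f F"] subspace_sum[OF V, of F f] by simp
qed (auto simp: \<rho>_0)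

lemma VK_subspace: "subspace VK"
 unfolding VK_def
 by (rule subspaceI) (auto simp: subspace_0[OF V] subspace_add[OF V] subspace_scale[OF V] \<rho>_0 \<rho>_add \<rho>_smul GL_int_GL)

lemma hecke_T_V: "v \<in> V ==> hecke_T k v \<in> V"
 unfolding hecke_T_def using \<rho>_closed HNk_GL by (intro subspace_sum[OF V]) auto

lemma hecke_T_VK:
 assumes v: "v \<in> VK" shows "hecke_T k v \<in> VK"
proof -
 have "\<rho> c (hecke_T k v) = hecke_T k v" if c: "c \<in> KG m" for c
 proof -
  have "\<rho> c (hecke_T k v) = (\<Sum>x\<in>HNk m k. \<rho> (c * x) v)"
   unfolding hecke_T_def using c v VK_V \<rho>_closed HNk_GL GL_int_GL
   by (subst \<rho>_sum) (auto simp: \<rho>_mult)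
  also have "\<dots> = hecke_T k v" unfolding hecke_T_def
   by (rule HNk_reindex[OF _ c]) (simp add: \<rho>_mult[OF Xk_GL GL_int_GL VK_V[OF v]] VK_fix[OF v])
  finally show ?thesis .
 qed
 then show ?thesis using hecke_T_V[OF VK_V[OF v]] by (auto simp: VK_def)
qed

lemma hecke_T_add: "v \<in> V ==> w \<in> V ==> hecke_T k (v + w) = hecke_T k v + hecke_T k w"
 unfolding hecke_T_def by (simp add: \<rho>_add HNk_GL sum.distrib)

lemma hecke_T_smul: "v \<in> V ==> hecke_T k (smul c v) = smul c (hecke_T k v)"
 unfolding hecke_T_def by (simp add: \<rho>_smul HNk_GL scale_sum_right)

definition coset :: "'a mat => 'a mat set" where "coset z = (\<lambda>u. z * u) ` KG m"

definition coset_val :: "'v => 'a mat set => 'v" where "coset_val v c = \<rho> (SOME z. z \<in> c) v"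

lemma coset_val:
 assumes z: "z \<in> GLc m" and v: "v \<in> VK" shows "coset_val v (coset z) = \<rho> z v"
proof -
 have "coset z \<noteq> {}" by (simp add: coset_def)
 then have "(SOME x. x \<in> coset z) \<in> coset z" by (simp add: some_in_eq)
 then obtain u where "u \<in> KG m" "(SOME x. x \<in> coset z) = z * u" by (auto simp: coset_def)
 then show ?thesis using z v by (simp add: coset_val_def \<rho>_mult GL_int_GL VK_V VK_fix)
qed

lemma coset_eqD:
 assumes z: "z \<in> GLc m" "z' \<in> GLc m" and e: "coset z = coset z'"
 shows "\<exists>u\<in>KG m. z' = z * u"
proof -
 have "z' * 1\<^sub>m m \<in> coset z'" unfolding coset_def using GL_int_one by blast
 then have "z' \<in> coset z" using e GL_carrier_mat[OF z(2)] by simp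
 then show ?thesis by (auto simp: coset_def)
qed

lemma coset_eqI:
 assumes z: "z \<in> GLc m" and u: "u \<in> KG m"
 shows "coset (z * u) = coset z"
proof -
 note c = GL_carrier_mat[OF z] GL_int_carrier[OF u]
 have 1: "coset (z * u) \<subseteq> coset z" if "z \<in> carrier_mat m m" "u \<in> KG m" for z u
 proof
  fix w assume "w \<in> coset (z * u)"
  then obtain k where k: "k \<in> KG m" "w = (z * u) * k" by (auto simp: coset_def)
  then have "w = z * (u * k)" using that GL_int_carrier[OF that(2)] GL_int_carrier[OF k(1)] by simp
  then show "w \<in> coset z" unfolding coset_def using GL_int_mult[OF that(2) k(1)] by blast
 qed
 have "coset ((z * u) * minv m u) \<subseteq> coset (z * u)" using c GL_int_minv[OF u] by (intro 1) auto
 then show ?thesis using 1[OF c(1) u] GL_cancel_right(1)[OF GL_int_GL[OF u] c(1)] by auto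
qed

text \<open>A pair is determined by its first member \<open>x\<close>, because the second one
  represents the coset of \<open>x^-1 z\<close>.\<close>

lemma card_coset_pairs:
 assumes z: "z \<in> GLc m"
 shows "card {p \<in> HNk m i \<times> HNk m j. coset (fst p * snd p) = coset z} = nij m i j z"
proof -
 let ?P = "{p \<in> HNk m i \<times> HNk m j. coset (fst p * snd p) = coset z}"
 have inj: "inj_on fst ?P"
 proof (rule inj_onI, clarsimp)
  fix x y y' assume x: "x \<in> HNk m i" and y: "y \<in> HNk m j" "y' \<in> HNk m j"
   and e: "coset (x * y) = coset z" "coset (x * y') = coset z"
  note g = HNk_GL[OF x] HNk_GL[OF y(1)] HNk_GL[OF y(2)]
  obtain u where u: "u \<in> KG m" "x * y' = (x * y) * u"
   using coset_eqD[of "x * y" "x * y'"] e g GL_mult_closed by metis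
  then have "x * y' = x * (y * u)" using g GL_carrier_mat GL_int_carrier by (metis assoc_mult_mat)
  then have "y' = y * u" using GL_cancel(1)[OF g(1)] g GL_carrier_mat GL_int_carrier[OF u(1)] by (metis mult_carrier_square)
  then show "y = y'" using HNk_unique[OF y u(1)] by simp
 qed
 have "fst ` ?P = {x \<in> HNk m i. minv m x * z \<in> Xk m j}"
 proof (intro equalityI subsetI)
  fix x assume "x \<in> fst ` ?P"
  then obtain y where x: "x \<in> HNk m i" and y: "y \<in> HNk m j" and e: "coset (x * y) = coset z" by auto
  note g = HNk_GL[OF x] HNk_GL[OF y]
  obtain u where u: "u \<in> KG m" "z = (x * y) * u" using coset_eqD[OF GL_mult_closed[OF g] z e] by blast
  have "z = x * (y * u)" using u g GL_carrier_mat GL_int_carrier by (metis assoc_mult_mat)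
  then have "minv m x * z = y * u" using GL_cancel(1)[OF g(1)] g GL_carrier_mat GL_int_carrier[OF u(1)] by (metis mult_carrier_square)
  then show "x \<in> {x \<in> HNk m i. minv m x * z \<in> Xk m j}" using x Xk_mult_right[OF subsetD[OF HNk_Xk y] u(1)] by simp
 next
  fix x assume "x \<in> {x \<in> HNk m i. minv m x * z \<in> Xk m j}"
  then have x: "x \<in> HNk m i" "minv m x * z \<in> Xk m j" by auto
  obtain y u where y: "y \<in> HNk m j" "u \<in> KG m" "minv m x * z = y * u" using Xk_rep[OF x(2)] by blast
  note g = HNk_GL[OF x(1)] HNk_GL[OF y(1)]
  have "z = x * (y * u)" using y(3) GL_cancel(2)[OF g(1) GL_carrier_mat[OF z]] by simp
  then have "z = (x * y) * u" using g GL_carrier_mat GL_int_carrier[OF y(2)] by (metis assoc_mult_mat)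
  then have "coset (x * y) = coset z" using coset_eqI[OF GL_mult_closed[OF g] y(2)] by simp
  then show "x \<in> fst ` ?P" using x y by force
 qed
 then show ?thesis unfolding nij_def using card_image[OF inj] by simp
qed

text \<open>On a spherical vector both compositions are sums of \<open>\<rho> z v\<close> over
  cosets \<open>z K\<close>, with multiplicities \<open>nij m i j z\<close> and
  \<open>nij m j i z\<close>, which agree.\<close>

lemma hecke_T_commute:
 assumes v: "v \<in> VK" shows "hecke_T i (hecke_T j v) = hecke_T j (hecke_T i v)"
proof -
 \<comment> \<open>The cosets from both orders together, so that the two sums share one index set; a
   coset that does not occur in one of them has multiplicity 0 there.\<close>
 define CC where "CC = (\<lambda>p. coset (fst p * snd p)) ` (HNk m i \<times> HNk m j) \<union> (\<lambda>p. coset (fst p * snd p)) ` (HNk m j \<times> HNk m i)"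
 have fin: "finite CC" by (simp add: CC_def finite_HNk)
 have CCz: "\<exists>z\<in>GLc m. c = coset z" if c: "c \<in> CC" for c
 proof -
  obtain x y where xy: "c = coset (x * y)" "x \<in> HNk m i \<union> HNk m j" "y \<in> HNk m i \<union> HNk m j"
  proof -
   obtain p where p: "c = coset (fst p * snd p)" "p \<in> HNk m i \<times> HNk m j \<union> HNk m j \<times> HNk m i"
    using c unfolding CC_def by blast
   then show ?thesis by (intro that[of "fst p" "snd p"]) auto
  qed
  then have "x * y \<in> GLc m" using HNk_GL by (intro GL_mult_closed) auto
  then show ?thesis using xy(1) by blast
 qed
 have main: "hecke_T i (hecke_T j v) = (\<Sum>c\<in>CC. smul (of_nat (card {p \<in> HNk m i \<times> HNk m j. coset (fst p * snd p) = c})) (coset_val v c))"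
  if sub: "(\<lambda>p. coset (fst p * snd p)) ` (HNk m i \<times> HNk m j) \<subseteq> CC" for i j
 proof -
  have "hecke_T i (hecke_T j v) = (\<Sum>x\<in>HNk m i. \<Sum>y\<in>HNk m j. \<rho> (x * y) v)"
   unfolding hecke_T_def
  proof (rule sum.cong)
   fix x assume x: "x \<in> HNk m i"
   have "\<rho> x (\<Sum>y\<in>HNk m j. \<rho> y v) = (\<Sum>y\<in>HNk m j. \<rho> x (\<rho> y v))"
    using \<rho>_closed[OF HNk_GL VK_V[OF v]] by (intro \<rho>_sum HNk_GL[OF x]) auto
   also have "\<dots> = (\<Sum>y\<in>HNk m j. \<rho> (x * y) v)"
    using \<rho>_mult[OF HNk_GL[OF x] HNk_GL VK_V[OF v]] by (intro sum.cong) auto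
   finally show "\<rho> x (\<Sum>y\<in>HNk m j. \<rho> y v) = (\<Sum>y\<in>HNk m j. \<rho> (x * y) v)" .
  qed simp
  also have "\<dots> = (\<Sum>p\<in>HNk m i \<times> HNk m j. coset_val v (coset (fst p * snd p)))"
   unfolding sum.cartesian_product
   by (intro sum.cong) (auto simp: coset_val[OF GL_mult_closed[OF HNk_GL HNk_GL] v])
  also have "\<dots> = (\<Sum>c\<in>CC. \<Sum>p\<in>{p \<in> HNk m i \<times> HNk m j. coset (fst p * snd p) = c}. coset_val v (coset (fst p * snd p)))"
   using sub by (intro sum.group[symmetric] fin) (auto simp: finite_HNk)
  also have "\<dots> = (\<Sum>c\<in>CC. \<Sum>p\<in>{p \<in> HNk m i \<times> HNk m j. coset (fst p * snd p) = c}. coset_val v c)"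
   by (intro sum.cong) auto
  also have "\<dots> = (\<Sum>c\<in>CC. smul (of_nat (card {p \<in> HNk m i \<times> HNk m j. coset (fst p * snd p) = c})) (coset_val v c))"
   by (simp add: sum_constant_scale)
  finally show ?thesis .
 qed
 have sub1: "(\<lambda>p. coset (fst p * snd p)) ` (HNk m i \<times> HNk m j) \<subseteq> CC"
  and sub2: "(\<lambda>p. coset (fst p * snd p)) ` (HNk m j \<times> HNk m i) \<subseteq> CC"
  unfolding CC_def by (rule Un_upper1, rule Un_upper2)
 have "card {p \<in> HNk m i \<times> HNk m j. coset (fst p * snd p) = c} = card {p \<in> HNk m j \<times> HNk m i. coset (fst p * snd p) = c}"
  if c: "c \<in> CC" for c
 proof -
  obtain z where z: "z \<in> GLc m" "c = coset z" using CCz[OF c] by blast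
  show ?thesis unfolding z(2) card_coset_pairs[OF z(1)] by (rule nij_commute[OF z(1)])
 qed
 then show ?thesis unfolding main[OF sub1] main[OF sub2] by (intro sum.cong) simp_all
qed

text \<open>The joint eigenspace \<open>W\<close> of the first \<open>N\<close> operators is stable
  under the next one because they commute on spherical vectors.\<close>

lemma common_eigenvector:
 assumes fin: "finite B" "VK \<subseteq> span B" and v0: "v0 \<in> VK" "v0 \<noteq> 0"
 shows "\<exists>c v. v \<in> VK \<and> v \<noteq> 0 \<and> (\<forall>j<N. hecke_T j v = smul (c j) v)"
proof (induction N)
 case 0
 then show ?case using v0 by blast
next
 case (Suc N)
 then obtain c v where v: "v \<in> VK" "v \<noteq> 0" "\<forall>j<N. hecke_T j v = smul (c j) v" by blast
 define W where "W = {w \<in> VK. \<forall>j<N. hecke_T j w = smul (c j) w}"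
 have W: "subspace W"
 proof (rule subspaceI)
  show "0 \<in> W" using subspace_0[OF VK_subspace] hecke_T_smul[of 0 _ 0] subspace_0[OF V] by (auto simp: W_def)
  show "x + y \<in> W" if "x \<in> W" "y \<in> W" for x y
   using that subspace_add[OF VK_subspace] by (auto simp: W_def hecke_T_add VK_V scale_right_distrib)
  show "smul a x \<in> W" if "x \<in> W" for a x
   using that subspace_scale[OF VK_subspace] by (auto simp: W_def hecke_T_smul VK_V mult.commute)
 qed
 have WV: "w \<in> VK" "w \<in> V" if "w \<in> W" for w using that VK_V by (auto simp: W_def)
 have TW: "hecke_T N w \<in> W" if "w \<in> W" for w
 proof -
  have "hecke_T j (hecke_T N w) = smul (c j) (hecke_T N w)" if "j < N" for j
   using \<open>w \<in> W\<close> that hecke_T_commute[of w j N] WV[OF \<open>w \<in> W\<close>] by (simp add: W_def hecke_T_smul)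
  then show ?thesis using hecke_T_VK[OF WV(1)[OF that]] by (simp add: W_def)
 qed
 have "\<exists>z w. w \<in> W \<and> w \<noteq> 0 \<and> hecke_T N w = smul z w"
 proof (rule eigenvector_exists[OF W fin(1)])
  show "W \<subseteq> span B" using WV fin(2) by auto
  show "v \<in> W" "v \<noteq> 0" using v by (auto simp: W_def)
  show "\<exists>z. poly p z = 0" if "degree p > 0" for p :: "complex poly"
   using that fundamental_theorem_of_algebra[of p] by (metis constant_degree less_irrefl)
 qed (use TW WV hecke_T_add hecke_T_smul in auto)
 then obtain z w where w: "w \<in> W" "w \<noteq> 0" "hecke_T N w = smul z w" by blast
 then have "\<forall>j<Suc N. hecke_T j w = smul ((c(N := z)) j) w" by (auto simp: W_def less_Suc_eq)
 then show ?case using w WV by blast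
qed

section \<open>The projection to spherical vectors\<close>

text \<open>Plays the part of the integral of \<open>\<rho> k w\<close> over the compact group of
  the \<open>k\<close>; the orbit being finite, each of its points has the same weight.\<close>

definition avg :: "'v => 'v"
 where "avg w = smul (1 / of_nat (card ((\<lambda>k. \<rho> k w) ` KG m))) (\<Sum>y\<in>(\<lambda>k. \<rho> k w) ` KG m. y)"

text \<open>An orbit covering another one equivariantly has fibres of constant size, so that averages may be
 computed upstairs; for orbits of pairs this gives the additivity of \<open>avg\<close>.\<close>

lemma avg_cover:
 assumes fin: "finite (a ` KG m)" and w: "w \<in> V"
  and T: "\<And>c k. c \<in> KG m ==> k \<in> KG m ==> T c (a k) = a (c * k)"
  and f: "\<And>k. k \<in> KG m ==> f (a k) = \<rho> k w"
 shows "smul (1 / of_nat (card (a ` KG m))) (\<Sum>x\<in>a ` KG m. f x) = avg w"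
proof -
 let ?O = "(\<lambda>k. \<rho> k w) ` KG m"
 define F where "F y = {x \<in> a ` KG m. f x = y}" for y
 \<comment> \<open>Translation by \<open>c\<close> carries the fibre over \<open>w\<close>
   bijectively to the fibre over \<open>\<rho> c w\<close>.\<close>
 have cF: "card (F y) = card (F w)" if y: "y \<in> ?O" for y
 proof -
  obtain c where c: "c \<in> KG m" "y = \<rho> c w" using y by auto
  note ci = GL_int_minv[OF c(1)]
  have inv: "T (minv m c) (T c (a k)) = a k" "T c (T (minv m c) (a k)) = a k" if k: "k \<in> KG m" for k
   using GL_cancel[OF GL_int_GL[OF c(1)] GL_int_carrier[OF k]]
   by (simp_all add: T c(1) ci k GL_int_mult)
  have "bij_betw (T c) (F w) (F y)"
  proof (rule bij_betw_byWitness[where f' = "T (minv m c)"])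
   show "T c ` F w \<subseteq> F y"
   proof
    fix x assume "x \<in> T c ` F w"
    then obtain k where k: "k \<in> KG m" "x = T c (a k)" "f (a k) = w" by (auto simp: F_def)
    have "x = a (c * k)" using T[OF c(1) k(1)] k(2) by simp
    moreover have "f (a (c * k)) = y"
     using f[OF GL_int_mult[OF c(1) k(1)]] \<rho>_mult[OF GL_int_GL[OF c(1)] GL_int_GL[OF k(1)] w] f[OF k(1)] k(3) c(2) by simp
    ultimately show "x \<in> F y" using GL_int_mult[OF c(1) k(1)] by (simp add: F_def)
   qed
   show "T (minv m c) ` F y \<subseteq> F w"
   proof
    fix x assume "x \<in> T (minv m c) ` F y"
    then obtain k where k: "k \<in> KG m" "x = T (minv m c) (a k)" "f (a k) = y" by (auto simp: F_def)
    then have k: "k \<in> KG m" "x = a (minv m c * k)" "\<rho> k w = y" using T[OF ci k(1)] f[OF k(1)] by simp_all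
    have "\<rho> (minv m c * k) w = \<rho> (minv m c * c) w"
     using k(3) c ci w k(1) \<rho>_mult[OF GL_int_GL GL_int_GL w] by simp
    also have "\<dots> = w" using minv(3)[OF GL_int_GL[OF c(1)]] w \<rho>_one by simp
    finally show "x \<in> F w" using k(2) GL_int_mult[OF ci k(1)] f[OF GL_int_mult[OF ci k(1)]] by (simp add: F_def)
   qed
  qed (use inv in \<open>force simp: F_def\<close>)+
  then show ?thesis using bij_betw_same_card by fastforce
 qed
 have finO: "finite ?O" using orbit_finite[OF w] .
 have sub: "f ` a ` KG m \<subseteq> ?O" using f by auto
 have "(\<Sum>x\<in>a ` KG m. f x) = (\<Sum>y\<in>?O. \<Sum>x\<in>F y. f x)"
  unfolding F_def using fin finO sub by (intro sum.group[symmetric])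
 also have "\<dots> = (\<Sum>y\<in>?O. smul (of_nat (card (F w))) y)"
 proof (rule sum.cong)
  fix y assume y: "y \<in> ?O"
  have "(\<Sum>x\<in>F y. f x) = (\<Sum>x\<in>F y. y)" by (intro sum.cong) (auto simp: F_def)
  then show "(\<Sum>x\<in>F y. f x) = smul (of_nat (card (F w))) y" using cF[OF y] by (simp add: sum_constant_scale)
 qed simp
 finally have s: "(\<Sum>x\<in>a ` KG m. f x) = smul (of_nat (card (F w))) (\<Sum>y\<in>?O. y)" by (simp add: scale_sum_right)
 have "card (a ` KG m) = (\<Sum>y\<in>?O. card (F y))"
  using sum.group[OF fin finO sub, of "\<lambda>_. 1 :: nat"] by (simp add: F_def)
 then have c: "card (a ` KG m) = card ?O * card (F w)" using cF by simp
 have "a ` KG m \<noteq> {}" by simp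
 then have "card (a ` KG m) \<noteq> 0" using fin by simp
 then have "card (F w) \<noteq> 0" using c by auto
 then show ?thesis unfolding s c avg_def by simp
qed

text \<open>The orbit of \<open>w\<close> covers the orbit of \<open>smul c w\<close>. For
  \<open>c = 0\<close> the latter is a single point, so \<open>avg_cover\<close> is used rather than
  a bijection of orbits.\<close>

lemma avg_smul: assumes w: "w \<in> V" shows "avg (smul c w) = smul c (avg w)"
proof -
 have "smul (1 / of_nat (card ((\<lambda>k. \<rho> k w) ` KG m))) (\<Sum>x\<in>(\<lambda>k. \<rho> k w) ` KG m. smul c x) = avg (smul c w)"
  using w \<rho>_mult[OF GL_int_GL GL_int_GL w] \<rho>_smul[OF GL_int_GL w] orbit_finite[OF w] subspace_scale[OF V w]
  by (intro avg_cover[where T = \<rho>]) auto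
 then show ?thesis by (simp add: avg_def scale_sum_right[symmetric] mult.commute)
qed

lemma avg_add: assumes v: "v \<in> V" and w: "w \<in> V" shows "avg (v + w) = avg v + avg w"
proof -
 let ?a = "\<lambda>k. (\<rho> k v, \<rho> k w)"
 let ?T = "\<lambda>c (x, y). (\<rho> c x, \<rho> c y)"
 have "?a ` KG m \<subseteq> (\<lambda>k. \<rho> k v) ` KG m \<times> (\<lambda>k. \<rho> k w) ` KG m" by auto
 then have fin: "finite (?a ` KG m)" using orbit_finite[OF v] orbit_finite[OF w] finite_subset by blast
 have T: "?T c (?a k) = ?a (c * k)" if "c \<in> KG m" "k \<in> KG m" for c k
  using that v w by (simp add: \<rho>_mult GL_int_GL)
 let ?s = "smul (1 / of_nat (card (?a ` KG m)))"
 have "?s (\<Sum>x\<in>?a ` KG m. fst x) = avg v" by (rule avg_cover[OF fin v T]) auto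
 moreover have "?s (\<Sum>x\<in>?a ` KG m. snd x) = avg w" by (rule avg_cover[OF fin w T]) auto
 moreover have "?s (\<Sum>x\<in>?a ` KG m. fst x + snd x) = avg (v + w)"
  by (rule avg_cover[OF fin subspace_add[OF V v w] T]) (use v w in \<open>auto simp: \<rho>_add GL_int_GL\<close>)
 ultimately show ?thesis by (simp only: sum.distrib scale_right_distrib)
qed

lemma avg_sum: "(\<And>i. i \<in> A ==> f i \<in> V) ==> avg (sum f A) = (\<Sum>i\<in>A. avg (f i))"
proof (induction A rule: infinite_finite_induct)
 case (insert x F)
 then show ?case using avg_add[of "f x" "sum f F"] subspace_sum[OF V, of F f] by simp
qed (use avg_smul[of 0 0] subspace_0[OF V] in auto)

lemma avg_fixed: assumes "w \<in> VK" shows "avg w = w"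
proof -
 have "(\<lambda>k. \<rho> k w) ` KG m = (\<lambda>k. w) ` KG m"
  by (intro image_cong VK_fix[OF assms]) auto
 then have "(\<lambda>k. \<rho> k w) ` KG m = {w}" by (simp add: image_constant_conv)
 then show ?thesis by (simp add: avg_def)
qed

lemma orbit_translate:
 assumes w: "w \<in> V" and c: "c \<in> KG m" shows "(\<lambda>k. \<rho> k (\<rho> c w)) ` KG m = (\<lambda>k. \<rho> k w) ` KG m"
proof -
 have "\<rho> k (\<rho> c w) \<in> (\<lambda>k. \<rho> k w) ` KG m" if "k \<in> KG m" for k
  using \<rho>_mult[OF GL_int_GL[OF that] GL_int_GL[OF c] w] GL_int_mult[OF that c] by (metis image_eqI)
 moreover have "\<rho> k w \<in> (\<lambda>k. \<rho> k (\<rho> c w)) ` KG m" if k: "k \<in> KG m" for k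
 proof (rule image_eqI)
  show kc: "k * minv m c \<in> KG m" using k c GL_int_mult GL_int_minv by blast
  show "\<rho> k w = \<rho> (k * minv m c) (\<rho> c w)"
   using \<rho>_mult[OF GL_int_GL[OF kc] GL_int_GL[OF c] w] GL_cancel_right(2)[OF GL_int_GL[OF c] GL_int_carrier[OF k]] by simp
 qed
 ultimately show ?thesis by blast
qed

lemma avg_translate: "w \<in> V ==> c \<in> KG m ==> avg (\<rho> c w) = avg w"
 unfolding avg_def by (simp add: orbit_translate)

lemma orbit_V: "w \<in> V ==> y \<in> (\<lambda>k. \<rho> k w) ` KG m ==> y \<in> V"
 using \<rho>_closed GL_int_GL by auto

lemma avg_VK: assumes w: "w \<in> V" shows "avg w \<in> VK"
proof -
 let ?O = "(\<lambda>k. \<rho> k w) ` KG m"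
 have "avg w \<in> V" unfolding avg_def using orbit_V[OF w] by (intro subspace_scale[OF V] subspace_sum[OF V])
 moreover have "\<rho> c (avg w) = avg w" if c: "c \<in> KG m" for c
 proof -
  have inj: "inj_on (\<rho> c) ?O"
  proof (rule inj_onI)
   fix x y assume x: "x \<in> ?O" and y: "y \<in> ?O" and e: "\<rho> c x = \<rho> c y"
   have "\<rho> (minv m c) (\<rho> c z) = z" if "z \<in> V" for z
    using \<rho>_mult[OF GL_int_GL[OF GL_int_minv[OF c]] GL_int_GL[OF c] that] minv(3)[OF GL_int_GL[OF c]] \<rho>_one[OF that] by simp
   then show "x = y" using e orbit_V[OF w x] orbit_V[OF w y] by metis
  qed
  have "\<rho> c ` ?O \<subseteq> ?O" using \<rho>_mult[OF GL_int_GL[OF c] GL_int_GL w] GL_int_mult[OF c] by auto (metis image_eqI)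
  then have im: "\<rho> c ` ?O = ?O" using inj orbit_finite[OF w] by (intro endo_inj_surj)
  have "\<rho> c (avg w) = smul (1 / of_nat (card ?O)) (\<Sum>y\<in>?O. \<rho> c y)"
   unfolding avg_def using orbit_V[OF w] c GL_int_GL by (simp add: \<rho>_smul \<rho>_sum subspace_sum[OF V])
  also have "(\<Sum>y\<in>?O. \<rho> c y) = (\<Sum>y\<in>?O. y)" using sum.reindex[OF inj, of "\<lambda>x. x"] im by simp
  finally show ?thesis by (simp add: avg_def)
 qed
 ultimately show ?thesis by (simp add: VK_def)
qed

end

section \<open>Uniqueness of spherical functions\<close>

context padic_field
begin

definition tdiag :: "nat => (nat => nat) => 'a mat"
 where "tdiag m \<nu> = mat_diag m (\<lambda>i. lq ^ \<nu> i)"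

lemma tdiag_carrier [simp]: "tdiag m \<nu> \<in> carrier_mat m m" by (simp add: tdiag_def)

lemma tdiag_GL: "tdiag m \<nu> \<in> GLc m"
 by (simp add: GL_carrier) (simp add: tdiag_def det_mat_diag)

lemma tdiag_index: "i < m ==> j < m ==> tdiag m \<nu> $$ (i, j) = (if i = j then lq ^ \<nu> i else 0)"
 by (auto simp: tdiag_def mat_diag_def)

lemma tdiag_cong: "(\<And>i. i < m ==> \<nu> i = \<nu>' i) ==> tdiag m \<nu> = tdiag m \<nu>'"
 by (auto simp: tdiag_index intro!: eq_matI simp del: tdiag_carrier) (simp_all add: tdiag_def mat_diag_def)

lemma vn_det_tdiag: "vn (mdet (tdiag m \<nu>)) = (1 / l) ^ (\<Sum>i<m. \<nu> i)"
 by (simp add: tdiag_def det_mat_diag vn_prod vn_lq_power power_sum)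

lemma det_zero_column:
 assumes A: "A \<in> carrier_mat m m" and j: "j < m" "\<And>i. i < m ==> A $$ (i, j) = (0 :: 'b::comm_ring_1)"
 shows "mdet A = 0"
 unfolding det_def'[OF A]
proof (rule sum.neutral, rule ballI)
 fix p assume "p \<in> {p. p permutes {0..<m}}"
 then have p: "p permutes {0..<m}" by simp
 have "j \<in> p ` {0..<m}" using permutes_image[OF p] j(1) by simp
 then obtain i where i: "i \<in> {0..<m}" "p i = j" by auto
 then have "A $$ (i, p i) = 0" using j(2)[of i] by simp
 then have "(\<Prod>i = 0..<m. A $$ (i, p i)) = 0" using i(1) by (intro prod_zero) auto
 then show "signof p * (\<Prod>i = 0..<m. A $$ (i, p i)) = 0" by simp
qed

text \<open>Otherwise the upper left block of the product of size \<open>i + 1\<close> would, after rescaling its rows, be congruent to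
 \<open>l ^ \<nu> i\<close> times an invertible matrix and also to a product of matrices of rank at most \<open>i\<close>.\<close>

lemma elementary_divisor_mono:
 assumes A: "A \<in> int_mat m" and B: "B \<in> int_mat m" and eq: "A * tdiag m \<kappa> * B = tdiag m \<nu>"
  and \<kappa>: "\<And>i j. i \<le> j ==> j < m ==> \<kappa> i \<le> \<kappa> j" and \<nu>: "\<And>i j. i \<le> j ==> j < m ==> \<nu> i \<le> \<nu> j"
  and i: "i < m"
 shows "\<kappa> i \<le> \<nu> i"
proof (rule ccontr)
 assume "\<not> \<kappa> i \<le> \<nu> i"
 then have lt: "\<nu> i < \<kappa> i" by simp
 note Ac = int_mat_carrier[OF A] and Bc = int_mat_carrier[OF B]
 have le1: "vn (A $$ (p, q)) \<le> 1" "vn (B $$ (p, q)) \<le> 1" if "p < m" "q < m" for p q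
  using A B that by (auto simp: int_mat_def)
 have At: "(A * tdiag m \<kappa>) $$ (j, p) = A $$ (j, p) * lq ^ \<kappa> p" if "j < m" "p < m" for j p
  unfolding tdiag_def mat_diag_mult_right[OF Ac] using that by simp
 have e: "(\<Sum>p<m. A $$ (j, p) * lq ^ \<kappa> p * B $$ (p, j')) = (if j = j' then lq ^ \<nu> j else 0)" if "j < m" "j' < m" for j j'
 proof -
  have "(A * tdiag m \<kappa> * B) $$ (j, j') = (\<Sum>p<m. (A * tdiag m \<kappa>) $$ (j, p) * B $$ (p, j'))"
   using Ac Bc that by (intro mat_mult_index) auto
  then show ?thesis unfolding eq using that by (simp add: tdiag_index At)
 qed
 let ?n = "Suc i"
 \<comment> \<open>The contribution of the indices from \<open>i\<close> on. It is divisible by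
   \<open>l ^ Suc (\<nu> i)\<close>, as \<open>\<kappa> p\<close> is at least
   \<open>\<kappa> i\<close>, which exceeds \<open>\<nu> i\<close>.\<close>
 define R where "R j j' = (\<Sum>p\<in>{i..<m}. A $$ (j, p) * lq ^ \<kappa> p * B $$ (p, j'))" for j j'
 \<comment> \<open>Scaling row \<open>j\<close> by \<open>l ^ (\<nu> i - \<nu> j)\<close> makes all
   diagonal entries of the block equal to \<open>l ^ \<nu> i\<close>; \<open>Z\<close> is the scaled
   \<open>R\<close> after division by \<open>l ^ Suc (\<nu> i)\<close>, and still integral.\<close>
 define Z where "Z j j' = lq ^ (\<nu> i - \<nu> j) * R j j' / lq ^ Suc (\<nu> i)" for j j'
 have Z: "vn (Z j j') \<le> 1" if "j \<le> i" "j' \<le> i" for j j'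
 proof -
  have "vn (R j j') \<le> (1 / l) ^ Suc (\<nu> i)"
   unfolding R_def
  proof (rule vn_sum_le)
   fix p assume p: "p \<in> {i..<m}"
   have "Suc (\<nu> i) \<le> \<kappa> p" using \<kappa>[of i p] p lt by auto
   then have "(1 / real l) ^ \<kappa> p \<le> (1 / l) ^ Suc (\<nu> i)"
    using l_gt_1 by (intro power_decreasing) auto
   moreover have "vn (A $$ (j, p)) * vn (lq ^ \<kappa> p) * vn (B $$ (p, j')) \<le> 1 * (1 / l) ^ \<kappa> p * 1"
    unfolding vn_lq_power using le1 p that i by (intro mult_mono) auto
   ultimately show "vn (A $$ (j, p) * lq ^ \<kappa> p * B $$ (p, j')) \<le> (1 / l) ^ Suc (\<nu> i)"
    by (simp add: vn_mult)
  qed simp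
  moreover have "vn (lq ^ (\<nu> i - \<nu> j)) \<le> 1" unfolding vn_lq_power using l_gt_1 by (intro power_le_one) auto
  ultimately have "vn (lq ^ (\<nu> i - \<nu> j)) * vn (R j j') \<le> 1 * (1 / l) ^ Suc (\<nu> i)" by (intro mult_mono) auto
  then show ?thesis unfolding Z_def vn_divide vn_mult vn_lq_power[of "Suc (\<nu> i)"] using l_pos
   by (intro divide_le_eq_1_pos[THEN iffD2]) auto
 qed
 define M where "M = Matrix.mat ?n ?n (\<lambda>(j, j'). (if j = j' then 1 else 0) - lq * Z j j')"
 have Mc: "M \<in> carrier_mat ?n ?n" by (simp add: M_def)
 have "cong_mat ?n M (1\<^sub>m ?n)"
  unfolding cong_mat_def
 proof (intro allI impI)
  fix j j' assume jj: "j < ?n" "j' < ?n"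
  have "vn (lq * Z j j') \<le> 1 / l" using Z[of j j'] jj l_pos by (simp add: vn_mult vn_l divide_right_mono)
  then have "vn (lq * Z j j') < 1" using vn_le_iff_less by blast
  then show "cong_l (M $$ (j, j')) (1\<^sub>m ?n $$ (j, j'))" using jj by (simp add: M_def cong_l_def)
 qed
 then have "vn (mdet M) = 1"
  using cong_det[OF _ int_mat_one Mc] cong_l_vn_eq_1[of _ 1] by simp
 then have d1: "mdet (lq ^ \<nu> i \<cdot>\<^sub>m M) \<noteq> 0" by auto
 \<comment> \<open>The remaining \<open>i\<close> columns, padded by a zero column to a square
   matrix of size \<open>i + 1\<close>, whose determinant is therefore 0.\<close>
 define P where "P = Matrix.mat ?n ?n (\<lambda>(j, p). if p < i then lq ^ (\<nu> i - \<nu> j) * (A $$ (j, p) * lq ^ \<kappa> p) else 0)"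
 define N where "N = Matrix.mat ?n ?n (\<lambda>(p, j'). B $$ (p, j'))"
 have PN: "P \<in> carrier_mat ?n ?n" "N \<in> carrier_mat ?n ?n" by (auto simp: P_def N_def)
 have "lq ^ \<nu> i \<cdot>\<^sub>m M = P * N"
 proof (rule eq_matI)
  fix j j' assume "j < dim_row (P * N)" "j' < dim_col (P * N)"
  then have jj: "j < ?n" "j' < ?n" using PN by auto
  have s: "(\<Sum>p<m. A $$ (j, p) * lq ^ \<kappa> p * B $$ (p, j')) = (\<Sum>p<i. A $$ (j, p) * lq ^ \<kappa> p * B $$ (p, j')) + R j j'"
   unfolding R_def using i by (subst sum.union_disjoint[symmetric]) (auto intro!: sum.cong)
  have \<nu>ij: "\<nu> j \<le> \<nu> i" using \<nu>[of j i] jj i by simp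
  have "(P * N) $$ (j, j') = (\<Sum>p<i. lq ^ (\<nu> i - \<nu> j) * (A $$ (j, p) * lq ^ \<kappa> p) * B $$ (p, j'))"
   unfolding mat_mult_index[OF PN jj] using jj by (simp add: P_def N_def)
  also have "\<dots> = lq ^ (\<nu> i - \<nu> j) * ((if j = j' then lq ^ \<nu> j else 0) - R j j')"
  proof -
   have "(\<Sum>p<i. A $$ (j, p) * lq ^ \<kappa> p * B $$ (p, j')) = (if j = j' then lq ^ \<nu> j else 0) - R j j'"
    using s e[of j j'] jj i by (simp add: eq_diff_eq del: if_split split del: if_split)
   then show ?thesis unfolding mult.assoc[of "lq ^ (\<nu> i - \<nu> j)"] sum_distrib_left[symmetric] by simp
  qed
  also have "\<dots> = lq ^ \<nu> i * ((if j = j' then 1 else 0) - lq * Z j j')"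
   using \<nu>ij by (auto simp: Z_def right_diff_distrib power_add[symmetric])
  also have "\<dots> = (lq ^ \<nu> i \<cdot>\<^sub>m M) $$ (j, j')" using jj by (simp add: M_def)
  finally show "(lq ^ \<nu> i \<cdot>\<^sub>m M) $$ (j, j') = (P * N) $$ (j, j')" by simp
 qed (use PN Mc in auto)
 moreover have "mdet P = 0" by (rule det_zero_column[of _ ?n i]) (auto simp: P_def)
 ultimately show False using d1 det_mult[OF PN] by simp
qed

text \<open>Invertibility excludes zeros in the Smith form, and integrality makes its exponents
  natural numbers.\<close>

lemma smith_int:
 assumes x: "x \<in> GLc m" "x \<in> int_mat m"
 shows "\<exists>\<nu>. K_equiv m x (tdiag m \<nu>) \<and> (\<forall>i j. i \<le> j \<and> j < m \<longrightarrow> \<nu> i \<le> \<nu> j)"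
proof -
 obtain d where d: "K_equiv m x (mat_diag m d)" "\<forall>i j. i \<le> j \<and> j < m \<longrightarrow> vn (d j) \<le> vn (d i)"
  "\<forall>i<m. d i = 0 \<or> (\<exists>k. d i = of_nat l powi k)" using smith[OF int_mat_carrier[OF x(2)]] by blast
 have "mat_diag m d \<in> GLc m"
 proof -
  obtain P Q where PQ: "P \<in> KG m" "Q \<in> KG m" "mat_diag m d = P * x * Q" using d(1) by (auto simp: K_equiv_def)
  show ?thesis unfolding PQ(3) using GL_mult_closed GL_int_GL[OF PQ(1)] GL_int_GL[OF PQ(2)] x(1) by metis
 qed
 then have "(\<Prod>i<m. d i) \<noteq> 0" by (simp add: GL_carrier det_mat_diag)
 then have nz: "d i \<noteq> 0" if "i < m" for i using that by auto
 have le: "vn (d i) \<le> 1" if "i < m" for i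
  using K_equiv_bound[OF int_mat_carrier[OF x(2)] d(1), of 1 i i] x(2) that by (auto simp: int_mat_def mat_diag_def)
 have "\<exists>k::nat. d i = lq ^ k" if im: "i < m" for i
 proof -
  obtain k where k: "d i = lq powi k" using d(3) nz[OF im] im by blast
  have "real l powi (- k) \<le> 1" using le[OF im] k by (simp add: vn_l_powi)
  then have "0 \<le> k" using l_gt_1
   by (metis linorder_not_less neg_0_less_iff_less one_less_power_int of_nat_1 of_nat_less_iff)
  then show ?thesis using k by (intro exI[of _ "nat k"]) (simp add: power_int_def)
 qed
 then obtain \<nu> where \<nu>: "\<And>i. i < m ==> d i = lq ^ \<nu> i" by metis
 have "mat_diag m d = tdiag m \<nu>" unfolding tdiag_def mat_diag_def using \<nu> by (intro eq_matI) auto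
 moreover have "\<nu> i \<le> \<nu> j" if "i \<le> j" "j < m" for i j
 proof -
  have "(1 / real l) ^ \<nu> j \<le> (1 / real l) ^ \<nu> i" using d(2) \<nu>[of i] \<nu>[of j] that vn_lq_power by (metis le_less_trans)
  then have "real l ^ \<nu> i \<le> real l ^ \<nu> j" using l_gt_1 by (simp add: power_one_over field_simps)
  then show ?thesis using l_gt_1 by (simp add: power_increasing_iff)
 qed
 ultimately show ?thesis using d(1) by auto
qed

lemma tdiag_mult: "tdiag m \<kappa> * tdiag m \<nu> = tdiag m (\<lambda>i. \<kappa> i + \<nu> i)"
 by (simp add: tdiag_def power_add)

lemma tdiag_HNk:
 assumes "S \<subseteq> {..<m}" shows "tdiag m (\<lambda>i. if i \<in> S then 1 else 0) \<in> HNk m (card S)"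
 using assms by (auto simp: HNk_def HN_def tdiag_index intro!: exI[of _ S])

lemma HNk_top: "HNk m m = {lq \<cdot>\<^sub>m 1\<^sub>m m}"
proof -
 have "{S. S \<subseteq> {..<m} \<and> card S = m} = {{..<m}}"
  using card_subset_eq[of "{..<m}"] by auto
 then have "HNk m m = HN m {..<m}" unfolding HNk_def by simp
 also have "\<dots> = {lq \<cdot>\<^sub>m 1\<^sub>m m}"
 proof (intro equalityI subsetI)
  fix A assume A: "A \<in> HN m {..<m}"
  have "A $$ (i, j) = (if i = j then lq else 0)" if "i < m" "j < m" for i j
   using HN_D(2)[OF A, of i] HN_D(4)[OF A, of i j] that by auto
  then have "A = lq \<cdot>\<^sub>m 1\<^sub>m m" using HN_D(1)[OF A] by (intro eq_matI) auto
  then show "A \<in> {lq \<cdot>\<^sub>m 1\<^sub>m m}" by simp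
 next
  fix A assume "A \<in> {lq \<cdot>\<^sub>m 1\<^sub>m m :: 'a mat}"
  then show "A \<in> HN m {..<m}" by (auto simp: HN_def)
 qed
 finally show ?thesis .
qed

text \<open>Induction on the weight \<open>\<Sum>i<m. Suc i * \<nu> i\<close>. Let
  \<open>\<kappa>\<close> be \<open>\<nu>\<close> with all \<open>k\<close> nonzero exponents
  lowered by 1. The Hecke equation for \<open>k\<close> at \<open>tdiag m \<kappa>\<close> has value
  0 on the right, and on the left only terms at exponents \<open>\<nu>'\<close> that are
  \<open>\<nu>\<close> itself or have smaller weight. The latter vanish, so a positive multiple of
  the value at \<open>\<nu>\<close> is 0.\<close>

lemma spherical_step:
 assumes vs: "vector_space (smul :: complex => 'v::ab_group_add => 'v)"
  and DK: "\<And>x u. x \<in> GLc m ==> u \<in> KG m ==> D (x * u) = D x"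
   "\<And>x u. x \<in> GLc m ==> u \<in> KG m ==> D (u * x) = D x"
  and eig: "\<And>k x. k \<le> m ==> x \<in> GLc m ==> (\<Sum>y\<in>HNk m k. D (x * y)) = smul (c k) (D x)"
  and D1: "D (1\<^sub>m m) = (0 :: 'v)"
 shows "(\<And>i j. i \<le> j ==> j < m ==> \<nu> i \<le> \<nu> j) ==> D (tdiag m \<nu>) = 0"
proof (induction "\<Sum>i<m. Suc i * \<nu> i" arbitrary: \<nu> rule: less_induct)
 case less
 interpret vector_space smul by (rule vs)
 note \<nu> = less.prems
 have K_equiv_D: "D y = D x" if xy: "K_equiv m x y" "x \<in> GLc m" for x y
 proof -
  obtain P Q where "P \<in> KG m" "Q \<in> KG m" "y = P * x * Q" using xy(1) by (auto simp: K_equiv_def)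
  then show ?thesis using DK xy(2) GL_mult_closed GL_int_GL by metis
 qed
 show ?case
 proof (cases "\<forall>i<m. \<nu> i = 0")
  case True
  then have "tdiag m \<nu> = 1\<^sub>m m" by (intro eq_matI) (auto simp: tdiag_index intro: carrier_matD[OF tdiag_carrier])
  then show ?thesis using D1 by simp
 next
  case False
  define i0 where "i0 = (LEAST i. i < m \<and> \<nu> i \<noteq> 0)"
  have "\<exists>i. i < m \<and> \<nu> i \<noteq> 0" using False by blast
  from LeastI_ex[OF this] have i0: "i0 < m" "\<nu> i0 \<noteq> 0" by (auto simp: i0_def)
  have low: "\<nu> i = 0" if "i < i0" for i using that not_less_Least[of i "\<lambda>i. i < m \<and> \<nu> i \<noteq> 0"] i0 unfolding i0_def by auto
  have high: "\<nu> i > 0" if "i0 \<le> i" "i < m" for i using \<nu>[OF that] i0 by simp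
  define \<kappa> where "\<kappa> i = (if i0 \<le> i then \<nu> i - 1 else \<nu> i)" for i
  define S where "S = {i0..<m}"
  define k where "k = card S"
  have S: "S \<subseteq> {..<m}" by (auto simp: S_def)
  have km: "k \<le> m" by (simp add: k_def S_def)
  have \<nu>\<kappa>: "\<nu> i = \<kappa> i + (if i \<in> S then 1 else 0)" if "i < m" for i
   using that high by (auto simp: \<kappa>_def S_def)
  have \<kappa>: "\<kappa> i \<le> \<kappa> j" if "i \<le> j" "j < m" for i j
   using \<nu>[OF that] low that by (auto simp: \<kappa>_def diff_le_mono)
  have "(\<Sum>i<m. Suc i * \<kappa> i) < (\<Sum>i<m. Suc i * \<nu> i)"
   using i0 \<nu>\<kappa> by (intro sum_strict_mono_ex1) (auto intro!: bexI[of _ i0] simp: S_def)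
  then have D\<kappa>: "D (tdiag m \<kappa>) = 0" using less.hyps \<kappa> by blast
  have trm: "D (tdiag m \<kappa> * y) = 0 \<or> D (tdiag m \<kappa> * y) = D (tdiag m \<nu>)" if y: "y \<in> HNk m k" for y
  proof -
   have yX: "y \<in> Xk m k" using y HNk_Xk by blast
   note yG = Xk_GL[OF yX] and yi = Xk_int[OF yX]
   have ti: "tdiag m \<kappa> \<in> int_mat m"
    using l_gt_1 by (auto simp: int_mat_def tdiag_index vn_lq_power intro!: power_le_one)
   have xG: "tdiag m \<kappa> * y \<in> GLc m" using tdiag_GL yG GL_mult_closed by blast
   have xi: "tdiag m \<kappa> * y \<in> int_mat m" using ti yi int_mat_mult by blast
   obtain \<nu>' where \<nu>': "K_equiv m (tdiag m \<kappa> * y) (tdiag m \<nu>')" "\<And>i j. i \<le> j ==> j < m ==> \<nu>' i \<le> \<nu>' j"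
    using smith_int[OF xG xi] by blast
   obtain P Q where PQ: "P \<in> KG m" "Q \<in> KG m" "tdiag m \<nu>' = P * (tdiag m \<kappa> * y) * Q"
    using \<nu>'(1) by (auto simp: K_equiv_def)
   obtain h where h: "h \<in> int_mat m" "y * h = lq \<cdot>\<^sub>m 1\<^sub>m m" using yX by (auto simp: Xk_def)
   note cs = GL_int_carrier[OF PQ(1)] GL_int_carrier[OF PQ(2)] GL_carrier_mat[OF yG] int_mat_carrier[OF h(1)]
    minv(4)[OF GL_int_GL[OF PQ(1)]] minv(4)[OF GL_int_GL[OF PQ(2)]]
   \<comment> \<open>The comparison of elementary divisors is used twice: multiplying by
     \<open>y\<close> gives the lower bound \<open>\<kappa>\<close> for \<open>\<nu>'\<close>, and
     multiplying further by the complement of \<open>y\<close> gives the upper bound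
     \<open>\<kappa> + 1\<close>.\<close>
   have "P * tdiag m \<kappa> * (y * Q) = tdiag m \<nu>'" unfolding PQ(3) using cs by (simp add: assoc_mult_mat[of _ m m _ m _ m])
   from elementary_divisor_mono[OF GL_int_int[OF PQ(1)] int_mat_mult[OF yi GL_int_int[OF PQ(2)]] this \<kappa> \<nu>'(2)]
   have lo: "\<kappa> i \<le> \<nu>' i" if "i < m" for i using that by blast
   have "minv m P * tdiag m \<nu>' * (minv m Q * h) = minv m P * (P * (tdiag m \<kappa> * (y * (Q * (minv m Q * h)))))"
    unfolding PQ(3) using cs by (simp add: assoc_mult_mat[of _ m m _ m _ m])
   also have "\<dots> = tdiag m \<kappa> * (y * h)"
    using GL_cancel(2)[OF GL_int_GL[OF PQ(2)] cs(4)] GL_cancel(1)[OF GL_int_GL[OF PQ(1)], of "tdiag m \<kappa> * (y * h)" m] cs by simp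
   also have "\<dots> = tdiag m \<kappa> * tdiag m (\<lambda>_. 1)"
    unfolding h(2) by (rule arg_cong[of _ _ "\<lambda>M. _ * M"]) (auto intro!: eq_matI simp: tdiag_def mat_diag_def)
   also have "\<dots> = tdiag m (\<lambda>i. \<kappa> i + 1)" by (rule tdiag_mult)
   finally have "minv m P * tdiag m \<nu>' * (minv m Q * h) = tdiag m (\<lambda>i. \<kappa> i + 1)" .
   from elementary_divisor_mono[OF GL_int_int[OF GL_int_minv[OF PQ(1)]]
     int_mat_mult[OF GL_int_int[OF GL_int_minv[OF PQ(2)]] h(1)] this \<nu>'(2)]
   have hi: "\<nu>' i \<le> \<kappa> i + 1" if "i < m" for i using that \<kappa> by (metis add_le_mono1)
   have "vn (mdet (tdiag m \<nu>')) = vn (mdet (tdiag m \<kappa>)) * vn (mdet y)"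
    unfolding PQ(3) using cs PQ det_mult[of "P * (tdiag m \<kappa> * y)" m Q] det_mult[of P m "tdiag m \<kappa> * y"] det_mult[of "tdiag m \<kappa>" m y]
    by (simp add: vn_mult GL_int_iff)
   then have "(1 / l) ^ (\<Sum>i<m. \<nu>' i) = (1 / l) ^ ((\<Sum>i<m. \<kappa> i) + k)"
    using yX by (simp add: vn_det_tdiag power_add Xk_def)
   then have "(\<Sum>i<m. \<nu>' i) = (\<Sum>i<m. \<kappa> i) + k" by (rule inv_l_power_inj)
   moreover have "(\<Sum>i<m. \<nu> i) = (\<Sum>i<m. \<kappa> i) + k"
    using \<nu>\<kappa> S by (simp add: sum.distrib k_def sum.If_cases Int_absorb1)
   ultimately have tot: "(\<Sum>i<m. int (\<nu> i) - int (\<nu>' i)) = 0" by (simp add: sum_subtractf flip: of_nat_sum)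
   \<comment> \<open>The differences have total 0, are nonnegative from \<open>i0\<close> on and
     nonpositive before. Hence weighting them by \<open>i + 1 - i0\<close> gives termwise
     nonnegative products whose sum is the difference of the weights. This factor is 0 at
     \<open>i0 - 1\<close>, so in the case of equality the indices below \<open>i0\<close> are
     settled by the total.\<close>
   define \<delta> where "\<delta> i = int (\<nu> i) - int (\<nu>' i)" for i
   have \<delta>: "i0 \<le> i ==> 0 \<le> \<delta> i" "i < i0 ==> \<delta> i \<le> 0" if "i < m" for i
    using \<nu>\<kappa>[OF that] lo[OF that] hi[OF that] that by (auto simp: \<delta>_def S_def)
   have nn: "0 \<le> (int i + 1 - int i0) * \<delta> i" if "i < m" for i
    using \<delta>[OF that] by (cases "i0 \<le> i") (auto simp: mult_nonneg_nonneg mult_nonpos_nonpos)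
   have tot': "(\<Sum>i<m. \<delta> i) = 0" using tot by (simp add: \<delta>_def)
   have s: "(\<Sum>i<m. (int i + 1 - int i0) * \<delta> i) = (\<Sum>i<m. (int i + 1) * \<delta> i)"
    using tot' by (simp add: left_diff_distrib sum_subtractf sum_distrib_left[symmetric])
   also have "\<dots> = int (\<Sum>i<m. Suc i * \<nu> i) - int (\<Sum>i<m. Suc i * \<nu>' i)"
    by (simp add: \<delta>_def sum_subtractf right_diff_distrib algebra_simps sum.distrib)
   finally have diff: "(\<Sum>i<m. (int i + 1 - int i0) * \<delta> i) = int (\<Sum>i<m. Suc i * \<nu> i) - int (\<Sum>i<m. Suc i * \<nu>' i)" .
   have ge: "0 \<le> (\<Sum>i<m. (int i + 1 - int i0) * \<delta> i)" using nn by (intro sum_nonneg) auto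
   have Dy: "D (tdiag m \<kappa> * y) = D (tdiag m \<nu>')" using K_equiv_D[OF \<nu>'(1) xG] by simp
   show ?thesis
   proof (cases "(\<Sum>i<m. Suc i * \<nu>' i) < (\<Sum>i<m. Suc i * \<nu> i)")
    case True
    then show ?thesis using less.hyps[OF True] \<nu>'(2) Dy by auto
   next
    case False
    then have "(\<Sum>i<m. (int i + 1 - int i0) * \<delta> i) = 0" using ge diff by linarith
    then have z: "(int i + 1 - int i0) * \<delta> i = 0" if "i < m" for i
     using nn that by (subst (asm) sum_nonneg_eq_0_iff) auto
    have z1: "\<delta> i = 0" if "i < m" "i0 \<le> i" for i using z[OF that(1)] that(2) by auto
    have "(\<Sum>i<m. - \<delta> i) = 0" using tot' by (simp add: sum_negf)
    then have "\<delta> i = 0" if "i < m" for i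
     using z1 \<delta>(2) that by (subst (asm) sum_nonneg_eq_0_iff) (force simp: not_le[symmetric])+
    then have "tdiag m \<nu>' = tdiag m \<nu>" by (intro tdiag_cong) (auto simp: \<delta>_def)
    then show ?thesis using Dy by simp
   qed
  qed
  let ?y0 = "tdiag m (\<lambda>i. if i \<in> S then 1 else 0)"
  have y0: "?y0 \<in> HNk m k" unfolding k_def by (rule tdiag_HNk[OF S])
  have "tdiag m \<kappa> * ?y0 = tdiag m \<nu>" unfolding tdiag_mult using \<nu>\<kappa> by (intro tdiag_cong) simp
  show ?thesis
  proof (rule ccontr)
   assume nz: "D (tdiag m \<nu>) \<noteq> 0"
   let ?Y = "{y \<in> HNk m k. D (tdiag m \<kappa> * y) \<noteq> 0}"
   have "(\<Sum>y\<in>HNk m k. D (tdiag m \<kappa> * y)) = (\<Sum>y\<in>?Y. D (tdiag m \<kappa> * y))"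
    by (intro sum.mono_neutral_right) (auto simp: finite_HNk)
   also have "\<dots> = (\<Sum>y\<in>?Y. D (tdiag m \<nu>))" using trm by (intro sum.cong) auto
   also have "\<dots> = smul (of_nat (card ?Y)) (D (tdiag m \<nu>))" by (simp add: sum_constant_scale)
   finally have "smul (of_nat (card ?Y)) (D (tdiag m \<nu>)) = 0"
    using eig[OF km tdiag_GL, of \<kappa>] D\<kappa> by simp
   moreover have "?y0 \<in> ?Y" using y0 nz \<open>tdiag m \<kappa> * ?y0 = tdiag m \<nu>\<close> by simp
   then have "card ?Y \<noteq> 0" using finite_HNk by (auto simp: card_eq_0_iff)
   ultimately show False using nz by simp
  qed
 qed
qed

text \<open>The Smith form reduces integral matrices to \<open>spherical_step\<close>. A general
  matrix becomes integral after scaling by a power of \<open>l\<close>; the Hecke equation for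
  \<open>k = m\<close>, whose only representative is the scalar \<open>l\<close>, removes the
  scaling because \<open>c m\<close> is nonzero.\<close>

lemma spherical_unique:
 assumes vs: "vector_space (smul :: complex => 'v::ab_group_add => 'v)"
  and DK: "\<And>x u. x \<in> GLc m ==> u \<in> KG m ==> D (x * u) = D x"
   "\<And>x u. x \<in> GLc m ==> u \<in> KG m ==> D (u * x) = D x"
  and eig: "\<And>k x. k \<le> m ==> x \<in> GLc m ==> (\<Sum>y\<in>HNk m k. D (x * y)) = smul (c k) (D x)"
  and cm: "c m \<noteq> 0" and D1: "D (1\<^sub>m m) = (0 :: 'v)" and x: "x \<in> GLc m"
 shows "D x = 0"
proof -
 interpret vector_space smul by (rule vs)
 have int: "D x = 0" if x: "x \<in> GLc m" "x \<in> int_mat m" for x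
 proof -
  obtain \<nu> where \<nu>: "K_equiv m x (tdiag m \<nu>)" "\<And>i j. i \<le> j ==> j < m ==> \<nu> i \<le> \<nu> j"
   using smith_int[OF x] by blast
  obtain P Q where "P \<in> KG m" "Q \<in> KG m" "tdiag m \<nu> = P * x * Q" using \<nu>(1) by (auto simp: K_equiv_def)
  then have "D (tdiag m \<nu>) = D x" using DK x(1) GL_mult_closed GL_int_GL by metis
  then show ?thesis using spherical_step[OF vs DK eig D1 \<nu>(2)] by simp
 qed
 have scaled: "D x = 0" if "x \<in> GLc m" "lq ^ s \<cdot>\<^sub>m x \<in> int_mat m" for s x
  using that
 proof (induction s arbitrary: x)
  case 0
  have "lq ^ 0 \<cdot>\<^sub>m x = x" by (auto intro!: eq_matI)
  then have "x \<in> int_mat m" using 0 by metis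
  then show ?case using int 0 by blast
 next
  case (Suc s)
  note xc = GL_carrier_mat[OF Suc.prems(1)]
  have e: "x * (lq \<cdot>\<^sub>m 1\<^sub>m m) = lq \<cdot>\<^sub>m x" using mult_smult_distrib[OF xc one_carrier_mat, of lq] xc by simp
  have "lq ^ s \<cdot>\<^sub>m (lq \<cdot>\<^sub>m x) = lq ^ Suc s \<cdot>\<^sub>m x" by (auto intro!: eq_matI)
  then have "lq ^ s \<cdot>\<^sub>m (lq \<cdot>\<^sub>m x) \<in> int_mat m" using Suc.prems(2) by simp
  moreover have "lq \<cdot>\<^sub>m x \<in> GLc m" using Suc.prems(1) by (auto simp: GL_carrier)
  ultimately have "D (x * (lq \<cdot>\<^sub>m 1\<^sub>m m)) = 0" unfolding e using Suc.IH by blast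
  then have "smul (c m) (D x) = 0" using eig[OF order_refl Suc.prems(1)] by (simp add: HNk_top)
  then show ?case using cm by simp
 qed
 let ?E = "insert 1 ((\<lambda>(i, j). vn (x $$ (i, j))) ` ({..<m} \<times> {..<m}))"
 obtain s where s: "Max ?E < real l ^ s" using real_arch_pow[of "real l" "Max ?E"] l_gt_1 by auto
 have "vn (x $$ (i, j)) \<le> real l ^ s" if "i < m" "j < m" for i j
 proof -
  have "vn (x $$ (i, j)) \<le> Max ?E" using that by (intro Max_ge) auto
  then show ?thesis using s by linarith
 qed
 then have "lq ^ s \<cdot>\<^sub>m x \<in> int_mat m"
  using GL_carrier_mat[OF x] l_pos by (auto simp: int_mat_def vn_mult vn_lq_power power_one_over field_simps)
 then show ?thesis using scaled[OF x] by blast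
qed

end

section \<open>The topology of the general linear group\<close>

context padic_field
begin

lemma Zl_totally_bounded: "\<exists>F. finite F \<and> (\<forall>x. vn x \<le> 1 \<longrightarrow> (\<exists>c\<in>F. vn (x - c) \<le> (1 / l) ^ t))"
proof (induction t)
 case 0
 then show ?case by (intro exI[of _ "{0}"]) auto
next
 case (Suc t)
 then obtain F where F: "finite F" "\<And>x. vn x \<le> 1 ==> \<exists>c\<in>F. vn (x - c) \<le> (1 / l) ^ t" by blast
 have "\<exists>c\<in>(\<lambda>(d, c). d + lq * c) ` (digits \<times> F). vn (x - c) \<le> (1 / l) ^ Suc t" if x: "vn x \<le> 1" for x
 proof -
  define y where "y = (x - res x) / lq"
  have "vn y \<le> 1" unfolding y_def by (rule cong_l_div[OF res(2)[OF x]])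
  then obtain c where c: "c \<in> F" "vn (y - c) \<le> (1 / l) ^ t" using F(2) by blast
  have "x - (res x + lq * c) = lq * (y - c)" by (simp add: y_def field_simps)
  then have "vn (x - (res x + lq * c)) \<le> (1 / l) ^ Suc t"
   using c(2) l_pos by (simp add: vn_mult vn_l divide_right_mono)
  then show ?thesis using c(1) res(1)[OF x] by (intro bexI[of _ "res x + lq * c"]) auto
 qed
 then show ?case using F(1) by (intro exI[of _ "(\<lambda>(d, c). d + lq * c) ` (digits \<times> F)"]) auto
qed

text \<open>Complete because closed, and totally bounded by truncated digit expansions after scaling
  into the unit ball by a power of \<open>l\<close>.\<close>

lemma compact_cball: "compact (cball (0 :: 'a) R)"
 unfolding compact_eq_totally_bounded
proof (intro conjI allI impI)
 show "complete (cball (0 :: 'a) R)" by (simp add: complete_eq_closed)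
next
 fix e :: real assume e: "0 < e"
 obtain s where s: "R < real l ^ s" using real_arch_pow[of "real l" R] l_gt_1 by auto
 obtain t where t: "(1 / real l) ^ t < e / real l ^ s"
  using real_arch_pow_inv[of "e / real l ^ s" "1 / real l"] e l_gt_1 by auto
 obtain F where F: "finite F" "\<And>x. vn x \<le> 1 ==> \<exists>c\<in>F. vn (x - c) \<le> (1 / l) ^ t"
  using Zl_totally_bounded[of t] by blast
 have "cball 0 R \<subseteq> (\<Union>x\<in>(\<lambda>c. c / lq ^ s) ` F. ball x e)"
 proof
  fix x :: 'a assume "x \<in> cball 0 R"
  then have "vn x < real l ^ s" using s by (simp add: dist_commute)
  then have "vn (lq ^ s * x) \<le> 1" using l_pos by (simp add: vn_mult vn_lq_power power_one_over field_simps)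
  then obtain c where c: "c \<in> F" "vn (lq ^ s * x - c) \<le> (1 / l) ^ t" using F(2) by blast
  have "c / lq ^ s - x = - ((lq ^ s * x - c) / lq ^ s)" by (simp add: field_simps)
  then have "vn (c / lq ^ s - x) = vn (lq ^ s * x - c) * real l ^ s"
   unfolding vn_minus vn_divide vn_lq_power by (simp add: vn_divide vn_lq_power power_one_over)
  also have "\<dots> \<le> (1 / l) ^ t * real l ^ s" using c(2) by (intro mult_right_mono) auto
  also have "\<dots> < e" using t l_pos by (simp add: field_simps)
  finally have "dist (c / lq ^ s) x < e" using dist_vn by simp
  then show "x \<in> (\<Union>x\<in>(\<lambda>c. c / lq ^ s) ` F. ball x e)" using c(1) by auto
 qed
 then show "\<exists>k. finite k \<and> cball (0 :: 'a) R \<subseteq> (\<Union>x\<in>k. ball x e)"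
  using F(1) by (intro exI[of _ "(\<lambda>c. c / lq ^ s) ` F"]) simp
qed

lemma prod_diff_bound:
 assumes "finite I" "1 \<le> R" "0 \<le> e"
  "\<And>i. i \<in> I ==> vn (f i) \<le> R" "\<And>i. i \<in> I ==> vn (g i) \<le> R" "\<And>i. i \<in> I ==> vn (f i - g i) \<le> e"
 shows "vn (prod f I - prod g I) \<le> e * R ^ card I \<and> vn (prod f I) \<le> R ^ card I"
 using assms(1,4-)
proof (induction I rule: finite_induct)
 case (insert i I)
 have IH: "vn (prod f I - prod g I) \<le> e * R ^ card I" "vn (prod f I) \<le> R ^ card I" using insert by auto
 have R: "0 \<le> R" using assms(2) by simp
 have eq: "prod f (insert i I) - prod g (insert i I) = (f i - g i) * prod f I + g i * (prod f I - prod g I)"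
  using insert.hyps by (simp add: algebra_simps)
 have "vn ((f i - g i) * prod f I) \<le> e * R ^ card I"
  unfolding vn_mult using insert.prems IH assms(3) by (intro mult_mono) auto
 also have "\<dots> \<le> e * R ^ Suc (card I)" using assms(2,3) by (intro mult_left_mono power_increasing) auto
 finally have 1: "vn ((f i - g i) * prod f I) \<le> e * R ^ Suc (card I)" .
 have "vn (g i * (prod f I - prod g I)) \<le> R * (e * R ^ card I)"
  unfolding vn_mult using insert.prems IH R by (intro mult_mono) auto
 then have "vn (g i * (prod f I - prod g I)) \<le> e * R ^ Suc (card I)" by (simp add: mult.left_commute)
 then have "vn (prod f (insert i I) - prod g (insert i I)) \<le> e * R ^ Suc (card I)"
  unfolding eq using 1 vn_add order_trans by (metis max.bounded_iff)
 moreover have "vn (prod f (insert i I)) \<le> R * R ^ card I"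
  using insert.hyps insert.prems IH R by (auto simp: vn_mult intro!: mult_mono)
 ultimately show ?case using insert.hyps by simp
qed (use assms in auto)

text \<open>A quantitative form of the continuity of the determinant on bounded matrices, for the
  closedness part of \<open>GL_bounded_compact\<close>.\<close>

lemma det_diff_bound:
 assumes A: "A \<in> carrier_mat m m" and B: "B \<in> carrier_mat m m" and R: "1 \<le> R" "0 \<le> e"
  and le: "\<And>i j. i < m ==> j < m ==> vn (A $$ (i, j)) \<le> R \<and> vn (B $$ (i, j)) \<le> R \<and> vn (A $$ (i, j) - B $$ (i, j)) \<le> e"
 shows "vn (mdet A - mdet B) \<le> e * R ^ m"
 unfolding det_def'[OF A] det_def'[OF B] sum_subtractf[symmetric]
proof (rule vn_sum_le)
 fix p assume p: "p \<in> {p. p permutes {0..<m}}"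
 have "vn ((\<Prod>i = 0..<m. A $$ (i, p i)) - (\<Prod>i = 0..<m. B $$ (i, p i))) \<le> e * R ^ card {0..<m}"
  using R le p permutes_in_image[of p "{0..<m}"]
  by (intro conjunct1[OF prod_diff_bound]) auto
 then show "vn (signof p * (\<Prod>i = 0..<m. A $$ (i, p i)) - signof p * (\<Prod>i = 0..<m. B $$ (i, p i))) \<le> e * R ^ m"
  by (simp add: right_diff_distrib[symmetric] vn_mult sign_def vn_neg_1)
qed (use R in auto)

abbreviation ent :: "nat => 'a mat => nat \<times> nat => 'a"
 where "ent m A \<equiv> restrict (\<lambda>ij. A $$ ij) ({..<m} \<times> {..<m})"

abbreviation entT :: "nat => (nat \<times> nat => 'a) topology"
 where "entT m \<equiv> product_topology (\<lambda>_. euclidean) ({..<m} \<times> {..<m})"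

definition mbox :: "nat => (nat \<times> nat => 'a) => real => (nat \<times> nat => 'a) set"
 where "mbox m g e = PiE ({..<m} \<times> {..<m}) (\<lambda>ij. ball (g ij) e)"

lemma open_mbox: "openin (entT m) (mbox m g e)"
 unfolding mbox_def openin_PiE_gen by (simp add: finite_subset[of _ "{..<m} \<times> {..<m}"])

lemma GL_topspace: "topspace (GL_top m) = (GLc m :: 'a mat set)"
 by (auto simp: GL_top_def topspace_pullback_topology)

text \<open>With \<open>GL_openD\<close> this replaces the pullback of the product topology by
  entrywise balls.\<close>

lemma GL_openI:
 assumes U: "U \<subseteq> GLc m"
  and e: "\<And>x0. x0 \<in> U ==> \<exists>e>0. \<forall>x\<in>GLc m. (\<forall>i<m. \<forall>j<m. vn (x $$ (i, j) - x0 $$ (i, j)) < e) \<longrightarrow> x \<in> U"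
 shows "openin (GL_top m) U"
proof -
 obtain d where d: "\<And>x0. x0 \<in> U ==> d x0 > 0"
  "\<And>x0 x. x0 \<in> U ==> x \<in> GLc m ==> (\<forall>i<m. \<forall>j<m. vn (x $$ (i, j) - x0 $$ (i, j)) < d x0) ==> x \<in> U"
  using e by metis
 define W where "W = (\<Union>x0\<in>U. mbox m (ent m x0) (d x0))"
 have "openin (entT m) W" unfolding W_def using open_mbox by blast
 moreover have "U = ent m -` W \<inter> GLc m"
 proof (intro equalityI subsetI)
  fix x assume "x \<in> U"
  then have "ent m x \<in> mbox m (ent m x) (d x)" using d(1) by (auto simp: mbox_def)
  then show "x \<in> ent m -` W \<inter> GLc m" using U \<open>x \<in> U\<close> unfolding W_def by blast
 next
  fix x assume "x \<in> ent m -` W \<inter> GLc m"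
  then obtain x0 where x0: "x0 \<in> U" "ent m x \<in> mbox m (ent m x0) (d x0)" "x \<in> GLc m" by (auto simp: W_def)
  have "vn (x $$ (i, j) - x0 $$ (i, j)) < d x0" if "i < m" "j < m" for i j
  proof -
   have "x $$ (i, j) \<in> ball (x0 $$ (i, j)) (d x0)"
    using PiE_mem[OF x0(2)[unfolded mbox_def], of "(i, j)"] that by simp
   then show ?thesis using dist_vn[of "x0 $$ (i, j)"] vn_diff_commute by simp
  qed
  then show "x \<in> U" using d(2) x0 by blast
 qed
 ultimately show ?thesis unfolding GL_top_def openin_pullback_topology by blast
qed

lemma GL_openD:
 assumes "openin (GL_top m) U" "x0 \<in> U"
 shows "\<exists>e>0. \<forall>x\<in>carrier (GL m :: 'a mat monoid). (\<forall>i<m. \<forall>j<m. vn (x $$ (i, j) - x0 $$ (i, j)) < e) \<longrightarrow> x \<in> U"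
proof -
 let ?I = "{..<m} \<times> {..<m}"
 obtain W where W: "openin (entT m) W" "U = ent m -` W \<inter> GLc m"
  using assms(1) unfolding GL_top_def openin_pullback_topology by blast
 have "ent m x0 \<in> W" using assms(2) W(2) by auto
 then obtain X where X: "finite {i \<in> ?I. X i \<noteq> UNIV}" "\<forall>i\<in>?I. open (X i)" "ent m x0 \<in> PiE ?I X" "PiE ?I X \<subseteq> W"
  using W(1) unfolding openin_product_topology_alt by fastforce
 have "\<exists>e>0. ball (x0 $$ ij) e \<subseteq> X ij" if "ij \<in> ?I" for ij
 proof -
  have "x0 $$ ij \<in> X ij" using PiE_mem[OF X(3) that] that by simp
  then show ?thesis using X(2) that open_contains_ball by blast
 qed
 then obtain e where e: "\<And>ij. ij \<in> ?I ==> e ij > 0 \<and> ball (x0 $$ ij) (e ij) \<subseteq> X ij" by metis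
 define d where "d = Min (insert 1 (e ` ?I))"
 have d0: "d > 0" unfolding d_def using e by (subst Min_gr_iff) auto
 have "x \<in> U" if x: "x \<in> GLc m" "\<forall>i<m. \<forall>j<m. vn (x $$ (i, j) - x0 $$ (i, j)) < d" for x
 proof -
  have "x $$ ij \<in> X ij" if I: "ij \<in> ?I" for ij
  proof -
   obtain i j where ij: "ij = (i, j)" "i < m" "j < m" using I by auto
   have "d \<le> e ij" unfolding d_def using I by (intro Min_le) auto
   then have "x $$ ij \<in> ball (x0 $$ ij) (e ij)"
    using x(2) ij dist_vn[of "x0 $$ (i, j)" "x $$ (i, j)"] vn_diff_commute[of "x0 $$ (i, j)"] by force
   then show ?thesis using e[OF I] by blast
  qed
  then have "ent m x \<in> PiE ?I X" by auto
  then have "ent m x \<in> W" using X(4) by (rule subsetD[rotated])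
  then show ?thesis unfolding W(2) using x(1) by blast
 qed
 then show ?thesis using d0 by blast
qed

text \<open>A matrix close to \<open>x0\<close> lies in the coset of \<open>x0\<close>: multiplication by the inverse of \<open>x0\<close>
 enlarges entries by a bounded factor.\<close>

lemma near_coset:
 assumes x0: "x0 \<in> GLc m" and e0: "0 < e0"
 shows "\<exists>e>0. \<forall>x\<in>GLc m. (\<forall>i<m. \<forall>j<m. vn (x $$ (i, j) - x0 $$ (i, j)) < e) \<longrightarrow>
  (\<forall>i<m. \<forall>j<m. vn ((minv m x0 * x) $$ (i, j) - 1\<^sub>m m $$ (i, j)) < e0)"
proof -
 let ?y = "minv m x0"
 note yc = minv(4)[OF x0] and x0c = GL_carrier_mat[OF x0]
 define M where "M = Max (insert 1 ((\<lambda>(i, j). vn (?y $$ (i, j))) ` ({..<m} \<times> {..<m})))"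
 have M1: "1 \<le> M" unfolding M_def by (intro Max_ge) auto
 have M: "vn (?y $$ (i, j)) \<le> M" if "i < m" "j < m" for i j
  unfolding M_def using that by (intro Max_ge) auto
 have "vn ((?y * x) $$ (i, j) - 1\<^sub>m m $$ (i, j)) < e0"
  if x: "x \<in> GLc m" "\<forall>i<m. \<forall>j<m. vn (x $$ (i, j) - x0 $$ (i, j)) < e0 / M" and ij: "i < m" "j < m" for x i j
 proof -
  note xc = GL_carrier_mat[OF x(1)]
  have "(?y * x) $$ (i, j) - (?y * x0) $$ (i, j) = (\<Sum>p<m. ?y $$ (i, p) * (x $$ (p, j) - x0 $$ (p, j)))"
   unfolding mat_mult_index[OF yc xc ij] mat_mult_index[OF yc x0c ij] by (simp add: sum_subtractf right_diff_distrib)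
  moreover have "vn (\<Sum>p<m. ?y $$ (i, p) * (x $$ (p, j) - x0 $$ (p, j))) < e0"
  proof (rule vn_sum_less)
   fix p assume p: "p \<in> {..<m}"
   have "vn (?y $$ (i, p)) * vn (x $$ (p, j) - x0 $$ (p, j)) \<le> M * vn (x $$ (p, j) - x0 $$ (p, j))"
    using M ij p by (intro mult_right_mono) auto
   also have "\<dots> < M * (e0 / M)" using x(2) ij p M1 by (intro mult_strict_left_mono) auto
   finally show "vn (?y $$ (i, p) * (x $$ (p, j) - x0 $$ (p, j))) < e0" using M1 by (simp add: vn_mult)
  qed (rule e0)
  ultimately show ?thesis using minv(3)[OF x0] by simp
 qed
 then show ?thesis using M1 e0 by (intro exI[of _ "e0 / M"]) auto
qed

text \<open>Matrices entrywise close to \<open>x0\<close> lie in \<open>x0 K\<close>, since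
  \<open>x0^-1 x\<close> is then congruent to the identity modulo \<open>l\<close>.\<close>

lemma right_invariant_open:
 assumes U: "U \<subseteq> GLc m" and K: "\<And>x u. x \<in> U ==> u \<in> KG m ==> x * u \<in> U"
 shows "openin (GL_top m) U"
proof (rule GL_openI[OF U])
 fix x0 assume x0: "x0 \<in> U"
 then have x0G: "x0 \<in> GLc m" using U by blast
 obtain e where e: "e > 0" "\<And>x. x \<in> GLc m ==> (\<forall>i<m. \<forall>j<m. vn (x $$ (i, j) - x0 $$ (i, j)) < e) ==>
  (\<forall>i<m. \<forall>j<m. vn ((minv m x0 * x) $$ (i, j) - 1\<^sub>m m $$ (i, j)) < 1)"
  using near_coset[OF x0G, of 1] by auto
 have "x \<in> U" if x: "x \<in> GLc m" "\<forall>i<m. \<forall>j<m. vn (x $$ (i, j) - x0 $$ (i, j)) < e" for x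
 proof -
  have "cong_mat m (minv m x0 * x) (1\<^sub>m m)" using e(2)[OF x] by (simp add: cong_mat_def cong_l_def)
  moreover have "minv m x0 * x \<in> carrier_mat m m" using minv(4)[OF x0G] GL_carrier_mat[OF x(1)] by simp
  ultimately have "minv m x0 * x \<in> KG m" using GL_int_cong GL_int_one by blast
  then have "x0 * (minv m x0 * x) \<in> U" using K[OF x0] by blast
  then show ?thesis using GL_cancel(2)[OF x0G GL_carrier_mat[OF x(1)]] by simp
 qed
 then show "\<exists>e>0. \<forall>x\<in>GLc m. (\<forall>i<m. \<forall>j<m. vn (x $$ (i, j) - x0 $$ (i, j)) < e) \<longrightarrow> x \<in> U" using e(1) by blast
qed

lemma KG_open: "openin (GL_top m) (KG m)"
 by (rule right_invariant_open) (auto simp: GL_int_GL GL_int_mult)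

lemma KG_open_subgroup: "open_subgroup (GL m) (GL_top m) (KG m)"
 by (simp add: open_subgroup_def GL_int_subgroup KG_open)

text \<open>The invertible matrices are not closed among all matrices, so the absolute value of the
  determinant is fixed at a positive value. The set is then a product of compact balls minus an open
  set, and compactness is carried back along the entry map.\<close>

lemma GL_bounded_compact:
 assumes d: "0 < d"
 shows "compactin (GL_top m) {x \<in> GLc m. (\<forall>i<m. \<forall>j<m. vn (x $$ (i, j)) \<le> R) \<and> vn (mdet x) = d}"
  (is "compactin _ ?S")
proof -
 let ?I = "{..<m} \<times> {..<m}"
 define P where "P = PiE ?I (\<lambda>_. cball (0 :: 'a) R)"
 define dt where "dt g = vn (mdet (Matrix.mat m m g))" for g :: "nat \<times> nat => 'a"
 define R' where "R' = max 1 R"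
 have R': "1 \<le> R'" "R \<le> R'" by (auto simp: R'_def)
 have mat_ent: "Matrix.mat m m (ent m x) = x" if "x \<in> carrier_mat m m" for x using that by (intro eq_matI) auto
 define C where "C = {g \<in> P. dt g \<noteq> d}"
 \<comment> \<open>Within this radius the determinant moves by less than its own absolute value,
   which therefore stays constant; if it is 0, it moves by less than \<open>d\<close> and cannot
   reach it.\<close>
 define rad where "rad g = Min {1, (if dt g = 0 then d else dt g) / (2 * R' ^ m)}" for g
 have dt_near: "dt h \<noteq> d" if g: "g \<in> C" and h: "h \<in> P" "h \<in> mbox m g (rad g)" for g h
 proof -
  define e where "e = (if dt g = 0 then d else dt g) / (2 * R' ^ m)"
  have "0 \<le> dt g" by (simp add: dt_def)
  then have pos: "(if dt g = 0 then d else dt g) > 0" using d by auto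
  have R'p: "R' ^ m > 0" using R' by simp
  have e: "0 < e" unfolding e_def using pos R'p by (intro divide_pos_pos) auto
  have 1: "vn (mdet (Matrix.mat m m h) - mdet (Matrix.mat m m g)) \<le> e * R' ^ m"
  proof (rule det_diff_bound)
   fix i j assume ij: "i < m" "j < m"
   have "vn (g (i, j)) \<le> R" "vn (h (i, j)) \<le> R" using g h(1) ij by (auto simp: C_def P_def PiE_iff dist_commute)
   moreover have "dist (g (i, j)) (h (i, j)) < e" using h(2) ij by (auto simp: mbox_def PiE_iff e_def rad_def)
   then have "vn (h (i, j) - g (i, j)) < e" using dist_vn vn_diff_commute by metis
   ultimately show "vn (Matrix.mat m m h $$ (i, j)) \<le> R' \<and> vn (Matrix.mat m m g $$ (i, j)) \<le> R' \<and>
    vn (Matrix.mat m m h $$ (i, j) - Matrix.mat m m g $$ (i, j)) \<le> e" using ij R' by simp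
  qed (use R' e in auto)
  have "e * R' ^ m = (if dt g = 0 then d else dt g) / 2" unfolding e_def using R'p R'(1) by (simp add: field_simps del: zero_less_power_eq)
  also have "\<dots> < (if dt g = 0 then d else dt g)" using pos by simp
  finally have 2: "vn (mdet (Matrix.mat m m h) - mdet (Matrix.mat m m g)) < (if dt g = 0 then d else dt g)"
   using 1 by linarith
  show ?thesis
  proof (cases "dt g = 0")
   case True
   then have "mdet (Matrix.mat m m g) = 0" by (simp add: dt_def)
   then show ?thesis using 2 True by (simp add: dt_def)
  next
   case False
   then have "dt h = dt g"
    using vn_add_eq[of "mdet (Matrix.mat m m h) - mdet (Matrix.mat m m g)" "mdet (Matrix.mat m m g)"] 2
    by (simp add: dt_def)
   then show ?thesis using g by (simp add: C_def)
  qed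
 qed
 define N' where "N' = (\<Union>g\<in>C. mbox m g (rad g))"
 have N'open: "openin (entT m) N'" unfolding N'_def using open_mbox by blast
 have CN: "C \<subseteq> N'"
 proof
  fix g assume g: "g \<in> C"
  have "0 \<le> dt g" by (simp add: dt_def)
  then have "0 < (if dt g = 0 then d else dt g) / (2 * R' ^ m)" using d R' by (intro divide_pos_pos) auto
  then have "g \<in> mbox m g (rad g)"
   using g by (auto simp: mbox_def C_def P_def PiE_iff rad_def)
  then show "g \<in> N'" unfolding N'_def using g by blast
 qed
 have "compactin (entT m) P" unfolding P_def compactin_PiE using compact_cball by simp
 moreover have "closedin (entT m) (topspace (entT m) - N')" using N'open by blast
 ultimately have "compactin (entT m) ((topspace (entT m) - N') \<inter> P)" by (intro closed_Int_compactin)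
 moreover have "ent m ` ?S = (topspace (entT m) - N') \<inter> P"
 proof (intro equalityI subsetI)
  fix g assume "g \<in> ent m ` ?S"
  then obtain x where x: "x \<in> ?S" "g = ent m x" by blast
  have xc: "x \<in> carrier_mat m m" using x(1) GL_carrier_mat by blast
  have gP: "g \<in> P" using x by (auto simp: P_def dist_commute)
  moreover have "dt g = d" using x(1) xc mat_ent[OF xc] by (simp add: dt_def x(2))
  then have "g \<notin> N'" unfolding N'_def using dt_near[OF _ gP] by blast
  ultimately show "g \<in> (topspace (entT m) - N') \<inter> P" by (auto simp: P_def)
 next
  fix g assume g: "g \<in> (topspace (entT m) - N') \<inter> P"
  then have "g \<notin> C" using CN by blast
  then have "dt g = d" using g by (auto simp: C_def)
  let ?x = "Matrix.mat m m g"
  have "vn (?x $$ (i, j)) \<le> R" if "i < m" "j < m" for i j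
   using g that by (auto simp: P_def PiE_iff dist_commute)
  moreover have "vn (mdet ?x) = d" using \<open>dt g = d\<close> by (simp add: dt_def)
  ultimately have "?x \<in> ?S" using d by (auto simp: GL_carrier)
  moreover have "g = ent m ?x" using g by (auto simp: P_def fun_eq_iff PiE_iff extensional_def restrict_def)
  ultimately show "g \<in> ent m ` ?S" by blast
 qed
 ultimately have cim: "compactin (entT m) (ent m ` ?S)" by simp
 show ?thesis
  unfolding compactin_def
 proof (intro conjI allI impI)
  show "?S \<subseteq> topspace (GL_top m)" by (auto simp: GL_topspace)
 next
  fix UU assume UU: "(\<forall>U\<in>UU. openin (GL_top m) U) \<and> ?S \<subseteq> \<Union>UU"
  \<comment> \<open>Each open set of matrices is the trace of an open set of entry functions; the
    finite subcover is selected there.\<close>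
  define Wf where "Wf U = (SOME W. openin (entT m) W \<and> U = ent m -` W \<inter> GLc m)" for U
  have Wf: "openin (entT m) (Wf U) \<and> U = ent m -` Wf U \<inter> GLc m" if "U \<in> UU" for U
   unfolding Wf_def by (rule someI_ex) (use UU that in \<open>auto simp: GL_top_def openin_pullback_topology\<close>)
  have "ent m ` ?S \<subseteq> \<Union>(Wf ` UU)"
  proof
   fix g assume "g \<in> ent m ` ?S"
   then obtain x where x: "x \<in> ?S" "g = ent m x" by blast
   then obtain U where "U \<in> UU" "x \<in> U" using UU by blast
   then show "g \<in> \<Union>(Wf ` UU)" using Wf x(2) by blast
  qed
  moreover have "\<forall>W\<in>Wf ` UU. openin (entT m) W" using Wf by blast
  ultimately have "\<exists>FF. finite FF \<and> FF \<subseteq> Wf ` UU \<and> ent m ` ?S \<subseteq> \<Union>FF"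
   using cim[unfolded compactin_def, THEN conjunct2, THEN spec, of "Wf ` UU"] by simp
  then obtain FF where FF: "finite FF" "FF \<subseteq> Wf ` UU" "ent m ` ?S \<subseteq> \<Union>FF" by (elim exE conjE)
  obtain F where F: "F \<subseteq> UU" "finite F" "FF = Wf ` F" using finite_subset_image[OF FF(1,2)] by blast
  have "?S \<subseteq> \<Union>F"
  proof
   fix x assume x: "x \<in> ?S"
   then obtain U where "U \<in> F" "ent m x \<in> Wf U" using FF(3) F(3) by blast
   then have "x \<in> U" using Wf F(1) x by blast
   then show "x \<in> \<Union>F" using \<open>U \<in> F\<close> by blast
  qed
  then show "\<exists>F. finite F \<and> F \<subseteq> UU \<and> ?S \<subseteq> \<Union>F" using F by blast
 qed
qed

lemma KG_compact: "compactin (GL_top m) (KG m)"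
proof -
 have "KG m = {x \<in> GLc m. (\<forall>i<m. \<forall>j<m. vn (x $$ (i, j)) \<le> 1) \<and> vn (mdet x) = 1}"
  by (auto simp: GL_int_iff int_mat_def GL_carrier)
 then show ?thesis using GL_bounded_compact[of 1 m 1] by simp
qed

text \<open>By compactness, finitely many cosets \<open>k U\<close> cover the integral group. This
  makes the orbits of smooth vectors finite.\<close>

lemma open_subgroup_finite_index:
 assumes U: "open_subgroup (GL m) (GL_top m) U"
 shows "\<exists>F. finite F \<and> F \<subseteq> KG m \<and> (\<forall>x\<in>KG m. \<exists>k\<in>F. \<exists>u\<in>U. x = k * u)"
proof -
 have "openin (GL_top m) U" "1\<^sub>m m \<in> U"
  using U subgroup.one_closed[of U "GL m"] by (auto simp: open_subgroup_def)
 then obtain e0 where e0: "e0 > 0"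
  "\<And>x. x \<in> GLc m ==> (\<forall>i<m. \<forall>j<m. vn (x $$ (i, j) - 1\<^sub>m m $$ (i, j)) < e0) ==> x \<in> U"
  using GL_openD by metis
 have "openin (GL_top m) {x \<in> GLc m. \<forall>i<m. \<forall>j<m. vn (x $$ (i, j) - k $$ (i, j)) < e}" if "e > 0" for k e
 proof (rule GL_openI)
  fix x0 assume x0: "x0 \<in> {x \<in> GLc m. \<forall>i<m. \<forall>j<m. vn (x $$ (i, j) - k $$ (i, j)) < e}"
  have "vn (x $$ (i, j) - k $$ (i, j)) < e" if "vn (x $$ (i, j) - x0 $$ (i, j)) < e" "i < m" "j < m" for x i j
   using vn_add[of "x $$ (i, j) - x0 $$ (i, j)" "x0 $$ (i, j) - k $$ (i, j)"] x0 that by fastforce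
  then show "\<exists>e'>0. \<forall>x\<in>GLc m. (\<forall>i<m. \<forall>j<m. vn (x $$ (i, j) - x0 $$ (i, j)) < e') \<longrightarrow>
    x \<in> {x \<in> GLc m. \<forall>i<m. \<forall>j<m. vn (x $$ (i, j) - k $$ (i, j)) < e}"
   using \<open>e > 0\<close> by blast
 qed auto
 note boxopen = this
 have "\<exists>e>0. \<forall>x\<in>GLc m. (\<forall>i<m. \<forall>j<m. vn (x $$ (i, j) - k $$ (i, j)) < e) \<longrightarrow> minv m k * x \<in> U" if k: "k \<in> KG m" for k
 proof -
  obtain e where e: "e > 0" "\<forall>x\<in>GLc m. (\<forall>i<m. \<forall>j<m. vn (x $$ (i, j) - k $$ (i, j)) < e) \<longrightarrow>
   (\<forall>i<m. \<forall>j<m. vn ((minv m k * x) $$ (i, j) - 1\<^sub>m m $$ (i, j)) < e0)"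
   using near_coset[OF GL_int_GL[OF k] e0(1)] by blast
  have "minv m k * x \<in> U" if "x \<in> GLc m" "\<forall>i<m. \<forall>j<m. vn (x $$ (i, j) - k $$ (i, j)) < e" for x
   using e0(2)[OF GL_mult_closed[OF GL_int_GL[OF GL_int_minv[OF k]] that(1)]] e(2) that by blast
  then show ?thesis using e(1) by blast
 qed
 then obtain ef where ef: "\<And>k. k \<in> KG m ==> ef k > 0 \<and> (\<forall>x\<in>GLc m. (\<forall>i<m. \<forall>j<m. vn (x $$ (i, j) - k $$ (i, j)) < ef k) \<longrightarrow> minv m k * x \<in> U)"
  by metis
 define B where "B k = {x \<in> GLc m. \<forall>i<m. \<forall>j<m. vn (x $$ (i, j) - k $$ (i, j)) < ef k}" for k
 have "\<forall>V\<in>B ` KG m. openin (GL_top m) V" unfolding B_def using boxopen ef by blast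
 moreover have "KG m \<subseteq> \<Union>(B ` KG m)"
 proof
  fix k assume k: "k \<in> KG m"
  then have "k \<in> B k" using ef GL_int_GL by (simp add: B_def)
  then show "k \<in> \<Union>(B ` KG m)" using k by blast
 qed
 ultimately obtain FF where FF: "finite FF" "FF \<subseteq> B ` KG m" "KG m \<subseteq> \<Union>FF"
  using KG_compact[of m, unfolded compactin_def, THEN conjunct2, THEN spec, of "B ` KG m"] by auto
 obtain F where F: "F \<subseteq> KG m" "finite F" "FF = B ` F" using finite_subset_image[OF FF(1,2)] by blast
 have "\<exists>k\<in>F. \<exists>u\<in>U. x = k * u" if x: "x \<in> KG m" for x
 proof -
  obtain k where k: "k \<in> F" "x \<in> B k" using FF(3) F(3) x by blast
  then have "minv m k * x \<in> U" using ef F(1) by (auto simp: B_def)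
  moreover have "x = k * (minv m k * x)" using GL_cancel(2)[OF GL_int_GL GL_int_carrier[OF x]] k(1) F(1) by (metis subsetD)
  ultimately show ?thesis using k(1) by blast
 qed
 then show ?thesis using F by blast
qed

end

section \<open>Spherical functions in the principal series\<close>

lemma upper_triangular_mult_diag:
 fixes A :: "'b::comm_ring_1 mat"
 assumes A: "A \<in> carrier_mat m m" "upper_triangular A" and B: "B \<in> carrier_mat m m" "upper_triangular B"
 shows "upper_triangular (A * B)" "i < m ==> (A * B) $$ (i, i) = A $$ (i, i) * B $$ (i, i)"
proof -
 have z: "A $$ (i, p) * B $$ (p, j) = 0" if "i < m" "p < m" "p < i \<or> j < p" for i j p
  using that A B upper_triangularD[of A p i] upper_triangularD[of B j p] by auto
 show "upper_triangular (A * B)"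
 proof (rule upper_triangularI)
  fix i j assume ij: "j < i" "i < dim_row (A * B)"
  then have im: "i < m" "j < m" using A(1) by auto
  have "A $$ (i, p) * B $$ (p, j) = 0" if "p < m" for p using z[of i p j] im that ij(1) by linarith
  then show "(A * B) $$ (i, j) = 0" unfolding mat_mult_index[OF A(1) B(1) im] by (intro sum.neutral) auto
 qed
 assume i: "i < m"
 show "(A * B) $$ (i, i) = A $$ (i, i) * B $$ (i, i)"
  unfolding mat_mult_index[OF A(1) B(1) i i] using z[of i _ i] i by (intro sum_only) (auto simp: nat_neq_iff)
qed

lemma upper_triangular_cancel:
 fixes A :: "'b::idom mat"
 assumes A: "A \<in> carrier_mat m m" "upper_triangular A" "\<And>i. i < m ==> A $$ (i, i) \<noteq> 0"
  and k: "k \<in> carrier_mat m m" and B: "upper_triangular (A * k)"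
 shows "upper_triangular k"
proof -
 have "k $$ (i, j) = 0" if "j < i" "i < m" for i j
  using that
 proof (induction "m - i" arbitrary: i rule: less_induct)
  case less
  have "A $$ (i, p) * k $$ (p, j) = 0" if "p < m" "p \<noteq> i" for p
   using A upper_triangularD[of A p i] less.hyps[of p] less.prems that by (cases "p < i") auto
  then have "(A * k) $$ (i, j) = A $$ (i, i) * k $$ (i, j)"
   using mat_mult_index[OF A(1) k, of i j] less.prems sum_only[of "{..<m}" i "\<lambda>p. A $$ (i, p) * k $$ (p, j)"] by simp
  moreover have "(A * k) $$ (i, j) = 0" using upper_triangularD[OF B, of j i] less.prems A(1) by simp
  ultimately show ?case using A(3) less.prems by simp
 qed
 then show ?thesis using k by (intro upper_triangularI) auto
qed

lemma GL1_simps [simp]: "carrier GL1 = UNIV - {0}" "x \<otimes>\<^bsub>GL1\<^esub> y = x * y" "\<one>\<^bsub>GL1\<^esub> = 1"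
 by (auto simp: GL1_def)

lemma GL1_group: "group (GL1 :: 'b::field monoid)"
 by (rule groupI) (auto intro!: bexI[of _ "inverse _"])

lemma GL1_inv: "x \<noteq> 0 ==> inv\<^bsub>GL1\<^esub> x = inverse (x :: 'b::field)"
 by (rule group.inv_equality[OF GL1_group]) auto

context padic_field
begin

lemma GL1_int_iff: "x \<in> (GL1_int :: 'a set) \<longleftrightarrow> vn x = 1"
proof
 assume "x \<in> (GL1_int :: 'a set)"
 then have x: "x \<noteq> 0" "vn x \<le> 1" "vn (inverse x) \<le> 1"
  using GL1_inv[of x] by (auto simp: GL1_int_def dist_commute)
 have "vn x * vn (inverse x) = 1" using x(1) by (simp add: vn_inverse)
 then show "vn x = 1" using x mult_left_le[of "vn (inverse x)" "vn x"] by simp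
next
 assume x: "vn x = 1"
 then have "x \<noteq> 0" by auto
 then show "x \<in> GL1_int" using x GL1_inv[of x] by (simp add: GL1_int_def Zl_iff vn_inverse del: mem_cball)
qed

lemma unram:
 assumes "unramified_char (\<omega> :: 'a => complex)"
 shows "x \<noteq> 0 ==> y \<noteq> 0 ==> \<omega> (x * y) = \<omega> x * \<omega> y" "x \<noteq> 0 ==> \<omega> x \<noteq> 0" "vn x = 1 ==> \<omega> x = 1"
 using assms GL1_int_iff by (auto simp: unramified_char_def hom_def Pi_iff)

lemma unram_inverse:
 assumes "unramified_char (\<omega> :: 'a => complex)" "x \<noteq> 0"
 shows "\<omega> (inverse x) = inverse (\<omega> x)"
proof -
 have "\<omega> x * \<omega> (inverse x) = 1" using unram(1)[OF assms(1), of x "inverse x"] unram(3)[OF assms(1), of 1] assms(2) by simp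
 then show ?thesis using inverse_unique by metis
qed

lemma unram_power: "unramified_char (\<omega> :: 'a => complex) ==> x \<noteq> 0 ==> \<omega> (x ^ k) = \<omega> x ^ k"
 by (induction k) (auto simp: unram)

lemma unram_charI:
 assumes "z \<noteq> 0" shows "unramified_char (\<lambda>x :: 'a. if x = 0 then 0 else (z :: complex) powi uval x)"
 unfolding unramified_char_def hom_def using assms
 by (auto simp: GL1_int_iff uval_unit uval_mult power_int_add)

text \<open>The \<open>i\<close>-th character of the torus including its share of the square root of
  the modulus character, so that the product \<open>bch\<close> is the full inducing
  character.\<close>

definition dch :: "nat => (nat => 'a => complex) => nat => 'a => complex"
 where "dch m \<mu> i x = \<mu> i x * of_real (vn x powr ((real m - 1 - 2 * real i) / 2))"

definition bch :: "nat => (nat => 'a => complex) => 'a mat => complex"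
 where "bch m \<mu> b = (\<Prod>i<m. dch m \<mu> i (b $$ (i, i)))"

lemma principal_series_bch: "principal_series m \<mu> = smooth_ind (GL m) (GL_top m) (borel_subgroup m) (bch m \<mu>)"
 unfolding principal_series_def bch_def[abs_def] dch_def ..

text \<open>The spherical vector of the principal series with value 1 at the identity. The Borel
  part \<open>b\<close> of an Iwasawa decomposition is unique up to integral upper triangular
  matrices with unit diagonal, on which \<open>bch\<close> is 1, so the choice does not
  matter.\<close>

definition sphf :: "nat => (nat => 'a => complex) => 'a mat => complex"
 where "sphf m \<mu> g = (if g \<in> GLc m then bch m \<mu> (SOME b. b \<in> borel_subgroup m \<and> (\<exists>k\<in>KG m. g = b * k)) else 0)"

lemma borelD:
 assumes "b \<in> borel_subgroup m"
 shows "b \<in> GLc m" "b \<in> carrier_mat m m" "upper_triangular b" "i < m ==> b $$ (i, i) \<noteq> (0 :: 'a)"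
proof -
 show b: "b \<in> GLc m" "b \<in> carrier_mat m m" "upper_triangular b"
  using assms GL_carrier_mat by (auto simp: borel_subgroup_def)
 then have "(\<Prod>i<m. b $$ (i, i)) \<noteq> 0" using det_prod_diag[OF b(2,3)] by (simp add: GL_carrier)
 then show "i < m ==> b $$ (i, i) \<noteq> 0" by auto
qed

lemma borel_mult:
 fixes a :: "'a mat"
 assumes a: "a \<in> borel_subgroup m" and b: "b \<in> borel_subgroup m" shows "a * b \<in> borel_subgroup m"
 using GL_mult_closed[OF borelD(1)[OF a] borelD(1)[OF b]]
  upper_triangular_mult_diag(1)[OF borelD(2,3)[OF a] borelD(2,3)[OF b]]
 by (simp add: borel_subgroup_def)

lemma iwasawa_borel:
 assumes "g \<in> GLc m" shows "\<exists>b\<in>borel_subgroup m. \<exists>k\<in>KG m. g = b * k"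
proof -
 obtain k where k: "k \<in> KG m" "upper_triangular (g * k)" using iwasawa[OF assms] by blast
 then have "g * k \<in> borel_subgroup m" using GL_mult_closed[OF assms GL_int_GL[OF k(1)]] by (simp add: borel_subgroup_def)
 moreover have "g = (g * k) * minv m k" using GL_cancel_right(1)[OF GL_int_GL[OF k(1)] GL_carrier_mat[OF assms]] by simp
 ultimately show ?thesis using GL_int_minv[OF k(1)] by blast
qed

context
 fixes m :: nat and \<mu> :: "nat => 'a => complex"
 assumes \<mu>: "\<And>i. i < m ==> unramified_char (\<mu> i)"
begin

lemma dch_mult: "i < m ==> x \<noteq> 0 ==> y \<noteq> 0 ==> dch m \<mu> i (x * y) = dch m \<mu> i x * dch m \<mu> i y"
 using unram(1)[OF \<mu>] by (simp add: dch_def vn_mult powr_mult)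

lemma dch_unit: "i < m ==> vn x = 1 ==> dch m \<mu> i x = 1"
 using unram(3)[OF \<mu>] by (simp add: dch_def)

lemma bch_mult:
 assumes "a \<in> borel_subgroup m" "b \<in> borel_subgroup m" shows "bch m \<mu> (a * b) = bch m \<mu> a * bch m \<mu> b"
 unfolding bch_def prod.distrib[symmetric]
 by (intro prod.cong)
  (simp_all add: upper_triangular_mult_diag(2)[OF borelD(2,3)[OF assms(1)] borelD(2,3)[OF assms(2)]]
   dch_mult borelD(4)[OF assms(1)] borelD(4)[OF assms(2)])

lemma bch_unit:
 assumes "k \<in> KG m" "upper_triangular k" shows "bch m \<mu> k = 1"
proof -
 have "(\<Prod>i<m. vn (k $$ (i, i))) = 1"
  using assms det_prod_diag[OF GL_int_carrier[OF assms(1)] assms(2)] by (simp add: GL_int_iff vn_prod)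
 moreover have le: "vn (k $$ (i, i)) \<le> 1" if "i < m" for i using assms that by (auto simp: GL_int_iff int_mat_def)
 ultimately have "vn (k $$ (i, i)) = 1" if "i < m" for i
 proof -
  have "vn (k $$ (i, i)) * (\<Prod>p\<in>{..<m} - {i}. vn (k $$ (p, p))) = 1"
   using \<open>(\<Prod>i<m. vn (k $$ (i, i))) = 1\<close> that by (subst (asm) prod.remove[of _ i]) auto
  moreover have "(\<Prod>p\<in>{..<m} - {i}. vn (k $$ (p, p))) \<le> 1" using le by (intro prod_le_1) auto
  ultimately show ?thesis using le[OF that] mult_left_le[of "\<Prod>p\<in>{..<m} - {i}. vn (k $$ (p, p))" "vn (k $$ (i, i))"] by simp
 qed
 then show ?thesis unfolding bch_def using dch_unit by (intro prod.neutral) auto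
qed

lemma sphf_eq:
 assumes b: "b \<in> borel_subgroup m" and k: "k \<in> KG m"
 shows "sphf m \<mu> (b * k) = bch m \<mu> b"
proof -
 have bk: "b * k \<in> GLc m" using borelD(1)[OF b] GL_int_GL[OF k] GL_mult_closed by blast
 let ?P = "\<lambda>b'. b' \<in> borel_subgroup m \<and> (\<exists>k'\<in>KG m. b * k = b' * k')"
 have "?P (SOME b'. ?P b')" by (rule someI[of ?P b]) (use b k in blast)
 then have "(SOME b'. ?P b') \<in> borel_subgroup m" "\<exists>k'\<in>KG m. b * k = (SOME b'. ?P b') * k'" by blast+
 then obtain b' k' where b': "(SOME b'. ?P b') = b'" "b' \<in> borel_subgroup m" "k' \<in> KG m" "b * k = b' * k'" by blast
 note c = borelD(2)[OF b] borelD(2)[OF b'(2)] GL_int_carrier[OF k] GL_int_carrier[OF b'(3)] minv(4)[OF GL_int_GL[OF k]]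
 define u where "u = k' * minv m k"
 have u: "u \<in> KG m" unfolding u_def using GL_int_mult GL_int_minv b'(3) k by blast
 have "b = (b * k) * minv m k" using GL_cancel_right(1)[OF GL_int_GL[OF k] c(1)] by simp
 also have "\<dots> = b' * u" unfolding b'(4) u_def using c by (simp add: assoc_mult_mat[of _ m m _ m _ m])
 finally have e: "b = b' * u" .
 have ut: "upper_triangular u"
  
 proof (rule upper_triangular_cancel[OF borelD(2,3)[OF b'(2)] _ GL_int_carrier[OF u]])
  show "b' $$ (i, i) \<noteq> 0" if "i < m" for i using borelD(4)[OF b'(2) that] .
  show "upper_triangular (b' * u)" using borelD(3)[OF b] unfolding e .
 qed
 then have "u \<in> borel_subgroup m" using GL_int_GL[OF u] by (simp add: borel_subgroup_def)
 then have "bch m \<mu> b = bch m \<mu> b' * bch m \<mu> u" unfolding e using bch_mult b'(2) by blast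
 then have "bch m \<mu> b = bch m \<mu> b'" using bch_unit[OF u ut] by simp
 then show ?thesis unfolding sphf_def using bk b'(1) by simp
qed

lemma sphf_borel:
 assumes s: "s \<in> borel_subgroup m" and x: "x \<in> GLc m"
 shows "sphf m \<mu> (s * x) = bch m \<mu> s * sphf m \<mu> x"
proof -
 obtain b k where b: "b \<in> borel_subgroup m" "k \<in> KG m" "x = b * k" using iwasawa_borel[OF x] by blast
 have "s * x = (s * b) * k" unfolding b(3) using borelD(2)[OF s] borelD(2)[OF b(1)] GL_int_carrier[OF b(2)]
  by (simp add: assoc_mult_mat[of _ m m _ m _ m])
 then show ?thesis using sphf_eq[OF borel_mult[OF s b(1)] b(2)] sphf_eq[OF b(1,2)] bch_mult[OF s b(1)] b(3) by simp
qed

lemma sphf_K: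
 assumes x: "x \<in> GLc m" and u: "u \<in> KG m" shows "sphf m \<mu> (x * u) = sphf m \<mu> x"
proof -
 obtain b k where b: "b \<in> borel_subgroup m" "k \<in> KG m" "x = b * k" using iwasawa_borel[OF x] by blast
 have "x * u = b * (k * u)" unfolding b(3) using GL_int_carrier[OF u] borelD(2)[OF b(1)] GL_int_carrier[OF b(2)]
  by (simp add: assoc_mult_mat[of _ m m _ m _ m])
 then show ?thesis using sphf_eq[OF b(1) GL_int_mult[OF b(2) u]] sphf_eq[OF b(1,2)] b(3) by simp
qed

lemma sphf_one: "sphf m \<mu> (1\<^sub>m m) = 1"
proof -
 have "(1\<^sub>m m :: 'a mat) \<in> borel_subgroup m" by (simp add: borel_subgroup_def GL_one_closed)
 from sphf_eq[OF this GL_int_one] have "sphf m \<mu> (1\<^sub>m m * 1\<^sub>m m) = bch m \<mu> (1\<^sub>m m)" .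
 also have "\<dots> = 1" by (rule bch_unit) auto
 finally show ?thesis by simp
qed

lemma sphf_principal_series: "sphf m \<mu> \<in> principal_series m \<mu>"
proof -
 have "right_translate (GL m) u (sphf m \<mu>) = sphf m \<mu>" if "u \<in> KG m" for u
  using sphf_K[OF _ that] by (auto simp: right_translate_def fun_eq_iff) (auto simp: sphf_def)
 then have "\<exists>U. open_subgroup (GL m) (GL_top m) U \<and> (\<forall>u\<in>U. right_translate (GL m) u (sphf m \<mu>) = sphf m \<mu>)"
  using KG_open_subgroup by (intro exI[of _ "KG m"]) simp
 moreover have "\<forall>x. x \<notin> GLc m \<longrightarrow> sphf m \<mu> x = 0" by (simp add: sphf_def)
 ultimately show ?thesis unfolding principal_series_bch smooth_ind_def using sphf_borel by simp
qed

text \<open>By the Iwasawa decomposition, a function that transforms under the Borel subgroup on the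
  left and is invariant on the right is determined by its value at the identity.\<close>

lemma spherical_line:
 assumes f: "f \<in> principal_series m \<mu>" "\<And>u. u \<in> KG m ==> right_translate (GL m) u f = f"
 shows "f = fun_scale (f (1\<^sub>m m)) (sphf m \<mu>)"
proof
 fix x
 show "f x = fun_scale (f (1\<^sub>m m)) (sphf m \<mu>) x"
 proof (cases "x \<in> GLc m")
  case True
  obtain b k where b: "b \<in> borel_subgroup m" "k \<in> KG m" "x = b * k" using iwasawa_borel[OF True] by blast
  note bc = borelD(1,2)[OF b(1)]
  have "f x = right_translate (GL m) k f b" using bc b(3) by (simp add: right_translate_def)
  also have "\<dots> = f (b * 1\<^sub>m m)" using f(2)[OF b(2)] bc by simp
  also have "\<dots> = bch m \<mu> b * f (1\<^sub>m m)"
   using f(1) b(1) GL_one_closed unfolding principal_series_bch smooth_ind_def by auto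
  finally show ?thesis using sphf_eq[OF b(1,2)] b(3) by (simp add: fun_scale_def)
 next
  case False
  then show ?thesis using f(1) by (simp add: principal_series_bch smooth_ind_def fun_scale_def sphf_def)
 qed
qed

text \<open>For \<open>y = b c\<close> the Borel part \<open>b\<close> comes out as a factor, and
  \<open>c\<close> only permutes the cosets. The eigenvalue is thus the Hecke sum evaluated at the
  identity.\<close>

lemma sphf_eigen:
 assumes y: "y \<in> GLc m"
 shows "(\<Sum>x\<in>HNk m k. sphf m \<mu> (y * x)) = (\<Sum>x\<in>HNk m k. sphf m \<mu> x) * sphf m \<mu> y"
proof -
 obtain b c where b: "b \<in> borel_subgroup m" "c \<in> KG m" "y = b * c" using iwasawa_borel[OF y] by blast
 have "sphf m \<mu> (y * x) = bch m \<mu> b * sphf m \<mu> (c * x)" if "x \<in> HNk m k" for x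
  using sphf_borel[OF b(1) GL_mult_closed[OF GL_int_GL[OF b(2)] HNk_GL[OF that]]]
   borelD(2)[OF b(1)] GL_int_carrier[OF b(2)] GL_carrier_mat[OF HNk_GL[OF that]] b(3)
  by (simp add: assoc_mult_mat[of _ m m _ m _ m])
 then have "(\<Sum>x\<in>HNk m k. sphf m \<mu> (y * x)) = bch m \<mu> b * (\<Sum>x\<in>HNk m k. sphf m \<mu> (c * x))"
  by (simp add: sum_distrib_left)
 also have "(\<Sum>x\<in>HNk m k. sphf m \<mu> (c * x)) = (\<Sum>x\<in>HNk m k. sphf m \<mu> x)"
  using sphf_K Xk_GL by (intro HNk_reindex b(2)) auto
 finally show ?thesis using sphf_eq[OF b(1,2)] b(3) by (simp add: mult.commute)
qed

end

section \<open>Hecke eigenvalues of the spherical function\<close>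

definition HNpos :: "nat => nat set => (nat \<times> nat) set"
 where "HNpos m S = {(i, j). i < j \<and> j < m \<and> i \<in> S \<and> j \<notin> S}"

lemma finite_HNpos: "finite (HNpos m S)"
 by (rule finite_subset[of _ "{..<m} \<times> {..<m}"]) (auto simp: HNpos_def)

lemma card_HN: "card (HN m S) = l ^ card (HNpos m S)"
proof -
 define F where "F C = Matrix.mat m m (\<lambda>(i, j). if i = j then (if i \<in> S then lq else 1) else
  if (i, j) \<in> HNpos m S then C (i, j) else 0)" for C :: "nat \<times> nat => 'a"
 have "bij_betw F (PiE (HNpos m S) (\<lambda>_. digits)) (HN m S)"
 proof (rule bij_betwI')
  fix C C' assume C: "C \<in> PiE (HNpos m S) (\<lambda>_. digits)" "C' \<in> PiE (HNpos m S) (\<lambda>_. digits)"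
  show "F C = F C' \<longleftrightarrow> C = C'"
  proof
   assume e: "F C = F C'"
   show "C = C'"
   proof (rule PiE_ext[OF C])
    fix p assume p: "p \<in> HNpos m S"
    then obtain i j where ij: "p = (i, j)" "i < j" "j < m" by (auto simp: HNpos_def)
    have "F C $$ (i, j) = F C' $$ (i, j)" using e by simp
    then show "C p = C' p" using ij p by (simp add: F_def)
   qed
  qed simp
 next
  fix C assume C: "C \<in> PiE (HNpos m S) (\<lambda>_. digits)"
  show "F C \<in> HN m S" using PiE_mem[OF C] by (auto simp: HN_def F_def HNpos_def)
 next
  fix A assume A: "A \<in> HN m S"
  let ?C = "restrict (\<lambda>p. A $$ p) (HNpos m S)"
  have "?C \<in> PiE (HNpos m S) (\<lambda>_. digits)" using HN_D(3)[OF A] by (auto simp: HNpos_def)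
  moreover have "A = F ?C"
  proof (rule eq_matI)
   fix i j assume "i < dim_row (F ?C)" "j < dim_col (F ?C)"
   then have ij: "i < m" "j < m" by (auto simp: F_def)
   then show "A $$ (i, j) = F ?C $$ (i, j)"
    using HN_D(2)[OF A, of i] HN_D(4)[OF A, of i j] by (auto simp: F_def HNpos_def)
  qed (use HN_D(1)[OF A] in \<open>auto simp: F_def\<close>)
  ultimately show "\<exists>C\<in>PiE (HNpos m S) (\<lambda>_. digits). A = F C" by blast
 qed
 then have "card (HN m S) = card (PiE (HNpos m S) (\<lambda>_. digits :: 'a set))" using bij_betw_same_card by fastforce
 then show ?thesis using finite_HNpos[of m S] card_digits by (simp add: card_PiE)
qed

lemma card_less_pairs:
 assumes "finite S" shows "2 * (\<Sum>i\<in>S. card {j \<in> S. (i :: nat) < j}) = card S * (card S - 1)"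
proof -
 have "(\<Sum>i\<in>S. card {j \<in> S. i < j}) = (\<Sum>i\<in>S. \<Sum>j\<in>S. if i < j then 1 else 0)"
  using assms by (simp add: sum.If_cases Int_def)
 also have "\<dots> = (\<Sum>j\<in>S. \<Sum>i\<in>S. if i < j then 1 else 0)" by (rule sum.swap)
 also have "\<dots> = (\<Sum>j\<in>S. card {i \<in> S. i < j})"
  using assms by (simp add: sum.If_cases Int_def)
 finally have "2 * (\<Sum>i\<in>S. card {j \<in> S. i < j}) = (\<Sum>i\<in>S. card {j \<in> S. i < j} + card {j \<in> S. j < i})"
  by (simp add: sum.distrib)
 also have "\<dots> = (\<Sum>i\<in>S. card S - 1)"
 proof (rule sum.cong)
  fix i assume i: "i \<in> S"
  have "card {j \<in> S. i < j} + card {j \<in> S. j < i} = card ({j \<in> S. i < j} \<union> {j \<in> S. j < i})"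
   using assms by (intro card_Un_disjoint[symmetric]) auto
  also have "{j \<in> S. i < j} \<union> {j \<in> S. j < i} = S - {i}" by auto
  finally show "card {j \<in> S. i < j} + card {j \<in> S. j < i} = card S - 1" using i assms by simp
 qed simp
 finally show ?thesis by simp
qed

text \<open>Row \<open>i\<close> has \<open>m - 1 - i\<close> places to the right of the diagonal,
  and those in columns of \<open>S\<close> are not free; summed over the rows of \<open>S\<close>,
  the excluded places are the pairs of elements of \<open>S\<close>.\<close>

lemma card_HNpos:
 assumes S: "S \<subseteq> {..<m}"
 shows "real (card (HNpos m S)) = (\<Sum>i\<in>S. real m - 1 - real i) - real (card S) * (real (card S) - 1) / 2"
proof -
 have fin: "finite S" using S finite_subset by blast
 have "HNpos m S = (SIGMA i:S. {j. i < j \<and> j < m \<and> j \<notin> S})" by (auto simp: HNpos_def)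
 then have 1: "card (HNpos m S) = (\<Sum>i\<in>S. card {j. i < j \<and> j < m \<and> j \<notin> S})"
  using fin by (simp add: card_SigmaI)
 have 2: "real (card {j. i < j \<and> j < m \<and> j \<notin> S}) = (real m - 1 - real i) - real (card {j \<in> S. i < j})" if i: "i \<in> S" for i
 proof -
  have "card {j. i < j \<and> j < m \<and> j \<notin> S} + card {j \<in> S. i < j} = card ({j. i < j \<and> j < m \<and> j \<notin> S} \<union> {j \<in> S. i < j})"
   using fin by (intro card_Un_disjoint[symmetric]) auto
  also have "{j. i < j \<and> j < m \<and> j \<notin> S} \<union> {j \<in> S. i < j} = {i<..<m}" using S by auto
  finally have "real (card {j. i < j \<and> j < m \<and> j \<notin> S}) + real (card {j \<in> S. i < j}) = real (m - Suc i)" by simp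
  moreover have "i < m" using i S by auto
  ultimately show ?thesis by (simp add: of_nat_diff)
 qed
 have "real (2 * (\<Sum>i\<in>S. card {j \<in> S. i < j})) = real (card S) * (real (card S) - 1)"
  unfolding card_less_pairs[OF fin] by (cases "card S") (auto simp: algebra_simps)
 then have 3: "(\<Sum>i\<in>S. real (card {j \<in> S. i < j})) = real (card S) * (real (card S) - 1) / 2" by simp
 show ?thesis unfolding 1 using 2 3 by (simp add: sum_subtractf)
qed

lemma HN_borel:
 assumes "A \<in> HN m S" "S \<subseteq> {..<m}" shows "A \<in> borel_subgroup m"
 using HN_upper[OF assms(1)] HN_D(1)[OF assms(1)] HN_det[OF assms] by (simp add: borel_subgroup_def GL_carrier)

text \<open>The elementary symmetric polynomial of degree \<open>k\<close> in
  \<open>\<alpha> 0, ..., \<alpha> (m - 1)\<close>.\<close>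

definition esym :: "nat => (nat => complex) => nat => complex"
 where "esym m \<alpha> k = (\<Sum>S\<in>{S. S \<subseteq> {..<m} \<and> card S = k}. \<Prod>i\<in>S. \<alpha> i)"

lemma HN_disjoint:
 assumes "A \<in> HN m S" "A \<in> HN m S'" "S \<subseteq> {..<m}" "S' \<subseteq> {..<m}" shows "S = S'"
 using HN_unique[OF assms(1,2) GL_int_one _ assms(3,4)] HN_D(1)[OF assms(1)] by simp

lemma sum_HNk:
 "(\<Sum>x\<in>HNk m k. f x) = (\<Sum>S\<in>{S. S \<subseteq> {..<m} \<and> card S = k}. \<Sum>x\<in>HN m S. f x)" (is "_ = sum _ ?I")
 unfolding HNk_def
proof (rule sum.UNION_disjoint)
 show "finite ?I" by (rule finite_subset[of _ "Pow {..<m}"]) auto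
 show "\<forall>S\<in>?I. \<forall>S'\<in>?I. S \<noteq> S' \<longrightarrow> HN m S \<inter> HN m S' = {}" using HN_disjoint by blast
qed (simp add: finite_HN)

text \<open>The spherical function is constant on the forms with diagonal \<open>l\<close> at
  \<open>S\<close>. The exponent from the modulus character and the number of free positions each
  depend on \<open>S\<close>, but their sum is \<open>k (m - k) / 2\<close> for every
  \<open>S\<close> with \<open>k\<close> elements, which leaves an elementary symmetric
  polynomial.\<close>

lemma sphf_eigenvalue:
 assumes \<mu>: "\<And>i. i < m ==> unramified_char (\<mu> i)" and k: "k \<le> m"
 shows "(\<Sum>x\<in>HNk m k. sphf m \<mu> x) = of_real (real l powr (real k * (real m - real k) / 2)) * esym m (\<lambda>i. \<mu> i lq) k"
proof -
 have "(\<Sum>x\<in>HN m S. sphf m \<mu> x) = of_real (real l powr (real k * (real m - real k) / 2)) * (\<Prod>i\<in>S. \<mu> i lq)"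
  if S: "S \<subseteq> {..<m}" "card S = k" for S
 proof -
  have val: "sphf m \<mu> x = (\<Prod>i\<in>S. \<mu> i lq) * of_real (real l powr (\<Sum>i\<in>S. - ((real m - 1 - 2 * real i) / 2)))"
   if x: "x \<in> HN m S" for x
  proof -
   have "sphf m \<mu> (x * 1\<^sub>m m) = bch m \<mu> x" by (rule sphf_eq[OF \<mu> HN_borel[OF x S(1)] GL_int_one])
   then have "sphf m \<mu> x = bch m \<mu> x" using HN_D(1)[OF x] by simp
   also have "\<dots> = (\<Prod>i<m. if i \<in> S then \<mu> i lq * of_real (real l powr (- ((real m - 1 - 2 * real i) / 2))) else 1)"
    unfolding bch_def
   proof (rule prod.cong)
    fix i assume "i \<in> {..<m}"
    then have i: "i < m" by simp
    have "(1 / real l) powr e = real l powr (- e)" for e using l_pos by (simp add: powr_divide powr_minus_divide)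
    then show "dch m \<mu> i (x $$ (i, i)) = (if i \<in> S then \<mu> i lq * of_real (real l powr (- ((real m - 1 - 2 * real i) / 2))) else 1)"
     using HN_D(2)[OF x i] unram(3)[OF \<mu>[OF i], of 1] i by (simp add: dch_def vn_l)
   qed simp
   also have "\<dots> = (\<Prod>i\<in>S. \<mu> i lq * of_real (real l powr (- ((real m - 1 - 2 * real i) / 2))))"
    using S(1) by (subst prod.If_cases) (auto simp: Int_absorb1)
   also have "\<dots> = (\<Prod>i\<in>S. \<mu> i lq) * of_real (\<Prod>i\<in>S. real l powr (- ((real m - 1 - 2 * real i) / 2)))"
    by (simp add: prod.distrib)
   also have "(\<Prod>i\<in>S. real l powr (- ((real m - 1 - 2 * real i) / 2))) = real l powr (\<Sum>i\<in>S. - ((real m - 1 - 2 * real i) / 2))"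
    using l_pos by (simp add: powr_sum)
   finally show ?thesis .
  qed
  have "(\<Sum>x\<in>HN m S. sphf m \<mu> x) = of_nat (l ^ card (HNpos m S)) * ((\<Prod>i\<in>S. \<mu> i lq) * of_real (real l powr (\<Sum>i\<in>S. - ((real m - 1 - 2 * real i) / 2))))"
   using val card_HN[of m S] by simp
  also have "\<dots> = of_real (real l powr real (card (HNpos m S)) * real l powr (\<Sum>i\<in>S. - ((real m - 1 - 2 * real i) / 2))) * (\<Prod>i\<in>S. \<mu> i lq)"
   using l_pos by (simp add: powr_realpow)
  also have "real l powr real (card (HNpos m S)) * real l powr (\<Sum>i\<in>S. - ((real m - 1 - 2 * real i) / 2)) =
   real l powr (real (card (HNpos m S)) + (\<Sum>i\<in>S. - ((real m - 1 - 2 * real i) / 2)))" by (simp add: powr_add)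
  also have "real (card (HNpos m S)) + (\<Sum>i\<in>S. - ((real m - 1 - 2 * real i) / 2)) =
   (\<Sum>i\<in>S. (real m - 1 - real i) + - ((real m - 1 - 2 * real i) / 2)) - real k * (real k - 1) / 2"
   unfolding card_HNpos[OF S(1)] S(2) by (simp only: sum.distrib)
  also have "(\<Sum>i\<in>S. (real m - 1 - real i) + - ((real m - 1 - 2 * real i) / 2)) = (\<Sum>i\<in>S. (real m - 1) / 2)"
   by (intro sum.cong) (auto simp: field_simps)
  also have "\<dots> = real k * (real m - 1) / 2" using S(2) by simp
  also have "real k * (real m - 1) / 2 - real k * (real k - 1) / 2 = real k * (real m - real k) / 2" by (simp add: field_simps)
  finally show ?thesis .
 qed
 then show ?thesis unfolding sum_HNk esym_def by (simp add: sum_distrib_left)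
qed

end

section \<open>Representations as Hecke modules\<close>

lemma fun_scale_vs: "vector_space (fun_scale :: complex => ('g => complex) => 'g => complex)"
 by unfold_locales (auto simp: fun_scale_def fun_eq_iff algebra_simps)

lemma fun_sum_apply: "(sum f A :: 'g => complex) x = (\<Sum>i\<in>A. f i x)"
 by (induction A rule: infinite_finite_induct) auto

lemma right_translate_add: "right_translate G g (f + h) = right_translate G g f + right_translate G g h"
 by (auto simp: right_translate_def fun_eq_iff)

lemma right_translate_scale: "right_translate G g (fun_scale c f) = fun_scale c (right_translate G g f)"
 by (auto simp: right_translate_def fun_scale_def fun_eq_iff)

lemma right_translate_mult:
 assumes "g \<in> GLc m" "h \<in> GLc m"
 shows "right_translate (GL m) (g * h) f = right_translate (GL m) g (right_translate (GL m) h f)"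
 using assms by (auto simp: right_translate_def fun_eq_iff GL_mult_closed GL_carrier_mat assoc_mult_mat[of _ m m _ m _ m])

lemma monic_poly_factorization:
 fixes p :: "complex poly"
 assumes "degree p = m" "lead_coeff p = 1"
 shows "\<exists>\<alpha>. p = (\<Prod>i<m. [:- \<alpha> i, 1:])"
 using assms
proof (induction m arbitrary: p)
 case 0
 then have "p = 1" by (metis degree_eq_zeroE lead_coeff_pCons(2) one_pCons)
 then show ?case by simp
next
 case (Suc m)
 then obtain z where "poly p z = 0"
  using fundamental_theorem_of_algebra[of p] by (metis constant_degree nat.distinct(1))
 then obtain q where q: "p = [:- z, 1:] * q" using poly_eq_0_iff_dvd by blast
 then have q0: "q \<noteq> 0" using Suc.prems by auto
 have "degree q = m" using Suc.prems(1) q0 unfolding q by (subst (asm) degree_mult_eq) auto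
 moreover have "lead_coeff q = 1" using Suc.prems(2) unfolding q lead_coeff_mult by simp
 ultimately obtain \<alpha> where \<alpha>: "q = (\<Prod>i<m. [:- \<alpha> i, 1:])" using Suc.IH by blast
 have "(\<Prod>i<m. [:- (\<alpha>(m := z)) i, 1:]) = (\<Prod>i<m. [:- \<alpha> i, 1:])" by (intro prod.cong) auto
 then have "p = (\<Prod>i<Suc m. [:- (\<alpha>(m := z)) i, 1:])" unfolding q \<alpha> by (simp add: mult.commute)
 then show ?case by blast
qed

lemma prod_pow_expand:
 fixes f :: "nat => 'b::comm_ring_1"
 shows "(\<Prod>i<m. f i + g) = (\<Sum>S\<in>Pow {..<m}. prod f S * g ^ (m - card S))"
proof -
 have "(\<Prod>i<m. f i + g) = (\<Sum>S\<in>Pow {..<m}. prod f S * (\<Prod>i\<in>{..<m} - S. g))" by (rule prod_add) simp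
 also have "\<dots> = (\<Sum>S\<in>Pow {..<m}. prod f S * g ^ (m - card S))"
 proof (rule sum.cong)
  fix S assume "S \<in> Pow {..<m}"
  then have "card ({..<m} - S) = m - card S" by (subst card_Diff_subset) (auto intro: finite_subset)
  then show "prod f S * (\<Prod>i\<in>{..<m} - S. g) = prod f S * g ^ (m - card S)" by simp
 qed simp
 finally show ?thesis .
qed

context padic_field
begin

text \<open>Vieta: the \<open>\<alpha> i\<close> are the roots of the monic polynomial that has the
  prescribed values, with alternating signs, as its coefficients.\<close>

lemma esym_prescribed: "\<exists>\<alpha>. \<forall>k\<in>{1..m}. esym m \<alpha> k = c k"
proof -
 define d where "d k = (if k = 0 then 1 else (-1) ^ k * c k)" for k
 define p where "p = (\<Sum>k\<le>m. monom (d k) (m - k))"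
 have co: "coeff p (m - k) = d k" if "k \<le> m" for k
 proof -
  have "coeff p (m - k) = (\<Sum>j\<le>m. if j = k then d j else 0)"
   unfolding p_def coeff_sum coeff_monom using that by (intro sum.cong) auto
  then show ?thesis using that by simp
 qed
 have "degree p \<le> m" unfolding p_def by (intro degree_sum_le) (auto intro: order_trans[OF degree_monom_le])
 moreover have "coeff p m = 1" using co[of 0] by (simp add: d_def)
 ultimately have deg: "degree p = m" "lead_coeff p = 1"
  by (metis le_antisym le_degree zero_neq_one)+
 obtain \<alpha> where \<alpha>: "p = (\<Prod>i<m. [:- \<alpha> i, 1:])" using monic_poly_factorization[OF deg] by blast
 have "p = (\<Prod>i<m. [:- \<alpha> i:] + monom 1 1)" unfolding \<alpha> by (intro prod.cong) (auto simp: monom_altdef)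
 also have "\<dots> = (\<Sum>S\<in>Pow {..<m}. (\<Prod>i\<in>S. [:- \<alpha> i:]) * monom 1 1 ^ (m - card S))" by (rule prod_pow_expand)
 also have "\<dots> = (\<Sum>S\<in>Pow {..<m}. monom (\<Prod>i\<in>S. - \<alpha> i) (m - card S))"
 proof (rule sum.cong)
  fix S assume "S \<in> Pow {..<m}"
  then have "finite S" using finite_subset by auto
  then have "(\<Prod>i\<in>S. [:- \<alpha> i:]) = [:\<Prod>i\<in>S. - \<alpha> i:]" by (induction S rule: finite_induct) (auto simp: one_pCons)
  then show "(\<Prod>i\<in>S. [:- \<alpha> i:]) * monom 1 1 ^ (m - card S) = monom (\<Prod>i\<in>S. - \<alpha> i) (m - card S)"
   by (simp add: monom_power smult_monom)
 qed simp
 finally have pe: "p = (\<Sum>S\<in>Pow {..<m}. monom (\<Prod>i\<in>S. - \<alpha> i) (m - card S))" .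
 have "esym m \<alpha> k = c k" if k: "k \<in> {1..m}" for k
 proof -
  have "d k = (\<Sum>S\<in>Pow {..<m}. if m - card S = m - k then \<Prod>i\<in>S. - \<alpha> i else 0)"
   using co[of k] k unfolding pe coeff_sum coeff_monom by simp
  also have "\<dots> = (\<Sum>S\<in>Pow {..<m}. if card S = k then (-1) ^ k * (\<Prod>i\<in>S. \<alpha> i) else 0)"
  proof (rule sum.cong)
   fix S assume "S \<in> Pow {..<m}"
   then have "card S \<le> m" using card_mono[of "{..<m}" S] by simp
   then show "(if m - card S = m - k then \<Prod>i\<in>S. - \<alpha> i else 0) = (if card S = k then (-1) ^ k * (\<Prod>i\<in>S. \<alpha> i) else 0)"
    using k by (auto simp: prod_uminus)
  qed simp
  also have "\<dots> = (\<Sum>S\<in>{S \<in> Pow {..<m}. card S = k}. (-1) ^ k * (\<Prod>i\<in>S. \<alpha> i))"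
   by (intro sum.mono_neutral_cong_right) auto
  also have "\<dots> = (-1) ^ k * esym m \<alpha> k" by (simp add: esym_def sum_distrib_left)
  finally have "(-1) ^ k * c k = (-1) ^ k * esym m \<alpha> k" using k by (simp add: d_def)
  then show ?thesis by simp
 qed
 then show ?thesis by blast
qed

lemma orbit_finite_of_smooth:
 assumes U: "open_subgroup (GL m) (GL_top m) U"
  and \<rho>: "\<And>k u. k \<in> KG m ==> u \<in> U ==> \<rho> (k * u) v = \<rho> k v"
 shows "finite ((\<lambda>k. \<rho> k v) ` KG m)"
proof -
 obtain F where F: "finite F" "F \<subseteq> KG m" "\<forall>x\<in>KG m. \<exists>k\<in>F. \<exists>u\<in>U. x = k * u"
  using open_subgroup_finite_index[OF U] by blast
 have "(\<lambda>k. \<rho> k v) ` KG m \<subseteq> (\<lambda>k. \<rho> k v) ` F"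
 proof
  fix y assume "y \<in> (\<lambda>k. \<rho> k v) ` KG m"
  then obtain x where x: "x \<in> KG m" "y = \<rho> x v" by blast
  then obtain k u where "k \<in> F" "u \<in> U" "x = k * u" using F(3) by blast
  then show "y \<in> (\<lambda>k. \<rho> k v) ` F" using \<rho>[of k u] F(2) x(2) by auto
 qed
 then show ?thesis using F(1) finite_subset by blast
qed

lemma open_subgroup_GL: "open_subgroup (GL m) (GL_top m) U ==> u \<in> U ==> u \<in> GLc m"
 using subgroup.mem_carrier[of U "GL m" u] by (simp add: open_subgroup_def)

lemma open_subgroup_Int:
 assumes "open_subgroup (GL m) (GL_top m :: 'a mat topology) U" "open_subgroup (GL m) (GL_top m) U'"
 shows "open_subgroup (GL m) (GL_top m) (U \<inter> U')"
 using assms group.subgroups_Inter_pair[OF GL_group, of U m U'] by (auto simp: open_subgroup_def)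

lemma mat_mult_bound:
 assumes A: "A \<in> carrier_mat m m"
 shows "\<exists>M\<ge>1. \<forall>Y\<in>carrier_mat m m. \<forall>r\<ge>0. (\<forall>i<m. \<forall>j<m. vn (Y $$ (i, j)) \<le> r) \<longrightarrow>
  (\<forall>i<m. \<forall>j<m. vn ((A * Y) $$ (i, j)) \<le> M * r \<and> vn ((Y * A) $$ (i, j)) \<le> M * r)"
proof -
 define M where "M = Max (insert 1 ((\<lambda>(i, j). vn (A $$ (i, j))) ` ({..<m} \<times> {..<m})))"
 have M1: "1 \<le> M" unfolding M_def by (intro Max_ge) auto
 have M: "vn (A $$ (i, j)) \<le> M" if "i < m" "j < m" for i j
  unfolding M_def using that by (intro Max_ge) auto
 have "vn ((A * Y) $$ (i, j)) \<le> M * r \<and> vn ((Y * A) $$ (i, j)) \<le> M * r"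
  if Y: "Y \<in> carrier_mat m m" "0 \<le> r" and Yr: "\<And>i j. i < m ==> j < m ==> vn (Y $$ (i, j)) \<le> r"
   and ij: "i < m" "j < m" for Y r i j
 proof
  have Mr: "0 \<le> M * r" using M1 Y(2) by simp
  have "vn (A $$ (i, p)) * vn (Y $$ (p, j)) \<le> M * r" if "p < m" for p
   using M[OF ij(1) that] Yr[OF that ij(2)] M1 by (intro mult_mono) auto
  then show "vn ((A * Y) $$ (i, j)) \<le> M * r" by (intro vn_mat_mult_le[OF A Y(1) ij Mr])
  have "vn (Y $$ (i, p)) * vn (A $$ (p, j)) \<le> r * M" if "p < m" for p
   using M[OF that ij(2)] Yr[OF ij(1) that] Y(2) by (intro mult_mono) auto
  then show "vn ((Y * A) $$ (i, j)) \<le> M * r"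
   by (intro vn_mat_mult_le[OF Y(1) A ij Mr]) (simp add: mult.commute)
 qed
 note b = this
 show ?thesis by (intro exI[of _ M] conjI[OF M1] ballI allI impI) (rule b, assumption, assumption, simp_all)
qed

text \<open>The translate by \<open>g\<close> of a function fixed by \<open>U\<close> is fixed by
  this conjugate of \<open>U\<close>, so smoothness is preserved by translation.\<close>

lemma open_subgroup_conj:
 assumes U: "open_subgroup (GL m) (GL_top m) U" and g: "g \<in> carrier (GL m :: 'a mat monoid)"
 shows "open_subgroup (GL m) (GL_top m) {x \<in> GLc m. minv m g * x * g \<in> U}" (is "open_subgroup _ _ ?U'")
proof -
 note gc = GL_carrier_mat[OF g] minv(4)[OF g]
 have sub: "subgroup U (GL m)" and op: "openin (GL_top m) U" using U by (auto simp: open_subgroup_def)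
 have "subgroup ?U' (GL m)"
 proof (rule group.subgroupI[OF GL_group])
  show "?U' \<subseteq> GLc m" by blast
  have "1\<^sub>m m \<in> ?U'" using subgroup.one_closed[OF sub] minv(3)[OF g] gc by (simp add: GL_one_closed)
  then show "?U' \<noteq> {}" by blast
 next
  fix a assume "a \<in> ?U'"
  then have a: "a \<in> GLc m" "minv m g * a * g \<in> U" by auto
  have "minv m (minv m g * a * g) = minv m g * minv m a * g"
   using a(1) g minv(1)[OF g] GL_carrier_mat minv(4)[OF a(1)] gc
   by (simp add: minv_mult GL_mult_closed minv_minv assoc_mult_mat[of _ m m _ m _ m])
  then show "minv m a \<in> ?U'" using subgroup.m_inv_closed[OF sub a(2)] minv(1)[OF a(1)] by simp
 next
  fix a b assume "a \<in> ?U'" "b \<in> ?U'"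
  then have ab: "a \<in> GLc m" "minv m g * a * g \<in> U" "b \<in> GLc m" "minv m g * b * g \<in> U" by auto
  note c = GL_carrier_mat[OF ab(1)] GL_carrier_mat[OF ab(3)]
  have "(minv m g * a * g) * (minv m g * b * g) = minv m g * a * (g * (minv m g * (b * g)))"
   using c gc by (simp add: assoc_mult_mat[of _ m m _ m _ m])
  also have "\<dots> = minv m g * (a * b) * g"
   using GL_cancel(2)[OF g, of "b * g" m] c gc by (simp add: assoc_mult_mat[of _ m m _ m _ m])
  finally show "a \<otimes>\<^bsub>GL m\<^esub> b \<in> ?U'"
   using subgroup.m_closed[OF sub ab(2,4)] GL_mult_closed[OF ab(1,3)] by simp
 qed
 moreover have "openin (GL_top m) ?U'"
 proof (rule GL_openI)
  fix x0 assume "x0 \<in> ?U'"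
  then have x0: "x0 \<in> GLc m" "minv m g * x0 * g \<in> U" by auto
  obtain e where e: "e > 0" "\<And>y. y \<in> GLc m ==> (\<forall>i<m. \<forall>j<m. vn (y $$ (i, j) - (minv m g * x0 * g) $$ (i, j)) < e) ==> y \<in> U"
   using GL_openD[OF op x0(2)] by blast
  obtain M where M: "M \<ge> 1" "\<forall>Y\<in>carrier_mat m m. \<forall>r\<ge>0. (\<forall>i<m. \<forall>j<m. vn (Y $$ (i, j)) \<le> r) \<longrightarrow>
   (\<forall>i<m. \<forall>j<m. vn ((minv m g * Y) $$ (i, j)) \<le> M * r \<and> vn ((Y * minv m g) $$ (i, j)) \<le> M * r)"
   using mat_mult_bound[OF gc(2)] by (elim exE conjE)
  obtain M' where M': "M' \<ge> 1" "\<forall>Y\<in>carrier_mat m m. \<forall>r\<ge>0. (\<forall>i<m. \<forall>j<m. vn (Y $$ (i, j)) \<le> r) \<longrightarrow>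
   (\<forall>i<m. \<forall>j<m. vn ((g * Y) $$ (i, j)) \<le> M' * r \<and> vn ((Y * g) $$ (i, j)) \<le> M' * r)"
   using mat_mult_bound[OF gc(1)] by (elim exE conjE)
  \<comment> \<open>Conjugation enlarges entries by at most \<open>M * M'\<close>; the factor 2
    turns the weak bounds into a strict one.\<close>
  define d where "d = e / (2 * M * M')"
  have d: "d > 0" using e(1) M(1) M'(1) by (simp add: d_def)
  have "x \<in> ?U'" if x: "x \<in> GLc m" "\<forall>i<m. \<forall>j<m. vn (x $$ (i, j) - x0 $$ (i, j)) < d" for x
  proof -
   note c = GL_carrier_mat[OF x(1)] GL_carrier_mat[OF x0(1)]
   have 0: "vn ((x - x0) $$ (i, j)) \<le> d" if "i < m" "j < m" for i j
    using x(2)[rule_format, OF that] that c by simp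
   have xc: "x - x0 \<in> carrier_mat m m" by (rule minus_carrier_mat[OF c(2)])
   have 1: "vn ((minv m g * (x - x0)) $$ (i, j)) \<le> M * d" if "i < m" "j < m" for i j
    using M(2)[rule_format, OF xc less_imp_le[OF d] 0 that] by simp
   have Md: "0 \<le> M * d" and mc: "minv m g * (x - x0) \<in> carrier_mat m m" using M(1) d xc gc by auto
   have 2: "vn ((minv m g * (x - x0) * g) $$ (i, j)) \<le> M' * (M * d)" if "i < m" "j < m" for i j
    using M'(2)[rule_format, OF mc Md 1 that] by simp
   have "minv m g * (x - x0) * g = minv m g * x * g - minv m g * x0 * g"
    using c gc by (simp add: mult_minus_distrib_mat[of _ m m] minus_mult_distrib_mat[of _ m m])
   then have "vn ((minv m g * x * g) $$ (i, j) - (minv m g * x0 * g) $$ (i, j)) < e" if "i < m" "j < m" for i j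
   proof -
    have "M' * (M * d) = e / 2" using M(1) M'(1) by (simp add: d_def field_simps)
    also have "\<dots> < e" using e(1) by simp
    finally have "M' * (M * d) < e" .
    then show ?thesis using 2[OF that] \<open>minv m g * (x - x0) * g = _\<close> that c gc by simp
   qed
   moreover have "minv m g * x * g \<in> GLc m" using x(1) g minv(1)[OF g] GL_mult_closed by blast
   ultimately show ?thesis using e(2) x(1) by blast
  qed
  then show "\<exists>e>0. \<forall>x\<in>GLc m. (\<forall>i<m. \<forall>j<m. vn (x $$ (i, j) - x0 $$ (i, j)) < e) \<longrightarrow> x \<in> ?U'" using d by blast
 qed blast
 ultimately show ?thesis by (simp add: open_subgroup_def)
qed

lemma smooth_ind_subspace: "module.subspace fun_scale (smooth_ind (GL m) (GL_top m :: 'a mat topology) S \<psi>)"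
proof -
 interpret vector_space "fun_scale :: complex => ('a mat => complex) => _" by (rule fun_scale_vs)
 show ?thesis
 proof (rule subspaceI)
  show "0 \<in> smooth_ind (GL m) (GL_top m) S \<psi>"
   using KG_open_subgroup[of m] by (auto simp: smooth_ind_def right_translate_def fun_eq_iff)
 next
  fix f h assume "f \<in> smooth_ind (GL m) (GL_top m) S \<psi>" "h \<in> smooth_ind (GL m) (GL_top m) S \<psi>"
  then have f: "\<forall>x. x \<notin> GLc m \<longrightarrow> f x = 0" "\<forall>s\<in>S. \<forall>x\<in>GLc m. f (s * x) = \<psi> s * f x"
    "\<exists>U. open_subgroup (GL m) (GL_top m) U \<and> (\<forall>u\<in>U. right_translate (GL m) u f = f)"
   and h: "\<forall>x. x \<notin> GLc m \<longrightarrow> h x = 0" "\<forall>s\<in>S. \<forall>x\<in>GLc m. h (s * x) = \<psi> s * h x"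
    "\<exists>U. open_subgroup (GL m) (GL_top m) U \<and> (\<forall>u\<in>U. right_translate (GL m) u h = h)"
   unfolding smooth_ind_def by auto
  obtain U U' where U: "open_subgroup (GL m) (GL_top m) U" "\<forall>u\<in>U. right_translate (GL m) u f = f"
   "open_subgroup (GL m) (GL_top m) U'" "\<forall>u\<in>U'. right_translate (GL m) u h = h" using f(3) h(3) by blast
  have "\<forall>u\<in>U \<inter> U'. right_translate (GL m) u (f + h) = f + h" using U by (simp add: right_translate_add)
  then have "\<exists>U. open_subgroup (GL m) (GL_top m) U \<and> (\<forall>u\<in>U. right_translate (GL m) u (f + h) = f + h)"
   using open_subgroup_Int[OF U(1,3)] by blast
  then show "f + h \<in> smooth_ind (GL m) (GL_top m) S \<psi>"
   unfolding smooth_ind_def using f(1,2) h(1,2) by (simp add: distrib_left)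
 next
  fix c f assume "f \<in> smooth_ind (GL m) (GL_top m) S \<psi>"
  then have f: "\<forall>x. x \<notin> GLc m \<longrightarrow> f x = 0" "\<forall>s\<in>S. \<forall>x\<in>GLc m. f (s * x) = \<psi> s * f x"
    "\<exists>U. open_subgroup (GL m) (GL_top m) U \<and> (\<forall>u\<in>U. right_translate (GL m) u f = f)"
   unfolding smooth_ind_def by auto
  have "\<exists>U. open_subgroup (GL m) (GL_top m) U \<and> (\<forall>u\<in>U. right_translate (GL m) u (fun_scale c f) = fun_scale c f)"
   using f(3) by (auto simp: right_translate_scale)
  then show "fun_scale c f \<in> smooth_ind (GL m) (GL_top m) S \<psi>"
   unfolding smooth_ind_def using f(1,2) by (simp add: fun_scale_def mult.left_commute)
 qed
qed

lemma smooth_ind_translate: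
 assumes f: "f \<in> smooth_ind (GL m) (GL_top m :: 'a mat topology) S \<psi>" and g: "g \<in> GLc m" and S: "S \<subseteq> GLc m"
 shows "right_translate (GL m) g f \<in> smooth_ind (GL m) (GL_top m) S \<psi>"
proof -
 have f1: "\<forall>x. x \<notin> GLc m \<longrightarrow> f x = 0" "\<forall>s\<in>S. \<forall>x\<in>GLc m. f (s * x) = \<psi> s * f x"
    "\<exists>U. open_subgroup (GL m) (GL_top m) U \<and> (\<forall>u\<in>U. right_translate (GL m) u f = f)"
   using f unfolding smooth_ind_def by auto
 obtain U where U: "open_subgroup (GL m) (GL_top m) U" "\<forall>u\<in>U. right_translate (GL m) u f = f" using f1(3) by blast
 let ?U' = "{x \<in> GLc m. minv m g * x * g \<in> U}"
 have "right_translate (GL m) u (right_translate (GL m) g f) = right_translate (GL m) g f" if "u \<in> ?U'" for u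
 proof -
  have u: "u \<in> GLc m" "minv m g * u * g \<in> U" using that by auto
  note c = GL_carrier_mat[OF u(1)] GL_carrier_mat[OF g] minv(4)[OF g]
  have "right_translate (GL m) u (right_translate (GL m) g f) = right_translate (GL m) (u * g) f"
   using right_translate_mult[OF u(1) g] by simp
  also have "u * g = g * (minv m g * (u * g))" using GL_cancel(2)[OF g, of "u * g" m] c by simp
  also have "minv m g * (u * g) = minv m g * u * g" using c by (simp add: assoc_mult_mat[of _ m m _ m _ m])
  finally show ?thesis using right_translate_mult[OF g open_subgroup_GL[OF U(1) u(2)]] U(2) u(2) by simp
 qed
 then have "\<exists>U. open_subgroup (GL m) (GL_top m) U \<and> (\<forall>u\<in>U. right_translate (GL m) u (right_translate (GL m) g f) = right_translate (GL m) g f)"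
  using open_subgroup_conj[OF U(1) g] by blast
 moreover have "right_translate (GL m) g f (s * x) = \<psi> s * right_translate (GL m) g f x" if s: "s \<in> S" and x: "x \<in> GLc m" for s x
 proof -
  have sG: "s \<in> GLc m" using S s by blast
  have "(s * x) * g = s * (x * g)" using GL_carrier_mat[OF sG] GL_carrier_mat[OF x] GL_carrier_mat[OF g] by (rule assoc_mult_mat)
  then show ?thesis using f1(2) s GL_mult_closed[OF x g] GL_mult_closed[OF sG x] x by (simp add: right_translate_def)
 qed
 ultimately show ?thesis unfolding smooth_ind_def by (simp add: right_translate_def)
qed

lemma translation_module:
 assumes W: "W \<subseteq> smooth_ind (GL m) (GL_top m :: 'a mat topology) S \<psi>" "module.subspace fun_scale W"
  and st: "\<And>g f. g \<in> GLc m ==> f \<in> W ==> right_translate (GL m) g f \<in> W"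
 shows "hecke_module l fun_scale m W (right_translate (GL m) :: 'a mat => ('a mat => complex) => _)"
proof (intro hecke_module.intro hecke_module_axioms.intro padic_field_axioms fun_scale_vs W(2) st)
 fix f assume f: "f \<in> W"
 then have "f \<in> smooth_ind (GL m) (GL_top m) S \<psi>" using W(1) by blast
 then have z: "\<forall>x. x \<notin> GLc m \<longrightarrow> f x = 0"
  and "\<exists>U. open_subgroup (GL m) (GL_top m) U \<and> (\<forall>u\<in>U. right_translate (GL m) u f = f)"
  by (auto simp: smooth_ind_def)
 then obtain U where U: "open_subgroup (GL m) (GL_top m) U" "\<forall>u\<in>U. right_translate (GL m) u f = f" by blast
 show "finite ((\<lambda>k. right_translate (GL m) k f) ` KG m)"
  using U(2) right_translate_mult[OF GL_int_GL open_subgroup_GL[OF U(1)]]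
  by (intro orbit_finite_of_smooth[OF U(1)]) simp
 show "right_translate (GL m) (1\<^sub>m m) f = f"
  using z by (auto simp: right_translate_def fun_eq_iff right_mult_one_mat[OF GL_carrier_mat])
qed (simp_all add: right_translate_add right_translate_scale right_translate_mult)

lemma rep_module:
 assumes rep: "group_rep smul (GL m) \<sigma>" and sm: "smooth_rep (GL m) (GL_top m :: 'a mat topology) \<sigma>"
 shows "hecke_module l smul m UNIV \<sigma>"
proof -
 have vs: "vector_space smul" and lin: "\<And>g. g \<in> GLc m ==> Vector_Spaces.linear smul smul (\<sigma> g)"
  and one: "\<And>v. \<sigma> (1\<^sub>m m) v = v"
  and mult: "\<And>g h v. g \<in> GLc m ==> h \<in> GLc m ==> \<sigma> (g * h) v = \<sigma> g (\<sigma> h v)"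
  using rep unfolding group_rep_def by auto
 interpret vector_space smul by (rule vs)
 show ?thesis
 proof (intro hecke_module.intro hecke_module_axioms.intro padic_field_axioms vs)
  fix v
  obtain U where U: "open_subgroup (GL m) (GL_top m) U" "v \<in> fixed_vectors \<sigma> U"
   using sm unfolding smooth_rep_def by blast
  show "finite ((\<lambda>k. \<sigma> k v) ` KG m)"
   using U(2) mult[OF GL_int_GL open_subgroup_GL[OF U(1)]]
   by (intro orbit_finite_of_smooth[OF U(1)]) (simp add: fixed_vectors_def)
 qed (auto simp: mult one module_hom.add[OF module_hom_linearI[OF lin]] module_hom.scale[OF module_hom_linearI[OF lin]])
qed

end

section \<open>Satake parameters\<close>

lemma fun_scale_apply: "fun_scale c f x = c * f x"
 by (simp add: fun_scale_def)

context padic_field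
begin

text \<open>A preimage of \<open>v\<close> in the principal series is averaged to a spherical
  preimage, which is a multiple of \<open>sphf m \<mu>\<close>, so \<open>v\<close> inherits the
  eigenvalues of that function. The lemma holds for every \<open>\<mu>\<close> that realises
  \<open>\<sigma>\<close> as a subquotient, hence for the one chosen in
  \<open>L_factor\<close>.\<close>

lemma satake_eigenvalue:
 fixes \<sigma> :: "'a mat => 'v::ab_group_add => 'v"
 assumes S: "hecke_module l smul m UNIV \<sigma>" and \<mu>: "\<And>i. i < m ==> unramified_char (\<mu> i)"
  and sub: "subquotient_of_principal_series m smul \<sigma> \<mu>"
  and v: "\<And>k. k \<in> KG m ==> \<sigma> k v = v"
 shows "(\<Sum>x\<in>HNk m k. \<sigma> x v) = smul (\<Sum>x\<in>HNk m k. sphf m \<mu> x) v"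
proof -
 let ?R = "right_translate (GL m :: 'a mat monoid)"
 obtain W \<Theta> where WT: "W \<subseteq> principal_series m \<mu> \<and> module.subspace fun_scale W \<and>
  (\<forall>g\<in>GLc m. ?R g ` W \<subseteq> W) \<and> Vector_Spaces.linear fun_scale smul \<Theta> \<and> \<Theta> ` W = UNIV \<and>
  (\<forall>g\<in>GLc m. \<forall>f\<in>W. \<Theta> (?R g f) = \<sigma> g (\<Theta> f))"
  using sub[unfolded subquotient_of_principal_series_def] by (elim exE)
 then have W: "W \<subseteq> principal_series m \<mu>" "module.subspace fun_scale W" and lin: "Vector_Spaces.linear fun_scale smul \<Theta>"
  and sur: "\<Theta> ` W = UNIV" by simp_all
 have W3: "?R g ` W \<subseteq> W" if "g \<in> GLc m" for g using WT that by simp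
 have eq: "\<Theta> (?R g f) = \<sigma> g (\<Theta> f)" if "g \<in> GLc m" "f \<in> W" for g f using WT that by simp
 interpret S: hecke_module Q l smul m UNIV \<sigma> by (rule S)
 interpret F: hecke_module Q l fun_scale m W ?R
 proof (rule translation_module[OF _ W(2)])
  show "W \<subseteq> smooth_ind (GL m) (GL_top m) (borel_subgroup m) (bch m \<mu>)" using W(1) unfolding principal_series_bch .
  show "?R g f \<in> W" if "g \<in> GLc m" "f \<in> W" for g f using W3[OF that(1)] that(2) by blast
 qed
 interpret \<Theta>: module_hom fun_scale smul \<Theta> by (rule module_hom_linearI[OF lin])
 obtain f where f: "f \<in> W" "v = \<Theta> f" using sur by blast
 define f0 where "f0 = F.avg f"
 have f0: "f0 \<in> F.VK" unfolding f0_def by (rule F.avg_VK[OF f(1)])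
 have f0W: "f0 \<in> W" using F.VK_V[OF f0] .
 \<comment> \<open>The map \<open>\<Theta>\<close> sends the orbit of \<open>f\<close> equivariantly
   onto the orbit of \<open>v\<close>, so it takes the average of \<open>f\<close> to the average of
   \<open>v\<close>, which is \<open>v\<close>.\<close>
 have "smul (1 / of_nat (card ((\<lambda>k. ?R k f) ` KG m))) (\<Sum>x\<in>(\<lambda>k. ?R k f) ` KG m. \<Theta> x) = S.avg v"
 proof (rule S.avg_cover[OF F.orbit_finite[OF f(1)], where T = ?R])
  show "?R c (?R k f) = ?R (c * k) f" if "c \<in> KG m" "k \<in> KG m" for c k
   using F.\<rho>_mult[OF GL_int_GL[OF that(1)] GL_int_GL[OF that(2)] f(1)] by simp
  show "\<Theta> (?R k f) = \<sigma> k v" if "k \<in> KG m" for k using eq[OF GL_int_GL[OF that] f(1)] f(2) by simp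
 qed simp
 moreover have "\<Theta> f0 = smul (1 / of_nat (card ((\<lambda>k. ?R k f) ` KG m))) (\<Sum>x\<in>(\<lambda>k. ?R k f) ` KG m. \<Theta> x)"
  unfolding f0_def F.avg_def by (simp add: \<Theta>.scale \<Theta>.sum)
 moreover have "S.avg v = v" by (rule S.avg_fixed) (simp add: S.VK_def v)
 ultimately have \<Theta>f0: "\<Theta> f0 = v" by simp
 have "f0 \<in> principal_series m \<mu>" using f0W W(1) by blast
 from spherical_line[OF \<mu> this F.VK_fix[OF f0]] have f0s: "f0 = fun_scale (f0 (1\<^sub>m m)) (sphf m \<mu>)" .
 have "(\<Sum>x\<in>HNk m k. ?R x f0) = fun_scale (\<Sum>x\<in>HNk m k. sphf m \<mu> x) f0"
 proof
  fix y
  show "(\<Sum>x\<in>HNk m k. ?R x f0) y = fun_scale (\<Sum>x\<in>HNk m k. sphf m \<mu> x) f0 y"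
  proof (cases "y \<in> GLc m")
   case True
   have fy: "f0 y = f0 (1\<^sub>m m) * sphf m \<mu> y" for y using f0s unfolding fun_scale_def by (rule fun_cong)
   have "(\<Sum>x\<in>HNk m k. ?R x f0) y = (\<Sum>x\<in>HNk m k. f0 (y * x))"
    using True by (simp add: fun_sum_apply right_translate_def)
   also have "\<dots> = f0 (1\<^sub>m m) * (\<Sum>x\<in>HNk m k. sphf m \<mu> (y * x))"
    unfolding sum_distrib_left by (rule sum.cong[OF refl fy])
   also have "\<dots> = (\<Sum>x\<in>HNk m k. sphf m \<mu> x) * f0 y" using sphf_eigen[OF \<mu> True, where k = k] fy[of y] by (simp add: mult.left_commute)
   finally show ?thesis by (simp add: fun_scale_def)
  next
   case False
   then have "f0 y = 0" using f0W W(1) unfolding principal_series_bch smooth_ind_def by auto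
   then show ?thesis using False by (simp add: fun_sum_apply right_translate_def fun_scale_def)
  qed
 qed
 then have "\<Theta> (\<Sum>x\<in>HNk m k. ?R x f0) = smul (\<Sum>x\<in>HNk m k. sphf m \<mu> x) v" using \<Theta>f0 by (simp add: \<Theta>.scale)
 moreover have "\<Theta> (\<Sum>x\<in>HNk m k. ?R x f0) = (\<Sum>x\<in>HNk m k. \<sigma> x v)"
  unfolding \<Theta>.sum using eq[OF HNk_GL f0W] \<Theta>f0 by (intro sum.cong) auto
 ultimately show ?thesis by simp
qed

lemma HNk_zero: "HNk m 0 = {1\<^sub>m m}"
proof -
 have "{S. S \<subseteq> {..<m} \<and> card S = 0} = {{}}" using finite_subset[of _ "{..<m}"] by auto
 then have "HNk m 0 = HN m {}" by (simp add: HNk_def)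
 also have "\<dots> = {1\<^sub>m m}"
 proof (intro equalityI subsetI)
  fix A assume A: "A \<in> HN m {}"
  have "A $$ (i, j) = (if i = j then 1 else 0)" if "i < m" "j < m" for i j
   using HN_D(2)[OF A, of i] HN_D(4)[OF A, of i j] that by auto
  then have "A = 1\<^sub>m m" using HN_D(1)[OF A] by (intro eq_matI) auto
  then show "A \<in> {1\<^sub>m m}" by simp
 next
  fix A assume "A \<in> {1\<^sub>m m :: 'a mat}"
  then show "A \<in> HN m {}" by (auto simp: HN_def)
 qed
 finally show ?thesis .
qed

text \<open>Otherwise the translates of \<open>w\<close> span the irreducible space, and the linear
  map \<open>avg\<close>, being 0 on all of them, would also be 0 at the spherical vector
  \<open>v\<close>, which it fixes.\<close>

lemma avg_translates_zero:
 fixes \<sigma> :: "'a mat => 'v::ab_group_add => 'v"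
 assumes S: "hecke_module l smul m UNIV \<sigma>" and irr: "irreducible_rep smul (GL m) \<sigma>"
  and v: "v \<noteq> 0" "v \<in> hecke_module.VK m UNIV \<sigma>"
  and w: "\<And>h. h \<in> GLc m ==> hecke_module.avg smul m \<sigma> (\<sigma> h w) = 0"
 shows "w = 0"
proof (rule ccontr)
 assume w0: "w \<noteq> 0"
 interpret S: hecke_module Q l smul m UNIV \<sigma> by (rule S)
 let ?X = "S.span ((\<lambda>h. \<sigma> h w) ` GLc m)"
 have st: "\<sigma> g x \<in> ?X" if g: "g \<in> GLc m" and x: "x \<in> ?X" for g x
  using x
 proof (induction x rule: S.span_induct)
  show "S.subspace {x. \<sigma> g x \<in> ?X}"
   by (rule S.subspaceI) (auto simp: S.\<rho>_0[OF g] S.\<rho>_add[OF g] S.\<rho>_smul[OF g] S.span_zero S.span_add S.span_scale)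
 next
  fix x assume "x \<in> (\<lambda>h. \<sigma> h w) ` GLc m"
  then obtain h where h: "h \<in> GLc m" "x = \<sigma> h w" by blast
  then have "\<sigma> g x = \<sigma> (g * h) w" using S.\<rho>_mult[OF g h(1)] by simp
  then show "\<sigma> g x \<in> ?X" using GL_mult_closed[OF g h(1)] by (auto intro: S.span_base)
 qed
 have "w \<in> ?X" using S.\<rho>_one[of w] GL_one_closed[of m] by (metis S.span_base image_eqI UNIV_I)
 then have "?X \<noteq> {0}" using w0 by blast
 moreover have "\<forall>g\<in>GLc m. \<sigma> g ` ?X \<subseteq> ?X" using st by blast
 ultimately have "?X = UNIV" using irr S.subspace_span unfolding irreducible_rep_def by blast
 then have "v \<in> ?X" by simp
 then have "S.avg v = 0"
 proof (induction v rule: S.span_induct)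
  show "S.subspace {x. S.avg x = 0}"
   using S.avg_smul[of 0 0] by (intro S.subspaceI) (auto simp: S.avg_add S.avg_smul)
 next
  fix x assume "x \<in> (\<lambda>h. \<sigma> h w) ` GLc m"
  then show "S.avg x = 0" using w by auto
 qed
 then show False using S.avg_fixed[OF v(2)] v(1) by simp
qed

text \<open>By uniqueness of spherical functions, the spherical matrix coefficient of \<open>\<sigma>\<close> is that of an
 unramified principal series with the same Hecke eigenvalues; hence the relations between the translates of the
 spherical vector of the principal series also hold in \<open>\<sigma>\<close>.\<close>

lemma spherical_subquotient:
 fixes \<sigma> :: "'a mat => 'v::ab_group_add => 'v"
 assumes S: "hecke_module l smul m UNIV \<sigma>" and irr: "irreducible_rep smul (GL m) \<sigma>"
  and v: "v \<noteq> 0" "v \<in> hecke_module.VK m UNIV \<sigma>"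
  and \<mu>: "\<And>i. i < m ==> unramified_char (\<mu> i)"
  and eig: "\<And>k. k \<le> m ==> (\<Sum>x\<in>HNk m k. \<sigma> x v) = smul (\<Sum>x\<in>HNk m k. sphf m \<mu> x) v"
 shows "subquotient_of_principal_series m smul \<sigma> \<mu>"
proof -
 let ?R = "right_translate (GL m :: 'a mat monoid)"
 let ?s = "sphf m \<mu>"
 let ?P = "smooth_ind (GL m) (GL_top m) (borel_subgroup m) (bch m \<mu>)"
 interpret S: hecke_module Q l smul m UNIV \<sigma> by (rule S)
 have BG: "borel_subgroup m \<subseteq> (GLc m :: 'a mat set)" using borelD(1) by blast
 interpret F: hecke_module Q l fun_scale m ?P ?R
  by (rule translation_module[OF order_refl smooth_ind_subspace smooth_ind_translate[OF _ _ BG]])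
 have sP: "?s \<in> ?P" using sphf_principal_series[OF \<mu>] unfolding principal_series_bch .
 have sV: "?s \<in> F.VK"
  unfolding F.VK_def using sP sphf_K[OF \<mu>] by (auto simp: right_translate_def fun_eq_iff) (auto simp: sphf_def)
 have RsP: "?R g ?s \<in> ?P" if "g \<in> GLc m" for g using F.\<rho>_closed[OF that sP] .
 \<comment> \<open>The spherical function of the principal series: projecting the translate by
   \<open>g\<close> of the spherical vector gives \<open>lam g\<close> times that vector.\<close>
 define lam where "lam g = F.avg (?R g ?s) (1\<^sub>m m)" for g
 have avg_lam: "F.avg (?R g ?s) = fun_scale (lam g) ?s" if "g \<in> GLc m" for g
 proof -
  have VK: "F.avg (?R g ?s) \<in> F.VK" using F.avg_VK[OF RsP[OF that]] .
  then have "F.avg (?R g ?s) \<in> principal_series m \<mu>" using F.VK_V unfolding principal_series_bch by blast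
  from spherical_line[OF \<mu> this F.VK_fix[OF VK]] show ?thesis by (simp add: lam_def)
 qed
 \<comment> \<open>Measures how far the spherical function of \<open>\<sigma>\<close> differs from
   \<open>lam\<close>. It is invariant on both sides, satisfies the common Hecke equations and is 0
   at the identity.\<close>
 define D where "D g = S.avg (\<sigma> g v) - smul (lam g) v" for g
 have eigF: "(\<Sum>x\<in>HNk m k. ?R x ?s) = fun_scale (\<Sum>x\<in>HNk m k. ?s x) ?s" for k
 proof
  fix y
  show "(\<Sum>x\<in>HNk m k. ?R x ?s) y = fun_scale (\<Sum>x\<in>HNk m k. ?s x) ?s y"
   using sphf_eigen[OF \<mu>, where y = y and k = k]
   by (cases "y \<in> GLc m") (simp_all add: fun_sum_apply right_translate_def fun_scale_def, simp add: sphf_def)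
 qed
 have D0: "D x = 0" if x: "x \<in> GLc m" for x
 proof (rule spherical_unique[OF S.vector_space_axioms, where c = "\<lambda>k. \<Sum>x\<in>HNk m k. ?s x" and m = m])
  fix x u :: "'a mat" assume x: "x \<in> GLc m" and u: "u \<in> KG m"
  note uG = GL_int_GL[OF u]
  have "?R (x * u) ?s = ?R x ?s" using F.\<rho>_mult[OF x uG sP] F.VK_fix[OF sV u] by simp
  moreover have "\<sigma> (x * u) v = \<sigma> x v" using S.\<rho>_mult[OF x uG, of v] S.VK_fix[OF v(2) u] by simp
  ultimately show "D (x * u) = D x" by (simp add: D_def lam_def)
  have "F.avg (?R (u * x) ?s) = F.avg (?R x ?s)" using F.\<rho>_mult[OF uG x sP] F.avg_translate[OF RsP[OF x] u] by simp
  moreover have "S.avg (\<sigma> (u * x) v) = S.avg (\<sigma> x v)" using S.\<rho>_mult[OF uG x, of v] S.avg_translate[OF _ u] by simp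
  ultimately show "D (u * x) = D x" by (simp add: D_def lam_def)
 next
  fix k and x :: "'a mat" assume k: "k \<le> m" and x: "x \<in> GLc m"
  let ?c = "\<Sum>y\<in>HNk m k. ?s y"
  have "(\<Sum>y\<in>HNk m k. S.avg (\<sigma> (x * y) v)) = S.avg (\<Sum>y\<in>HNk m k. \<sigma> (x * y) v)" by (simp add: S.avg_sum)
  also have "(\<Sum>y\<in>HNk m k. \<sigma> (x * y) v) = \<sigma> x (\<Sum>y\<in>HNk m k. \<sigma> y v)"
   using S.\<rho>_mult[OF x HNk_GL] by (simp add: S.\<rho>_sum[OF x])
  also have "S.avg \<dots> = smul ?c (S.avg (\<sigma> x v))" unfolding eig[OF k] by (simp add: S.\<rho>_smul[OF x] S.avg_smul)
  finally have 1: "(\<Sum>y\<in>HNk m k. S.avg (\<sigma> (x * y) v)) = smul ?c (S.avg (\<sigma> x v))" .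
  have "(\<Sum>y\<in>HNk m k. F.avg (?R (x * y) ?s)) = F.avg (\<Sum>y\<in>HNk m k. ?R (x * y) ?s)"
   by (rule F.avg_sum[symmetric]) (rule RsP[OF GL_mult_closed[OF x HNk_GL]])
  also have "(\<Sum>y\<in>HNk m k. ?R (x * y) ?s) = ?R x (\<Sum>y\<in>HNk m k. ?R y ?s)"
  proof -
   have "?R x (\<Sum>y\<in>HNk m k. ?R y ?s) = (\<Sum>y\<in>HNk m k. ?R x (?R y ?s))"
    by (rule F.\<rho>_sum[OF x]) (rule RsP[OF HNk_GL])
   then show ?thesis using F.\<rho>_mult[OF x HNk_GL sP] by simp
  qed
  also have "F.avg \<dots> = fun_scale ?c (F.avg (?R x ?s))"
   unfolding eigF F.\<rho>_smul[OF x sP] by (rule F.avg_smul[OF RsP[OF x]])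
  finally have eqn: "(\<Sum>y\<in>HNk m k. F.avg (?R (x * y) ?s)) = fun_scale ?c (F.avg (?R x ?s))" .
  have 2: "(\<Sum>y\<in>HNk m k. lam (x * y)) = ?c * lam x"
   using fun_cong[OF eqn, of "1\<^sub>m m"] unfolding fun_sum_apply fun_scale_apply lam_def .
  have "(\<Sum>y\<in>HNk m k. D (x * y)) = smul ?c (S.avg (\<sigma> x v)) - smul (?c * lam x) v"
   unfolding D_def sum_subtractf 1 S.scale_sum_left[symmetric] 2 ..
  then show "(\<Sum>y\<in>HNk m k. D (x * y)) = smul ?c (D x)" by (simp add: D_def S.scale_right_diff_distrib)
 next
  have "smul (\<Sum>x\<in>HNk m m. ?s x) v = \<sigma> (lq \<cdot>\<^sub>m 1\<^sub>m m) v" using eig[of m] by (simp add: HNk_top)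
  moreover have "\<sigma> (lq \<cdot>\<^sub>m 1\<^sub>m m) v \<noteq> 0"
  proof
   assume z: "\<sigma> (lq \<cdot>\<^sub>m 1\<^sub>m m) v = 0"
   let ?z = "lq \<cdot>\<^sub>m 1\<^sub>m m :: 'a mat"
   have "v = \<sigma> (minv m ?z * ?z) v" using minv(3)[OF smult_one_GL] S.\<rho>_one by simp
   also have "\<dots> = \<sigma> (minv m ?z) (\<sigma> ?z v)" using S.\<rho>_mult[OF minv(1)[OF smult_one_GL] smult_one_GL] by simp
   finally show False using z v(1) S.\<rho>_0[OF minv(1)[OF smult_one_GL]] by simp
  qed
  ultimately show "(\<Sum>x\<in>HNk m m. ?s x) \<noteq> 0" by auto
 next
  have "F.avg (?R (1\<^sub>m m) ?s) = ?s" using F.\<rho>_one[OF sP] F.avg_fixed[OF sV] by simp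
  then have "lam (1\<^sub>m m) = 1" by (simp add: lam_def sphf_one[OF \<mu>])
  then show "D (1\<^sub>m m) = 0" using S.\<rho>_one[of v] S.avg_fixed[OF v(2)] by (simp add: D_def)
 qed (rule x)
 then have avg_S: "S.avg (\<sigma> g v) = smul (lam g) v" if "g \<in> GLc m" for g using that by (simp add: D_def)
 \<comment> \<open>A relation between translates of \<open>sphf m \<mu>\<close> survives further
   translation by any \<open>h\<close> and averaging, so it becomes a relation between values of
   \<open>lam\<close>. The same values occur for \<open>\<sigma>\<close>, and
   \<open>avg_translates_zero\<close> turns them back into a relation between vectors.\<close>
 have key: "\<sigma> g v = (\<Sum>i\<in>I. smul (c i) (\<sigma> (\<gamma> i) v))"
  if I: "finite I" and g: "g \<in> GLc m" and \<gamma>: "\<And>i. i \<in> I ==> \<gamma> i \<in> GLc m"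
   and rel: "?R g ?s = (\<Sum>i\<in>I. fun_scale (c i) (?R (\<gamma> i) ?s))" for g :: "'a mat" and I :: "('a mat => complex) set" and c \<gamma>
 proof -
  have "\<sigma> g v - (\<Sum>i\<in>I. smul (c i) (\<sigma> (\<gamma> i) v)) = 0"
  proof (rule avg_translates_zero[OF S irr v])
   fix h :: "'a mat" assume h: "h \<in> GLc m"
   let ?w = "\<Sum>i\<in>I. smul (c i) (\<sigma> (\<gamma> i) v)"
   have "\<sigma> h (\<sigma> g v - ?w) = \<sigma> (h * g) v + smul (-1) (\<sigma> h ?w)"
    using S.\<rho>_add[OF h, of "\<sigma> g v" "smul (-1) ?w"] S.\<rho>_smul[OF h, of ?w "-1"] S.\<rho>_mult[OF h g, of v] by simp
   then have "S.avg (\<sigma> h (\<sigma> g v - ?w)) = S.avg (\<sigma> (h * g) v) - S.avg (\<sigma> h ?w)"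
    using S.avg_add[of "\<sigma> (h * g) v" "smul (-1) (\<sigma> h ?w)"] S.avg_smul[of "\<sigma> h ?w" "-1"] by simp
   also have "\<sigma> h ?w = (\<Sum>i\<in>I. smul (c i) (\<sigma> (h * \<gamma> i) v))"
    using S.\<rho>_mult[OF h \<gamma>] by (simp add: S.\<rho>_sum[OF h] S.\<rho>_smul[OF h])
   also have "S.avg \<dots> = smul (\<Sum>i\<in>I. c i * lam (h * \<gamma> i)) v"
    using avg_S[OF GL_mult_closed[OF h \<gamma>]] by (simp add: S.avg_sum S.avg_smul S.scale_sum_left)
   also have "(\<Sum>i\<in>I. c i * lam (h * \<gamma> i)) = lam (h * g)"
   proof -
    have "?R (h * g) ?s = ?R h (\<Sum>i\<in>I. fun_scale (c i) (?R (\<gamma> i) ?s))" using F.\<rho>_mult[OF h g sP] rel by simp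
    also have "\<dots> = (\<Sum>i\<in>I. ?R h (fun_scale (c i) (?R (\<gamma> i) ?s)))"
     by (rule F.\<rho>_sum[OF h]) (rule F.subspace_scale[OF F.V RsP[OF \<gamma>]])
    also have "\<dots> = (\<Sum>i\<in>I. fun_scale (c i) (?R (h * \<gamma> i) ?s))"
     by (intro sum.cong refl) (simp add: F.\<rho>_smul[OF h RsP[OF \<gamma>]] F.\<rho>_mult[OF h \<gamma> sP])
    finally have e: "?R (h * g) ?s = (\<Sum>i\<in>I. fun_scale (c i) (?R (h * \<gamma> i) ?s))" .
    have "F.avg (?R (h * g) ?s) = (\<Sum>i\<in>I. F.avg (fun_scale (c i) (?R (h * \<gamma> i) ?s)))"
     unfolding e by (rule F.avg_sum) (rule F.subspace_scale[OF F.V RsP[OF GL_mult_closed[OF h \<gamma>]]])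
    also have "\<dots> = (\<Sum>i\<in>I. fun_scale (c i) (F.avg (?R (h * \<gamma> i) ?s)))"
     by (intro sum.cong refl F.avg_smul RsP GL_mult_closed[OF h \<gamma>])
    finally have eqn: "F.avg (?R (h * g) ?s) = (\<Sum>i\<in>I. fun_scale (c i) (F.avg (?R (h * \<gamma> i) ?s)))" .
    show ?thesis using fun_cong[OF eqn, of "1\<^sub>m m"] unfolding fun_sum_apply fun_scale_apply lam_def by (rule sym)
   qed
   finally show "S.avg (\<sigma> h (\<sigma> g v - ?w)) = 0" using avg_S[OF GL_mult_closed[OF h g]] by simp
  qed
  then show ?thesis by simp
 qed
 define GS where "GS = (\<lambda>g. ?R g ?s) ` GLc m"
 define W where "W = F.span GS"
 \<comment> \<open>The intertwining map is prescribed on a basis consisting of translates and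
   extended linearly; \<open>key\<close> shows that it has the expected value on all the other
   translates.\<close>
 obtain B where B: "B \<subseteq> GS" "F.independent B" "GS \<subseteq> F.span B" by (rule F.maximal_independent_subset)
 have "\<exists>g\<in>GLc m. b = ?R g ?s" if "b \<in> B" for b using B(1) that by (auto simp: GS_def)
 then obtain \<gamma> where \<gamma>: "\<And>b. b \<in> B ==> \<gamma> b \<in> GLc m \<and> b = ?R (\<gamma> b) ?s" by metis
 interpret pair: vector_space_pair fun_scale smul by (rule vector_space_pair.intro[OF fun_scale_vs S.vector_space_axioms])
 obtain \<Theta> where \<Theta>: "Vector_Spaces.linear fun_scale smul \<Theta>" "\<forall>b\<in>B. \<Theta> b = \<sigma> (\<gamma> b) v"
  using pair.linear_independent_extend[OF B(2), of "\<lambda>b. \<sigma> (\<gamma> b) v"] by blast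
 interpret \<Theta>: module_hom fun_scale smul \<Theta> by (rule module_hom_linearI[OF \<Theta>(1)])
 have \<Theta>R: "\<Theta> (?R g ?s) = \<sigma> g v" if g: "g \<in> GLc m" for g
 proof -
  have "?R g ?s \<in> F.span B" using B(3) g by (auto simp: GS_def)
  then obtain t r where t: "finite t" "t \<subseteq> B" "?R g ?s = (\<Sum>b\<in>t. fun_scale (r b) b)" unfolding F.span_explicit by blast
  have tB: "b \<in> B" if "b \<in> t" for b using t(2) that by blast
  have "?R g ?s = (\<Sum>b\<in>t. fun_scale (r b) (?R (\<gamma> b) ?s))"
   unfolding t(3) by (intro sum.cong refl arg_cong[of _ _ "fun_scale _"] conjunct2[OF \<gamma>] tB)
  from key[OF t(1) g conjunct1[OF \<gamma>[OF tB]] this] have "\<sigma> g v = (\<Sum>b\<in>t. smul (r b) (\<sigma> (\<gamma> b) v))" .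
  also have "\<dots> = (\<Sum>b\<in>t. smul (r b) (\<Theta> b))" using \<Theta>(2) tB by (intro sum.cong) auto
  also have "\<dots> = \<Theta> (?R g ?s)" unfolding t(3) by (simp add: \<Theta>.sum \<Theta>.scale)
  finally show ?thesis by simp
 qed
 have GSP: "GS \<subseteq> ?P" unfolding GS_def using RsP by blast
 have WP: "W \<subseteq> ?P" unfolding W_def by (rule F.span_minimal[OF GSP F.V])
 have Wst: "?R g f \<in> W \<and> \<Theta> (?R g f) = \<sigma> g (\<Theta> f)" if g: "g \<in> GLc m" and f: "f \<in> W" for g f
  using f unfolding W_def
 proof (induction f rule: F.span_induct)
  have z: "?R g 0 = 0" by (auto simp: right_translate_def fun_eq_iff)
  show "F.subspace {f. ?R g f \<in> F.span GS \<and> \<Theta> (?R g f) = \<sigma> g (\<Theta> f)}"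
   by (rule F.subspaceI) (auto simp: z \<Theta>.zero S.\<rho>_0[OF g] F.span_zero right_translate_add F.span_add \<Theta>.add S.\<rho>_add[OF g]
    right_translate_scale F.span_scale \<Theta>.scale S.\<rho>_smul[OF g])
 next
  fix f assume "f \<in> GS"
  then obtain h where h: "h \<in> GLc m" "f = ?R h ?s" by (auto simp: GS_def)
  note gh = GL_mult_closed[OF g h(1)]
  have e: "?R g f = ?R (g * h) ?s" using F.\<rho>_mult[OF g h(1) sP] h(2) by simp
  have "?R g f \<in> GS" unfolding e GS_def using gh by blast
  moreover have "\<Theta> (?R g f) = \<sigma> g (\<Theta> f)"
  proof -
   have "\<Theta> (?R g f) = \<sigma> g (\<sigma> h v)" unfolding e using \<Theta>R[OF gh] S.\<rho>_mult[OF g h(1)] by simp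
   then show ?thesis unfolding h(2) using \<Theta>R[OF h(1)] by simp
  qed
  ultimately show "?R g f \<in> F.span GS \<and> \<Theta> (?R g f) = \<sigma> g (\<Theta> f)" using F.span_base by blast
 qed
 have Wsub: "F.subspace W" unfolding W_def by (rule F.subspace_span)
 have im: "\<Theta> ` W = UNIV"
 proof -
  have "S.subspace (\<Theta> ` W)"
  proof (rule S.subspaceI)
   show "0 \<in> \<Theta> ` W" using \<Theta>.zero F.subspace_0[OF Wsub] by (metis image_eqI)
   show "x + y \<in> \<Theta> ` W" if "x \<in> \<Theta> ` W" "y \<in> \<Theta> ` W" for x y
    using that F.subspace_add[OF Wsub] by (auto simp: \<Theta>.add[symmetric])
   show "smul c x \<in> \<Theta> ` W" if "x \<in> \<Theta> ` W" for c x
    using that F.subspace_scale[OF Wsub] by (auto simp: \<Theta>.scale[symmetric])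
  qed
  moreover have "\<forall>g\<in>GLc m. \<sigma> g ` (\<Theta> ` W) \<subseteq> \<Theta> ` W"
  proof (intro ballI subsetI)
   fix g y assume g: "g \<in> GLc m" and "y \<in> \<sigma> g ` (\<Theta> ` W)"
   then obtain f where f: "f \<in> W" "y = \<sigma> g (\<Theta> f)" by blast
   then show "y \<in> \<Theta> ` W" using Wst[OF g f(1)] by (metis image_eqI)
  qed
  moreover have "v \<in> \<Theta> ` W"
  proof (rule image_eqI)
   show "v = \<Theta> (?R (1\<^sub>m m) ?s)" using \<Theta>R[OF GL_one_closed] S.\<rho>_one[of v] by simp
   show "?R (1\<^sub>m m) ?s \<in> W" unfolding W_def GS_def using GL_one_closed[of m] by (intro F.span_base) blast
  qed
  then have "\<Theta> ` W \<noteq> {0}" using v(1) by blast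
  ultimately show ?thesis using irr unfolding irreducible_rep_def by blast
 qed
 show ?thesis
  unfolding subquotient_of_principal_series_def principal_series_bch
  using WP Wsub \<Theta>(1) im Wst by (intro exI[of _ W] exI[of _ \<Theta>]) auto
qed

text \<open>A common eigenvector supplies the numbers \<open>c k\<close>. The parameters
  \<open>\<alpha> i\<close> are chosen with elementary symmetric polynomials
  \<open>c k / q k\<close>, as \<open>sphf_eigenvalue\<close> dictates; they are nonzero because the
  scalar \<open>l\<close> acts invertibly, so they are the values at \<open>l\<close> of unramified
  characters.\<close>

lemma satake_exists:
 fixes \<sigma> :: "'a mat => 'v::ab_group_add => 'v"
 assumes S: "hecke_module l smul m UNIV \<sigma>" and irr: "irreducible_rep smul (GL m) \<sigma>"
  and adm: "admissible_rep smul (GL m) (GL_top m :: 'a mat topology) \<sigma>" and unr: "unramified_rep m \<sigma>"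
 shows "\<exists>\<mu>. (\<forall>i<m. unramified_char (\<mu> i)) \<and> subquotient_of_principal_series m smul \<sigma> \<mu>"
proof -
 interpret S: hecke_module Q l smul m UNIV \<sigma> by (rule S)
 have VK: "S.VK = fixed_vectors \<sigma> (KG m)" by (auto simp: S.VK_def fixed_vectors_def)
 obtain v0 where v0: "v0 \<in> S.VK" "v0 \<noteq> 0" using unr unfolding unramified_rep_def VK by blast
 obtain B where B: "finite B" "S.VK \<subseteq> S.span B"
  using adm KG_open_subgroup KG_compact unfolding admissible_rep_def VK by blast
 obtain c v where v: "v \<in> S.VK" "v \<noteq> 0" and cv: "\<forall>k<Suc m. S.hecke_T k v = smul (c k) v"
  using S.common_eigenvector[OF B v0] by blast
 have ev: "(\<Sum>x\<in>HNk m k. \<sigma> x v) = smul (c k) v" if "k \<le> m" for k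
  using cv that by (simp add: S.hecke_T_def less_Suc_eq_le)
 \<comment> \<open>Degree 0 is outside the range of \<open>esym_prescribed\<close>; there both sides
   are 1.\<close>
 have "smul (c 0) v = smul 1 v" using ev[of 0] S.\<rho>_one[of v] by (simp add: HNk_zero)
 then have c0: "c 0 = 1" using v(2) by (metis S.scale_right_imp_eq)
 have cm: "c m \<noteq> 0"
 proof
  let ?z = "lq \<cdot>\<^sub>m 1\<^sub>m m :: 'a mat"
  assume "c m = 0"
  then have z: "\<sigma> ?z v = 0" using ev[of m] by (simp add: HNk_top)
  have "v = \<sigma> (minv m ?z * ?z) v" using minv(3)[OF smult_one_GL] S.\<rho>_one by simp
  also have "\<dots> = \<sigma> (minv m ?z) (\<sigma> ?z v)" using S.\<rho>_mult[OF minv(1)[OF smult_one_GL] smult_one_GL] by simp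
  finally show False using z v(2) S.\<rho>_0[OF minv(1)[OF smult_one_GL]] by simp
 qed
 define q where "q k = complex_of_real (real l powr (real k * (real m - real k) / 2))" for k
 have q: "q k \<noteq> 0" for k using l_pos by (simp add: q_def)
 obtain \<alpha> where \<alpha>: "\<forall>k\<in>{1..m}. esym m \<alpha> k = c k / q k" using esym_prescribed[of m "\<lambda>k. c k / q k"] by blast
 have e0: "esym m \<alpha> 0 = 1"
 proof -
  have "{S. S \<subseteq> {..<m} \<and> card S = 0} = {{}}" using finite_subset[of _ "{..<m}"] by auto
  then show ?thesis by (simp add: esym_def)
 qed
 have \<alpha>0: "\<alpha> i \<noteq> 0" if "i < m" for i
 proof -
  have "{S. S \<subseteq> {..<m} \<and> card S = m} = {{..<m}}" using card_subset_eq[of "{..<m}"] by auto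
  then have "esym m \<alpha> m = (\<Prod>i<m. \<alpha> i)" by (simp add: esym_def)
  moreover have "esym m \<alpha> m = c m / q m" using \<alpha> that by simp
  ultimately have "(\<Prod>i<m. \<alpha> i) \<noteq> 0" using cm q[of m] by (metis divide_eq_0_iff)
  then show ?thesis using that by auto
 qed
 define \<mu> where "\<mu> i x = (if x = 0 then 0 else \<alpha> i powi uval x)" for i and x :: 'a
 have \<mu>: "unramified_char (\<mu> i)" if "i < m" for i
  unfolding \<mu>_def[abs_def] by (rule unram_charI[OF \<alpha>0[OF that]])
 have es: "esym m (\<lambda>i. \<mu> i lq) k = esym m \<alpha> k" for k by (simp add: \<mu>_def uval_l)
 have lamk: "(\<Sum>x\<in>HNk m k. sphf m \<mu> x) = c k" if "k \<le> m" for k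
 proof -
  have "(\<Sum>x\<in>HNk m k. sphf m \<mu> x) = q k * esym m \<alpha> k" using sphf_eigenvalue[OF \<mu> that] es by (simp add: q_def)
  then show ?thesis using \<alpha> that q[of k] c0 e0 l_pos by (cases "k = 0") (auto simp: q_def)
 qed
 have "subquotient_of_principal_series m smul \<sigma> \<mu>"
  by (rule spherical_subquotient[OF S irr v(2,1) \<mu>]) (simp_all add: lamk ev)
 then show ?thesis using \<mu> by blast
qed

end

section \<open>Matrices of given rank modulo \<open>l\<close>\<close>

lemma sum_Pow_Suc:
 "(\<Sum>S\<in>Pow {..<Suc k}. f S) = (\<Sum>S\<in>Pow {..<k}. f S + f (insert k S))"
proof -
 have "Pow {..<Suc k} = Pow {..<k} \<union> insert k ` Pow {..<k}" by (simp add: lessThan_Suc Pow_insert)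
 moreover have "Pow {..<k} \<inter> insert k ` Pow {..<k} = {}" by auto
 ultimately have "(\<Sum>S\<in>Pow {..<Suc k}. f S) = (\<Sum>S\<in>Pow {..<k}. f S) + (\<Sum>S\<in>insert k ` Pow {..<k}. f S)"
  by (simp add: sum.union_disjoint)
 also have "(\<Sum>S\<in>insert k ` Pow {..<k}. f S) = (\<Sum>S\<in>Pow {..<k}. f (insert k S))"
  by (subst sum.reindex) (auto intro!: inj_onI)
 finally show ?thesis by (simp add: sum.distrib)
qed

context padic_field
begin

definition Xr :: "nat => nat => 'a mat"
 where "Xr n r = Matrix.mat n n (\<lambda>(i, j). if i = j \<and> i < r then 1 else 0)"

lemma Xr_int: "Xr n r \<in> int_mat n" by (auto simp: Xr_def int_mat_def)

text \<open>The rank of the reduction modulo \<open>l\<close>, expressed by its normal form, so that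
  the matrices \<open>Xr n r\<close> from \<open>g_elt\<close> appear directly. Its uniqueness comes
  later, from counting the row space.\<close>

definition has_rank :: "nat => 'a mat => nat => bool"
 where "has_rank n C r \<longleftrightarrow> r \<le> n \<and> (\<exists>P\<in>KG n. \<exists>B\<in>KG n. cong_mat n C (P * Xr n r * B))"

text \<open>In the Smith form the elementary divisors that are units come first and are equal to 1,
  and all others are congruent to 0.\<close>

lemma has_rank_ex:
 assumes C: "C \<in> int_mat n" shows "\<exists>r. has_rank n C r"
proof -
 note Cc = int_mat_carrier[OF C]
 obtain d where d: "K_equiv n C (mat_diag n d)" "\<forall>i j. i \<le> j \<and> j < n \<longrightarrow> vn (d j) \<le> vn (d i)"
  "\<forall>i<n. d i = 0 \<or> (\<exists>k. d i = of_nat l powi k)" using smith[OF Cc] by blast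
 obtain P B where PQ: "P \<in> KG n" "B \<in> KG n" "mat_diag n d = P * C * B" using d(1) by (auto simp: K_equiv_def)
 note cs = GL_int_carrier[OF PQ(1)] GL_int_carrier[OF PQ(2)]
 have le: "vn (d i) \<le> 1" if "i < n" for i
  using K_equiv_bound[OF Cc d(1), of 1 i i] C that by (auto simp: int_mat_def mat_diag_def)
 define T where "T = {i. i < n \<and> vn (d i) = 1}"
 define r where "r = card T"
 have down: "i \<in> T" if "j \<in> T" "i \<le> j" for i j
  using that d(2)[rule_format, of i j] le[of i] by (auto simp: T_def)
 have T: "T = {..<r}"
 proof -
  have "finite T" by (simp add: T_def)
  show ?thesis
  proof (cases "T = {}")
   case False
   have M: "Max T \<in> T" using \<open>finite T\<close> False by simp
   have "T = {..Max T}" using down[OF M] \<open>finite T\<close> by auto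
   then have "T = {..<Suc (Max T)}" by (simp add: lessThan_Suc_atMost)
   then show ?thesis unfolding r_def by (metis card_lessThan)
  qed (simp add: r_def)
 qed
 have rn: "r \<le> n" unfolding r_def T_def using card_mono[of "{..<n}" "{i. i < n \<and> vn (d i) = 1}"] by auto
 have d1: "d i = 1" if "i < r" for i
 proof -
  have i: "i < n" "vn (d i) = 1" using that T by (auto simp: T_def)
  then obtain k where k: "d i = lq powi k" using d(3) by force
  have "real l powi (- k) = real l powi 0" using i(2) unfolding k vn_l_powi by simp
  then have "k = 0" using powi_l_inj by fastforce
  then show ?thesis using k by simp
 qed
 have d0: "cong_l (d i) 0" if "r \<le> i" "i < n" for i
 proof -
  have "i \<notin> T" using T that by auto
  then show ?thesis using le[OF that(2)] that(2) by (simp add: T_def cong_l_def less_le)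
 qed
 have c: "cong_mat n (mat_diag n d) (Xr n r)"
  unfolding cong_mat_def
 proof (intro allI impI)
  fix i j assume "i < n" "j < n"
  then show "cong_l (mat_diag n d $$ (i, j)) (Xr n r $$ (i, j))"
   using d1[of i] d0[of i] by (cases "i < r") (auto simp: mat_diag_def Xr_def)
 qed
 let ?P = "minv n P" and ?B = "minv n B"
 note K = GL_int_minv[OF PQ(1)] GL_int_minv[OF PQ(2)]
 note Kc = GL_int_carrier[OF K(1)] GL_int_carrier[OF K(2)]
 have dint: "mat_diag n d \<in> int_mat n" unfolding PQ(3) by (intro int_mat_mult GL_int_int PQ(1,2) C)
 have "?P * (mat_diag n d * ?B) = ?P * (P * C)"
  unfolding PQ(3) using GL_cancel_right(1)[OF GL_int_GL[OF PQ(2)], of "P * C" n] Cc cs by simp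
 then have Ceq: "C = ?P * (mat_diag n d * ?B)" using GL_cancel(1)[OF GL_int_GL[OF PQ(1)] Cc] by simp
 have c2: "cong_mat n (mat_diag n d * ?B) (Xr n r * ?B)"
  by (rule cong_mat_mult[OF c cong_mat_refl Xr_int GL_int_int[OF K(2)] int_mat_carrier[OF dint] Kc(2)])
 have "cong_mat n (?P * (mat_diag n d * ?B)) (?P * (Xr n r * ?B))"
  using Kc int_mat_carrier[OF Xr_int, of n r]
  by (intro cong_mat_mult[OF cong_mat_refl c2 GL_int_int[OF K(1)] int_mat_mult[OF dint GL_int_int[OF K(2)]]]) auto
 moreover have "?P * (Xr n r * ?B) = ?P * Xr n r * ?B"
  using Kc int_mat_carrier[OF Xr_int, of n r] by (simp add: assoc_mult_mat[of _ n n _ n _ n])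
 ultimately have "cong_mat n C (?P * Xr n r * ?B)" using Ceq by simp
 then show ?thesis unfolding has_rank_def using K rn by blast
qed

section \<open>The row space modulo \<open>l\<close> and the uniqueness of the rank\<close>

abbreviation dvec :: "nat => (nat => 'a) set" where "dvec n \<equiv> PiE {..<n} (\<lambda>_. digits)"

text \<open>The row space modulo \<open>l\<close>, with vectors given by their digits.\<close>

definition rs :: "nat => 'a mat => (nat => 'a) set"
 where "rs n C = {x \<in> dvec n. \<exists>y. (\<forall>i<n. vn (y i) \<le> 1) \<and>
  (\<forall>j<n. cong_l (x j) (\<Sum>i<n. y i * C $$ (i, j)))}"

lemma rs_I:
 assumes "x \<in> dvec n" "\<And>i. i < n ==> vn (y i) \<le> 1"
  "\<And>j. j < n ==> cong_l (x j) (\<Sum>i<n. y i * C $$ (i, j))"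
 shows "x \<in> rs n C"
 using assms by (auto simp: rs_def)

lemma finite_rs: "finite (rs n C)"
 by (rule finite_subset[of _ "dvec n"]) (auto simp: rs_def intro!: finite_PiE)

lemma vn_comb: "C \<in> int_mat n ==> (\<And>i. i < n ==> vn (y i) \<le> 1) ==> j < n ==> vn (\<Sum>i<n. y i * C $$ (i, j)) \<le> 1"
 by (intro vn_sum_le) (auto simp: vn_mult int_mat_def intro!: mult_le_one)

lemma res_vec_rs:
 assumes C: "C \<in> int_mat n" and y: "\<And>i. i < n ==> vn (y i) \<le> 1"
 shows "restrict (\<lambda>j. res (\<Sum>i<n. y i * C $$ (i, j))) {..<n} \<in> rs n C"
proof (rule rs_I[where y = y])
 show "restrict (\<lambda>j. res (\<Sum>i<n. y i * C $$ (i, j))) {..<n} \<in> dvec n"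
  using res(1)[OF vn_comb[OF C y]] by auto
 show "cong_l (restrict (\<lambda>j. res (\<Sum>i<n. y i * C $$ (i, j))) {..<n} j) (\<Sum>i<n. y i * C $$ (i, j))" if "j < n" for j
  using cong_l_sym[OF res(2)[OF vn_comb[OF C y that]]] that by simp
qed (rule y)

lemma rs_cong_le:
 assumes "cong_mat n C C'" "C \<in> int_mat n" shows "rs n C \<subseteq> rs n C'"
proof
 fix x assume "x \<in> rs n C"
 then obtain y where y: "x \<in> dvec n" "\<And>i. i < n ==> vn (y i) \<le> 1"
  "\<And>j. j < n ==> cong_l (x j) (\<Sum>i<n. y i * C $$ (i, j))" by (auto simp: rs_def)
 show "x \<in> rs n C'"
 proof (rule rs_I[OF y(1,2)])
  fix j assume j: "j < n"
  have "cong_l (\<Sum>i<n. y i * C $$ (i, j)) (\<Sum>i<n. y i * C' $$ (i, j))"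
   using assms y(2) j by (intro cong_l_sum cong_l_mult) (auto simp: cong_mat_def int_mat_def)
  then show "cong_l (x j) (\<Sum>i<n. y i * C' $$ (i, j))" using y(3)[OF j] cong_l_trans by blast
 qed
qed

lemma rs_cong:
 assumes "cong_mat n C C'" "C \<in> int_mat n" "C' \<in> int_mat n" shows "rs n C = rs n C'"
 using rs_cong_le[OF assms(1,2)] rs_cong_le[OF cong_mat_sym[OF assms(1)] assms(3)] by blast

lemma comb_mult:
 assumes "P \<in> carrier_mat n n" "C \<in> carrier_mat n n" "j < n"
 shows "(\<Sum>i<n. y i * (P * C) $$ (i, j)) = (\<Sum>p<n. (\<Sum>i<n. y i * P $$ (i, p)) * C $$ (p, j))"
proof -
 have "(\<Sum>i<n. y i * (P * C) $$ (i, j)) = (\<Sum>i<n. \<Sum>p<n. y i * P $$ (i, p) * C $$ (p, j))"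
  using assms mat_mult_index[OF assms(1,2) _ assms(3)] by (intro sum.cong) (auto simp: sum_distrib_left mult.assoc)
 also have "\<dots> = (\<Sum>p<n. \<Sum>i<n. y i * P $$ (i, p) * C $$ (p, j))" by (rule sum.swap)
 finally show ?thesis by (simp add: sum_distrib_right)
qed

lemma rs_left_le:
 assumes P: "P \<in> int_mat n" and C: "C \<in> int_mat n" shows "rs n (P * C) \<subseteq> rs n C"
proof
 fix x assume "x \<in> rs n (P * C)"
 then obtain y where y: "x \<in> dvec n" "\<And>i. i < n ==> vn (y i) \<le> 1"
  "\<And>j. j < n ==> cong_l (x j) (\<Sum>i<n. y i * (P * C) $$ (i, j))" by (auto simp: rs_def)
 show "x \<in> rs n C"
 proof (rule rs_I[OF y(1)])
  show "vn (\<Sum>i<n. y i * P $$ (i, p)) \<le> 1" if "p < n" for p by (rule vn_comb[OF P y(2) that])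
  show "cong_l (x j) (\<Sum>p<n. (\<Sum>i<n. y i * P $$ (i, p)) * C $$ (p, j))" if "j < n" for j
   using y(3)[OF that] comb_mult[OF int_mat_carrier[OF P] int_mat_carrier[OF C] that, of y] by simp
 qed
qed

lemma rs_left:
 assumes P: "P \<in> KG n" and C: "C \<in> int_mat n" shows "rs n (P * C) = rs n C"
proof
 have "rs n (minv n P * (P * C)) \<subseteq> rs n (P * C)"
  by (intro rs_left_le GL_int_int GL_int_minv P int_mat_mult C)
 then show "rs n C \<subseteq> rs n (P * C)" using GL_cancel(1)[OF GL_int_GL[OF P] int_mat_carrier[OF C]] by simp
qed (rule rs_left_le[OF GL_int_int[OF P] C])

text \<open>Multiplying row vectors by \<open>B\<close> and taking digits maps one row space into
  the other; multiplying back by the inverse of \<open>B\<close> shows that nothing is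
  identified.\<close>

lemma card_rs_right_le:
 assumes B: "B \<in> KG n" and C: "C \<in> int_mat n" shows "card (rs n C) \<le> card (rs n (C * B))"
proof (rule card_inj_on_le)
 note Qi = GL_int_int[OF B] and Qc = GL_int_carrier[OF B]
 let ?f = "\<lambda>x. restrict (\<lambda>j. res (\<Sum>p<n. x p * B $$ (p, j))) {..<n}"
 have xi: "vn (x i) \<le> 1" if "x \<in> dvec n" "i < n" for x i
  using that digits_vn[of "x i"] by (auto simp: PiE_iff)
 show "?f ` rs n C \<subseteq> rs n (C * B)"
 proof clarify
  fix x assume "x \<in> rs n C"
  then obtain y where y: "x \<in> dvec n" "\<And>i. i < n ==> vn (y i) \<le> 1"
   "\<And>j. j < n ==> cong_l (x j) (\<Sum>i<n. y i * C $$ (i, j))" by (auto simp: rs_def)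
  have v: "vn (\<Sum>p<n. x p * B $$ (p, j)) \<le> 1" if "j < n" for j by (rule vn_comb[OF Qi xi[OF y(1)] that])
  show "?f x \<in> rs n (C * B)"
  proof (rule rs_I[OF _ y(2)])
   show "?f x \<in> dvec n" using res(1)[OF v] by auto
   fix j assume j: "j < n"
   have "cong_l (\<Sum>p<n. x p * B $$ (p, j)) (\<Sum>p<n. (\<Sum>i<n. y i * C $$ (i, p)) * B $$ (p, j))"
    using y(3) vn_comb[OF C y(2)] Qi j by (intro cong_l_sum cong_l_mult) (auto simp: int_mat_def)
   also have "(\<Sum>p<n. (\<Sum>i<n. y i * C $$ (i, p)) * B $$ (p, j)) = (\<Sum>i<n. y i * (C * B) $$ (i, j))"
    using comb_mult[OF int_mat_carrier[OF C] Qc j] by simp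
   finally show "cong_l (?f x j) (\<Sum>i<n. y i * (C * B) $$ (i, j))"
    using cong_l_trans[OF cong_l_sym[OF res(2)[OF v[OF j]]]] j by simp
  qed
 qed
 show "inj_on ?f (rs n C)"
 proof (rule inj_onI)
  fix x x' assume x: "x \<in> rs n C" "x' \<in> rs n C" and e: "?f x = ?f x'"
  have xd: "x \<in> dvec n" "x' \<in> dvec n" using x by (auto simp: rs_def)
  have c: "cong_l (\<Sum>p<n. x p * B $$ (p, j)) (\<Sum>p<n. x' p * B $$ (p, j))" if "j < n" for j
  proof -
   have "res (\<Sum>p<n. x p * B $$ (p, j)) = res (\<Sum>p<n. x' p * B $$ (p, j))" using fun_cong[OF e, of j] that by simp
   moreover have "vn (\<Sum>p<n. x p * B $$ (p, j)) \<le> 1" "vn (\<Sum>p<n. x' p * B $$ (p, j)) \<le> 1"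
    by (rule vn_comb[OF Qi _ that], rule xi, rule xd, assumption)+
   ultimately show ?thesis using res_eq_iff[of "\<Sum>p<n. x p * B $$ (p, j)" "\<Sum>p<n. x' p * B $$ (p, j)"] by simp
  qed
  have cv: "vn (\<Sum>p<n. x' p * B $$ (p, j)) \<le> 1" if "j < n" for j
   by (rule vn_comb[OF Qi _ that], rule xi, rule xd)
  let ?Bi = "minv n B"
  note B'i = GL_int_int[OF GL_int_minv[OF B]] and B'c = GL_int_carrier[OF GL_int_minv[OF B]]
  have undo: "(\<Sum>p<n. (\<Sum>i<n. z i * B $$ (i, p)) * ?Bi $$ (p, j)) = z j" if j: "j < n" for z j
  proof -
   have "(\<Sum>p<n. (\<Sum>i<n. z i * B $$ (i, p)) * ?Bi $$ (p, j)) = (\<Sum>i<n. z i * (B * ?Bi) $$ (i, j))"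
    using comb_mult[OF Qc B'c j] by simp
   also have "\<dots> = (\<Sum>i<n. if i = j then z i else 0)"
    unfolding minv(2)[OF GL_int_GL[OF B]] using j by (intro sum.cong) auto
   finally show ?thesis using j by simp
  qed
  show "x = x'"
  proof (rule PiE_ext[OF xd])
   fix j assume "j \<in> {..<n}"
   then have j: "j < n" by simp
   have "cong_l (\<Sum>p<n. (\<Sum>i<n. x i * B $$ (i, p)) * ?Bi $$ (p, j)) (\<Sum>p<n. (\<Sum>i<n. x' i * B $$ (i, p)) * ?Bi $$ (p, j))"
    using c cv B'i j by - (rule cong_l_sum, rule cong_l_mult, auto simp: int_mat_def)
   then have "cong_l (x j) (x' j)" unfolding undo[OF j] .
   then show "x j = x' j" using xd j by (intro digit_cong_eq) (auto simp: PiE_iff)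
  qed
 qed
qed (rule finite_rs)

lemma card_rs_right:
 assumes B: "B \<in> KG n" and C: "C \<in> int_mat n" shows "card (rs n (C * B)) = card (rs n C)"
proof (rule antisym)
 have "card (rs n (C * B)) \<le> card (rs n ((C * B) * minv n B))"
  by (intro card_rs_right_le GL_int_minv B int_mat_mult C GL_int_int)
 then show "card (rs n (C * B)) \<le> card (rs n C)"
  using GL_cancel_right(1)[OF GL_int_GL[OF B] int_mat_carrier[OF C]] by simp
qed (rule card_rs_right_le[OF assms])

lemma card_rs_Xr: assumes r: "r \<le> n" shows "card (rs n (Xr n r)) = l ^ r"
proof -
 have s: "(\<Sum>i<n. y i * Xr n r $$ (i, j)) = (if j < r then y j else 0)" if "j < n" for y j
 proof -
  have "(\<Sum>i<n. y i * Xr n r $$ (i, j)) = (\<Sum>i<n. if i = j then (if j < r then y j else 0) else 0)"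
   using that by (intro sum.cong) (auto simp: Xr_def)
  then show ?thesis using that by simp
 qed
 have "bij_betw (\<lambda>x. restrict (\<lambda>j. if j < r then x j else 0) {..<n}) (PiE {..<r} (\<lambda>_. digits)) (rs n (Xr n r))"
 proof (rule bij_betwI')
  fix x x' assume x: "x \<in> PiE {..<r} (\<lambda>_. digits :: 'a set)" "x' \<in> PiE {..<r} (\<lambda>_. digits)"
  show "restrict (\<lambda>j. if j < r then x j else 0) {..<n} = restrict (\<lambda>j. if j < r then x' j else 0) {..<n} \<longleftrightarrow> x = x'"
  proof
   assume e: "restrict (\<lambda>j. if j < r then x j else 0) {..<n} = restrict (\<lambda>j. if j < r then x' j else 0) {..<n}"
   show "x = x'"
   proof (rule PiE_ext[OF x])
    fix j assume "j \<in> {..<r}"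
    then show "x j = x' j" using fun_cong[OF e, of j] r by auto
   qed
  qed (simp only:)
 next
  fix x assume x: "x \<in> PiE {..<r} (\<lambda>_. digits :: 'a set)"
  have xd: "x j \<in> digits" if "j < r" for j using x that by auto
  show "restrict (\<lambda>j. if j < r then x j else 0) {..<n} \<in> rs n (Xr n r)"
   by (rule rs_I[where y = "\<lambda>j. if j < r then x j else 0"]) (auto simp: xd s digits_vn)
 next
  fix z assume "z \<in> rs n (Xr n r)"
  then obtain y where y: "z \<in> dvec n" "\<And>i. i < n ==> vn (y i) \<le> 1"
   "\<And>j. j < n ==> cong_l (z j) (\<Sum>i<n. y i * Xr n r $$ (i, j))" by (auto simp: rs_def)
  have z0: "z j = 0" if "r \<le> j" "j < n" for j
   using y(1) y(3)[OF that(2)] s[OF that(2), of y] that by (intro digit_cong_eq) (auto simp: PiE_iff)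
  have "restrict z {..<r} \<in> PiE {..<r} (\<lambda>_. digits)" using y(1) r by (auto simp: PiE_iff)
  moreover have "z = restrict (\<lambda>j. if j < r then restrict z {..<r} j else 0) {..<n}"
   using z0 y(1) by (auto simp: fun_eq_iff PiE_iff extensional_def)
  ultimately show "\<exists>x\<in>PiE {..<r} (\<lambda>_. digits). z = restrict (\<lambda>j. if j < r then x j else 0) {..<n}" by blast
 qed
 then have "card (rs n (Xr n r)) = card (PiE {..<r} (\<lambda>_. digits :: 'a set))" using bij_betw_same_card by fastforce
 then show ?thesis by (simp add: card_PiE card_digits)
qed

lemma card_rs:
 assumes C: "C \<in> int_mat n" and r: "has_rank n C r" shows "card (rs n C) = l ^ r"
proof -
 obtain P B where PQ: "P \<in> KG n" "B \<in> KG n" "cong_mat n C (P * Xr n r * B)" "r \<le> n" using r by (auto simp: has_rank_def)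
 have PX: "P * Xr n r \<in> int_mat n" by (intro int_mat_mult GL_int_int PQ(1) Xr_int)
 have "rs n C = rs n (P * Xr n r * B)" by (intro rs_cong PQ(3) C int_mat_mult PX GL_int_int PQ(2))
 then have "card (rs n C) = card (rs n (P * Xr n r))" using card_rs_right[OF PQ(2) PX] by simp
 then show ?thesis using rs_left[OF PQ(1) Xr_int] card_rs_Xr[OF PQ(4)] by simp
qed

definition rkm :: "nat => 'a mat => nat" where "rkm n C = (SOME r. has_rank n C r)"

lemma rkm: "C \<in> int_mat n ==> has_rank n C (rkm n C)"
 unfolding rkm_def using has_rank_ex by (rule someI_ex)

lemma l_power_inj: "l ^ r = l ^ s ==> r = s" using l_gt_1 by simp

text \<open>A matrix of rank \<open>r\<close> has a row space of \<open>l ^ r\<close> elements, and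
  this number determines \<open>r\<close>.\<close>

lemma rkm_eqI: "C \<in> int_mat n ==> has_rank n C r ==> rkm n C = r"
 using card_rs[of C n "rkm n C"] card_rs[of C n r] rkm[of C n] l_power_inj by metis

lemma card_rs_rkm: "C \<in> int_mat n ==> card (rs n C) = l ^ rkm n C"
 using card_rs rkm by blast

section \<open>Counting digit matrices by their rank, row by row\<close>

text \<open>The possible upper right blocks of a Hermite form of size \<open>2 n\<close>;
  \<open>J\<close> will be the complement of the set of places where the lower right block has
  \<open>l\<close> on its diagonal.\<close>

definition dmat :: "nat => nat set => nat set => 'a mat set"
 where "dmat n S J = {C \<in> carrier_mat n n. \<forall>i<n. \<forall>j<n. if i \<in> S \<and> j \<in> J then C $$ (i, j) \<in> digits else C $$ (i, j) = 0}"

lemma dmat_D: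
 assumes "C \<in> dmat n S J"
 shows "C \<in> carrier_mat n n" "i < n ==> j < n ==> i \<in> S ==> j \<in> J ==> C $$ (i, j) \<in> digits"
  "i < n ==> j < n ==> \<not> (i \<in> S \<and> j \<in> J) ==> C $$ (i, j) = 0"
 using assms unfolding dmat_def by (auto dest!: spec[of _ i] spec[of _ j])

lemma dmat_digits: assumes "C \<in> dmat n S J" "i < n" "j < n" shows "C $$ (i, j) \<in> digits"
 using dmat_D(2,3)[OF assms] by (cases "i \<in> S \<and> j \<in> J") auto

lemma dmat_int: assumes "C \<in> dmat n S J" shows "C \<in> int_mat n"
 using dmat_D(1)[OF assms] dmat_digits[OF assms] digits_vn by (simp add: int_mat_def)

lemma finite_dmat: "finite (dmat n S J)"
proof -
 have "dmat n S J \<subseteq> (\<lambda>f. Matrix.mat n n f) ` (PiE ({..<n} \<times> {..<n}) (\<lambda>_. digits))"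
 proof
  fix A assume A: "A \<in> dmat n S J"
  let ?f = "restrict (\<lambda>p. A $$ p) ({..<n} \<times> {..<n})"
  have "?f \<in> PiE ({..<n} \<times> {..<n}) (\<lambda>_. digits)" using dmat_digits[OF A] by auto
  moreover have "A = Matrix.mat n n ?f" using dmat_D(1)[OF A] by (intro eq_matI) auto
  ultimately show "A \<in> (\<lambda>f. Matrix.mat n n f) ` (PiE ({..<n} \<times> {..<n}) (\<lambda>_. digits))" by blast
 qed
 then show ?thesis by (rule finite_subset) (intro finite_imageI finite_PiE, auto)
qed

text \<open>For \<open>S\<close> and \<open>J\<close> both equal to \<open>{..<n}\<close> this
  counts the \<open>n\<close> by \<open>n\<close> matrices of rank \<open>r\<close> over the residue
  field.\<close>

definition Nr :: "nat => nat set => nat set => nat => nat"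
 where "Nr n S J r = card {C \<in> dmat n S J. rkm n C = r}"

lemma Nr_empty: "Nr n {} J r = (if r = 0 then 1 else 0)"
proof -
 have "C = 0\<^sub>m n n" if "C \<in> dmat n {} J" for C using dmat_D(1,3)[OF that] by (intro eq_matI) auto
 then have d: "dmat n {} J = {0\<^sub>m n n}" by (auto simp: dmat_def)
 have z: "0\<^sub>m n n \<in> int_mat n" by (auto simp: int_mat_def)
 have "Xr n 0 = 0\<^sub>m n n" by (intro eq_matI) (auto simp: Xr_def)
 then have "has_rank n (0\<^sub>m n n) 0"
  unfolding has_rank_def by (intro conjI bexI[of _ "1\<^sub>m n"]) auto
 then have "rkm n (0\<^sub>m n n) = 0" using rkm_eqI[OF z] by blast
 then have "{C \<in> dmat n {} J. rkm n C = r} = (if r = 0 then {0\<^sub>m n n} else {})" using d by auto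
 then show ?thesis by (simp add: Nr_def)
qed

context
 fixes n :: nat and i0 :: nat and S J :: "nat set" and C :: "'a mat"
 assumes i0: "i0 < n" "i0 \<notin> S" and J: "J \<subseteq> {..<n}" and C: "C \<in> dmat n S J"
begin

definition set_row :: "(nat => 'a) => 'a mat"
 where "set_row R = Matrix.mat n n (\<lambda>(i, j). if i = i0 then (if j \<in> J then R j else 0) else C $$ (i, j))"

definition ext :: "(nat => 'a) => nat => 'a"
 where "ext R = restrict (\<lambda>j. if j \<in> J then R j else 0) {..<n}"

lemma set_row_dmat: "R \<in> PiE J (\<lambda>_. digits) ==> set_row R \<in> dmat n (insert i0 S) J"
 using dmat_D(2,3)[OF C] i0 by (auto simp: dmat_def set_row_def)

lemma C_row0: "j < n ==> C $$ (i0, j) = 0"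
 using dmat_D(3)[OF C] i0 by simp

lemma set_row_comb:
 assumes "j < n"
 shows "(\<Sum>i<n. y i * set_row R $$ (i, j)) = (\<Sum>i<n. y i * C $$ (i, j)) + y i0 * ext R j"
proof -
 have "(\<Sum>i<n. y i * set_row R $$ (i, j)) = y i0 * ext R j + (\<Sum>i\<in>{..<n} - {i0}. y i * C $$ (i, j))"
  using i0 assms by (subst sum.remove[of _ i0]) (auto simp: set_row_def ext_def intro!: sum.cong)
 also have "(\<Sum>i\<in>{..<n} - {i0}. y i * C $$ (i, j)) = (\<Sum>i<n. y i * C $$ (i, j))"
  using i0 C_row0[OF assms] by (subst sum.remove[of "{..<n}" i0]) auto
 finally show ?thesis by simp
qed

text \<open>Both cases are decided by the size of the row space. A new row inside the old row space
  changes nothing; otherwise each new vector is uniquely an old one plus a digit times the new row,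
  and the size is multiplied by \<open>l\<close>.\<close>

lemma rkm_set_row:
 assumes R: "R \<in> PiE J (\<lambda>_. digits)"
 shows "rkm n (set_row R) = (if ext R \<in> rs n C then rkm n C else Suc (rkm n C))"
proof -
 note Ci = dmat_int[OF C] and C'i = dmat_int[OF set_row_dmat[OF R]]
 have Rd: "ext R \<in> dvec n" using R by (auto simp: ext_def)
 have Rv: "vn (ext R j) \<le> 1" if "j < n" for j using Rd that by (intro digits_vn) (auto simp: PiE_iff)
 show ?thesis
 proof (cases "ext R \<in> rs n C")
  case True
  then obtain z where z: "\<And>i. i < n ==> vn (z i) \<le> 1" "\<And>j. j < n ==> cong_l (ext R j) (\<Sum>i<n. z i * C $$ (i, j))"
   by (auto simp: rs_def)
  have "rs n (set_row R) = rs n C"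
  proof (intro equalityI subsetI)
   fix x assume "x \<in> rs n (set_row R)"
   then obtain y where y: "x \<in> dvec n" "\<And>i. i < n ==> vn (y i) \<le> 1"
    "\<And>j. j < n ==> cong_l (x j) (\<Sum>i<n. y i * set_row R $$ (i, j))" by (auto simp: rs_def)
   show "x \<in> rs n C"
   proof (rule rs_I[OF y(1), where y = "\<lambda>i. y i + y i0 * z i"])
    show "vn (y i + y i0 * z i) \<le> 1" if "i < n" for i
     using vn_add[of "y i" "y i0 * z i"] y(2)[OF that] y(2)[OF i0(1)] z(1)[OF that]
      mult_le_one[of "vn (y i0)" "vn (z i)"] by (simp add: vn_mult)
    fix j assume j: "j < n"
    have "cong_l (y i0 * ext R j) (y i0 * (\<Sum>i<n. z i * C $$ (i, j)))"
     using z(2)[OF j] y(2)[OF i0(1)] Rv[OF j] by (intro cong_l_mult) auto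
    then have "cong_l ((\<Sum>i<n. y i * C $$ (i, j)) + y i0 * ext R j)
      ((\<Sum>i<n. y i * C $$ (i, j)) + y i0 * (\<Sum>i<n. z i * C $$ (i, j)))" by (intro cong_l_add) auto
    then show "cong_l (x j) (\<Sum>i<n. (y i + y i0 * z i) * C $$ (i, j))"
     using y(3)[OF j] unfolding set_row_comb[OF j]
     by (simp add: distrib_right sum.distrib sum_distrib_left mult.assoc) (blast intro: cong_l_trans)
   qed
  next
   fix x assume "x \<in> rs n C"
   then obtain y where y: "x \<in> dvec n" "\<And>i. i < n ==> vn (y i) \<le> 1"
    "\<And>j. j < n ==> cong_l (x j) (\<Sum>i<n. y i * C $$ (i, j))" by (auto simp: rs_def)
   have e: "(\<Sum>i<n. (y(i0 := 0)) i * C $$ (i, j)) = (\<Sum>i<n. y i * C $$ (i, j))" if "j < n" for j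
    using C_row0[OF that] by (intro sum.cong) auto
   show "x \<in> rs n (set_row R)"
    by (rule rs_I[OF y(1), where y = "y(i0 := 0)"]) (use y in \<open>simp_all add: set_row_comb e del: fun_upd_apply\<close>, simp_all)
  qed
  then have "l ^ rkm n (set_row R) = l ^ rkm n C" using card_rs_rkm[OF Ci] card_rs_rkm[OF C'i] by simp
  then show ?thesis using True l_power_inj by simp
 next
  case False
  let ?f = "\<lambda>(x, t). restrict (\<lambda>j. res (x j + t * ext R j)) {..<n}"
  have v: "vn (x j + t * ext R j) \<le> 1" if "vn (x j) \<le> 1" "vn t \<le> 1" "j < n" for x t j
   using vn_add[of "x j" "t * ext R j"] that Rv[OF that(3)] mult_le_one[of "vn t" "vn (ext R j)"] by (simp add: vn_mult)
  have "bij_betw ?f (rs n C \<times> digits) (rs n (set_row R))"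
  proof (rule bij_betwI')
   fix p p' assume p: "p \<in> rs n C \<times> digits" "p' \<in> rs n C \<times> digits"
   obtain x t x' t' where pp: "p = (x, t)" "p' = (x', t')" by fastforce
   have xd: "x \<in> dvec n" "x' \<in> dvec n" and td: "t \<in> digits" "t' \<in> digits"
    using p pp by (auto simp: rs_def)
   have xv: "vn (x j) \<le> 1" "vn (x' j) \<le> 1" if "j < n" for j using xd that by (auto intro!: digits_vn simp: PiE_iff)
   show "?f p = ?f p' \<longleftrightarrow> p = p'"
   proof
    assume e: "?f p = ?f p'"
    have c: "cong_l (x j + t * ext R j) (x' j + t' * ext R j)" if "j < n" for j
    proof -
     have "res (x j + t * ext R j) = res (x' j + t' * ext R j)" using fun_cong[OF e, of j] that by (simp add: pp)
     then show ?thesis using res_eq_iff v xv digits_vn td that by metis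
    qed
    \<comment> \<open>If the digits differed, \<open>t - t'\<close> would be a unit, and dividing by
      it would express the new row through the old ones.\<close>
    have tt: "t = t'"
    proof (rule ccontr)
     assume "t \<noteq> t'"
     then have "\<not> cong_l t t'" using digit_cong_eq td by blast
     moreover have "vn (t - t') \<le> 1" using vn_diff[of t t'] digits_vn[OF td(1)] digits_vn[OF td(2)] by simp
     ultimately have u: "vn (t - t') = 1" by (simp add: cong_l_def)
     then have u0: "t - t' \<noteq> 0" by auto
     have "x \<in> rs n C" "x' \<in> rs n C" using p pp by auto
     then obtain y y' where "\<forall>i<n. vn (y i) \<le> 1" "\<forall>j<n. cong_l (x j) (\<Sum>i<n. y i * C $$ (i, j))"
      "\<forall>i<n. vn (y' i) \<le> 1" "\<forall>j<n. cong_l (x' j) (\<Sum>i<n. y' i * C $$ (i, j))"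
      unfolding rs_def by blast
     then have y: "\<And>i. i < n ==> vn (y i) \<le> 1" "\<And>j. j < n ==> cong_l (x j) (\<Sum>i<n. y i * C $$ (i, j))"
      and y': "\<And>i. i < n ==> vn (y' i) \<le> 1" "\<And>j. j < n ==> cong_l (x' j) (\<Sum>i<n. y' i * C $$ (i, j))"
      by blast+
     have "ext R \<in> rs n C"
     proof (rule rs_I[OF Rd, where y = "\<lambda>i. (y' i - y i) / (t - t')"])
      show "vn ((y' i - y i) / (t - t')) \<le> 1" if "i < n" for i
       using vn_diff[of "y' i" "y i"] y(1)[OF that] y'(1)[OF that] u by (simp add: vn_divide)
      fix j assume j: "j < n"
      let ?s = "\<Sum>i<n. y i * C $$ (i, j)" and ?s' = "\<Sum>i<n. y' i * C $$ (i, j)"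
      have "cong_l (x' j - x j) (?s' - ?s)" by (intro cong_l_diff y(2) y'(2) j)
      moreover have "cong_l ((t - t') * ext R j) (x' j - x j)"
       using c[OF j] unfolding cong_l_def by (simp add: algebra_simps)
      ultimately have "cong_l ((t - t') * ext R j) (?s' - ?s)" using cong_l_trans by blast
      then have "vn ((t - t') * ext R j - (?s' - ?s)) < 1" by (simp add: cong_l_def)
      moreover have "ext R j - (?s' - ?s) / (t - t') = ((t - t') * ext R j - (?s' - ?s)) / (t - t')"
       using u0 by (simp add: field_simps)
      ultimately have "cong_l (ext R j) ((?s' - ?s) / (t - t'))" unfolding cong_l_def using u by (simp add: vn_divide)
      also have "(?s' - ?s) / (t - t') = (\<Sum>i<n. (y' i - y i) / (t - t') * C $$ (i, j))"
       by (simp add: sum_subtractf[symmetric] left_diff_distrib[symmetric] sum_divide_distrib)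
      finally show "cong_l (ext R j) (\<Sum>i<n. (y' i - y i) / (t - t') * C $$ (i, j))" .
     qed
     then show False using False by blast
    qed
    have "x = x'"
    proof (rule PiE_ext[OF xd])
     fix j assume "j \<in> {..<n}"
     then have j: "j < n" by simp
     have "cong_l (x j) (x' j)" using c[OF j] tt by (simp add: cong_l_def)
     then show "x j = x' j" using xd j by (intro digit_cong_eq) (auto simp: PiE_iff)
    qed
    then show "p = p'" using tt pp by simp
   qed simp
  next
   fix p assume p: "p \<in> rs n C \<times> digits"
   obtain x t where pp: "p = (x, t)" by fastforce
   have x: "x \<in> rs n C" and t: "t \<in> digits" using p pp by auto
   obtain y where y: "x \<in> dvec n" "\<And>i. i < n ==> vn (y i) \<le> 1"
    "\<And>j. j < n ==> cong_l (x j) (\<Sum>i<n. y i * C $$ (i, j))" using x by (auto simp: rs_def)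
   have xv: "vn (x j) \<le> 1" if "j < n" for j using y(1) that by (auto intro!: digits_vn simp: PiE_iff)
   have e: "(\<Sum>i<n. (y(i0 := t)) i * C $$ (i, j)) = (\<Sum>i<n. y i * C $$ (i, j))" if "j < n" for j
    using C_row0[OF that] by (intro sum.cong) auto
   show "?f p \<in> rs n (set_row R)"
   proof (rule rs_I[where y = "y(i0 := t)"])
    show "?f p \<in> dvec n" using res(1)[OF v[of x _ t]] xv digits_vn[OF t] by (auto simp: pp)
    show "vn ((y(i0 := t)) i) \<le> 1" if "i < n" for i using y(2)[OF that] digits_vn[OF t] by simp
    fix j assume j: "j < n"
    have c1: "cong_l (res (x j + t * ext R j)) (x j + t * ext R j)"
     by (rule cong_l_sym, rule res(2), rule v[of x j t, OF xv[OF j] digits_vn[OF t] j])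
    have c2: "cong_l (x j + t * ext R j) ((\<Sum>i<n. y i * C $$ (i, j)) + t * ext R j)"
     by (rule cong_l_add[OF y(3)[OF j] cong_l_refl])
    show "cong_l (?f p j) (\<Sum>i<n. (y(i0 := t)) i * set_row R $$ (i, j))"
     unfolding set_row_comb[OF j] e[OF j] using j cong_l_trans[OF c1 c2] by (simp add: pp)
   qed
  next
   fix z assume "z \<in> rs n (set_row R)"
   then obtain y where y: "z \<in> dvec n" "\<And>i. i < n ==> vn (y i) \<le> 1"
    "\<And>j. j < n ==> cong_l (z j) (\<Sum>i<n. y i * set_row R $$ (i, j))" by (auto simp: rs_def)
   define t where "t = res (y i0)"
   define x where "x = restrict (\<lambda>j. res (\<Sum>i<n. y i * C $$ (i, j))) {..<n}"
   have t: "t \<in> digits" "cong_l (y i0) t" unfolding t_def using res[OF y(2)[OF i0(1)]] by auto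
   have x: "x \<in> rs n C" unfolding x_def by (rule res_vec_rs[OF Ci y(2)])
   have xv: "vn (x j) \<le> 1" if "j < n" for j using x that by (auto intro!: digits_vn simp: PiE_iff rs_def)
   have "z = ?f (x, t)"
   proof (rule PiE_ext[OF y(1)])
    show "?f (x, t) \<in> dvec n" using res(1)[OF v[of x _ t]] xv digits_vn[OF t(1)] by auto
    fix j assume "j \<in> {..<n}"
    then have j: "j < n" by simp
    have "cong_l ((\<Sum>i<n. y i * C $$ (i, j)) + y i0 * ext R j) (x j + t * ext R j)"
     using res(2)[OF vn_comb[OF Ci y(2) j]] t j Rv[OF j] digits_vn[OF t(1)]
     by (intro cong_l_add cong_l_mult) (auto simp: x_def)
    then have "cong_l (x j + t * ext R j) (z j)" using y(3)[OF j] unfolding set_row_comb[OF j]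
     by (meson cong_l_sym cong_l_trans)
    then have "res (x j + t * ext R j) = z j"
     using y(1) j by (intro res_eqI v xv digits_vn t(1)) (auto simp: PiE_iff)
    then show "z j = ?f (x, t) j" using j by simp
   qed
   then show "\<exists>p\<in>rs n C \<times> digits. z = ?f p" using x t(1) by blast
  qed
  from bij_betw_same_card[OF this] have "card (rs n (set_row R)) = card (rs n C) * l"
   by (simp add: card_cartesian_product card_digits)
  then have "l ^ rkm n (set_row R) = l ^ Suc (rkm n C)" using card_rs_rkm[OF Ci] card_rs_rkm[OF C'i] by simp
  then show ?thesis using False l_power_inj by simp
 qed
qed

text \<open>The columns of \<open>C\<close> outside \<open>J\<close> are zero, so all vectors of its
  row space vanish there and are recovered from their restriction to \<open>J\<close>.\<close>

lemma card_ext_rs: "card {R \<in> PiE J (\<lambda>_. digits). ext R \<in> rs n C} = l ^ rkm n C"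
proof -
 have "bij_betw ext {R \<in> PiE J (\<lambda>_. digits). ext R \<in> rs n C} (rs n C)"
 proof (rule bij_betwI')
  fix R R' assume R: "R \<in> {R \<in> PiE J (\<lambda>_. digits). ext R \<in> rs n C}" "R' \<in> {R \<in> PiE J (\<lambda>_. digits). ext R \<in> rs n C}"
  show "ext R = ext R' \<longleftrightarrow> R = R'"
  proof
   assume e: "ext R = ext R'"
   show "R = R'"
   proof (rule PiE_ext[of R J "\<lambda>_. digits" R'])
    show "R \<in> PiE J (\<lambda>_. digits)" "R' \<in> PiE J (\<lambda>_. digits)" using R by blast+
    fix j assume "j \<in> J"
    then show "R j = R' j" using fun_cong[OF e, of j] J by (auto simp: ext_def)
   qed
  qed simp
 next
  fix z assume z: "z \<in> rs n C"
  then obtain y where y: "z \<in> dvec n" "\<And>i. i < n ==> vn (y i) \<le> 1"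
   "\<And>j. j < n ==> cong_l (z j) (\<Sum>i<n. y i * C $$ (i, j))" by (auto simp: rs_def)
  have z0: "z j = 0" if "j < n" "j \<notin> J" for j
  proof -
   have "(\<Sum>i<n. y i * C $$ (i, j)) = 0" using dmat_D(3)[OF C _ that(1)] that(2) by (intro sum.neutral) auto
   then show ?thesis using y(1) y(3)[OF that(1)] that by (intro digit_cong_eq) (auto simp: PiE_iff)
  qed
  have e: "z = ext (restrict z J)"
   using z0 y(1) J by (auto simp: ext_def fun_eq_iff PiE_iff extensional_def)
  moreover have "restrict z J \<in> PiE J (\<lambda>_. digits)" using y(1) J by (auto simp: PiE_iff)
  ultimately show "\<exists>R\<in>{R \<in> PiE J (\<lambda>_. digits). ext R \<in> rs n C}. z = ext R"
   using z by (intro bexI[of _ "restrict z J"] CollectI conjI) simp_all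
 qed auto
 from bij_betw_same_card[OF this] show ?thesis using card_rs_rkm[OF dmat_int[OF C]] by simp
qed

end

text \<open>Of the \<open>l ^ card J\<close> possible rows at \<open>i0\<close>, the
  \<open>l ^ rkm n C\<close> in the row space of the other rows keep the rank, and the rest raise it
  by 1.\<close>

lemma sum_dmat_insert:
 fixes f :: "nat => 'b::comm_semiring_1"
 assumes i0: "i0 < n" "i0 \<notin> S" and J: "J \<subseteq> {..<n}"
 shows "(\<Sum>C\<in>dmat n (insert i0 S) J. f (rkm n C)) =
  (\<Sum>C\<in>dmat n S J. of_nat (l ^ rkm n C) * f (rkm n C) + of_nat (l ^ card J - l ^ rkm n C) * f (Suc (rkm n C)))"
proof -
 let ?E = "PiE J (\<lambda>_. digits)"
 have finJ: "finite J" using J finite_subset by blast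
 have finE: "finite ?E" using finJ by (intro finite_PiE) auto
 have "bij_betw (\<lambda>(C, R). set_row n i0 J C R) (dmat n S J \<times> ?E) (dmat n (insert i0 S) J)"
 proof (rule bij_betwI')
  fix p p' assume p: "p \<in> dmat n S J \<times> ?E" "p' \<in> dmat n S J \<times> ?E"
  obtain C R C' R' where pp: "p = (C, R)" "p' = (C', R')" by fastforce
  have C: "C \<in> dmat n S J" "C' \<in> dmat n S J" and R: "R \<in> ?E" "R' \<in> ?E" using p pp by auto
  show "(case p of (C, R) => set_row n i0 J C R) = (case p' of (C, R) => set_row n i0 J C R) \<longleftrightarrow> p = p'"
  proof
   assume "(case p of (C, R) => set_row n i0 J C R) = (case p' of (C, R) => set_row n i0 J C R)"
   then have e: "set_row n i0 J C R $$ (i, j) = set_row n i0 J C' R' $$ (i, j)" for i j by (simp add: pp)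
   have "R = R'"
   proof (rule PiE_ext[OF R])
    fix j assume "j \<in> J"
    then show "R j = R' j" using e[of i0 j] i0 J by (auto simp: set_row_def[OF i0 J C(1)] set_row_def[OF i0 J C(2)])
   qed
   moreover have "C = C'"
   proof (rule eq_matI)
    fix i j assume "i < dim_row C'" "j < dim_col C'"
    then have ij: "i < n" "j < n" using dmat_D(1)[OF C(2)] by auto
    show "C $$ (i, j) = C' $$ (i, j)"
    proof (cases "i = i0")
     case True
     then show ?thesis using dmat_D(3)[OF C(1) ij] dmat_D(3)[OF C(2) ij] i0 by simp
    next
     case False
     then show ?thesis using e[of i j] ij by (simp add: set_row_def[OF i0 J C(1)] set_row_def[OF i0 J C(2)])
    qed
   qed (use dmat_D(1)[OF C(1)] dmat_D(1)[OF C(2)] in auto)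
   ultimately show "p = p'" by (simp add: pp)
  qed simp
 next
  fix p assume "p \<in> dmat n S J \<times> ?E"
  then show "(case p of (C, R) => set_row n i0 J C R) \<in> dmat n (insert i0 S) J"
   using set_row_dmat[OF i0 J] by auto
 next
  fix A assume A: "A \<in> dmat n (insert i0 S) J"
  define C where "C = Matrix.mat n n (\<lambda>(i, j). if i = i0 then 0 else A $$ (i, j))"
  have C: "C \<in> dmat n S J" using dmat_D(2,3)[OF A] i0 by (auto simp: dmat_def C_def)
  define R where "R = restrict (\<lambda>j. A $$ (i0, j)) J"
  have R: "R \<in> ?E" using dmat_D(2)[OF A i0(1)] J by (auto simp: R_def)
  have "A = set_row n i0 J C R"
  proof (rule eq_matI)
   fix i j assume "i < dim_row (set_row n i0 J C R)" "j < dim_col (set_row n i0 J C R)"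
   then have ij: "i < n" "j < n" by (auto simp: set_row_def[OF i0 J C])
   then show "A $$ (i, j) = set_row n i0 J C R $$ (i, j)"
    unfolding set_row_def[OF i0 J C] using dmat_D(3)[OF A i0(1) ij(2)] ij
    by (cases "i = i0"; cases "j \<in> J") (simp_all add: C_def R_def)
  qed (use dmat_D(1)[OF A] in \<open>auto simp: set_row_def[OF i0 J C]\<close>)
  then show "\<exists>p\<in>dmat n S J \<times> ?E. A = (case p of (C, R) => set_row n i0 J C R)" using C R by auto
 qed
 then have "(\<Sum>C\<in>dmat n (insert i0 S) J. f (rkm n C)) = (\<Sum>(C, R)\<in>dmat n S J \<times> ?E. f (rkm n (set_row n i0 J C R)))"
  by (subst sum.reindex_bij_betw[symmetric]) (auto simp: case_prod_unfold)
 also have "\<dots> = (\<Sum>C\<in>dmat n S J. \<Sum>R\<in>?E. f (rkm n (set_row n i0 J C R)))"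
  by (rule sum.cartesian_product[symmetric])
 also have "\<dots> = (\<Sum>C\<in>dmat n S J. of_nat (l ^ rkm n C) * f (rkm n C) + of_nat (l ^ card J - l ^ rkm n C) * f (Suc (rkm n C)))"
 proof (rule sum.cong)
  fix C assume C: "C \<in> dmat n S J"
  let ?A = "{R \<in> ?E. ext n J R \<in> rs n C}"
  have cA: "card ?A = l ^ rkm n C" by (rule card_ext_rs[OF i0 J C])
  have cE: "card ?E = l ^ card J" using finJ by (simp add: card_PiE card_digits)
  have "(\<Sum>R\<in>?E. f (rkm n (set_row n i0 J C R))) = (\<Sum>R\<in>?E. if ext n J R \<in> rs n C then f (rkm n C) else f (Suc (rkm n C)))"
   by (intro sum.cong) (auto simp: rkm_set_row[OF i0 J C])
  also have "\<dots> = (\<Sum>R\<in>?E \<inter> {R. ext n J R \<in> rs n C}. f (rkm n C)) + (\<Sum>R\<in>?E \<inter> - {R. ext n J R \<in> rs n C}. f (Suc (rkm n C)))"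
   using finE by (rule sum.If_cases)
  also have "?E \<inter> {R. ext n J R \<in> rs n C} = ?A" by auto
  also have "?E \<inter> - {R. ext n J R \<in> rs n C} = ?E - ?A" by auto
  also have "(\<Sum>R\<in>?E - ?A. f (Suc (rkm n C))) = of_nat (l ^ card J - l ^ rkm n C) * f (Suc (rkm n C))"
   using card_Diff_subset[of ?A ?E] finE cA cE by simp
  finally show "(\<Sum>R\<in>?E. f (rkm n (set_row n i0 J C R))) =
   of_nat (l ^ rkm n C) * f (rkm n C) + of_nat (l ^ card J - l ^ rkm n C) * f (Suc (rkm n C))" using cA by simp
 qed simp
 finally show ?thesis .
qed

end

section \<open>Weighted sums of rank counts over sets of rows\<close>

text \<open>The exponent \<open>k (k - 1) / 2\<close>, kept as a sum to avoid division of natural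
  numbers.\<close>

definition tri :: "nat => nat" where "tri k = (\<Sum>i<k. i)"

lemma tri_0 [simp]: "tri 0 = 0" and tri_Suc: "tri (Suc k) = tri k + k"
 by (simp_all add: tri_def)

lemma two_tri: "2 * tri k + k = k * k" by (induction k) (simp_all add: tri_Suc)

lemma tri_add: "tri (r + d) + (tri r + r + r * d + tri (Suc d)) = (r + d)\<^sup>2"
proof -
 have "(r + d) * (r + d) = r * r + 2 * (r * d) + d * d" by (simp add: algebra_simps)
 then show ?thesis unfolding tri_Suc power2_eq_square using two_tri[of "r + d"] two_tri[of r] two_tri[of d] by linarith
qed

text \<open>The factor that rank \<open>r\<close> receives in \<open>rank_sum\<close> when there are
  \<open>r + d\<close> rows. For \<open>r = 0\<close> it is the finite q-product of the
  \<open>1 - Y / q ^ i\<close>.\<close>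

definition co :: "complex => complex => nat => nat => complex"
 where "co q Y r d = (- Y) ^ r / q ^ (tri r + r * d) * (\<Prod>i<d. 1 - Y / q ^ i)"

lemma co_Suc_right:
 assumes "q \<noteq> 0" shows "co q Y r (Suc d) * q ^ r = (1 - Y / q ^ d) * co q Y r d"
proof -
 have e: "q ^ (tri r + r * Suc d) = q ^ (tri r + r * d) * q ^ r" by (simp add: power_add)
 have gen: "x / (a * b) * (p * f) * b = f * (x / a * p)" if "b \<noteq> 0" for x a b p f :: complex
  using that by simp
 show ?thesis unfolding co_def e prod.lessThan_Suc by (rule gen) (use assms in simp)
qed

lemma co_Suc_left: "co q Y (Suc r) d = - Y / q ^ (r + d) * co q Y r d"
proof -
 have e: "q ^ (tri (Suc r) + Suc r * d) = q ^ (tri r + r * d) * q ^ (r + d)"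
  by (simp add: tri_Suc power_add mult_ac)
 show ?thesis unfolding co_def e by (simp add: mult_ac)
qed

text \<open>Here \<open>N S r\<close> stands for the number of rank \<open>r\<close> matrices with
  rows in \<open>S\<close> and \<open>c\<close> columns over a field with \<open>q\<close> elements;
  the argument uses only what happens when a row beyond the previous ones is added.\<close>

context
 fixes N :: "nat set => nat => complex" and q :: complex and n c :: nat
 assumes q: "q \<noteq> 0"
  and N0: "\<And>r. N {} r = (if r = 0 then 1 else 0)"
  and rec0: "\<And>k S. k < n ==> S \<subseteq> {..<k} ==> N (insert k S) 0 = N S 0"
  and recS: "\<And>k S r. k < n ==> S \<subseteq> {..<k} ==>
   N (insert k S) (Suc r) = q ^ Suc r * N S (Suc r) + (q ^ c - q ^ r) * N S r"
begin

lemma rank_large: "k \<le> n ==> k < r ==> N {..<k} r = 0"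
proof (induction k arbitrary: r)
 case (Suc k)
 then obtain r' where r: "r = Suc r'" by (cases r) auto
 show ?case unfolding r lessThan_Suc using Suc r recS[of k "{..<k}" r'] by simp
qed (simp add: N0)

text \<open>The factor \<open>q ^ c - q ^ r'\<close> is 0 at \<open>r' = c\<close>, which stops the
  rank at the number of columns.\<close>

lemma rank_large_c: "k \<le> n ==> c < r ==> N {..<k} r = 0"
proof (induction k arbitrary: r)
 case (Suc k)
 then obtain r' where r: "r = Suc r'" by (cases r) auto
 have "(q ^ c - q ^ r') * N {..<k} r' = 0" using Suc r by (cases "r' = c") auto
 then show ?case unfolding r lessThan_Suc using Suc r recS[of k "{..<k}" r'] by simp
qed (simp add: N0)

text \<open>Induction on \<open>k\<close>. The sets that contain \<open>k\<close> contribute the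
  recursion for a new row, weighted by \<open>- Y / q ^ k\<close>, and \<open>co\<close> is made to
  satisfy the matching recursions \<open>co_Suc_right\<close> and \<open>co_Suc_left\<close>. So the
  sum over all row sets is proportional to the count with all rows present, rank by rank.\<close>

lemma rank_sum:
 "k \<le> n ==> (\<Sum>S\<in>Pow {..<k}. (\<Prod>i\<in>S. - Y / q ^ i) * N S r) = (if r \<le> k then co q Y r (k - r) else 0) * N {..<k} r"
proof (induction k arbitrary: r)
 case 0
 then show ?case by (simp add: N0 co_def)
next
 case (Suc k)
 let ?w = "\<lambda>S. \<Prod>i\<in>S. - Y / q ^ i" and ?E = "\<lambda>r. \<Sum>S\<in>Pow {..<k}. (\<Prod>i\<in>S. - Y / q ^ i) * N S r"
 have k: "k < n" "k \<le> n" using Suc.prems by auto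
 have w: "?w (insert k S) = - Y / q ^ k * ?w S" if "S \<in> Pow {..<k}" for S
 proof -
  have "finite S" "k \<notin> S" using that finite_subset by auto
  then show ?thesis by simp
 qed
 note IH = Suc.IH[OF k(2)]
 show ?case
 proof (cases r)
  case 0
  have "(\<Sum>S\<in>Pow {..<Suc k}. ?w S * N S r) = (\<Sum>S\<in>Pow {..<k}. (1 - Y / q ^ k) * (?w S * N S 0))"
   unfolding sum_Pow_Suc using w rec0[OF k(1)] 0 by (intro sum.cong) (auto simp: algebra_simps)
  also have "\<dots> = (1 - Y / q ^ k) * ?E 0" by (simp only: sum_distrib_left)
  also have "\<dots> = (1 - Y / q ^ k) * co q Y 0 k * N {..<k} 0" unfolding IH by simp
  also have "\<dots> = co q Y 0 (Suc k) * N {..<Suc k} 0"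
   using co_Suc_right[OF q, of Y 0 k] rec0[OF k(1), of "{..<k}"] by (simp add: lessThan_Suc)
  finally show ?thesis using 0 by simp
 next
  case (Suc r')
  have "(\<Sum>S\<in>Pow {..<Suc k}. ?w S * N S r) = (\<Sum>S\<in>Pow {..<k}. (1 - Y / q ^ k * q ^ Suc r') * (?w S * N S (Suc r'))
    + - Y / q ^ k * (q ^ c - q ^ r') * (?w S * N S r'))"
   unfolding sum_Pow_Suc
  proof (rule sum.cong[OF refl])
   fix S assume S: "S \<in> Pow {..<k}"
   then have S': "S \<subseteq> {..<k}" by simp
   show "?w S * N S r + ?w (insert k S) * N (insert k S) r =
    (1 - Y / q ^ k * q ^ Suc r') * (?w S * N S (Suc r')) + - Y / q ^ k * (q ^ c - q ^ r') * (?w S * N S r')"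
    unfolding w[OF S] Suc recS[OF k(1) S'] by (simp only: ring_distribs mult_ac) (simp add: algebra_simps)
  qed
  also have "\<dots> = (1 - Y / q ^ k * q ^ Suc r') * ?E (Suc r') + - Y / q ^ k * (q ^ c - q ^ r') * ?E r'"
   by (simp only: sum.distrib sum_distrib_left)
  finally have E: "(\<Sum>S\<in>Pow {..<Suc k}. ?w S * N S r) =
   (1 - Y / q ^ k * q ^ Suc r') * ?E (Suc r') + - Y / q ^ k * (q ^ c - q ^ r') * ?E r'" .
  have R: "N {..<Suc k} r = q ^ Suc r' * N {..<k} (Suc r') + (q ^ c - q ^ r') * N {..<k} r'"
   unfolding Suc lessThan_Suc using recS[OF k(1), of "{..<k}" r'] by simp
  \<comment> \<open>At \<open>r' = k\<close> the term of rank \<open>Suc r'\<close> drops out, as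
    \<open>k\<close> rows cannot have it; beyond that both terms do.\<close>
  consider "Suc r' \<le> k" | "r' = k" | "k < r'" by linarith
  then show ?thesis
  proof cases
   case 1
   then obtain d where d: "k = Suc r' + d" using le_Suc_ex[OF 1] by blast
   have "q ^ k = q ^ Suc r' * q ^ d" unfolding d by (rule power_add)
   then have y: "1 - Y / q ^ k * q ^ Suc r' = 1 - Y / q ^ d" using q by simp
   have e1: "?E (Suc r') = co q Y (Suc r') d * N {..<k} (Suc r')" unfolding IH using d by simp
   have e2: "?E r' = co q Y r' (Suc d) * N {..<k} r'" unfolding IH using d by simp
   have c1: "co q Y (Suc r') (Suc d) * q ^ Suc r' = (1 - Y / q ^ d) * co q Y (Suc r') d" by (rule co_Suc_right[OF q])
   have c2: "co q Y (Suc r') (Suc d) = - Y / q ^ k * co q Y r' (Suc d)"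
    using co_Suc_left[of q Y r' "Suc d"] d by simp
   have "(1 - Y / q ^ d) * (co q Y (Suc r') d * N {..<k} (Suc r')) + - Y / q ^ k * (q ^ c - q ^ r') * (co q Y r' (Suc d) * N {..<k} r')
    = (1 - Y / q ^ d) * co q Y (Suc r') d * N {..<k} (Suc r') + (- Y / q ^ k * co q Y r' (Suc d)) * (q ^ c - q ^ r') * N {..<k} r'"
    by (simp only: mult_ac)
   also have "\<dots> = co q Y (Suc r') (Suc d) * N {..<Suc k} r"
    unfolding c1[symmetric] c2[symmetric] R by (simp only: ring_distribs mult_ac)
   finally have "(\<Sum>S\<in>Pow {..<Suc k}. ?w S * N S r) = co q Y (Suc r') (Suc d) * N {..<Suc k} r"
    unfolding E y e1 e2 .
   moreover have "Suc k - r = Suc d" "r \<le> Suc k" using d Suc by auto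
   ultimately show ?thesis using Suc by simp
  next
   case 2
   have z: "N {..<k} (Suc r') = 0" using rank_large[OF k(2), of "Suc r'"] 2 by simp
   have e1: "?E (Suc r') = 0" unfolding IH z by simp
   have e2: "?E r' = co q Y k 0 * N {..<k} r'" unfolding IH 2 by simp
   have c2: "co q Y (Suc k) 0 = - Y / q ^ k * co q Y k 0" using co_Suc_left[of q Y k 0] by simp
   have "r \<le> Suc k" "Suc k - r = 0" using Suc 2 by auto
   then show ?thesis unfolding E e1 e2 R z using c2 Suc 2 by simp
  next
   case 3
   have z: "N {..<k} (Suc r') = 0" "N {..<k} r' = 0" using rank_large[OF k(2), of "Suc r'"] rank_large[OF k(2) 3] 3 by auto
   show ?thesis unfolding E IH R z using 3 Suc by simp
  qed
 qed
qed

text \<open>For \<open>r <= n - b\<close> the product in \<open>co\<close> contains the index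
  \<open>i = b - 1\<close>, where \<open>Y / q ^ i\<close> is 1. For larger \<open>r\<close> there
  are no matrices, having only \<open>n - b\<close> columns.\<close>

lemma rank_sum_vanish:
 assumes b: "1 \<le> b" "b \<le> n" "c = n - b" and Y: "Y = q ^ b / q"
 shows "(\<Sum>S\<in>Pow {..<n}. (\<Prod>i\<in>S. - Y / q ^ i) * N S r) = 0"
proof -
 have "co q Y r (n - r) = 0" if "r \<le> c"
 proof -
  have "Y / q ^ (b - 1) = 1" unfolding Y using b(1) q by (cases b) auto
  then have "\<exists>i\<in>{..<n - r}. 1 - Y / q ^ i = 0" using b that by (intro bexI[of _ "b - 1"]) auto
  then have "(\<Prod>i<n - r. 1 - Y / q ^ i) = 0" by (intro prod_zero) auto
  then show ?thesis by (simp add: co_def)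
 qed
 moreover have "N {..<n} r = 0" if "c < r" using rank_large_c[OF order_refl that] .
 ultimately show ?thesis unfolding rank_sum[OF order_refl] by (cases "r \<le> c") auto
qed

end

text \<open>By \<open>tri_add\<close> the exponent \<open>(r + d)^2\<close> is the sum of those
  needed to clear \<open>q ^ (tri r + r * d)\<close>, the \<open>q ^ r\<close> from
  \<open>Y = 1 / q\<close>, and the denominators of the product, with \<open>tri (r + d)\<close> to
  spare. This explains the power of \<open>l\<close> in the constant of the theorem.\<close>

lemma co_one_div:
 assumes q: "q \<noteq> 0"
 shows "q ^ ((r + d)\<^sup>2) * co q (1 / q) r d = (- 1) ^ r * q ^ tri (r + d) * (\<Prod>i<d. q ^ Suc i - 1)"
proof -
 have P: "(\<Prod>i<d. 1 - 1 / q / q ^ i) * q ^ tri (Suc d) = (\<Prod>i<d. q ^ Suc i - 1)"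
 proof (induction d)
  case (Suc d)
  have f: "(1 - 1 / q / q ^ d) * q ^ Suc d = q ^ Suc d - 1" using q by (simp add: field_simps)
  have "(\<Prod>i<Suc d. 1 - 1 / q / q ^ i) * q ^ tri (Suc (Suc d)) =
   ((\<Prod>i<d. 1 - 1 / q / q ^ i) * q ^ tri (Suc d)) * ((1 - 1 / q / q ^ d) * q ^ Suc d)"
   unfolding tri_Suc[of "Suc d"] power_add[of q "tri (Suc d)"] prod.lessThan_Suc by (simp only: mult_ac)
  also have "\<dots> = (\<Prod>i<Suc d. q ^ Suc i - 1)" unfolding Suc.IH f prod.lessThan_Suc ..
  finally show ?case .
 qed (simp add: tri_Suc)
 have e: "q ^ ((r + d)\<^sup>2) = q ^ tri (r + d) * (q ^ (tri r + r * d) * q ^ r * q ^ tri (Suc d))"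
  unfolding tri_add[symmetric] power_add by (simp only: mult_ac)
 have m: "(- (1 / q)) ^ r = (- 1) ^ r / q ^ r" using power_divide[of "- 1" q r] by simp
 have gen: "t * (a * b * w) * (s / b / a * p) = s * t * (p * w)" if "a \<noteq> 0" "b \<noteq> 0" for t a b w s p :: complex
  using that by simp
 show ?thesis unfolding e co_def m P[symmetric] by (rule gen) (use q in auto)
qed

context padic_field
begin

lemma rkm_le_card:
 assumes "i0 < n" "i0 \<notin> S" "J \<subseteq> {..<n}" "C \<in> dmat n S J" shows "l ^ rkm n C \<le> l ^ card J"
proof -
 have J: "finite J" using assms(3) finite_subset by blast
 have "card {R \<in> PiE J (\<lambda>_. digits). ext n J R \<in> rs n C} \<le> card (PiE J (\<lambda>_. digits :: 'a set))"
  using J by (intro card_mono finite_PiE) auto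
 then show ?thesis unfolding card_ext_rs[OF assms] using J by (simp add: card_PiE card_digits)
qed

lemma Nr_sum: "(of_nat (Nr n S J r) :: complex) = (\<Sum>C\<in>dmat n S J. if rkm n C = r then 1 else 0)"
 unfolding Nr_def using finite_dmat[of n S J] by (simp add: sum.If_cases Int_def)

lemma Nr_rec:
 assumes i0: "i0 < n" "i0 \<notin> S" and J: "J \<subseteq> {..<n}"
 shows "(of_nat (Nr n (insert i0 S) J 0) :: complex) = of_nat (Nr n S J 0)"
  "(of_nat (Nr n (insert i0 S) J (Suc r)) :: complex) =
   of_nat l ^ Suc r * of_nat (Nr n S J (Suc r)) + (of_nat l ^ card J - of_nat l ^ r) * of_nat (Nr n S J r)"
proof -
 let ?q = "of_nat l :: complex"
 have s: "(of_nat (Nr n (insert i0 S) J r) :: complex) = (\<Sum>C\<in>dmat n S J.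
  ?q ^ rkm n C * (if rkm n C = r then 1 else 0) + (?q ^ card J - ?q ^ rkm n C) * (if Suc (rkm n C) = r then 1 else 0))" for r
  unfolding Nr_sum sum_dmat_insert[OF i0 J, of "\<lambda>x. if x = r then 1 else 0"]
  using rkm_le_card[OF i0 J] by (intro sum.cong) (simp_all add: of_nat_diff)
 show "(of_nat (Nr n (insert i0 S) J 0) :: complex) = of_nat (Nr n S J 0)"
  unfolding s unfolding Nr_sum by (intro sum.cong) auto
 have "(of_nat (Nr n (insert i0 S) J (Suc r)) :: complex) = (\<Sum>C\<in>dmat n S J.
  ?q ^ Suc r * (if rkm n C = Suc r then 1 else 0) + (?q ^ card J - ?q ^ r) * (if rkm n C = r then 1 else 0))"
  unfolding s by (intro sum.cong) auto
 then show "(of_nat (Nr n (insert i0 S) J (Suc r)) :: complex) =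
   ?q ^ Suc r * of_nat (Nr n S J (Suc r)) + (?q ^ card J - ?q ^ r) * of_nat (Nr n S J r)"
  unfolding Nr_sum by (simp only: sum.distrib sum_distrib_left)
qed

lemma Nr_rank_sum:
 assumes J: "J \<subseteq> {..<n}"
 shows "k \<le> n ==> k < r ==> (of_nat (Nr n {..<k} J r) :: complex) = 0"
  "(\<Sum>S\<in>Pow {..<n}. (\<Prod>i\<in>S. - Y / of_nat l ^ i) * of_nat (Nr n S J r)) =
   (if r \<le> n then co (of_nat l) Y r (n - r) else 0) * of_nat (Nr n {..<n} J r)"
  "1 \<le> b ==> b \<le> n ==> card J = n - b ==>
   (\<Sum>S\<in>Pow {..<n}. (\<Prod>i\<in>S. - (of_nat l ^ b / of_nat l) / of_nat l ^ i) * (of_nat (Nr n S J r) :: complex)) = 0"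
proof -
 let ?N = "\<lambda>S r. of_nat (Nr n S J r) :: complex"
 have A: "(of_nat l :: complex) \<noteq> 0" by simp
 have B: "?N {} r = (if r = 0 then 1 else 0)" for r by (simp add: Nr_empty)
 have nin: "k \<notin> S" if "S \<subseteq> {..<k}" for k :: nat and S using that by auto
 note C = Nr_rec(1)[OF _ nin J] and D = Nr_rec(2)[OF _ nin J]
 show "k \<le> n ==> k < r ==> ?N {..<k} r = 0"
  by (rule rank_large[where N = ?N and q = "of_nat l" and n = n and c = "card J", OF A B C D]) auto
 show "(\<Sum>S\<in>Pow {..<n}. (\<Prod>i\<in>S. - Y / of_nat l ^ i) * ?N S r) =
   (if r \<le> n then co (of_nat l) Y r (n - r) else 0) * ?N {..<n} r"
  by (rule rank_sum[where N = ?N and q = "of_nat l" and n = n and c = "card J", OF A B C D]) auto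
 show "(\<Sum>S\<in>Pow {..<n}. (\<Prod>i\<in>S. - (of_nat l ^ b / of_nat l) / of_nat l ^ i) * ?N S r) = 0"
  if "1 \<le> b" "b \<le> n" "card J = n - b"
  by (rule rank_sum_vanish[where N = ?N and q = "of_nat l" and n = n and c = "card J", OF A B C D that(1) that(2) that(3)]) auto
qed

text \<open>The number \<open>c\<close> is the index computed in \<open>card_rcosets\<close>. For
  \<open>r < n\<close> the product of the \<open>q ^ Suc i - 1\<close> contains
  \<open>q - 1\<close>, which cancels the denominator, and the remaining \<open>M\<close> together
  with the factor \<open>l - 1\<close> outside matches \<open>c\<close>. For \<open>r = n\<close>
  the product is empty and \<open>l - 1\<close> has to come out of \<open>M\<close>.\<close>

lemma coefficient_exists:
 assumes n: "1 \<le> n" and r: "r \<le> n"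
 defines "M \<equiv> Nr n {..<n} {..<n} r"
 shows "\<exists>b :: int. (of_int b :: complex) =
   of_nat l ^ (n\<^sup>2) / (of_nat l - 1) * (co (of_nat l) (1 / of_nat l) r (n - r) * of_nat M) \<and>
  (\<forall>c. c = (if r < n then M * (l - 1) else M) \<longrightarrow> (real l - 1) * of_int b * inverse (real c) \<in> \<int>)"
proof -
 let ?q = "of_nat l :: complex"
 have q: "?q \<noteq> 0" "?q - 1 \<noteq> 0" using l_gt_1 by auto
 have q': "real l - 1 \<noteq> 0" "real (l - 1) = real l - 1" using l_gt_1 by (auto simp: of_nat_diff)
 have gen: "x * (t * m) * inverse (m * x) = t" if "x \<noteq> 0" "m \<noteq> 0" for x t m :: real using that by (simp add: field_simps)
 obtain d where d: "n = r + d" using le_Suc_ex[OF r] by blast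
 have main: "?q ^ (n\<^sup>2) / (?q - 1) * (co ?q (1 / ?q) r (n - r) * of_nat M) =
  (- 1) ^ r * ?q ^ tri n * (\<Prod>i<d. ?q ^ Suc i - 1) * of_nat M / (?q - 1)"
  using co_one_div[OF q(1), of r d] d by simp
 show ?thesis
 proof (cases d)
  case (Suc d')
  let ?b = "(- 1) ^ r * int l ^ tri n * (\<Prod>i<d'. int l ^ Suc (Suc i) - 1) * int M"
  have "(\<Prod>i<d. ?q ^ Suc i - 1) = (?q - 1) * (\<Prod>i<d'. ?q ^ Suc (Suc i) - 1)"
   unfolding Suc prod.lessThan_Suc_shift by simp
  then have "of_int ?b = ?q ^ (n\<^sup>2) / (?q - 1) * (co ?q (1 / ?q) r (n - r) * of_nat M)"
   unfolding main using q by simp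
  moreover have "(real l - 1) * of_int ?b * inverse (real c) \<in> \<int>" if "c = (if r < n then M * (l - 1) else M)" for c
  proof (cases "M = 0")
   case False
   have "real c = real M * (real l - 1)" using that d Suc q'(2) by simp
   moreover have "(of_int ?b :: real) = of_int ((- 1) ^ r * int l ^ tri n * (\<Prod>i<d'. int l ^ Suc (Suc i) - 1)) * real M" by simp
   ultimately have "(real l - 1) * of_int ?b * inverse (real c) = of_int ((- 1) ^ r * int l ^ tri n * (\<Prod>i<d'. int l ^ Suc (Suc i) - 1))"
    by (simp only:) (rule gen, use False q' in simp_all)
   then show ?thesis by (metis Ints_of_int)
  qed simp
  ultimately show ?thesis by blast
 next
  case 0
  then have rn: "r = n" using d by simp
  obtain n' where n': "n = Suc n'" using n by (cases n) auto
  let ?M' = "Nr n {..<n'} {..<n} n'"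
  have z: "(of_nat (Nr n {..<n'} {..<n} (Suc n')) :: complex) = 0" by (rule Nr_rank_sum(1)) (use n' in auto)
  \<comment> \<open>The last row of an invertible matrix avoids the span of the others, leaving
    \<open>q ^ n - q ^ n'\<close> choices, a multiple of \<open>q - 1\<close>.\<close>
  have "(of_nat M :: complex) = (?q ^ n - ?q ^ n') * of_nat ?M'"
   using Nr_rec(2)[of n' n "{..<n'}" "{..<n}" n'] z unfolding M_def rn n' by (simp add: lessThan_Suc)
  also have "\<dots> = of_nat ((l - 1) * l ^ n' * ?M')" using l_gt_1 by (simp add: n' of_nat_diff algebra_simps)
  finally have M: "M = (l - 1) * l ^ n' * ?M'" using of_nat_eq_iff by blast
  let ?b = "(- 1) ^ r * int l ^ tri n * (int l ^ n' * int ?M')"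
  have "of_int ?b = ?q ^ (n\<^sup>2) / (?q - 1) * (co ?q (1 / ?q) r (n - r) * of_nat M)"
   unfolding main unfolding 0 M using q l_gt_1 by (simp add: of_nat_diff)
  moreover have "(real l - 1) * of_int ?b * inverse (real c) \<in> \<int>" if "c = (if r < n then M * (l - 1) else M)" for c
  proof (cases "?M' = 0")
   case False
   have "real c = real (l ^ n' * ?M') * (real l - 1)" unfolding q'(2)[symmetric] of_nat_mult[symmetric] using that rn M by simp
   moreover have "(of_int ?b :: real) = of_int ((- 1) ^ r * int l ^ tri n) * real (l ^ n' * ?M')" by simp
   ultimately have "(real l - 1) * of_int ?b * inverse (real c) = of_int ((- 1) ^ r * int l ^ tri n)"
    by (simp only:) (rule gen, use False q' l_neq_0 in simp_all)
   then show ?thesis by (metis Ints_of_int)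
  qed simp
  ultimately show ?thesis by blast
 qed
qed

section \<open>Block upper triangular matrices\<close>

definition um :: "nat => 'a mat => 'a mat"
 where "um n X = four_block_mat (1\<^sub>m n) X (0\<^sub>m n n) (1\<^sub>m n)"

abbreviation ur :: "nat => nat => 'a mat"
 where "ur n r \<equiv> um n (inverse lq \<cdot>\<^sub>m Xr n r)"

definition dg :: "nat => 'a mat => 'a mat => 'a mat"
 where "dg n A D = four_block_mat A (0\<^sub>m n n) (0\<^sub>m n n) D"

lemma fb_carrier: "A \<in> carrier_mat n n ==> D \<in> carrier_mat n n ==> four_block_mat A B C D \<in> carrier_mat (2 * n) (2 * n)"
 unfolding mult_2 by (rule four_block_carrier_mat)

lemma fb_mult:
 fixes A :: "'a mat"
 assumes "A \<in> carrier_mat n n" "B \<in> carrier_mat n n" "D \<in> carrier_mat n n"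
  "A' \<in> carrier_mat n n" "B' \<in> carrier_mat n n" "D' \<in> carrier_mat n n"
 shows "four_block_mat A B (0\<^sub>m n n) D * four_block_mat A' B' (0\<^sub>m n n) D' =
  four_block_mat (A * A') (A * B' + B * D') (0\<^sub>m n n) (D * D')"
proof -
 have c: "A * A' \<in> carrier_mat n n" "A * B' \<in> carrier_mat n n" "B * D' \<in> carrier_mat n n" "D * D' \<in> carrier_mat n n"
  using assms by auto
 show ?thesis
  using mult_four_block_mat[OF assms(1,2) zero_carrier_mat assms(3) assms(4,5) zero_carrier_mat assms(6)] assms c by simp
qed

lemma det_fb:
 fixes A :: "'a mat"
 assumes "A \<in> carrier_mat n n" "B \<in> carrier_mat n n" "D \<in> carrier_mat n n"
 shows "mdet (four_block_mat A B (0\<^sub>m n n) D) = mdet A * mdet D"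
 by (rule det_four_block_mat_lower_left_zero[OF assms(1,2) refl assms(3)])

lemma um_mult: "X \<in> carrier_mat n n ==> Y \<in> carrier_mat n n ==> um n X * um n Y = um n (X + Y)"
 unfolding um_def by (subst fb_mult) (auto simp: comm_add_mat[of _ n n])

lemma um_carrier: "um n X \<in> carrier_mat (2 * n) (2 * n)"
 unfolding um_def by (rule fb_carrier) auto

lemma um_GL: assumes "X \<in> carrier_mat n n" shows "um n X \<in> GLc (2 * n)" "minv (2 * n) (um n X) = um n (- X)"
proof -
 have z: "X + - X = 0\<^sub>m n n" using assms by (intro eq_matI) auto
 have "um n X * um n (- X) = um n (0\<^sub>m n n)" using assms um_mult[of X n "- X"] unfolding z by simp
 also have "\<dots> = 1\<^sub>m (2 * n)" unfolding um_def mult_2 by (rule four_block_one_mat)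
 finally have "um n X * um n (- X) = 1\<^sub>m (2 * n)" .
 from minv_eqI[OF um_carrier um_carrier this]
 show "um n X \<in> GLc (2 * n)" "minv (2 * n) (um n X) = um n (- X)" by auto
qed

lemma dg_um:
 assumes "A \<in> carrier_mat n n" "D \<in> carrier_mat n n" "X \<in> carrier_mat n n"
 shows "dg n A D * um n X = four_block_mat A (A * X) (0\<^sub>m n n) D"
 unfolding dg_def um_def using assms by (subst fb_mult) auto

lemma um_dg:
 assumes "A \<in> carrier_mat n n" "D \<in> carrier_mat n n" "X \<in> carrier_mat n n"
 shows "um n X * dg n A D = four_block_mat A (X * D) (0\<^sub>m n n) D"
 unfolding dg_def um_def using assms by (subst fb_mult) auto

lemma fb_eqD:
 fixes A :: "'a mat"
 assumes "four_block_mat A B C D = four_block_mat A' B' C' D'"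
  "A \<in> carrier_mat n n" "B \<in> carrier_mat n n" "D \<in> carrier_mat n n"
  "A' \<in> carrier_mat n n" "B' \<in> carrier_mat n n" "D' \<in> carrier_mat n n"
 shows "A = A'" "B = B'" "D = D'"
proof -
 note c = assms(2-7)
 have e: "four_block_mat A B C D $$ (i, j) = four_block_mat A' B' C' D' $$ (i, j)" for i j using assms(1) by simp
 show "A = A'"
 proof (rule eq_matI)
  fix i j assume "i < dim_row A'" "j < dim_col A'"
  then show "A $$ (i, j) = A' $$ (i, j)" using e[of i j] c by auto
 qed (use c in auto)
 show "B = B'"
 proof (rule eq_matI)
  fix i j assume "i < dim_row B'" "j < dim_col B'"
  then show "B $$ (i, j) = B' $$ (i, j)" using e[of i "n + j"] c by auto
 qed (use c in auto)
 show "D = D'"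
 proof (rule eq_matI)
  fix i j assume "i < dim_row D'" "j < dim_col D'"
  then show "D $$ (i, j) = D' $$ (i, j)" using e[of "n + i" "n + j"] c by auto
 qed (use c in auto)
qed

lemma dg_GL:
 assumes "A \<in> GLc n" "D \<in> GLc n" shows "dg n A D \<in> GLc (2 * n)"
 using assms det_fb[of A n "0\<^sub>m n n" D] fb_carrier[of A n D] by (simp add: dg_def GL_carrier)

lemma fb_KG_iff:
 fixes A :: "'a mat"
 assumes c: "A \<in> carrier_mat n n" "B \<in> carrier_mat n n" "D \<in> carrier_mat n n"
 shows "four_block_mat A B (0\<^sub>m n n) D \<in> KG (2 * n) \<longleftrightarrow> A \<in> KG n \<and> D \<in> KG n \<and> B \<in> int_mat n"
proof
 assume K: "four_block_mat A B (0\<^sub>m n n) D \<in> KG (2 * n)"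
 have b: "vn (four_block_mat A B (0\<^sub>m n n) D $$ (i, j)) \<le> 1" if "i < n + n" "j < n + n" for i j
  using GL_int_int[OF K] that by (auto simp: int_mat_def mult_2)
 have A: "A \<in> int_mat n" unfolding int_mat_def
 proof (intro CollectI conjI allI impI c(1))
  fix i j assume "i < n" "j < n"
  then show "vn (A $$ (i, j)) \<le> 1" using b[of i j] c by auto
 qed
 have B: "B \<in> int_mat n" unfolding int_mat_def
 proof (intro CollectI conjI allI impI c(2))
  fix i j assume "i < n" "j < n"
  then show "vn (B $$ (i, j)) \<le> 1" using b[of i "n + j"] c by auto
 qed
 have D: "D \<in> int_mat n" unfolding int_mat_def
 proof (intro CollectI conjI allI impI c(3))
  fix i j assume "i < n" "j < n"
  then show "vn (D $$ (i, j)) \<le> 1" using b[of "n + i" "n + j"] c by auto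
 qed
 have p: "vn (mdet A) * vn (mdet D) = 1"
  using K unfolding GL_int_iff det_fb[OF c] by (simp add: vn_mult)
 have le: "vn (mdet A) \<le> 1" "vn (mdet D) \<le> 1" using det_int_mat A D by blast+
 have "vn (mdet A) * vn (mdet D) \<le> vn (mdet A)"
  "vn (mdet A) * vn (mdet D) \<le> vn (mdet D)"
  using le by (simp_all add: mult_left_le mult_left_le_one_le)
 then have "vn (mdet A) = 1" "vn (mdet D) = 1" using p le by auto
 then show "A \<in> KG n \<and> D \<in> KG n \<and> B \<in> int_mat n" using A B D by (simp add: GL_int_iff)
next
 assume "A \<in> KG n \<and> D \<in> KG n \<and> B \<in> int_mat n"
 then show "four_block_mat A B (0\<^sub>m n n) D \<in> KG (2 * n)"
  unfolding mult_2 by (intro GL_int_block_upper) (auto simp: int_mat_def)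
qed

lemma g_elt_um: "g_elt l n r = (1, ur n r)"
 by (simp add: g_elt_def um_def Xr_def)

lemma Xr_carrier [simp]: "Xr n r \<in> carrier_mat n n" by (simp add: Xr_def)

end

section \<open>The index of \<open>V1\<close>\<close>

context padic_field
begin

lemma Gt_mult: "((a, g), t) \<otimes>\<^bsub>Gt n\<^esub> ((a', g'), t') = ((a * a', g * g'), t * (t' :: 'a))"
 by (simp add: Gt_def)

lemma Gt_inv:
 assumes "(a :: 'a) \<noteq> 0" "g \<in> GLc (2 * n)" "t \<noteq> 0"
 shows "inv\<^bsub>Gt n\<^esub> ((a, g), t) = ((inverse a, minv (2 * n) g), inverse t)"
 unfolding Gt_def using assms by (simp add: DirProd_group GL1_group GL_group GL1_inv)

lemma ur_GL: "ur n r \<in> GLc (2 * n)" by (rule um_GL) simp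

lemma g_elt_ur: "g_elt l n r = (1, ur n r)" by (simp add: g_elt_um)

lemma vn_div_l: "vn (inverse lq * y) \<le> 1 \<longleftrightarrow> vn y < 1"
 unfolding vn_le_iff_less vn_mult vn_inverse vn_l using l_pos by (simp add: field_simps)

lemma int_scaled:
 assumes "A \<in> carrier_mat n n" "B \<in> carrier_mat n n"
 shows "inverse lq \<cdot>\<^sub>m A + - (inverse lq \<cdot>\<^sub>m B) \<in> int_mat n \<longleftrightarrow> cong_mat n A B"
proof -
 have "(inverse lq \<cdot>\<^sub>m A + - (inverse lq \<cdot>\<^sub>m B)) $$ (i, j) = inverse lq * (A $$ (i, j) - B $$ (i, j))" if "i < n" "j < n" for i j
  using assms that by (simp add: algebra_simps)
 then show ?thesis unfolding int_mat_def cong_mat_def cong_l_def using assms by (simp add: vn_div_l)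
qed

text \<open>Conjugating \<open>diag(h1, h2)\<close> back by the unipotent matrix creates the upper
  right block \<open>(h1 X - X h2) / l\<close> with \<open>X = Xr n r\<close>, which is integral
  exactly when the two products agree modulo \<open>l\<close>.\<close>

lemma conj_ur:
 assumes h: "h1 \<in> GLc n" "h2 \<in> GLc n"
 shows "(\<exists>k\<in>KG (2 * n). dg n h1 h2 = ur n r * k * minv (2 * n) (ur n r)) \<longleftrightarrow>
  h1 \<in> KG n \<and> h2 \<in> KG n \<and> cong_mat n (h1 * Xr n r) (Xr n r * h2)"
proof -
 let ?U = "ur n r" and ?Z = "inverse lq \<cdot>\<^sub>m Xr n r"
 note hc = GL_carrier_mat[OF h(1)] GL_carrier_mat[OF h(2)]
 note Uc = GL_carrier_mat[OF ur_GL, of n r]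
 note dc = GL_carrier_mat[OF dg_GL[OF h]]
 have Zc: "?Z \<in> carrier_mat n n" by simp
 have Ui: "minv (2 * n) ?U = um n (- ?Z)" by (rule um_GL(2)[OF Zc])
 have "um n (- ?Z) * (dg n h1 h2 * ?U) = four_block_mat h1 (h1 * ?Z + - ?Z * h2) (0\<^sub>m n n) h2"
  unfolding dg_um[OF hc Zc] unfolding um_def using hc Zc by (subst fb_mult) auto
 also have "h1 * ?Z + - ?Z * h2 = inverse lq \<cdot>\<^sub>m (h1 * Xr n r) + - (inverse lq \<cdot>\<^sub>m (Xr n r * h2))"
 proof -
  have "- ?Z * h2 = - (?Z * h2)" using hc by (subst uminus_mult_left_mat) (auto simp: Xr_def)
  then show ?thesis using hc mult_smult_distrib[OF hc(1) Xr_carrier, of "inverse lq" r]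
   mult_smult_assoc_mat[OF Xr_carrier hc(2), of "inverse lq" r] by simp
 qed
 finally have e: "minv (2 * n) ?U * (dg n h1 h2 * ?U) =
  four_block_mat h1 (inverse lq \<cdot>\<^sub>m (h1 * Xr n r) + - (inverse lq \<cdot>\<^sub>m (Xr n r * h2))) (0\<^sub>m n n) h2" unfolding Ui .
 have "(\<exists>k\<in>KG (2 * n). dg n h1 h2 = ?U * k * minv (2 * n) ?U) \<longleftrightarrow> minv (2 * n) ?U * (dg n h1 h2 * ?U) \<in> KG (2 * n)"
 proof
  assume "\<exists>k\<in>KG (2 * n). dg n h1 h2 = ?U * k * minv (2 * n) ?U"
  then obtain k where k: "k \<in> KG (2 * n)" "dg n h1 h2 = ?U * k * minv (2 * n) ?U" by blast
  note kc = GL_int_carrier[OF k(1)]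
  have Ukc: "?U * k \<in> carrier_mat (2 * n) (2 * n)" using Uc kc by simp
  have "dg n h1 h2 * ?U = ?U * k" unfolding k(2) by (rule GL_cancel_right(2)[OF ur_GL Ukc])
  then show "minv (2 * n) ?U * (dg n h1 h2 * ?U) \<in> KG (2 * n)" using GL_cancel(1)[OF ur_GL kc, of r] k(1) by simp
 next
  let ?k = "minv (2 * n) ?U * (dg n h1 h2 * ?U)"
  assume "?k \<in> KG (2 * n)"
  moreover have "?U * ?k * minv (2 * n) ?U = dg n h1 h2"
   using GL_cancel(2)[OF ur_GL, of "dg n h1 h2 * ?U" n "2 * n" r] GL_cancel_right(1)[OF ur_GL dc, of r] dc Uc by simp
  ultimately show "\<exists>k\<in>KG (2 * n). dg n h1 h2 = ?U * k * minv (2 * n) ?U" by (intro bexI[of _ ?k]) simp_all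
 qed
 also have "\<dots> \<longleftrightarrow> h1 \<in> KG n \<and> h2 \<in> KG n \<and> cong_mat n (h1 * Xr n r) (Xr n r * h2)"
  unfolding e using hc by (subst fb_KG_iff) (auto simp: int_scaled)
 finally show ?thesis .
qed

text \<open>The outer components commute with everything, so conjugation by \<open>g_elt\<close>
  leaves them alone, and the last one becomes a congruence for the ratio of the
  determinants.\<close>

lemma V1_iff:
 "(a, h1, h2) \<in> V1 l n r \<longleftrightarrow> vn a = 1 \<and> h1 \<in> KG n \<and> h2 \<in> KG n \<and>
  cong_mat n (h1 * Xr n r) (Xr n r * h2) \<and> cong_l (mdet h2 / mdet h1) (1 :: 'a)"
proof -
 let ?g = "((1, ur n r), 1) :: ('a \<times> 'a mat) \<times> 'a" and ?U = "ur n r"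
 have H: "(a, h1, h2) \<in> carrier (H_grp n) \<longleftrightarrow> a \<noteq> 0 \<and> h1 \<in> GLc n \<and> h2 \<in> GLc n"
  by (simp add: H_grp_def)
 have inv: "inv\<^bsub>Gt n\<^esub> ?g = ((1, minv (2 * n) ?U), 1)" using Gt_inv[of 1 ?U n 1] ur_GL by simp
 have E: "H_emb n (a, h1, h2) = ((a, dg n h1 h2), mdet h2 / mdet h1)"
  by (simp add: H_emb_def dg_def)
 have "H_emb n (a, h1, h2) \<in> (?g <#\<^bsub>Gt n\<^esub> K1_int l n) #>\<^bsub>Gt n\<^esub> inv\<^bsub>Gt n\<^esub> ?g \<longleftrightarrow>
  (\<exists>x\<in>GL1_int. \<exists>k\<in>KG (2 * n). \<exists>t\<in>(\<lambda>x. 1 + of_nat l * x) ` Zl. H_emb n (a, h1, h2) = ((x, ?U * k * minv (2 * n) ?U), t))"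
  unfolding inv by (auto simp: l_coset_def r_coset_def K1_int_def Gt_mult)
 also have "\<dots> \<longleftrightarrow> a \<in> GL1_int \<and> (\<exists>k\<in>KG (2 * n). dg n h1 h2 = ?U * k * minv (2 * n) ?U) \<and>
  mdet h2 / mdet h1 \<in> (\<lambda>x. 1 + of_nat l * x) ` Zl"
  unfolding E by blast
 finally have "(a, h1, h2) \<in> V1 l n r \<longleftrightarrow> (a \<noteq> 0 \<and> h1 \<in> GLc n \<and> h2 \<in> GLc n) \<and> vn a = 1 \<and>
  (\<exists>k\<in>KG (2 * n). dg n h1 h2 = ?U * k * minv (2 * n) ?U) \<and> cong_l (mdet h2 / mdet h1) 1"
  unfolding V1_def g_elt_ur mem_Collect_eq H GL1_int_iff one_plus_l_Zl by simp
 also have "\<dots> \<longleftrightarrow> vn a = 1 \<and> h1 \<in> KG n \<and> h2 \<in> KG n \<and>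
  cong_mat n (h1 * Xr n r) (Xr n r * h2) \<and> cong_l (mdet h2 / mdet h1) 1"
 proof (cases "h1 \<in> GLc n \<and> h2 \<in> GLc n")
  case True
  have "vn a = 1 ==> a \<noteq> 0" by auto
  then show ?thesis using True conj_ur[of h1 n h2 r] by blast
 next
  case False
  then show ?thesis using GL_int_GL[of h1 n] GL_int_GL[of h2 n] by blast
 qed
 finally show ?thesis .
qed

lemma V1_subset: "V1 l n r \<subseteq> (H_int n :: ('a \<times> 'a mat \<times> 'a mat) set)"
 by (auto simp: V1_iff H_int_def GL1_int_iff)

text \<open>A complete invariant of the right cosets of \<open>V1\<close> with a computable set of
  values; counting these values gives the index.\<close>

definition cosmap :: "nat => nat => 'a \<times> 'a mat \<times> 'a mat => 'a mat \<times> 'a"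
 where "cosmap n r = (\<lambda>(a, h1, h2). (Matrix.mat n n (\<lambda>ij. res ((minv n h1 * Xr n r * h2) $$ ij)),
  res (mdet h2 / mdet h1)))"

lemma conj_int:
 assumes "h1 \<in> KG n" "h2 \<in> KG n" shows "minv n h1 * Xr n r * h2 \<in> int_mat n"
 using assms by (intro int_mat_mult GL_int_int GL_int_minv Xr_int)

lemma vn_det_quot: assumes "h1 \<in> KG n" "h2 \<in> KG n" shows "vn (mdet h2 / mdet h1) = 1"
 using assms by (simp add: GL_int_iff vn_divide)

lemma cosmap_eq:
 assumes "h1 \<in> KG n" "h2 \<in> KG n" "k1 \<in> KG n" "k2 \<in> KG n"
 shows "cosmap n r (a, h1, h2) = cosmap n r (b, k1, k2) \<longleftrightarrow>
  cong_mat n (minv n h1 * Xr n r * h2) (minv n k1 * Xr n r * k2) \<and>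
  cong_l (mdet h2 / mdet h1) (mdet k2 / mdet k1)"
proof -
 let ?A = "minv n h1 * Xr n r * h2" and ?B = "minv n k1 * Xr n r * k2"
 have i: "vn (?A $$ (i, j)) \<le> 1" "vn (?B $$ (i, j)) \<le> 1" if "i < n" "j < n" for i j
  using conj_int[OF assms(1,2), of r] conj_int[OF assms(3,4), of r] that by (auto simp: int_mat_def)
 have "Matrix.mat n n (\<lambda>ij. res (?A $$ ij)) = Matrix.mat n n (\<lambda>ij. res (?B $$ ij)) \<longleftrightarrow>
  (\<forall>i<n. \<forall>j<n. res (?A $$ (i, j)) = res (?B $$ (i, j)))"
 proof
  assume e: "Matrix.mat n n (\<lambda>ij. res (?A $$ ij)) = Matrix.mat n n (\<lambda>ij. res (?B $$ ij))"
  show "\<forall>i<n. \<forall>j<n. res (?A $$ (i, j)) = res (?B $$ (i, j))"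
  proof (intro allI impI)
   fix i j assume "i < n" "j < n"
   then show "res (?A $$ (i, j)) = res (?B $$ (i, j))"
    using arg_cong[OF e, of "\<lambda>M. M $$ (i, j)"] by simp
  qed
 qed (auto intro!: eq_matI)
 also have "\<dots> \<longleftrightarrow> cong_mat n ?A ?B" unfolding cong_mat_def using i by (simp add: res_eq_iff)
 finally show ?thesis using vn_det_quot[OF assms(1,2)] vn_det_quot[OF assms(3,4)] by (simp add: cosmap_def res_eq_iff)
qed

lemma cong_conj:
 assumes P: "P \<in> KG n" and B: "B \<in> KG n" and A: "A \<in> int_mat n" "A' \<in> int_mat n" "cong_mat n A A'"
 shows "cong_mat n (P * A * B) (P * A' * B)"
proof -
 note c = GL_int_carrier[OF P] GL_int_carrier[OF B] int_mat_carrier[OF A(1)] int_mat_carrier[OF A(2)]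
 have "cong_mat n (P * A) (P * A')"
  by (rule cong_mat_mult[OF cong_mat_refl A(3) GL_int_int[OF P] A(1) c(1,4)])
 then show ?thesis
  by (rule cong_mat_mult[OF _ cong_mat_refl int_mat_mult[OF GL_int_int[OF P] A(2)] GL_int_int[OF B]]) (use c in simp_all)
qed

lemma cong_l_quot:
 assumes "cong_l x y" "vn y = 1" shows "cong_l (x / y) 1"
proof -
 have "x / y - 1 = (x - y) / y" using assms(2) by (cases "y = 0") (auto simp: field_simps)
 then show ?thesis using assms unfolding cong_l_def by (simp add: vn_divide)
qed

lemma H_mult: "(a, h1, h2) \<otimes>\<^bsub>(H_grp n)\<lparr>carrier := X\<rparr>\<^esub> (b, k1, k2) = ((a :: 'a) * b, h1 * k1, h2 * k2)"
 by (simp add: H_grp_def)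

text \<open>The first condition in \<open>V1_iff\<close> says that \<open>(h1, h2)\<close> fixes
  \<open>Xr n r\<close> modulo \<open>l\<close> under the action \<open>X -> h1^-1 X h2\<close>, and
  the second that it lies in the kernel of the determinant ratio modulo \<open>l\<close>. Cosets of
  a stabiliser are the fibres of the orbit map.\<close>

lemma V1_coset:
 assumes h: "h \<in> H_int n"
 shows "V1 l n r #>\<^bsub>(H_grp n)\<lparr>carrier := H_int n\<rparr>\<^esub> h = {h' \<in> H_int n. cosmap n r h' = cosmap n r h}" (is "?L = ?R")
proof -
 obtain a h1 h2 where hh: "h = (a, h1, h2)" by (metis prod_cases3)
 have a: "vn a = 1" and K: "h1 \<in> KG n" "h2 \<in> KG n" using h unfolding hh by (auto simp: H_int_def GL1_int_iff)
 note c = GL_int_carrier[OF K(1)] GL_int_carrier[OF K(2)]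
 note Ki = GL_int_minv[OF K(1)] GL_int_minv[OF K(2)]
 note ci = GL_int_carrier[OF Ki(1)] GL_int_carrier[OF Ki(2)]
 note G = GL_int_GL[OF K(1)] GL_int_GL[OF K(2)]
 show ?thesis
 proof (intro equalityI subsetI)
  fix x assume "x \<in> ?L"
  then obtain v where v: "v \<in> V1 l n r" "x = v \<otimes>\<^bsub>(H_grp n)\<lparr>carrier := H_int n\<rparr>\<^esub> h" by (auto simp: r_coset_def)
  obtain b k1 k2 where vv: "v = (b, k1, k2)" by (metis prod_cases3)
  have x: "x = (b * a, k1 * h1, k2 * h2)" using v(2) unfolding vv hh H_mult .
  have k: "vn b = 1" "k1 \<in> KG n" "k2 \<in> KG n" "cong_mat n (k1 * Xr n r) (Xr n r * k2)"
   "cong_l (mdet k2 / mdet k1) 1" using v(1) unfolding vv V1_iff by auto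
  note kc = GL_int_carrier[OF k(2)] GL_int_carrier[OF k(3)] GL_int_carrier[OF GL_int_minv[OF k(2)]]
  have xK: "k1 * h1 \<in> KG n" "k2 * h2 \<in> KG n" using k K by (auto intro: GL_int_mult)
  have "cong_mat n (minv n k1 * (k1 * Xr n r)) (minv n k1 * (Xr n r * k2))"
   by (rule cong_mat_mult[OF cong_mat_refl k(4) GL_int_int[OF GL_int_minv[OF k(2)]]
    int_mat_mult[OF GL_int_int[OF k(2)] Xr_int] kc(3)]) (use kc in simp)
  then have "cong_mat n (Xr n r) (minv n k1 * (Xr n r * k2))" using GL_cancel(1)[OF GL_int_GL[OF k(2)] Xr_carrier] by simp
  from cong_conj[OF Ki(1) K(2) Xr_int _ this] have
   "cong_mat n (minv n h1 * Xr n r * h2) (minv n h1 * (minv n k1 * (Xr n r * k2)) * h2)"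
   by (simp add: int_mat_mult GL_int_int GL_int_minv k Xr_int)
  moreover have "minv n h1 * (minv n k1 * (Xr n r * k2)) * h2 = minv n (k1 * h1) * Xr n r * (k2 * h2)"
   unfolding minv_mult[OF GL_int_GL[OF k(2)] G(1)] using c ci kc by (simp add: assoc_mult_mat[of _ n n _ n _ n])
  moreover have "cong_l (mdet (k2 * h2) / mdet (k1 * h1)) (mdet h2 / mdet h1)"
  proof -
   have "mdet (k2 * h2) / mdet (k1 * h1) =
    (mdet k2 / mdet k1) * (mdet h2 / mdet h1)"
    using det_mult[OF kc(2) c(2)] det_mult[OF kc(1) c(1)] by simp
   moreover have "cong_l ((mdet k2 / mdet k1) * (mdet h2 / mdet h1))
    (1 * (mdet h2 / mdet h1))"
    by (rule cong_l_mult[OF k(5) cong_l_refl]) (use vn_det_quot[OF K] in auto)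
   ultimately show ?thesis by simp
  qed
  ultimately have "cosmap n r x = cosmap n r h" unfolding x hh cosmap_eq[OF xK K]
   by (simp add: cong_mat_sym)
  moreover have "x \<in> H_int n" using xK k(1) a unfolding x by (simp add: H_int_def GL1_int_iff vn_mult)
  ultimately show "x \<in> ?R" by simp
 next
  fix x assume "x \<in> ?R"
  then have xi: "x \<in> H_int n" and e: "cosmap n r x = cosmap n r h" by auto
  obtain b k1 k2 where x: "x = (b, k1, k2)" by (metis prod_cases3)
  have k: "vn b = 1" "k1 \<in> KG n" "k2 \<in> KG n" using xi unfolding x by (auto simp: H_int_def GL1_int_iff)
  note kc = GL_int_carrier[OF k(2)] GL_int_carrier[OF k(3)] GL_int_carrier[OF GL_int_minv[OF k(2)]]
  have ce: "cong_mat n (minv n k1 * Xr n r * k2) (minv n h1 * Xr n r * h2)"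
   "cong_l (mdet k2 / mdet k1) (mdet h2 / mdet h1)"
   using e unfolding x hh cosmap_eq[OF k(2,3) K] by auto
  let ?v = "(b / a, k1 * minv n h1, k2 * minv n h2)"
  have vK: "k1 * minv n h1 \<in> KG n" "k2 * minv n h2 \<in> KG n" using k Ki by (auto intro: GL_int_mult)
  have "cong_mat n (k1 * (minv n k1 * Xr n r * k2) * minv n h2) (k1 * (minv n h1 * Xr n r * h2) * minv n h2)"
   by (rule cong_conj[OF k(2) Ki(2) conj_int[OF k(2,3)] conj_int[OF K] ce(1)])
  moreover have "k1 * (minv n k1 * Xr n r * k2) * minv n h2 = Xr n r * (k2 * minv n h2)"
   using kc ci GL_cancel(2)[OF GL_int_GL[OF k(2)], of "Xr n r * (k2 * minv n h2)" n]
   by (simp add: assoc_mult_mat[of _ n n _ n _ n])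
  moreover have "k1 * (minv n h1 * Xr n r * h2) * minv n h2 = k1 * minv n h1 * Xr n r"
   using kc c ci minv(2)[OF G(2)] right_mult_one_mat[OF Xr_carrier, of n r] by (simp add: assoc_mult_mat[of _ n n _ n _ n])
  ultimately have m: "cong_mat n (k1 * minv n h1 * Xr n r) (Xr n r * (k2 * minv n h2))" using cong_mat_sym by metis
  have "mdet (k2 * minv n h2) / mdet (k1 * minv n h1) =
   (mdet k2 / mdet k1) / (mdet h2 / mdet h1)"
   using det_mult[OF kc(2) ci(2)] det_mult[OF kc(1) ci(1)] det_minv[OF G(1)] det_minv[OF G(2)] by (simp add: field_simps)
  then have "cong_l (mdet (k2 * minv n h2) / mdet (k1 * minv n h1)) 1"
   using cong_l_quot[OF ce(2) vn_det_quot[OF K]] by simp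
  then have "?v \<in> V1 l n r" unfolding V1_iff using m vK k(1) a by (simp add: vn_divide)
  moreover have "?v \<otimes>\<^bsub>(H_grp n)\<lparr>carrier := H_int n\<rparr>\<^esub> h = x"
  proof -
   have "a \<noteq> 0" using a by auto
   then show ?thesis unfolding x hh H_mult using GL_cancel_right(2)[OF G(1) kc(1)] GL_cancel_right(2)[OF G(2) kc(2)] by simp
  qed
  ultimately show "x \<in> ?L" unfolding r_coset_def by blast
 qed
qed

lemma cosmap_I:
 assumes K: "h1 \<in> KG n" "h2 \<in> KG n" and C: "C \<in> dmat n {..<n} {..<n}" "cong_mat n C (minv n h1 * Xr n r * h2)"
  and t: "t \<in> digits" "cong_l (mdet h2 / mdet h1) t"
 shows "cosmap n r (a, h1, h2) = (C, t)"
proof -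
 have "Matrix.mat n n (\<lambda>ij. res ((minv n h1 * Xr n r * h2) $$ ij)) = C"
 proof (rule eq_matI)
  fix i j assume "i < dim_row C" "j < dim_col C"
  then have ij: "i < n" "j < n" using dmat_D(1)[OF C(1)] by auto
  have "res ((minv n h1 * Xr n r * h2) $$ (i, j)) = C $$ (i, j)"
  proof (rule res_eqI)
   show "vn ((minv n h1 * Xr n r * h2) $$ (i, j)) \<le> 1" using conj_int[OF K, of r] ij unfolding int_mat_def by blast
   show "cong_l ((minv n h1 * Xr n r * h2) $$ (i, j)) (C $$ (i, j))"
    using cong_mat_sym[OF C(2)] ij unfolding cong_mat_def by blast
  qed (rule dmat_digits[OF C(1) ij])
  then show "Matrix.mat n n (\<lambda>ij. res ((minv n h1 * Xr n r * h2) $$ ij)) $$ (i, j) = C $$ (i, j)" using ij by simp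
 qed (use dmat_D(1)[OF C(1)] in auto)
 then show ?thesis using res_eqI[OF _ t] vn_det_quot[OF K] by (simp add: cosmap_def)
qed

lemma cosmap_D:
 assumes h: "h \<in> H_int n" and e: "cosmap n r h = (C, t)" and r: "r \<le> n"
 shows "C \<in> dmat n {..<n} {..<n}" "rkm n C = r" "t \<in> digits - {0}"
  "r = n ==> cong_l t (mdet C)"
proof -
 obtain a h1 h2 where hh: "h = (a, h1, h2)" by (metis prod_cases3)
 have K: "h1 \<in> KG n" "h2 \<in> KG n" using h unfolding hh by (auto simp: H_int_def)
 let ?A = "minv n h1 * Xr n r * h2" and ?t = "mdet h2 / mdet h1"
 have Ce: "C = Matrix.mat n n (\<lambda>ij. res (?A $$ ij))" and te: "t = res ?t" using e unfolding hh cosmap_def by auto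
 note Ai = conj_int[OF K, of r]
 have vA: "vn (?A $$ (i, j)) \<le> 1" if "i < n" "j < n" for i j using Ai that by (auto simp: int_mat_def)
 show C: "C \<in> dmat n {..<n} {..<n}" unfolding Ce dmat_def using res(1)[OF vA] by auto
 have cg: "cong_mat n C ?A" unfolding cong_mat_def Ce using res(2)[OF vA] by (auto intro: cong_l_sym)
 have "has_rank n C r" unfolding has_rank_def using r cg GL_int_minv[OF K(1)] K(2) by blast
 then show "rkm n C = r" by (rule rkm_eqI[OF dmat_int[OF C]])
 have v: "vn ?t = 1" by (rule vn_det_quot[OF K])
 have tc: "cong_l ?t t" "t \<in> digits" unfolding te using res[of ?t] v by auto
 have "t \<noteq> 0" using tc(1) v by (auto simp: cong_l_def)
 then show "t \<in> digits - {0}" using tc by simp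
 show "cong_l t (mdet C)" if "r = n"
 proof -
  have "Xr n r = 1\<^sub>m n" using that by (intro eq_matI) (auto simp: Xr_def)
  then have "?A = minv n h1 * h2" using GL_int_carrier[OF GL_int_minv[OF K(1)]] by simp
  then have "mdet ?A = ?t"
   using det_mult[OF GL_int_carrier[OF GL_int_minv[OF K(1)]] GL_int_carrier[OF K(2)]] det_minv[OF GL_int_GL[OF K(1)]]
   by (simp add: field_simps)
  then have "cong_l (mdet C) ?t" using cong_det[OF cg Ai dmat_D(1)[OF C]] by simp
  then show ?thesis using tc(1) cong_l_sym cong_l_trans by blast
 qed
qed

text \<open>For \<open>r < n\<close> the last column of \<open>Xr n r\<close> is zero, so the last
  diagonal entry of \<open>h2\<close> can be changed by a unit without affecting the matrix; hence
  the determinant ratio is independent of it.\<close>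

lemma cosmap_image_lt:
 assumes r: "r < n"
 shows "cosmap n r ` H_int n = {C \<in> dmat n {..<n} {..<n}. rkm n C = r} \<times> (digits - {0})"
proof (intro equalityI subsetI)
 fix y assume "y \<in> cosmap n r ` H_int n"
 then obtain h where h: "h \<in> H_int n" "cosmap n r h = y" by blast
 obtain C t where y: "y = (C, t)" by fastforce
 show "y \<in> {C \<in> dmat n {..<n} {..<n}. rkm n C = r} \<times> (digits - {0})"
  using cosmap_D[OF h(1) h(2)[unfolded y]] r unfolding y by simp
next
 fix y assume "y \<in> {C \<in> dmat n {..<n} {..<n}. rkm n C = r} \<times> (digits - {0 :: 'a})"
 then obtain C t where y: "y = (C, t)" and C: "C \<in> dmat n {..<n} {..<n}" "rkm n C = r" and t: "t \<in> digits" "t \<noteq> 0" by blast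
 obtain P B where PB: "P \<in> KG n" "B \<in> KG n" "cong_mat n C (P * Xr n r * B)"
  using rkm[OF dmat_int[OF C(1)]] C(2) by (auto simp: has_rank_def)
 let ?h1 = "minv n P"
 have vt: "vn t = 1"
 proof -
  have "\<not> cong_l t 0" using digit_cong_eq[OF t(1) zero_digit] t(2) by blast
  then show ?thesis using digits_vn[OF t(1)] by (simp add: cong_l_def)
 qed
 \<comment> \<open>Chosen so that scaling by \<open>u\<close> makes the ratio of determinants equal
   to \<open>t\<close>.\<close>
 define u where "u = t * mdet ?h1 / mdet B"
 have dets: "vn (mdet ?h1) = 1" "vn (mdet B) = 1"
  using GL_int_minv[OF PB(1)] PB(2) by (auto simp: GL_int_iff)
 then have d0: "mdet ?h1 \<noteq> 0" "mdet B \<noteq> 0" by auto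
 have u: "vn u = 1" unfolding u_def using dets vt by (simp add: vn_mult vn_divide)
 let ?D = "mat_diag n (\<lambda>i. if i = n - 1 then u else 1)"
 have dD: "mdet ?D = u"
  unfolding det_mat_diag using r by (subst prod.delta) auto
 have D: "?D \<in> KG n" unfolding GL_int_iff dD using u by (auto simp: int_mat_def mat_diag_def)
 note c = GL_int_carrier[OF PB(1)] GL_int_carrier[OF PB(2)] GL_int_carrier[OF D]
 have XD: "Xr n r * ?D = Xr n r"
 proof (rule eq_matI)
  fix i j assume "i < dim_row (Xr n r)" "j < dim_col (Xr n r)"
  then have ij: "i < n" "j < n" by (auto simp: Xr_def)
  have "(Xr n r * ?D) $$ (i, j) = (\<Sum>p<n. Xr n r $$ (i, p) * ?D $$ (p, j))"
   by (rule mat_mult_index[OF Xr_carrier c(3) ij])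
  also have "\<dots> = (\<Sum>p<n. if p = j then Xr n r $$ (i, j) else 0)"
   using ij r by (intro sum.cong) (auto simp: mat_diag_def Xr_def)
  finally show "(Xr n r * ?D) $$ (i, j) = Xr n r $$ (i, j)" using ij by simp
 qed (auto simp: Xr_def mat_diag_def)
 let ?h2 = "?D * B"
 have K: "?h1 \<in> KG n" "?h2 \<in> KG n" using PB D by (auto intro: GL_int_minv GL_int_mult)
 have "minv n ?h1 * Xr n r * ?h2 = P * (Xr n r * ?D) * B"
  unfolding minv_minv[OF GL_int_GL[OF PB(1)]] using c by (simp add: assoc_mult_mat[of _ n n _ n _ n])
 then have "cong_mat n C (minv n ?h1 * Xr n r * ?h2)" unfolding XD using PB(3) by simp
 moreover have "mdet ?h2 / mdet ?h1 = t"
 proof -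
  have "mdet ?h2 = u * mdet B" using det_mult[OF c(3,2)] dD by simp
  then have "mdet ?h2 = t * mdet ?h1" using d0 by (simp add: u_def)
  then show ?thesis using d0 by simp
 qed
 ultimately have e: "cosmap n r (1, ?h1, ?h2) = (C, t)" using cosmap_I[OF K C(1) _ t(1)] by simp
 have "(1, ?h1, ?h2) \<in> H_int n" using K by (simp add: H_int_def GL1_int_iff)
 then show "y \<in> cosmap n r ` H_int n" unfolding y e[symmetric] by (rule imageI)
qed

text \<open>For \<open>r = n\<close> the first component is \<open>h1^-1 h2\<close> modulo
  \<open>l\<close>, whose determinant is the second component. This is why the factor
  \<open>l - 1\<close> is missing in the index.\<close>

lemma cosmap_image_n:
 "bij_betw fst (cosmap n n ` H_int n) {C \<in> dmat n {..<n} {..<n}. rkm n C = n}"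
 unfolding bij_betw_def
proof (intro conjI equalityI subsetI)
 show "inj_on fst (cosmap n n ` H_int n)"
 proof (rule inj_onI)
  fix y y' assume "y \<in> cosmap n n ` H_int n" "y' \<in> cosmap n n ` H_int n" and e: "fst y = fst y'"
  then obtain h h' where h: "h \<in> H_int n" "cosmap n n h = y" "h' \<in> H_int n" "cosmap n n h' = y'" by blast
  obtain C t t' where y: "y = (C, t)" "y' = (C, t')" using e by (metis fst_conv surj_pair)
  have "cong_l t (mdet C)" "cong_l t' (mdet C)" "t \<in> digits" "t' \<in> digits"
   using cosmap_D(3,4)[OF h(1) h(2)[unfolded y]] cosmap_D(3,4)[OF h(3) h(4)[unfolded y]] by auto
  then have "t = t'" using digit_cong_eq cong_l_sym cong_l_trans by metis
  then show "y = y'" by (simp add: y)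
 qed
next
 fix C assume "C \<in> fst ` cosmap n n ` H_int n"
 then obtain h where h: "h \<in> H_int n" "C = fst (cosmap n n h)" by blast
 obtain t where "cosmap n n h = (C, t)" using h(2) by (metis prod.collapse)
 then show "C \<in> {C \<in> dmat n {..<n} {..<n}. rkm n C = n}" using cosmap_D(1,2)[OF h(1)] by blast
next
 fix C assume "C \<in> {C \<in> dmat n {..<n} {..<n}. rkm n C = n}"
 then have C: "C \<in> dmat n {..<n} {..<n}" "rkm n C = n" by auto
 obtain P B where PB: "P \<in> KG n" "B \<in> KG n" "cong_mat n C (P * Xr n n * B)"
  using rkm[OF dmat_int[OF C(1)]] C(2) by (auto simp: has_rank_def)
 let ?h1 = "minv n P"
 have K: "?h1 \<in> KG n" by (rule GL_int_minv[OF PB(1)])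
 let ?t = "mdet B / mdet ?h1"
 have t: "res ?t \<in> digits" "cong_l ?t (res ?t)" using res[of ?t] vn_det_quot[OF K PB(2)] by auto
 have "cosmap n n (1, ?h1, B) = (C, res ?t)"
  by (rule cosmap_I[OF K PB(2) C(1) _ t]) (use PB(3) minv_minv[OF GL_int_GL[OF PB(1)]] in simp)
 moreover have "(1, ?h1, B) \<in> H_int n" using K PB by (simp add: H_int_def GL1_int_iff)
 ultimately show "C \<in> fst ` cosmap n n ` H_int n" by (metis fst_conv imageI)
qed

lemma card_rcosets:
 assumes r: "r \<le> n"
 shows "finite (rcosets\<^bsub>(H_grp n)\<lparr>carrier := H_int n\<rparr>\<^esub> (V1 l n r :: ('a \<times> 'a mat \<times> 'a mat) set))"
  "card (rcosets\<^bsub>(H_grp n)\<lparr>carrier := H_int n\<rparr>\<^esub> (V1 l n r :: ('a \<times> 'a mat \<times> 'a mat) set)) =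
   (if r < n then Nr n {..<n} {..<n} r * (l - 1) else Nr n {..<n} {..<n} r)"
proof -
 let ?T = "cosmap n r ` H_int n"
 have "rcosets\<^bsub>(H_grp n)\<lparr>carrier := H_int n\<rparr>\<^esub> (V1 l n r :: ('a \<times> 'a mat \<times> 'a mat) set) =
  (\<lambda>h. V1 l n r #>\<^bsub>(H_grp n)\<lparr>carrier := H_int n\<rparr>\<^esub> h) ` H_int n" by (auto simp: RCOSETS_def)
 also have "\<dots> = (\<lambda>h. {h' \<in> H_int n. cosmap n r h' = cosmap n r h}) ` H_int n"
  by (rule image_cong[OF refl V1_coset])
 also have "\<dots> = (\<lambda>t. {h' \<in> H_int n. cosmap n r h' = t}) ` ?T" by (simp add: image_image)
 finally have e: "rcosets\<^bsub>(H_grp n)\<lparr>carrier := H_int n\<rparr>\<^esub> (V1 l n r :: ('a \<times> 'a mat \<times> 'a mat) set) =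
  (\<lambda>t. {h' \<in> H_int n. cosmap n r h' = t}) ` ?T" .
 have inj: "inj_on (\<lambda>t. {h' \<in> H_int n. cosmap n r h' = t}) ?T"
 proof (rule inj_onI)
  fix t t' assume "t \<in> ?T" and e: "{h' \<in> H_int n. cosmap n r h' = t} = {h' \<in> H_int n. cosmap n r h' = t'}"
  then obtain h where "h \<in> {h' \<in> H_int n. cosmap n r h' = t}" by blast
  then show "t = t'" using e by blast
 qed
 have "finite ?T \<and> card ?T = (if r < n then Nr n {..<n} {..<n} r * (l - 1) else Nr n {..<n} {..<n} r)"
 proof (cases "r < n")
  case True
  have "card (digits - {0 :: 'a}) = l - 1" by (simp add: card_digits)
  then show ?thesis unfolding cosmap_image_lt[OF True] using True finite_dmat by (simp add: card_cartesian_product Nr_def)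
 next
  case False
  then have rn: "r = n" using r by simp
  note b = cosmap_image_n[of n]
  have "finite {C \<in> dmat n {..<n} {..<n}. rkm n C = n}" using finite_dmat by simp
  then show ?thesis using bij_betw_finite[OF b] bij_betw_same_card[OF b] unfolding rn by (simp add: Nr_def)
 qed
 then have fin: "finite ?T" and cT: "card ?T = (if r < n then Nr n {..<n} {..<n} r * (l - 1) else Nr n {..<n} {..<n} r)"
  by blast+
 show "finite (rcosets\<^bsub>(H_grp n)\<lparr>carrier := H_int n\<rparr>\<^esub> (V1 l n r :: ('a \<times> 'a mat \<times> 'a mat) set))"
  unfolding e by (rule finite_imageI[OF fin])
 show "card (rcosets\<^bsub>(H_grp n)\<lparr>carrier := H_int n\<rparr>\<^esub> (V1 l n r :: ('a \<times> 'a mat \<times> 'a mat) set)) =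
   (if r < n then Nr n {..<n} {..<n} r * (l - 1) else Nr n {..<n} {..<n} r)"
  unfolding e card_image[OF inj] by (rule cT)
qed

end

section \<open>The action of sums of cosets\<close>

text \<open>Around any point, intersecting the given sets that contain it with the complements of
  the others gives a neighbourhood on which all indicators are constant.\<close>

lemma clopen_step_loc_const_compact_supp:
 assumes I: "finite I" and C: "\<And>r. r \<in> I ==> openin T (C r) \<and> closedin T (C r) \<and> compactin T (C r)"
 shows "loc_const_compact_supp T (\<lambda>g. \<Sum>r\<in>I. b r * indicator (C r) g :: int)"
proof -
 let ?f = "\<lambda>g. \<Sum>r\<in>I. b r * indicator (C r) g :: int"
 have "openin T {x \<in> topspace T. ?f x \<in> U}" for U
 proof (subst openin_subopen, intro ballI)
  fix x assume x: "x \<in> {x \<in> topspace T. ?f x \<in> U}"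
  let ?N = "(\<Inter>r\<in>I. if x \<in> C r then C r else topspace T - C r) \<inter> topspace T"
  have 1: "openin T ?N" using C by (intro openin_INT I) auto
  have 2: "x \<in> ?N" using x by auto
  have 3: "?f y = ?f x" if y: "y \<in> ?N" for y
  proof (rule sum.cong[OF refl])
   fix r assume "r \<in> I"
   then have "y \<in> (if x \<in> C r then C r else topspace T - C r)" using y by blast
   then show "b r * indicator (C r) y = b r * (indicator (C r) x :: int)" by (auto simp: indicator_def split: if_splits)
  qed
  have "?N \<subseteq> {x \<in> topspace T. ?f x \<in> U}"
  proof
   fix y assume y: "y \<in> ?N"
   then have "y \<in> topspace T" by blast
   moreover have "?f y \<in> U" using 3[OF y] x by (simp only: mem_Collect_eq)
   ultimately show "y \<in> {x \<in> topspace T. ?f x \<in> U}" by (simp only: mem_Collect_eq)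
  qed
  then show "\<exists>N. openin T N \<and> x \<in> N \<and> N \<subseteq> {x \<in> topspace T. ?f x \<in> U}" using 1 2 by (intro exI conjI)
 qed
 then have "continuous_map T (discrete_topology UNIV) ?f" by (simp add: continuous_map_def)
 moreover have "compactin T (T closure_of {g \<in> topspace T. ?f g \<noteq> 0})"
 proof (rule closed_compactin)
  show "compactin T (\<Union>(C ` I))" using C I by (intro compactin_Union) auto
  show "T closure_of {g \<in> topspace T. ?f g \<noteq> 0} \<subseteq> \<Union>(C ` I)"
  proof (rule closure_of_minimal)
   show "{g \<in> topspace T. ?f g \<noteq> 0} \<subseteq> \<Union>(C ` I)"
   proof
    fix g assume "g \<in> {g \<in> topspace T. ?f g \<noteq> 0}"
    then have "?f g \<noteq> 0" by simp
    then obtain r where "r \<in> I" "b r * (indicator (C r) g :: int) \<noteq> 0" by (meson sum.not_neutral_contains_not_neutral)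
    then show "g \<in> \<Union>(C ` I)" by (auto simp: indicator_def split: if_splits)
   qed
   show "closedin T (\<Union>(C ` I))" using C I by (intro closedin_Union) auto
  qed
 qed simp
 ultimately show ?thesis by (simp add: loc_const_compact_supp_def)
qed

text \<open>As \<open>hecke_act\<close> sums over the values of the integrand, cosets on which it
  takes equal values are merged there. Each coset has measure 1 by invariance, so the measure of a
  level set counts its cosets, and regrouping gives the sum over \<open>I\<close>.\<close>

lemma hecke_act_cosets:
 fixes I :: "'i set"
 assumes haar: "haar_measure G T K \<mu>" and vs: "vector_space smul" and I: "finite I"
  and K: "openin T K" "K \<subseteq> carrier G" "K \<noteq> {}" and g: "\<And>r. r \<in> I ==> g r \<in> carrier G"
  and C: "\<And>r. r \<in> I ==> openin T (g r <#\<^bsub>G\<^esub> K)" "\<And>r. r \<in> I ==> g r <#\<^bsub>G\<^esub> K \<subseteq> carrier G"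
  and dis: "\<And>r s. r \<in> I ==> s \<in> I ==> r \<noteq> s ==> (g r <#\<^bsub>G\<^esub> K) \<inter> (g s <#\<^bsub>G\<^esub> K) = {}"
  and w: "\<And>r x. r \<in> I ==> x \<in> g r <#\<^bsub>G\<^esub> K ==> \<tau> x v = w r"
 shows "hecke_act smul \<mu> \<tau> (\<lambda>x. \<Sum>r\<in>I. b r * indicator (g r <#\<^bsub>G\<^esub> K) x) v = (\<Sum>r\<in>I. smul (of_int (b r)) (w r))"
proof -
 interpret VS: vector_space smul by (rule vs)
 let ?C = "\<lambda>r. g r <#\<^bsub>G\<^esub> K" and ?f = "\<lambda>x. \<Sum>r\<in>I. b r * indicator (g r <#\<^bsub>G\<^esub> K) x :: int"
 let ?F = "\<lambda>x. smul (of_int (?f x)) (\<tau> x v)" and ?y = "\<lambda>r. smul (of_int (b r)) (w r)"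
 have sp: "space \<mu> = carrier G" and st: "sets \<mu> = sigma_sets (carrier G) {U. openin T U}"
  and inv: "\<And>h A. h \<in> carrier G ==> A \<in> sets \<mu> ==> emeasure \<mu> (h <#\<^bsub>G\<^esub> A) = emeasure \<mu> A" and one: "emeasure \<mu> K = 1"
  using haar by (auto simp: haar_measure_def)
 have op: "U \<in> sets \<mu>" if "openin T U" for U unfolding st using that by (intro sigma_sets.Basic) simp
 have mC: "emeasure \<mu> (?C r) = 1" if "r \<in> I" for r using inv[OF g[OF that] op[OF K(1)]] one by simp
 have Fin: "?F x = ?y r" if "r \<in> I" "x \<in> ?C r" for r x
 proof -
  have "?f x = (\<Sum>s\<in>I. if s = r then b r else 0)"
   using dis[of r] that by (intro sum.cong) (auto simp: indicator_def)
  then have "?f x = b r" using I that(1) by simp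
  then show ?thesis using w[OF that] by simp
 qed
 have Fout: "?F x = 0" if "\<And>r. r \<in> I ==> x \<notin> ?C r" for x
 proof -
  have "?f x = 0" using that by (intro sum.neutral) (auto simp: indicator_def)
  then show ?thesis by simp
 qed
 have ne: "\<exists>x. x \<in> ?C r" for r using K(3) by (auto simp: l_coset_def)
 have img: "?F ` space \<mu> - {0} = ?y ` I - {0}"
 proof (intro equalityI subsetI)
  fix z assume "z \<in> ?F ` space \<mu> - {0}"
  then obtain x where x: "z = ?F x" "z \<noteq> 0" by blast
  then obtain r where r: "r \<in> I" "x \<in> ?C r" using Fout by blast
  show "z \<in> ?y ` I - {0}" using Fin[OF r] x r(1) by auto
 next
  fix z assume z: "z \<in> ?y ` I - {0}"
  then obtain r where r: "r \<in> I" "z = ?y r" by blast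
  obtain x where x: "x \<in> ?C r" using ne by blast
  have "x \<in> space \<mu>" using C(2)[OF r(1)] x sp by blast
  then show "z \<in> ?F ` space \<mu> - {0}" using Fin[OF r(1) x] r(2) z by (metis (no_types, lifting) DiffD2 DiffI image_eqI)
 qed
 have meas: "measure \<mu> {x \<in> space \<mu>. ?F x = z} = card {r \<in> I. ?y r = z}" if z: "z \<noteq> 0" for z
 proof -
  let ?J = "{r \<in> I. ?y r = z}"
  have "{x \<in> space \<mu>. ?F x = z} = (\<Union>r\<in>?J. ?C r)"
  proof (intro equalityI subsetI)
   fix x assume x: "x \<in> {x \<in> space \<mu>. ?F x = z}"
   then have Fx: "?F x = z" by simp
   then obtain r where r: "r \<in> I" "x \<in> ?C r" using Fout[of x] z by blast
   then show "x \<in> (\<Union>r\<in>?J. ?C r)" using Fin[OF r] Fx by auto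
  next
   fix x assume "x \<in> (\<Union>r\<in>?J. ?C r)"
   then obtain r where r: "r \<in> I" "?y r = z" "x \<in> ?C r" by blast
   show "x \<in> {x \<in> space \<mu>. ?F x = z}" using Fin[OF r(1,3)] r(2) C(2)[OF r(1)] r(3) sp by auto
  qed
  also have "measure \<mu> (\<Union>r\<in>?J. ?C r) = (\<Sum>r\<in>?J. measure \<mu> (?C r))"
  proof (rule measure_finite_Union)
   show "disjoint_family_on ?C ?J" using dis by (auto simp: disjoint_family_on_def)
  qed (use I op C mC in auto)
  also have "\<dots> = (\<Sum>r\<in>?J. 1)" using mC by (intro sum.cong) (auto simp: measure_def)
  finally show ?thesis by simp
 qed
 have sc: "finite A ==> smul (of_nat (card A)) z = (\<Sum>r\<in>A. z)" for A :: "'i set" and z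
  by (induction A rule: finite_induct) (simp_all add: VS.scale_left_distrib)
 have "hecke_act smul \<mu> \<tau> ?f v = (\<Sum>z\<in>?y ` I - {0}. smul (of_real (measure \<mu> {x \<in> space \<mu>. ?F x = z})) z)"
  unfolding hecke_act_def Let_def img ..
 also have "\<dots> = (\<Sum>z\<in>?y ` I - {0}. \<Sum>r\<in>{r \<in> I. ?y r = z}. ?y r)"
 proof (rule sum.cong[OF refl])
  fix z assume "z \<in> ?y ` I - {0}"
  then have "smul (of_real (measure \<mu> {x \<in> space \<mu>. ?F x = z})) z = (\<Sum>r\<in>{r \<in> I. ?y r = z}. z)"
   using meas[of z] sc[of "{r \<in> I. ?y r = z}" z] I by simp
  also have "\<dots> = (\<Sum>r\<in>{r \<in> I. ?y r = z}. ?y r)" by (rule sum.cong) auto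
  finally show "smul (of_real (measure \<mu> {x \<in> space \<mu>. ?F x = z})) z = (\<Sum>r\<in>{r \<in> I. ?y r = z}. ?y r)" .
 qed
 also have "\<dots> = (\<Sum>z\<in>?y ` I. \<Sum>r\<in>{r \<in> I. ?y r = z}. ?y r)"
 proof (rule sum.mono_neutral_left)
  show "\<forall>z\<in>?y ` I - (?y ` I - {0}). (\<Sum>r\<in>{r \<in> I. ?y r = z}. ?y r) = 0"
  proof
   fix z assume "z \<in> ?y ` I - (?y ` I - {0})"
   then have "z = 0" by blast
   then show "(\<Sum>r\<in>{r \<in> I. ?y r = z}. ?y r) = 0" by (intro sum.neutral) auto
  qed
 qed (use I in auto)
 also have "\<dots> = (\<Sum>r\<in>I. ?y r)" by (rule sum.group) (use I in auto)
 finally show ?thesis .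
qed

context padic_field
begin

lemma GL1_int_Collect: "(GL1_int :: 'a set) = {x. dist x 0 = 1}"
 by (simp add: GL1_int_iff set_eq_iff)

lemma GL1_int_top:
 "openin GL1_top (GL1_int :: 'a set)" "closedin GL1_top (GL1_int :: 'a set)" "compactin GL1_top (GL1_int :: 'a set)"
proof -
 have sub: "(GL1_int :: 'a set) \<subseteq> UNIV - {0}" by (auto simp: GL1_int_iff)
 have "open (GL1_int :: 'a set)"
 proof (rule openI)
  fix x :: 'a assume x: "x \<in> GL1_int"
  have "ball x 1 \<subseteq> GL1_int"
  proof
   fix y assume "y \<in> ball x 1"
   then have "cong_l y x" using dist_vn[of y x] by (simp add: cong_l_def dist_commute)
   then show "y \<in> GL1_int" using x cong_l_vn_eq_1 by (simp add: GL1_int_iff)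
  qed
  then show "\<exists>e>0. ball x e \<subseteq> GL1_int" by (intro exI[of _ 1]) simp
 qed
 then show "openin GL1_top (GL1_int :: 'a set)"
  unfolding GL1_top_def openin_open GL1_simps using sub by blast
 have cl: "closed (GL1_int :: 'a set)" unfolding GL1_int_Collect by (intro closed_Collect_eq continuous_intros)
 then show "closedin GL1_top (GL1_int :: 'a set)"
  unfolding GL1_top_def closedin_closed GL1_simps using sub by blast
 have "GL1_int = cball 0 1 \<inter> (GL1_int :: 'a set)" unfolding GL1_int_Collect by (auto simp: dist_commute)
 then have "compact (GL1_int :: 'a set)" using compact_Int_closed[OF compact_cball cl] by metis
 then show "compactin GL1_top (GL1_int :: 'a set)"
  unfolding GL1_top_def compactin_subtopology using sub by simp
qed

text \<open>The coset and its complement are both right invariant, hence open. Integral factors on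
  the right preserve a bound for the entries and the absolute value of the determinant, so
  \<open>GL_bounded_compact\<close> applies.\<close>

lemma GL_coset_top:
 assumes g: "g \<in> carrier (GL m :: 'a mat monoid)"
 shows "openin (GL_top m) ((\<lambda>k. g * k) ` KG m)" "closedin (GL_top m) ((\<lambda>k. g * k) ` KG m)"
  "compactin (GL_top m) ((\<lambda>k. g * k) ` KG m)"
proof -
 let ?S = "(\<lambda>k. g * k) ` KG m"
 note gc = GL_carrier_mat[OF g]
 have S: "?S \<subseteq> GLc m" using g GL_int_GL GL_mult_closed by blast
 have assoc: "g * k * u = g * (k * u)" if "k \<in> KG m" "u \<in> KG m" for k u
  using assoc_mult_mat[OF gc GL_int_carrier[OF that(1)] GL_int_carrier[OF that(2)]] .
 have inv: "x * u \<in> ?S" if x: "x \<in> ?S" and u: "u \<in> KG m" for x u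
 proof -
  obtain k where k: "k \<in> KG m" "x = g * k" using x by blast
  show ?thesis unfolding k(2) assoc[OF k(1) u] using GL_int_mult[OF k(1) u] by blast
 qed
 show "openin (GL_top m) ?S" by (rule right_invariant_open[OF S inv])
 have "openin (GL_top m) (GLc m - ?S)"
 proof (rule right_invariant_open)
  fix x u assume x: "x \<in> GLc m - ?S" and u: "u \<in> KG m"
  have "x * u \<notin> ?S"
  proof
   assume "x * u \<in> ?S"
   then have "x * u * minv m u \<in> ?S" using inv[OF _ GL_int_minv[OF u]] by blast
   moreover have "x \<in> carrier_mat m m" using x GL_carrier_mat[of x m] by blast
   ultimately show False using x GL_cancel_right(1)[OF GL_int_GL[OF u], of x m] by simp
  qed
  then show "x * u \<in> GLc m - ?S" using x GL_mult_closed GL_int_GL[OF u] by blast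
 qed auto
 then show cl: "closedin (GL_top m) ?S" unfolding closedin_def GL_topspace using S by blast
 define R where "R = Max (insert 0 ((\<lambda>ij. vn (g $$ ij)) ` ({..<m} \<times> {..<m})))"
 have R: "vn (g $$ (i, j)) \<le> R" if "i < m" "j < m" for i j
  unfolding R_def using that by (intro Max_ge) auto
 have R0: "0 \<le> R" unfolding R_def by (intro Max_ge) auto
 let ?d = "vn (mdet g)"
 have d: "0 < ?d" using g by (simp add: GL_carrier)
 have "?S \<subseteq> {x \<in> GLc m. (\<forall>i<m. \<forall>j<m. vn (x $$ (i, j)) \<le> R) \<and> vn (mdet x) = ?d}"
 proof clarify
  fix k assume k: "k \<in> KG m"
  have "vn (mdet (g * k)) = ?d"
   using det_mult[OF gc GL_int_carrier[OF k]] k by (simp add: vn_mult GL_int_iff)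
  moreover have "vn ((g * k) $$ (i, j)) \<le> R" if "i < m" "j < m" for i j
   by (rule mult_int_mat_bound[OF GL_int_int[OF k] gc R0 R that])
  ultimately show "g * k \<in> GLc m \<and> (\<forall>i<m. \<forall>j<m. vn ((g * k) $$ (i, j)) \<le> R) \<and> vn (mdet (g * k)) = ?d"
   using GL_mult_closed[OF g GL_int_GL[OF k]] by blast
 qed
 then show "compactin (GL_top m) ?S" by (rule closed_compactin[OF GL_bounded_compact[OF d] _ cl])
qed

lemma K_coset:
 "((1, g), 1) <#\<^bsub>Gt n\<^esub> K_int n = (GL1_int \<times> (\<lambda>k. g * k) ` KG (2 * n)) \<times> (GL1_int :: 'a set)"
 by (auto simp: l_coset_def K_int_def Gt_def image_def)

lemma K_coset_top:
 assumes g: "g \<in> carrier (GL (2 * n) :: 'a mat monoid)"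
 shows "openin (Gt_top n) (((1, g), 1) <#\<^bsub>Gt n\<^esub> K_int n) \<and> closedin (Gt_top n) (((1, g), 1) <#\<^bsub>Gt n\<^esub> K_int n) \<and>
  compactin (Gt_top n) (((1, g), 1) <#\<^bsub>Gt n\<^esub> K_int n)"
 unfolding K_coset Gt_top_def openin_prod_Times_iff closedin_prod_Times_iff compactin_Times
 using GL1_int_top GL_coset_top[OF g] by simp

text \<open>If the cosets met, the difference of the two matrices \<open>Xr\<close>, divided by
  \<open>l\<close>, would be integral; but its diagonal entry at \<open>min r s\<close> is
  \<open>1 / l\<close> up to sign.\<close>

lemma ur_coset_disjoint:
 assumes rs: "r \<le> n" "s \<le> n" "r \<noteq> s" and k: "k \<in> KG (2 * n)" "k' \<in> KG (2 * n)"
 shows "ur n r * k \<noteq> um n (inverse lq \<cdot>\<^sub>m Xr n s) * k'"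
proof
 let ?Z = "\<lambda>r. inverse lq \<cdot>\<^sub>m Xr n r"
 assume e: "um n (?Z r) * k = um n (?Z s) * k'"
 have Zc: "?Z r \<in> carrier_mat n n" for r by simp
 note kc = GL_int_carrier[OF k(1)] GL_int_carrier[OF k(2)]
 have inv: "minv (2 * n) (um n (?Z s)) = um n (- ?Z s)" by (rule um_GL(2)[OF Zc])
 have "um n (- ?Z s) * (um n (?Z r) * k) = k'"
  unfolding e using GL_cancel(1)[OF um_GL(1)[OF Zc] kc(2), of s] unfolding inv .
 then have "um n (- ?Z s) * um n (?Z r) * k = k'"
  using assoc_mult_mat[OF um_carrier[of n "- ?Z s"] um_carrier[of n "?Z r"] kc(1)] by simp
 then have e2: "um n (- ?Z s + ?Z r) * k = k'" using um_mult[of "- ?Z s" n "?Z r"] by simp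
 have "um n (- ?Z s + ?Z r) = k' * minv (2 * n) k"
  using GL_cancel_right(1)[OF GL_int_GL[OF k(1)] um_carrier[of n "- ?Z s + ?Z r"]] unfolding e2 by simp
 then have "um n (- ?Z s + ?Z r) \<in> KG (2 * n)" using GL_int_mult[OF k(2) GL_int_minv[OF k(1)]] by simp
 then have "- ?Z s + ?Z r \<in> int_mat n" unfolding um_def by (subst (asm) fb_KG_iff) auto
 moreover define i where "i = min r s"
 have i: "i < n" using rs by (auto simp: i_def)
 ultimately have v: "vn ((- ?Z s + ?Z r) $$ (i, i)) \<le> 1" by (auto simp: int_mat_def)
 have "(- ?Z s + ?Z r) $$ (i, i) = - inverse lq \<or> (- ?Z s + ?Z r) $$ (i, i) = inverse lq"
  using i rs(3) by (auto simp: Xr_def i_def min_def)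
 then have "vn ((- ?Z s + ?Z r) $$ (i, i)) = real l" by (auto simp: vn_inverse vn_l)
 then show False using v l_gt_1 by simp
qed

text \<open>All points of one coset act alike on \<open>v\<close>: the first component acts
  trivially, the integral matrix fixes \<open>v\<close>, and \<open>\<omega>\<close> is 1 on
  units.\<close>

lemma hecke_act_phi:
 fixes \<mu> :: "(('a \<times> 'a mat) \<times> 'a) measure" and \<sigma> :: "'a mat => 'v::ab_group_add => 'v"
 assumes haar: "haar_measure (Gt n) (Gt_top n) (K_int n) \<mu>" and vs: "vector_space smul"
  and mult: "\<And>g h. g \<in> GLc (2 * n) ==> h \<in> GLc (2 * n) ==> \<sigma> (g * h) v = \<sigma> g (\<sigma> h v)"
  and v: "\<And>k. k \<in> KG (2 * n) ==> \<sigma> k v = v" and \<omega>: "unramified_char \<omega>"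
 shows "hecke_act smul \<mu> (box_inv_char smul (triv_box \<sigma>) \<omega>)
   (\<lambda>x. \<Sum>r\<in>{..n}. b r * indicator ((g_elt l n r, 1) <#\<^bsub>Gt n\<^esub> K_int n) x) v =
  (\<Sum>r\<in>{..n}. smul (of_int (b r)) (\<sigma> (ur n r) v))"
proof -
 interpret VS: vector_space smul by (rule vs)
 let ?u = "\<lambda>r. ur n r"
 have uG: "?u r \<in> GLc (2 * n)" for r by (rule um_GL(1)) simp
 have K1: "K_int n = (GL1_int \<times> (\<lambda>k. 1\<^sub>m (2 * n) * k) ` KG (2 * n)) \<times> (GL1_int :: 'a set)"
  unfolding K_int_def using GL_int_carrier[of _ "2 * n"] by (force simp: image_def)
 then have K2: "K_int n = ((1, 1\<^sub>m (2 * n)), 1 :: 'a) <#\<^bsub>Gt n\<^esub> K_int n" unfolding K_coset by simp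
 have oneC: "1\<^sub>m (2 * n) \<in> carrier (GL (2 * n) :: 'a mat monoid)" by (rule GL_one_closed)
 have carr: "((1, g), 1) <#\<^bsub>Gt n\<^esub> K_int n \<subseteq> carrier (Gt n)" if "g \<in> carrier (GL (2 * n) :: 'a mat monoid)" for g
  unfolding K_coset using GL_mult_closed[OF that GL_int_GL] by (auto simp: Gt_def GL1_int_iff)
 show ?thesis unfolding g_elt_um
 proof (rule hecke_act_cosets[OF haar vs])
  show "openin (Gt_top n) (K_int n :: (('a \<times> 'a mat) \<times> 'a) set)" using K_coset_top[OF oneC] K2 by simp
  show "K_int n \<subseteq> carrier (Gt n :: (('a \<times> 'a mat) \<times> 'a) monoid)" using carr[OF oneC] K2 by simp
  have "((1, 1\<^sub>m (2 * n)), 1) \<in> (K_int n :: (('a \<times> 'a mat) \<times> 'a) set)" by (simp add: K_int_def GL1_int_iff)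
  then show "K_int n \<noteq> ({} :: (('a \<times> 'a mat) \<times> 'a) set)" by blast
  show "((1, ?u r), 1) \<in> carrier (Gt n)" for r using uG by (simp add: Gt_def)
  show "openin (Gt_top n) (((1, ?u r), 1) <#\<^bsub>Gt n\<^esub> K_int n)" for r using K_coset_top[OF uG] by blast
  show "((1, ?u r), 1) <#\<^bsub>Gt n\<^esub> K_int n \<subseteq> carrier (Gt n)" for r by (rule carr[OF uG])
  show "(((1, ?u r), 1) <#\<^bsub>Gt n\<^esub> K_int n) \<inter> (((1, ?u s), 1) <#\<^bsub>Gt n\<^esub> K_int n) = {}"
   if "r \<in> {..n}" "s \<in> {..n}" "r \<noteq> s" for r s
   unfolding K_coset using ur_coset_disjoint[of r n s] that by auto
  fix r x assume "x \<in> ((1, ?u r), 1) <#\<^bsub>Gt n\<^esub> K_int n"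
  then obtain a k t where x: "x = ((a, ?u r * k), t)" "k \<in> KG (2 * n)" "vn t = 1"
   unfolding K_coset by (auto simp: GL1_int_iff)
  have "\<omega> t = 1" by (rule unram(3)[OF \<omega> x(3)])
  then show "box_inv_char smul (triv_box \<sigma>) \<omega> x v = \<sigma> (?u r) v"
   unfolding x(1) box_inv_char_def triv_box_def using mult[OF uG GL_int_GL[OF x(2)]] v[OF x(2)] by simp
 qed simp
qed

end

section \<open>Invariant functionals on translates of a spherical vector\<close>

lemma all_less_add: "(\<forall>i<n + n. P i) \<longleftrightarrow> (\<forall>i<n. P i) \<and> (\<forall>i<n. P (n + i))" for n :: nat
proof (intro iffI conjI allI impI)
 fix i assume a: "(\<forall>i<n. P i) \<and> (\<forall>i<n. P (n + i))" and i: "i < n + n"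
 show "P i"
 proof (cases "i < n")
  case False
  then obtain j where "i = n + j" using le_Suc_ex[of n i] by auto
  then show ?thesis using a i by simp
 qed (use a in simp)
qed auto

lemma all_cong2:
 fixes n :: nat
 assumes "\<And>i j. i < n ==> j < n ==> X i j = Y i j"
 shows "(\<forall>i<n. \<forall>j<n. X i j) \<longleftrightarrow> (\<forall>i<n. \<forall>j<n. Y i j)"
 using assms by blast

lemma bij_Pow_split:
 "bij_betw (\<lambda>(S, S'). S \<union> (\<lambda>i. n + i) ` S') (Pow {..<n} \<times> Pow {..<n}) (Pow {..<2 * n})" for n :: nat
proof (rule bij_betw_byWitness[where f' = "\<lambda>T. (T \<inter> {..<n}, {i. i < n \<and> n + i \<in> T})"])
 show "\<forall>p\<in>Pow {..<n} \<times> Pow {..<n}. (\<lambda>T. (T \<inter> {..<n}, {i. i < n \<and> n + i \<in> T})) ((\<lambda>(S, S'). S \<union> (\<lambda>i. n + i) ` S') p) = p"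
  by force
 show "\<forall>T\<in>Pow {..<2 * n}. (\<lambda>(S, S'). S \<union> (\<lambda>i. n + i) ` S') (T \<inter> {..<n}, {i. i < n \<and> n + i \<in> T}) = T"
 proof
  fix T assume T: "T \<in> Pow {..<2 * n}"
  have "x \<in> (\<lambda>i. n + i) ` {i. i < n \<and> n + i \<in> T}" if "x \<in> T" "\<not> x < n" for x
   using that T by (intro image_eqI[of _ _ "x - n"]) auto
  then show "(\<lambda>(S, S'). S \<union> (\<lambda>i. n + i) ` S') (T \<inter> {..<n}, {i. i < n \<and> n + i \<in> T}) = T" by auto
 qed
 show "(\<lambda>(S, S'). S \<union> (\<lambda>i. n + i) ` S') ` (Pow {..<n} \<times> Pow {..<n}) \<subseteq> Pow {..<2 * n}" by force
 show "(\<lambda>T. (T \<inter> {..<n}, {i. i < n \<and> n + i \<in> T})) ` Pow {..<2 * n} \<subseteq> Pow {..<n} \<times> Pow {..<n}" by force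
qed

context padic_field
begin

section \<open>Hermite forms of size \<open>2 n\<close> in blocks\<close>

text \<open>The condition of \<open>HN\<close> at a single position, which lets the four blocks be
  compared entry by entry.\<close>

definition hcond :: "nat set => nat => nat => 'a => bool"
 where "hcond S i j x \<longleftrightarrow> (if i = j then x = (if i \<in> S then lq else 1)
  else if i < j \<and> i \<in> S \<and> j \<notin> S then x \<in> digits else x = 0)"

lemma HN_iff: "A \<in> HN m S \<longleftrightarrow> A \<in> carrier_mat m m \<and> (\<forall>i<m. \<forall>j<m. hcond S i j (A $$ (i, j)))"
proof
 assume "A \<in> HN m S"
 then show "A \<in> carrier_mat m m \<and> (\<forall>i<m. \<forall>j<m. hcond S i j (A $$ (i, j)))"
  unfolding hcond_def using HN_D[of A m S] by auto
next
 assume a: "A \<in> carrier_mat m m \<and> (\<forall>i<m. \<forall>j<m. hcond S i j (A $$ (i, j)))"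
 then have h: "hcond S i j (A $$ (i, j))" if "i < m" "j < m" for i j using that by blast
 show "A \<in> HN m S" unfolding HN_def
 proof (intro CollectI conjI allI impI)
  show "A \<in> carrier_mat m m" using a by blast
  show "A $$ (i, i) = (if i \<in> S then lq else 1)" if "i < m" for i using h[OF that that] by (simp add: hcond_def)
  show "if i < j \<and> i \<in> S \<and> j \<notin> S then A $$ (i, j) \<in> digits else A $$ (i, j) = 0" if "i < m" "j < m" "i \<noteq> j" for i j
   using h[OF that(1,2)] that(3) by (simp add: hcond_def split: if_splits)
 qed
qed

text \<open>In the upper right block the row index is always smaller than the column index, so only
  membership in \<open>S\<close> and \<open>S'\<close> remains, which is the condition of
  \<open>dmat\<close>.\<close>

lemma HN_four_block:
 assumes c: "A \<in> carrier_mat n n" "C \<in> carrier_mat n n" "D \<in> carrier_mat n n" and S: "S \<subseteq> {..<n}" "S' \<subseteq> {..<n}"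
 shows "four_block_mat A C (0\<^sub>m n n) D \<in> HN (2 * n) (S \<union> (\<lambda>i. n + i) ` S') \<longleftrightarrow>
  A \<in> HN n S \<and> D \<in> HN n S' \<and> C \<in> dmat n S ({..<n} - S')"
proof -
 let ?T = "S \<union> (\<lambda>i. n + i) ` S'" and ?M = "four_block_mat A C (0\<^sub>m n n) D"
 have m1: "i \<in> ?T \<longleftrightarrow> i \<in> S" if "i < n" for i using that by auto
 have m2: "n + i \<in> ?T \<longleftrightarrow> i \<in> S'" if "i < n" for i using that S(1) by auto
 have e1: "hcond ?T i j (?M $$ (i, j)) = hcond S i j (A $$ (i, j))" if "i < n" "j < n" for i j
  using that c by (simp add: hcond_def m1 del: Un_iff)
 have e2: "hcond ?T i (n + j) (?M $$ (i, n + j)) = (if i \<in> S \<and> j \<in> {..<n} - S' then C $$ (i, j) \<in> digits else C $$ (i, j) = 0)"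
  if "i < n" "j < n" for i j
  using that c by (simp add: hcond_def m1 m2 del: Un_iff)
 have e3: "hcond ?T (n + i) j (?M $$ (n + i, j))" if "i < n" "j < n" for i j
  using that c by (simp add: hcond_def del: Un_iff)
 have e4: "hcond ?T (n + i) (n + j) (?M $$ (n + i, n + j)) = hcond S' i j (D $$ (i, j))" if "i < n" "j < n" for i j
  using that c by (simp add: hcond_def m2 del: Un_iff)
 have "?M \<in> HN (2 * n) ?T \<longleftrightarrow> (\<forall>i<n + n. \<forall>j<n + n. hcond ?T i j (?M $$ (i, j)))"
  unfolding HN_iff using fb_carrier[OF c(1,3)] by (simp add: mult_2)
 also have "\<dots> \<longleftrightarrow> (\<forall>i<n. (\<forall>j<n. hcond ?T i j (?M $$ (i, j))) \<and> (\<forall>j<n. hcond ?T i (n + j) (?M $$ (i, n + j)))) \<and>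
  (\<forall>i<n. (\<forall>j<n. hcond ?T (n + i) j (?M $$ (n + i, j))) \<and> (\<forall>j<n. hcond ?T (n + i) (n + j) (?M $$ (n + i, n + j))))"
  by (simp only: all_less_add)
 also have "\<dots> \<longleftrightarrow> (\<forall>i<n. \<forall>j<n. hcond ?T i j (?M $$ (i, j))) \<and> (\<forall>i<n. \<forall>j<n. hcond ?T i (n + j) (?M $$ (i, n + j))) \<and>
  (\<forall>i<n. \<forall>j<n. hcond ?T (n + i) (n + j) (?M $$ (n + i, n + j)))"
  using e3 by blast
 also have "\<dots> \<longleftrightarrow> (\<forall>i<n. \<forall>j<n. hcond S i j (A $$ (i, j))) \<and>
  (\<forall>i<n. \<forall>j<n. if i \<in> S \<and> j \<in> {..<n} - S' then C $$ (i, j) \<in> digits else C $$ (i, j) = 0) \<and>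
  (\<forall>i<n. \<forall>j<n. hcond S' i j (D $$ (i, j)))"
  by (intro arg_cong2[where f = "(\<and>)"] all_cong2 e1 e2 e4)
 also have "\<dots> \<longleftrightarrow> A \<in> HN n S \<and> D \<in> HN n S' \<and> C \<in> dmat n S ({..<n} - S')"
 proof -
  have "P \<and> R \<and> T \<longleftrightarrow> (x \<and> P) \<and> (z \<and> T) \<and> (y \<and> R)" if x y z for P R T x y z using that by simp blast
  from this[OF c] show ?thesis unfolding HN_iff dmat_def mem_Collect_eq .
 qed
 finally show ?thesis .
qed

lemma HN_split:
 assumes S: "S \<subseteq> {..<n}" "S' \<subseteq> {..<n}"
 shows "bij_betw (\<lambda>(A, D, C). four_block_mat A C (0\<^sub>m n n) D) (HN n S \<times> HN n S' \<times> dmat n S ({..<n} - S'))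
  (HN (2 * n) (S \<union> (\<lambda>i. n + i) ` S'))"
proof -
 let ?T = "S \<union> (\<lambda>i. n + i) ` S'" and ?f = "\<lambda>(A, D, C). four_block_mat A C (0\<^sub>m n n) D"
 have cs: "A \<in> carrier_mat n n" "D \<in> carrier_mat n n" "C \<in> carrier_mat n n"
  if "(A, D, C) \<in> HN n S \<times> HN n S' \<times> dmat n S ({..<n} - S')" for A D C
  using that HN_D(1) dmat_D(1) by blast+
 have "inj_on ?f (HN n S \<times> HN n S' \<times> dmat n S ({..<n} - S'))"
 proof (rule inj_onI)
  fix p p' assume p: "p \<in> HN n S \<times> HN n S' \<times> dmat n S ({..<n} - S')" "p' \<in> HN n S \<times> HN n S' \<times> dmat n S ({..<n} - S')"
   and e: "?f p = ?f p'"
  obtain A D C A' D' C' where pp: "p = (A, D, C)" "p' = (A', D', C')" by (metis prod_cases3)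
  have e': "four_block_mat A C (0\<^sub>m n n) D = four_block_mat A' C' (0\<^sub>m n n) D'" using e unfolding pp by simp
  note c = cs[OF p(1)[unfolded pp]] and c' = cs[OF p(2)[unfolded pp]]
  show "p = p'" unfolding pp using fb_eqD[OF e' c(1,3,2) c'(1,3,2)] by simp
 qed
 moreover have "?f ` (HN n S \<times> HN n S' \<times> dmat n S ({..<n} - S')) = HN (2 * n) ?T"
 proof (intro equalityI subsetI)
  fix x assume "x \<in> ?f ` (HN n S \<times> HN n S' \<times> dmat n S ({..<n} - S'))"
  then obtain A D C where p: "(A, D, C) \<in> HN n S \<times> HN n S' \<times> dmat n S ({..<n} - S')"
   and x: "x = four_block_mat A C (0\<^sub>m n n) D" by auto
  show "x \<in> HN (2 * n) ?T" unfolding x using HN_four_block[OF cs(1)[OF p] cs(3)[OF p] cs(2)[OF p] S] p by blast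
 next
  fix M assume M: "M \<in> HN (2 * n) ?T"
  define A where "A = Matrix.mat n n (\<lambda>(i, j). M $$ (i, j))"
  define C where "C = Matrix.mat n n (\<lambda>(i, j). M $$ (i, n + j))"
  define D where "D = Matrix.mat n n (\<lambda>(i, j). M $$ (n + i, n + j))"
  have c: "A \<in> carrier_mat n n" "C \<in> carrier_mat n n" "D \<in> carrier_mat n n" by (auto simp: A_def C_def D_def)
  note Mc = HN_D(1)[OF M]
  have "M = four_block_mat A C (0\<^sub>m n n) D"
  proof (rule eq_matI)
   fix i j assume "i < dim_row (four_block_mat A C (0\<^sub>m n n) D)" "j < dim_col (four_block_mat A C (0\<^sub>m n n) D)"
   then have ij: "i < n + n" "j < n + n" using c by auto
   have z: "M $$ (i, j) = 0" if "\<not> i < n" "j < n" using HN_D(4)[OF M, of i j] ij that by auto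
   show "M $$ (i, j) = four_block_mat A C (0\<^sub>m n n) D $$ (i, j)"
    using ij z c by (cases "i < n"; cases "j < n") (auto simp: A_def C_def D_def)
  qed (use c Mc in auto)
  then show "M \<in> ?f ` (HN n S \<times> HN n S' \<times> dmat n S ({..<n} - S'))"
   using HN_four_block[OF c S] M by (intro image_eqI[of _ _ "(A, D, C)"]) auto
 qed
 ultimately show ?thesis by (simp add: bij_betw_def)
qed

text \<open>Applied to \<open>F g = \<xi> (\<sigma> g v)\<close> for a spherical vector \<open>v\<close> and an invariant functional \<open>\<xi>\<close>.\<close>

context
 fixes n :: nat and F :: "'a mat => complex" and \<omega> :: "'a => complex"
 assumes \<omega>: "unramified_char \<omega>"
  and FK: "\<And>g k. g \<in> GLc (2 * n) ==> k \<in> KG (2 * n) ==> F (g * k) = F g"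
  and FH: "\<And>h1 h2 g. h1 \<in> GLc n ==> h2 \<in> GLc n ==> g \<in> GLc (2 * n) ==>
   F (dg n h1 h2 * g) = \<omega> (mdet h2) ^ 2 * F g"
begin

abbreviation xr :: "nat => complex" where "xr r \<equiv> F (ur n r)"

text \<open>Modulo \<open>l\<close> the matrix \<open>C\<close> is \<open>P X B\<close> with
  \<open>X\<close> in normal form. The error is \<open>l\<close> times an integral matrix and is
  absorbed on the right. Moving \<open>diag(P, B^-1)\<close> through \<open>u(X / l)\<close> trades
  the right invariance for the left one, and \<open>\<omega>\<close> is 1 at the unit
  determinant.\<close>

lemma F_um:
 assumes C: "C \<in> int_mat n" shows "F (um n (inverse lq \<cdot>\<^sub>m C)) = xr (rkm n C)"
proof -
 let ?r = "rkm n C"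
 obtain P B where PB: "P \<in> KG n" "B \<in> KG n" "cong_mat n C (P * Xr n ?r * B)"
  using rkm[OF C] by (auto simp: has_rank_def)
 let ?M = "P * Xr n ?r * B" and ?B = "minv n B" and ?X = "inverse lq \<cdot>\<^sub>m Xr n ?r"
 note c = GL_int_carrier[OF PB(1)] GL_int_carrier[OF PB(2)] GL_int_carrier[OF GL_int_minv[OF PB(2)]]
 have Mc: "?M \<in> carrier_mat n n" using c by simp
 have Xc: "?X \<in> carrier_mat n n" by simp
 define E where "E = Matrix.mat n n (\<lambda>ij. (C $$ ij - ?M $$ ij) / lq)"
 have E: "E \<in> int_mat n" using PB(3) cong_l_div by (auto simp: E_def int_mat_def cong_mat_def)
 have cE: "inverse lq \<cdot>\<^sub>m C = inverse lq \<cdot>\<^sub>m ?M + E"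
 proof (rule eq_matI)
  fix i j assume "i < dim_row (inverse lq \<cdot>\<^sub>m ?M + E)" "j < dim_col (inverse lq \<cdot>\<^sub>m ?M + E)"
  then have ij: "i < n" "j < n" by (auto simp: E_def)
  have "(inverse lq \<cdot>\<^sub>m ?M) $$ (i, j) = inverse lq * ?M $$ (i, j)" by (rule index_smult_mat(1)) (use Mc ij in auto)
  moreover have "(inverse lq \<cdot>\<^sub>m C) $$ (i, j) = inverse lq * C $$ (i, j)"
   by (rule index_smult_mat(1)) (use int_mat_carrier[OF C] ij in auto)
  moreover have "(inverse lq \<cdot>\<^sub>m ?M + E) $$ (i, j) = (inverse lq \<cdot>\<^sub>m ?M) $$ (i, j) + E $$ (i, j)"
   by (rule index_add_mat(1)) (use ij in \<open>auto simp: E_def\<close>)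
  moreover have "E $$ (i, j) = (C $$ (i, j) - ?M $$ (i, j)) / lq" using ij by (simp add: E_def)
  ultimately show "(inverse lq \<cdot>\<^sub>m C) $$ (i, j) = (inverse lq \<cdot>\<^sub>m ?M + E) $$ (i, j)" by (simp add: divide_inverse algebra_simps)
 qed (use int_mat_carrier[OF C] in \<open>auto simp: E_def\<close>)
 have cMc: "inverse lq \<cdot>\<^sub>m ?M \<in> carrier_mat n n" using Mc by simp
 have "um n E \<in> KG (2 * n)" unfolding um_def using E int_mat_carrier[OF E] by (subst fb_KG_iff) auto
 then have 1: "F (um n (inverse lq \<cdot>\<^sub>m C)) = F (um n (inverse lq \<cdot>\<^sub>m ?M))"
  unfolding cE um_mult[OF cMc int_mat_carrier[OF E], symmetric] by (rule FK[OF um_GL(1)[OF cMc]])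
 have dK: "dg n P ?B \<in> KG (2 * n)"
  unfolding dg_def mult_2 by (rule GL_int_diag_block[OF PB(1) GL_int_minv[OF PB(2)]])
 have PXc: "P * Xr n ?r \<in> carrier_mat n n" using c by simp
 have MB: "?M * ?B = P * Xr n ?r" by (rule GL_cancel_right(1)[OF GL_int_GL[OF PB(2)] PXc])
 have "inverse lq \<cdot>\<^sub>m ?M * ?B = P * ?X"
  using mult_smult_assoc_mat[OF Mc c(3), of "inverse lq"] mult_smult_distrib[OF c(1) Xr_carrier, of "inverse lq" ?r] MB by simp
 then have "um n (inverse lq \<cdot>\<^sub>m ?M) * dg n P ?B = dg n P ?B * um n ?X"
  unfolding um_dg[OF c(1,3) cMc] dg_um[OF c(1,3) Xc] by simp
 then have "F (um n (inverse lq \<cdot>\<^sub>m ?M)) = F (dg n P ?B * um n ?X)" using FK[OF um_GL(1)[OF cMc] dK] by simp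
 also have "\<dots> = \<omega> (mdet ?B) ^ 2 * F (um n ?X)"
  by (rule FH[OF GL_int_GL[OF PB(1)] GL_int_GL[OF GL_int_minv[OF PB(2)]] um_GL(1)[OF Xc]])
 also have "\<omega> (mdet ?B) = 1" using GL_int_minv[OF PB(2)] by (intro unram(3)[OF \<omega>]) (simp add: GL_int_iff)
 finally show ?thesis using 1 by simp
qed

lemma HN_GL: "A \<in> HN m S ==> S \<subseteq> {..<m} ==> A \<in> GLc m"
 using HN_D(1) HN_det by (simp add: GL_carrier)

text \<open>The rows of \<open>C\<close> lie in \<open>S\<close>, where the diagonal of
  \<open>A\<close> is \<open>l\<close>, while off-diagonal entries of \<open>A\<close> lie in
  columns outside \<open>S\<close>. So \<open>A C = l C\<close>, and the form factors as
  \<open>diag(A, D) u(C / l)\<close>.\<close>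

lemma F_HN:
 assumes S: "S \<subseteq> {..<n}" "S' \<subseteq> {..<n}" and A: "A \<in> HN n S" and D: "D \<in> HN n S'" and C: "C \<in> dmat n S J"
 shows "F (four_block_mat A C (0\<^sub>m n n) D) = \<omega> lq ^ (2 * card S') * xr (rkm n C)"
proof -
 note c = HN_D(1)[OF A] dmat_D(1)[OF C] HN_D(1)[OF D]
 have AC: "A * C = lq \<cdot>\<^sub>m C"
 proof (rule eq_matI)
  fix i j assume "i < dim_row (lq \<cdot>\<^sub>m C)" "j < dim_col (lq \<cdot>\<^sub>m C)"
  then have ij: "i < n" "j < n" using c by auto
  have "(A * C) $$ (i, j) = (\<Sum>p<n. A $$ (i, p) * C $$ (p, j))" by (rule mat_mult_index[OF c(1,2) ij])
  also have "\<dots> = A $$ (i, i) * C $$ (i, j)"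
  proof (rule sum_only)
   fix p assume p: "p \<in> {..<n}" "p \<noteq> i"
   show "A $$ (i, p) * C $$ (p, j) = 0"
   proof (cases "p \<in> S")
    case True
    then show ?thesis using HN_D(4)[OF A ij(1), of p] p by simp
   next
    case False
    then show ?thesis using dmat_D(3)[OF C _ ij(2), of p] p by simp
   qed
  qed (use ij in auto)
  also have "\<dots> = lq * C $$ (i, j)"
   using HN_D(2)[OF A ij(1)] dmat_D(3)[OF C ij] by (cases "i \<in> S") auto
  finally show "(A * C) $$ (i, j) = (lq \<cdot>\<^sub>m C) $$ (i, j)" using ij c by simp
 qed (use c in auto)
 have cC: "inverse lq \<cdot>\<^sub>m C \<in> carrier_mat n n" using c by simp
 have "A * (inverse lq \<cdot>\<^sub>m C) = inverse lq \<cdot>\<^sub>m (lq \<cdot>\<^sub>m C)" using mult_smult_distrib[OF c(1,2), of "inverse lq"] AC by simp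
 also have "\<dots> = C" using c by (intro eq_matI) auto
 finally have "four_block_mat A C (0\<^sub>m n n) D = dg n A D * um n (inverse lq \<cdot>\<^sub>m C)"
  unfolding dg_um[OF c(1,3) cC] by simp
 then have "F (four_block_mat A C (0\<^sub>m n n) D) = \<omega> (mdet D) ^ 2 * F (um n (inverse lq \<cdot>\<^sub>m C))"
  using FH[OF HN_GL[OF A S(1)] HN_GL[OF D S(2)] um_GL(1)[OF cC]] by simp
 also have "\<omega> (mdet D) = \<omega> lq ^ card S'" unfolding HN_det[OF D S(2)] by (rule unram_power[OF \<omega>]) simp
 finally show ?thesis unfolding F_um[OF dmat_int[OF C]] by (simp add: power_mult mult.commute[of 2])
qed

text \<open>The value in \<open>F_HN\<close> depends on \<open>A\<close> not at all and on
  \<open>D\<close> only through \<open>card S'\<close>, so both contribute just the number of their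
  choices.\<close>

lemma sum_F_HN:
 assumes S: "S \<subseteq> {..<n}" "S' \<subseteq> {..<n}"
 shows "(\<Sum>g\<in>HN (2 * n) (S \<union> (\<lambda>i. n + i) ` S'). F g) =
  of_nat l ^ (card (HNpos n S) + card (HNpos n S')) * \<omega> lq ^ (2 * card S') *
  (\<Sum>r\<le>n. of_nat (Nr n S ({..<n} - S') r) * xr r)"
proof -
 let ?J = "{..<n} - S'"
 have "(\<Sum>g\<in>HN (2 * n) (S \<union> (\<lambda>i. n + i) ` S'). F g) =
  (\<Sum>p\<in>HN n S \<times> HN n S' \<times> dmat n S ?J. F ((\<lambda>(A, D, C). four_block_mat A C (0\<^sub>m n n) D) p))"
  by (rule sum.reindex_bij_betw[OF HN_split[OF S], symmetric])
 also have "\<dots> = (\<Sum>p\<in>HN n S \<times> HN n S' \<times> dmat n S ?J. \<omega> lq ^ (2 * card S') * xr (rkm n (snd (snd p))))"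
  using F_HN[OF S] by (intro sum.cong) auto
 also have "\<dots> = (\<Sum>A\<in>HN n S. \<Sum>D\<in>HN n S'. \<Sum>C\<in>dmat n S ?J. \<omega> lq ^ (2 * card S') * xr (rkm n C))"
  by (simp only: sum.cartesian_product') (simp add: sum.cartesian_product case_prod_unfold)
 also have "\<dots> = of_nat (card (HN n S)) * (of_nat (card (HN n S')) * (\<omega> lq ^ (2 * card S') * (\<Sum>C\<in>dmat n S ?J. xr (rkm n C))))"
  by (simp add: sum_distrib_left)
 also have "(\<Sum>C\<in>dmat n S ?J. xr (rkm n C)) = (\<Sum>r\<le>n. \<Sum>C\<in>{C \<in> dmat n S ?J. rkm n C = r}. xr (rkm n C))"
 proof (rule sum.group[symmetric])
  show "rkm n ` dmat n S ?J \<subseteq> {..n}" using rkm[OF dmat_int] by (auto simp: has_rank_def)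
 qed (use finite_dmat in auto)
 also have "\<dots> = (\<Sum>r\<le>n. of_nat (Nr n S ?J r) * xr r)"
  by (intro sum.cong) (auto simp: Nr_def)
 finally show ?thesis by (simp add: card_HN power_add mult_ac)
qed

text \<open>The normalising power of \<open>l\<close> times the numbers of choices for
  \<open>A\<close> and \<open>D\<close> becomes a product over \<open>S\<close> and
  \<open>S'\<close>. The mixed term \<open>card S * card S'\<close> in the exponent is absorbed in
  the factors over \<open>S\<close>, as the parameter \<open>Y = q ^ card S' / q\<close> of
  \<open>rank_sum\<close>.\<close>

lemma HN_weight:
 assumes S: "S \<subseteq> {..<n}" "S' \<subseteq> {..<n}"
 defines "k \<equiv> card S + card S'"
 shows "(- 1) ^ k * real l powr (- real k / 2 - real k * (2 * real n - real k) / 2) * real l ^ (card (HNpos n S) + card (HNpos n S')) =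
  (\<Prod>i\<in>S. - (real l ^ card S' / real l) / real l ^ i) * (\<Prod>i\<in>S'. - (1 / real l) / real l ^ i)"
proof -
 have fin: "finite S" "finite S'" using S finite_subset by auto
 have P: "(\<Prod>i\<in>T. - (real l ^ c / real l) / real l ^ i) = (- 1) ^ card T * real l powr (\<Sum>i\<in>T. real c - 1 - real i)"
  if "finite T" for T :: "nat set" and c
 proof -
  have "- (real l ^ c / real l) / real l ^ i = - 1 * real l powr (real c - 1 - real i)" for i
   using l_pos by (simp add: powr_diff powr_realpow)
  then have "(\<Prod>i\<in>T. - (real l ^ c / real l) / real l ^ i) = (\<Prod>i\<in>T. - 1 * real l powr (real c - 1 - real i))" by simp
  also have "\<dots> = (- 1) ^ card T * (\<Prod>i\<in>T. real l powr (real c - 1 - real i))" by (simp only: prod.distrib prod_constant)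
  finally show ?thesis using l_pos by (simp add: powr_sum that)
 qed
 have P0: "(\<Prod>i\<in>S'. - (1 / real l) / real l ^ i) = (- 1) ^ card S' * real l powr (\<Sum>i\<in>S'. - 1 - real i)"
  using P[OF fin(2), of 0] by simp
 have h: "real l ^ (card (HNpos n S) + card (HNpos n S')) = real l powr (real (card (HNpos n S)) + real (card (HNpos n S')))"
  using l_pos by (simp add: powr_realpow[symmetric])
 let ?s = "\<Sum>i\<in>S. real i" and ?s' = "\<Sum>i\<in>S'. real i"
 have s: "(\<Sum>i\<in>T. x - real i) = real (card T) * x - (\<Sum>i\<in>T. real i)" for T x by (simp add: sum_subtractf)
 have ex: "(- real k / 2 - real k * (2 * real n - real k) / 2) + (real (card (HNpos n S)) + real (card (HNpos n S'))) =
  (\<Sum>i\<in>S. real (card S') - 1 - real i) + (\<Sum>i\<in>S'. - 1 - real i)"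
  unfolding card_HNpos[OF S(1)] card_HNpos[OF S(2)] s k_def of_nat_add by (simp add: field_simps)
 show ?thesis unfolding P[OF fin(1)] P0 h mult.assoc powr_add[symmetric] ex
  unfolding k_def power_add powr_add by (simp only: mult_ac)
qed

text \<open>For fixed \<open>S'\<close> the sum over \<open>S\<close> is the one in
  \<open>rank_sum\<close> with \<open>Y = q ^ card S' / q\<close> and \<open>n - card S'\<close>
  columns. By \<open>rank_sum_vanish\<close> only the empty \<open>S'\<close> contributes, where
  \<open>Y\<close> is \<open>1 / q\<close>.\<close>

lemma H_sum:
 "(\<Sum>k\<le>2 * n. (- 1) ^ k * of_real (real l powr (- real k / 2 - real k * (real (2 * n) - real k) / 2)) * (\<Sum>x\<in>HNk (2 * n) k. F x)) =
  (\<Sum>r\<le>n. co (of_nat l) (1 / of_nat l) r (n - r) * of_nat (Nr n {..<n} {..<n} r) * xr r)"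
proof -
 let ?w = "\<lambda>k. (- 1) ^ k * of_real (real l powr (- real k / 2 - real k * (real (2 * n) - real k) / 2)) :: complex"
 let ?q = "of_nat l :: complex"
 let ?V = "\<lambda>S'. (\<Prod>i\<in>S'. - (1 / ?q) / ?q ^ i) * \<omega> lq ^ (2 * card S')"
 let ?f = "\<lambda>S. ?w (card S) * (\<Sum>x\<in>HN (2 * n) S. F x)"
 have "(\<Sum>k\<le>2 * n. ?w k * (\<Sum>x\<in>HNk (2 * n) k. F x)) = (\<Sum>k\<le>2 * n. \<Sum>S\<in>{S \<in> Pow {..<2 * n}. card S = k}. ?f S)"
 proof (rule sum.cong[OF refl])
  fix k
  have "?w k * (\<Sum>x\<in>HNk (2 * n) k. F x) = (\<Sum>S\<in>{S. S \<subseteq> {..<2 * n} \<and> card S = k}. ?w k * (\<Sum>x\<in>HN (2 * n) S. F x))"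
   unfolding sum_HNk sum_distrib_left ..
  also have "\<dots> = (\<Sum>S\<in>{S \<in> Pow {..<2 * n}. card S = k}. ?f S)" by (rule sum.cong) auto
  finally show "?w k * (\<Sum>x\<in>HNk (2 * n) k. F x) = (\<Sum>S\<in>{S \<in> Pow {..<2 * n}. card S = k}. ?f S)" .
 qed
 also have "\<dots> = (\<Sum>S\<in>Pow {..<2 * n}. ?f S)"
 proof (rule sum.group)
  show "card ` Pow {..<2 * n} \<subseteq> {..2 * n}" using card_mono[of "{..<2 * n}"] by force
 qed auto
 also have "\<dots> = (\<Sum>p\<in>Pow {..<n} \<times> Pow {..<n}. ?f ((\<lambda>(S, S'). S \<union> (\<lambda>i. n + i) ` S') p))"
  by (rule sum.reindex_bij_betw[OF bij_Pow_split, symmetric])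
 also have "\<dots> = (\<Sum>(S, S')\<in>Pow {..<n} \<times> Pow {..<n}. ?V S' *
  (\<Sum>r\<le>n. xr r * ((\<Prod>i\<in>S. - (?q ^ card S' / ?q) / ?q ^ i) * of_nat (Nr n S ({..<n} - S') r))))"
 proof (rule sum.cong[OF refl])
  fix p assume p: "p \<in> Pow {..<n} \<times> Pow {..<n}"
  obtain S S' where pp: "p = (S, S')" by fastforce
  have S: "S \<subseteq> {..<n}" "S' \<subseteq> {..<n}" using p unfolding pp by auto
  have fin: "finite S" "finite S'" using S finite_subset by auto
  let ?k = "card S + card S'"
  have "card (S \<union> (\<lambda>i. n + i) ` S') = card S + card ((\<lambda>i. n + i) ` S')" using fin S by (intro card_Un_disjoint) auto
  then have k: "card (S \<union> (\<lambda>i. n + i) ` S') = ?k" by (simp add: card_image)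
  have W: "?w ?k * ?q ^ (card (HNpos n S) + card (HNpos n S')) =
   (\<Prod>i\<in>S. - (?q ^ card S' / ?q) / ?q ^ i) * (\<Prod>i\<in>S'. - (1 / ?q) / ?q ^ i)"
  proof -
   have "?w ?k * ?q ^ (card (HNpos n S) + card (HNpos n S')) =
    of_real ((- 1) ^ ?k * real l powr (- real ?k / 2 - real ?k * (2 * real n - real ?k) / 2) * real l ^ (card (HNpos n S) + card (HNpos n S')))"
    by simp
   also have "\<dots> = of_real ((\<Prod>i\<in>S. - (real l ^ card S' / real l) / real l ^ i) * (\<Prod>i\<in>S'. - (1 / real l) / real l ^ i))"
    unfolding HN_weight[OF S] ..
   also have "\<dots> = (\<Prod>i\<in>S. - (?q ^ card S' / ?q) / ?q ^ i) * (\<Prod>i\<in>S'. - (1 / ?q) / ?q ^ i)" by simp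
   finally show ?thesis .
  qed
  have "?f (S \<union> (\<lambda>i. n + i) ` S') = (?w ?k * ?q ^ (card (HNpos n S) + card (HNpos n S'))) * \<omega> lq ^ (2 * card S') *
   (\<Sum>r\<le>n. of_nat (Nr n S ({..<n} - S') r) * xr r)"
   unfolding k sum_F_HN[OF S] by (simp only: mult_ac)
  also have "\<dots> = ?V S' * ((\<Prod>i\<in>S. - (?q ^ card S' / ?q) / ?q ^ i) * (\<Sum>r\<le>n. of_nat (Nr n S ({..<n} - S') r) * xr r))"
   unfolding W by (simp only: mult_ac)
  finally show "?f ((\<lambda>(S, S'). S \<union> (\<lambda>i. n + i) ` S') p) = (case p of (S, S') => ?V S' *
   (\<Sum>r\<le>n. xr r * ((\<Prod>i\<in>S. - (?q ^ card S' / ?q) / ?q ^ i) * of_nat (Nr n S ({..<n} - S') r))))"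
   unfolding pp prod.case sum_distrib_left by (simp only: mult_ac)
 qed
 also have "\<dots> = (\<Sum>S\<in>Pow {..<n}. \<Sum>S'\<in>Pow {..<n}. ?V S' *
  (\<Sum>r\<le>n. xr r * ((\<Prod>i\<in>S. - (?q ^ card S' / ?q) / ?q ^ i) * of_nat (Nr n S ({..<n} - S') r))))"
  by (rule sum.cartesian_product[symmetric])
 also have "\<dots> = (\<Sum>S'\<in>Pow {..<n}. \<Sum>S\<in>Pow {..<n}. ?V S' *
  (\<Sum>r\<le>n. xr r * ((\<Prod>i\<in>S. - (?q ^ card S' / ?q) / ?q ^ i) * of_nat (Nr n S ({..<n} - S') r))))"
  by (rule sum.swap)
 also have "\<dots> = (\<Sum>S'\<in>Pow {..<n}. ?V S' * (\<Sum>r\<le>n. xr r *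
  (\<Sum>S\<in>Pow {..<n}. (\<Prod>i\<in>S. - (?q ^ card S' / ?q) / ?q ^ i) * of_nat (Nr n S ({..<n} - S') r))))"
 proof (rule sum.cong[OF refl])
  fix S' :: "nat set"
  let ?g = "\<lambda>S r. (\<Prod>i\<in>S. - (?q ^ card S' / ?q) / ?q ^ i) * of_nat (Nr n S ({..<n} - S') r)"
  have "(\<Sum>S\<in>Pow {..<n}. ?V S' * (\<Sum>r\<le>n. xr r * ?g S r)) = ?V S' * (\<Sum>S\<in>Pow {..<n}. \<Sum>r\<le>n. xr r * ?g S r)"
   by (simp only: sum_distrib_left)
  also have "(\<Sum>S\<in>Pow {..<n}. \<Sum>r\<le>n. xr r * ?g S r) = (\<Sum>r\<le>n. \<Sum>S\<in>Pow {..<n}. xr r * ?g S r)" by (rule sum.swap)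
  finally show "(\<Sum>S\<in>Pow {..<n}. ?V S' * (\<Sum>r\<le>n. xr r * ?g S r)) = ?V S' * (\<Sum>r\<le>n. xr r * (\<Sum>S\<in>Pow {..<n}. ?g S r))"
   by (simp only: sum_distrib_left)
 qed
 also have "\<dots> = (\<Sum>S'\<in>Pow {..<n}. if S' = {} then
  (\<Sum>r\<le>n. co ?q (1 / ?q) r (n - r) * of_nat (Nr n {..<n} {..<n} r) * xr r) else 0)"
 proof (rule sum.cong[OF refl])
  fix S' assume S': "S' \<in> Pow {..<n}"
  let ?E = "\<lambda>r. \<Sum>S\<in>Pow {..<n}. (\<Prod>i\<in>S. - (?q ^ card S' / ?q) / ?q ^ i) * of_nat (Nr n S ({..<n} - S') r)"
  show "?V S' * (\<Sum>r\<le>n. xr r * ?E r) = (if S' = {} then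
   (\<Sum>r\<le>n. co ?q (1 / ?q) r (n - r) * of_nat (Nr n {..<n} {..<n} r) * xr r) else 0)"
  proof (cases "S' = {}")
   case True
   have "?E r = co ?q (1 / ?q) r (n - r) * of_nat (Nr n {..<n} {..<n} r)" if "r \<le> n" for r
    using Nr_rank_sum(2)[of "{..<n}" n "1 / ?q" r] that True by simp
   then have "(\<Sum>r\<le>n. xr r * ?E r) = (\<Sum>r\<le>n. co ?q (1 / ?q) r (n - r) * of_nat (Nr n {..<n} {..<n} r) * xr r)"
    by (intro sum.cong) (simp_all add: mult_ac)
   then show ?thesis using True by simp
  next
   case False
   have fS: "finite S'" using S' finite_subset by auto
   have b: "1 \<le> card S'" using False fS card_gt_0_iff[of S'] by linarith
   have bn: "card S' \<le> n" using card_mono[of "{..<n}" S'] S' by simp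
   have cJ: "card ({..<n} - S') = n - card S'" using S' fS by (simp add: card_Diff_subset)
   have "?E r = 0" for r by (rule Nr_rank_sum(3)[OF _ b bn cJ]) auto
   then show ?thesis using False by simp
  qed
 qed
 also have "\<dots> = (\<Sum>r\<le>n. co ?q (1 / ?q) r (n - r) * of_nat (Nr n {..<n} {..<n} r) * xr r)"
  by (subst sum.delta) auto
 finally show ?thesis .
qed

end

section \<open>The L-value as an alternating sum of Hecke eigenvalues\<close>

text \<open>In the normalising exponent the term \<open>- k (m - k) / 2\<close> cancels the power of
  \<open>l\<close> in \<open>sphf_eigenvalue\<close>, and \<open>- k / 2\<close> is the value of
  \<open>q ^ (- s k)\<close> at \<open>s = 1 / 2\<close>. What remains is the expansion of the
  product of the \<open>1 - \<mu> i lq * q ^ (- s)\<close> in elementary symmetric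
  polynomials.\<close>

lemma satake_L_factor:
 fixes \<tau> :: "'a mat => 'v::ab_group_add => 'v" and \<xi> :: "'v => complex"
 assumes S: "hecke_module l smul m UNIV \<tau>" and irr: "irreducible_rep smul (GL m) \<tau>"
  and adm: "admissible_rep smul (GL m) (GL_top m :: 'a mat topology) \<tau>" and unr: "unramified_rep m \<tau>"
  and v: "\<And>k. k \<in> KG m ==> \<tau> k v = v" and \<xi>: "\<And>c w. \<xi> (smul c w) = c * \<xi> w"
 shows "(\<Sum>k\<le>m. (- 1) ^ k * of_real (real l powr (- real k / 2 - real k * (real m - real k) / 2)) * \<xi> (\<Sum>x\<in>HNk m k. \<tau> x v)) =
  inverse (L_factor l m smul \<tau> (1 / 2)) * \<xi> v"
proof -
 define \<mu> where "\<mu> = (SOME \<mu>. (\<forall>i<m. unramified_char (\<mu> i)) \<and> subquotient_of_principal_series m smul \<tau> \<mu>)"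
 have "(\<forall>i<m. unramified_char (\<mu> i)) \<and> subquotient_of_principal_series m smul \<tau> \<mu>"
  unfolding \<mu>_def by (rule someI_ex[OF satake_exists[OF S irr adm unr]])
 then have \<mu>: "\<And>i. i < m ==> unramified_char (\<mu> i)" and sub: "subquotient_of_principal_series m smul \<tau> \<mu>" by auto
 let ?\<alpha> = "\<lambda>i. \<mu> i lq"
 define z where "z = (- of_real (real l powr (- 1 / 2)) :: complex)"
 have T: "(- 1) ^ k * of_real (real l powr (- real k / 2 - real k * (real m - real k) / 2)) * \<xi> (\<Sum>x\<in>HNk m k. \<tau> x v) =
  z ^ k * esym m ?\<alpha> k * \<xi> v" if k: "k \<le> m" for k
 proof -
  have "(\<Sum>x\<in>HNk m k. \<tau> x v) = smul (\<Sum>x\<in>HNk m k. sphf m \<mu> x) v"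
   by (rule satake_eigenvalue[OF S _ sub]) (simp_all add: \<mu> v)
  also have "(\<Sum>x\<in>HNk m k. sphf m \<mu> x) = of_real (real l powr (real k * (real m - real k) / 2)) * esym m ?\<alpha> k"
   by (rule sphf_eigenvalue) (simp_all add: \<mu> k)
  finally have e: "\<xi> (\<Sum>x\<in>HNk m k. \<tau> x v) = of_real (real l powr (real k * (real m - real k) / 2)) * esym m ?\<alpha> k * \<xi> v"
   by (simp add: \<xi>)
  have "(real l powr (- 1 / 2)) ^ k = real l powr (- real k / 2)" using l_pos by (simp add: powr_powr flip: powr_realpow)
  also have "\<dots> = real l powr (- real k / 2 - real k * (real m - real k) / 2) * real l powr (real k * (real m - real k) / 2)"
   by (simp add: powr_add[symmetric])
  finally have "z ^ k = (- 1) ^ k * (of_real (real l powr (- real k / 2 - real k * (real m - real k) / 2)) *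
   of_real (real l powr (real k * (real m - real k) / 2)))"
   unfolding z_def power_minus[of "of_real _"] of_real_power[symmetric] of_real_mult[symmetric] by simp
  then show ?thesis unfolding e by (simp only: mult_ac)
 qed
 have "(\<Sum>k\<le>m. z ^ k * esym m ?\<alpha> k) = (\<Prod>i<m. 1 - \<mu> i lq * of_real (real l powr (- 1 / 2)))"
 proof -
  have "(\<Prod>i<m. 1 - \<mu> i lq * of_real (real l powr (- 1 / 2))) = (\<Prod>i<m. ?\<alpha> i * z + 1)" by (simp add: z_def)
  also have "\<dots> = (\<Sum>S\<in>Pow {..<m}. z ^ card S * prod ?\<alpha> S)"
   unfolding prod_pow_expand by (intro sum.cong) (simp_all add: prod.distrib mult.commute)
  also have "\<dots> = (\<Sum>k\<le>m. \<Sum>S\<in>{S \<in> Pow {..<m}. card S = k}. z ^ card S * prod ?\<alpha> S)"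
  proof (rule sum.group[symmetric])
   show "card ` Pow {..<m} \<subseteq> {..m}" using card_mono[of "{..<m}"] by force
  qed auto
  also have "\<dots> = (\<Sum>k\<le>m. z ^ k * esym m ?\<alpha> k)"
   unfolding esym_def sum_distrib_left by (intro sum.cong) auto
  finally show ?thesis ..
 qed
 also have "\<dots> = inverse (L_factor l m smul \<tau> (1 / 2))"
 proof -
  have "(of_nat l :: complex) powr (- (1 / 2)) = of_real (real l powr (- 1 / 2))"
   using powr_of_real[of "real l" "- 1 / 2"] by simp
  moreover have "inverse (\<Prod>i<k. inverse (f i)) = (\<Prod>i<k. f i)" for k and f :: "nat => complex"
   by (induction k) simp_all
  ultimately show ?thesis unfolding L_factor_def Let_def \<mu>_def[symmetric] by simp
 qed
 finally show ?thesis using T by (simp add: sum_distrib_right[symmetric])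
qed


section \<open>Unramified twists\<close>

text \<open>Compactness bounds the determinant on \<open>U\<close>, while the powers of an element
  with determinant above 1 in absolute value would make it unbounded; inverses exclude values below
  1. Hence an unramified twist has the same vectors fixed by \<open>U\<close>, which preserves
  admissibility.\<close>

lemma compact_subgroup_det:
 assumes U: "open_subgroup (GL m) (GL_top m) U" "compactin (GL_top m) U" and u: "u \<in> U"
 shows "vn (mdet (u :: 'a mat)) = 1"
proof -
 interpret subgroup U "GL m" using U(1) by (simp add: open_subgroup_def)
 let ?W = "\<lambda>N :: nat. {x \<in> carrier (GL m :: 'a mat monoid). vn (mdet x) < real N}"
 have op: "openin (GL_top m) (?W N)" for N
 proof (rule right_invariant_open)
  fix x k assume x: "x \<in> ?W N" and k: "k \<in> KG m"
  have "mdet (x * k) = mdet x * mdet k"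
   using x by (intro det_mult[OF GL_carrier_mat GL_int_carrier[OF k]]) blast
  then show "x * k \<in> ?W N" using x k GL_mult_closed[of x m k] GL_int_GL[OF k] by (simp add: vn_mult GL_int_iff)
 qed auto
 have cov: "U \<subseteq> \<Union>(range ?W)"
 proof
  fix x assume x: "x \<in> U"
  obtain N :: nat where "vn (mdet x) < real N" using reals_Archimedean2 by blast
  then show "x \<in> \<Union>(range ?W)" using subset x by blast
 qed
 obtain \<F> where F: "finite \<F>" "\<F> \<subseteq> range ?W" "U \<subseteq> \<Union>\<F>"
  using compactinD[OF U(2), of "range ?W"] op cov by blast
 obtain I where I: "finite I" "\<F> = ?W ` I" using finite_subset_image[OF F(1,2)] by blast
 have bound: "vn (mdet x) < real (Max (insert 0 I))" if x: "x \<in> U" for x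
 proof -
  obtain N where N: "N \<in> I" "x \<in> ?W N" using F(3) I(2) x by blast
  have "N \<le> Max (insert 0 I)" using I(1) N(1) by simp
  then have "real N \<le> real (Max (insert 0 I))" by simp
  then show ?thesis using N(2) by simp
 qed
 have le: "vn (mdet x) \<le> 1" if x: "x \<in> U" for x
 proof (rule ccontr)
  assume "\<not> vn (mdet x) \<le> 1"
  then have gt: "1 < vn (mdet x)" by simp
  have pw: "\<exists>y\<in>U. vn (mdet y) = vn (mdet x) ^ k" for k
  proof (induction k)
   case 0
   then show ?case using one_closed by (intro bexI[of _ "1\<^sub>m m"]) auto
  next
   case (Suc k)
   then obtain y where y: "y \<in> U" "vn (mdet y) = vn (mdet x) ^ k" by blast
   have c: "x \<in> carrier_mat m m" "y \<in> carrier_mat m m" using GL_carrier_mat subset x y(1) by blast+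
   have "x * y \<in> U" using m_closed[OF x y(1)] by simp
   moreover have "vn (mdet (x * y)) = vn (mdet x) ^ Suc k"
    using y(2) det_mult[OF c] by (simp add: vn_mult)
   ultimately show ?case by blast
  qed
  obtain k where k: "real (Max (insert 0 I)) < vn (mdet x) ^ k" using real_arch_pow[OF gt] by blast
  obtain y where "y \<in> U" "vn (mdet y) = vn (mdet x) ^ k" using pw by blast
  then show False using bound[of y] k by simp
 qed
 have "vn (mdet (minv m u)) \<le> 1" using le m_inv_closed[OF u] by blast
 moreover have uG: "u \<in> GLc m" using subset u by blast
 ultimately have "inverse (vn (mdet u)) \<le> 1" by (simp add: det_minv vn_inverse)
 moreover have "0 < vn (mdet u)" using uG by (simp add: GL_carrier)
 ultimately have "1 \<le> vn (mdet u)" by (simp add: field_simps)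
 then show ?thesis using le[OF u] by simp
qed

context
 fixes smul :: "complex => 'v::ab_group_add => 'v" and \<sigma> :: "'a mat => 'v => 'v" and m :: nat and \<omega> :: "'a => complex"
 assumes rep: "group_rep smul (GL m) \<sigma>" and \<omega>: "unramified_char \<omega>"
begin

interpretation VS: vector_space smul using rep by (simp add: group_rep_def)

lemma twist_unit: "vn (mdet g) = 1 ==> twist smul \<sigma> \<omega> g v = \<sigma> g v"
 by (simp add: twist_def unram(3)[OF \<omega>])

lemma det_GL: "g \<in> GLc m ==> mdet g \<noteq> 0" by (simp add: GL_carrier)

lemma group_rep_twist: "group_rep smul (GL m) (twist smul \<sigma> \<omega>)"
proof -
 have lin: "Vector_Spaces.linear smul smul (\<sigma> g)" if "g \<in> carrier (GL m :: 'a mat monoid)" for g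
  using rep that unfolding group_rep_def by blast
 have one: "\<sigma> (1\<^sub>m m) v = v" for v using rep unfolding group_rep_def by simp
 have mult: "\<sigma> (g * h) v = \<sigma> g (\<sigma> h v)" if "g \<in> carrier (GL m :: 'a mat monoid)" "h \<in> carrier (GL m :: 'a mat monoid)" for g h v
  using rep that unfolding group_rep_def by simp
 show ?thesis unfolding group_rep_def
 proof (intro conjI ballI allI)
  show "vector_space smul" using rep by (simp add: group_rep_def)
  fix g assume g: "g \<in> carrier (GL m :: 'a mat monoid)"
  interpret L: Vector_Spaces.linear smul smul "\<sigma> g" by (rule lin[OF g])
  show "Vector_Spaces.linear smul smul (twist smul \<sigma> \<omega> g)"
   by unfold_locales (simp_all add: twist_def L.add L.scale VS.scale_right_distrib mult.commute)
  fix h v assume h: "h \<in> carrier (GL m :: 'a mat monoid)"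
  have d: "mdet (g * h) = mdet g * mdet h"
   by (rule det_mult[OF GL_carrier_mat[OF g] GL_carrier_mat[OF h]])
  show "twist smul \<sigma> \<omega> (g \<otimes>\<^bsub>GL m\<^esub> h) v = twist smul \<sigma> \<omega> g (twist smul \<sigma> \<omega> h v)"
   by (simp add: twist_def d unram(1)[OF \<omega> det_GL[OF g] det_GL[OF h]] mult[OF g h] L.scale)
 next
  fix v show "twist smul \<sigma> \<omega> \<one>\<^bsub>GL m\<^esub> v = v" using twist_unit[of "1\<^sub>m m" v] one by simp
 qed
qed

lemma smooth_rep_twist:
 assumes "smooth_rep (GL m) (GL_top m) \<sigma>" shows "smooth_rep (GL m) (GL_top m) (twist smul \<sigma> \<omega>)"
 unfolding smooth_rep_def
proof
 fix v
 obtain U where U: "open_subgroup (GL m) (GL_top m) U" "v \<in> fixed_vectors \<sigma> U"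
  using assms by (auto simp: smooth_rep_def)
 \<comment> \<open>On integral matrices the twist is trivial, so the stabiliser is shrunk to its
   integral part.\<close>
 have "v \<in> fixed_vectors (twist smul \<sigma> \<omega>) (U \<inter> KG m)"
  unfolding fixed_vectors_def
 proof (intro CollectI ballI)
  fix u assume u: "u \<in> U \<inter> KG m"
  then have "vn (mdet u) = 1" by (simp add: GL_int_iff)
  then show "twist smul \<sigma> \<omega> u v = v" using twist_unit[of u v] U(2) u by (simp add: fixed_vectors_def)
 qed
 then show "\<exists>U. open_subgroup (GL m) (GL_top m) U \<and> v \<in> fixed_vectors (twist smul \<sigma> \<omega>) U"
  using open_subgroup_Int[OF U(1) KG_open_subgroup] by blast
qed

lemma irreducible_rep_twist:
 assumes irr: "irreducible_rep smul (GL m) \<sigma>" shows "irreducible_rep smul (GL m) (twist smul \<sigma> \<omega>)"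
 unfolding irreducible_rep_def
proof (intro conjI allI impI)
 show "\<exists>v::'v. v \<noteq> 0" using irr by (simp add: irreducible_rep_def)
 fix W assume W: "VS.subspace W \<and> (\<forall>g\<in>GLc m. twist smul \<sigma> \<omega> g ` W \<subseteq> W)"
 have "\<sigma> g w \<in> W" if g: "g \<in> carrier (GL m :: 'a mat monoid)" and w: "w \<in> W" for g w
 proof -
  have "twist smul \<sigma> \<omega> g w \<in> W" using W g w by blast
  then have "smul (inverse (\<omega> (mdet g))) (twist smul \<sigma> \<omega> g w) \<in> W" using W VS.subspace_scale by blast
  then show ?thesis using unram(2)[OF \<omega> det_GL[OF g]] by (simp add: twist_def)
 qed
 then have "VS.subspace W \<and> (\<forall>g\<in>GLc m. \<sigma> g ` W \<subseteq> W)" using W by blast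
 then show "W = {0} \<or> W = UNIV" using irr unfolding irreducible_rep_def by blast
qed

lemma admissible_rep_twist:
 assumes adm: "admissible_rep smul (GL m) (GL_top m) \<sigma>" shows "admissible_rep smul (GL m) (GL_top m) (twist smul \<sigma> \<omega>)"
 unfolding admissible_rep_def
proof (intro allI impI)
 fix U :: "'a mat set" assume U: "open_subgroup (GL m) (GL_top m) U \<and> compactin (GL_top m) U"
 have "fixed_vectors (twist smul \<sigma> \<omega>) U = fixed_vectors \<sigma> U"
  unfolding fixed_vectors_def using twist_unit[OF compact_subgroup_det[OF conjunct1[OF U] conjunct2[OF U]]] by auto
 then show "\<exists>B. finite B \<and> fixed_vectors (twist smul \<sigma> \<omega>) U \<subseteq> VS.span B"
  using adm U unfolding admissible_rep_def by simp
qed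

lemma unramified_rep_twist:
 assumes "unramified_rep m \<sigma>" shows "unramified_rep m (twist smul \<sigma> \<omega>)"
proof -
 have "fixed_vectors (twist smul \<sigma> \<omega>) (KG m) = fixed_vectors \<sigma> (KG m)"
  unfolding fixed_vectors_def using twist_unit by (auto simp: GL_int_iff)
 then show ?thesis using assms by (simp add: unramified_rep_def)
qed

end

text \<open>The same alternating sum of Hecke operators is evaluated twice: by \<open>H_sum\<close>
  from the invariance of the functional, and by \<open>satake_L_factor\<close> from the principal
  series.\<close>

lemma Hom_H_eigenvalue:
 fixes \<sigma> :: "'a mat => 'v::ab_group_add => 'v"
 assumes n: "1 \<le> n" and rep: "group_rep smul (GL (2 * n)) \<sigma>" and irr: "irreducible_rep smul (GL (2 * n)) \<sigma>"
  and sm: "smooth_rep (GL (2 * n)) (GL_top (2 * n)) \<sigma>" and adm: "admissible_rep smul (GL (2 * n)) (GL_top (2 * n)) \<sigma>"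
  and unr: "unramified_rep (2 * n) \<sigma>" and \<omega>: "unramified_char \<omega>"
  and \<xi>: "\<xi> \<in> Hom_H n smul (box_inv_char smul (triv_box \<sigma>) \<omega>)" and v: "\<And>k. k \<in> KG (2 * n) ==> \<sigma> k v = v"
 shows "(\<Sum>r\<le>n. co (of_nat l) (1 / of_nat l) r (n - r) * of_nat (Nr n {..<n} {..<n} r) * \<xi> (\<sigma> (ur n r) v)) =
  inverse (L_factor l (2 * n) smul (twist smul \<sigma> \<omega>) (1 / 2)) * \<xi> v"
proof -
 let ?t = "twist smul \<sigma> \<omega>"
 let ?F = "\<lambda>g. \<xi> (?t g v)"
 have \<xi>lin: "Vector_Spaces.linear smul (*) \<xi>"
  and \<xi>H: "\<And>h w. h \<in> carrier (H_grp n) ==> \<xi> (box_inv_char smul (triv_box \<sigma>) \<omega> (H_emb n h) w) = \<xi> w"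
  using \<xi> by (auto simp: Hom_H_def)
 interpret X: Vector_Spaces.linear smul "(*)" \<xi> by (rule \<xi>lin)
 note trep = group_rep_twist[OF rep \<omega>]
 have tmult: "?t (g * h) w = ?t g (?t h w)" if "g \<in> GLc (2 * n)" "h \<in> GLc (2 * n)" for g h w
  using trep that unfolding group_rep_def by simp
 have tv: "?t k v = v" if "k \<in> KG (2 * n)" for k
  using v[OF that] that twist_unit[OF rep \<omega>, of k v] by (simp add: GL_int_iff)
 have FK: "?F (g * k) = ?F g" if "g \<in> GLc (2 * n)" "k \<in> KG (2 * n)" for g k
  using tmult[OF that(1) GL_int_GL[OF that(2)]] tv[OF that(2)] by simp
 \<comment> \<open>The last component of \<open>H_emb\<close> gives
   \<open>\<omega> (det h2) / \<omega> (det h1)\<close>, the twist gives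
   \<open>\<omega> (det h1) \<omega> (det h2)\<close>.\<close>
 have FH: "?F (dg n h1 h2 * g) = \<omega> (mdet h2) ^ 2 * ?F g"
  if h: "h1 \<in> GLc n" "h2 \<in> GLc n" and g: "g \<in> GLc (2 * n)" for h1 h2 g
 proof -
  let ?d1 = "mdet h1" and ?d2 = "mdet h2" and ?w = "?t g v"
  have d: "?d1 \<noteq> 0" "?d2 \<noteq> 0" using h by (auto simp: GL_carrier)
  have "(1, h1, h2) \<in> carrier (H_grp n)" using h by (simp add: H_grp_def)
  from \<xi>H[OF this, of ?w] have "inverse (\<omega> (?d2 / ?d1)) * \<xi> (\<sigma> (dg n h1 h2) ?w) = \<xi> ?w"
   by (simp add: H_emb_def box_inv_char_def triv_box_def dg_def X.scale)
  moreover have "\<omega> (?d2 / ?d1) = \<omega> ?d2 * inverse (\<omega> ?d1)"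
   using unram(1)[OF \<omega>, of ?d2 "inverse ?d1"] unram_inverse[OF \<omega> d(1)] d by (simp add: divide_inverse)
  moreover have nz: "\<omega> ?d1 \<noteq> 0" "\<omega> ?d2 \<noteq> 0" using unram(2)[OF \<omega>] d by auto
  ultimately have "\<xi> (\<sigma> (dg n h1 h2) ?w) = \<omega> ?d2 * inverse (\<omega> ?d1) * \<xi> ?w" by (simp add: field_simps)
  moreover have "\<omega> (mdet (dg n h1 h2)) = \<omega> ?d1 * \<omega> ?d2"
   unfolding dg_def using det_fb[OF GL_carrier_mat[OF h(1)] zero_carrier_mat GL_carrier_mat[OF h(2)]] unram(1)[OF \<omega> d] by simp
  moreover have "?F (dg n h1 h2 * g) = \<omega> (mdet (dg n h1 h2)) * \<xi> (\<sigma> (dg n h1 h2) ?w)"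
   unfolding tmult[OF dg_GL[OF h] g] by (simp only: twist_def[of smul \<sigma> \<omega> "dg n h1 h2"] X.scale)
  ultimately show ?thesis using nz by (simp add: power2_eq_square field_simps)
 qed
 have xr: "?F (ur n r) = \<xi> (\<sigma> (ur n r) v)" for r
 proof -
  have "mdet (ur n r) = 1"
   unfolding um_def using det_fb[of "1\<^sub>m n" n "inverse lq \<cdot>\<^sub>m Xr n r" "1\<^sub>m n"] by simp
  then show ?thesis using twist_unit[OF rep \<omega>] by simp
 qed
 have "(\<Sum>r\<le>n. co (of_nat l) (1 / of_nat l) r (n - r) * of_nat (Nr n {..<n} {..<n} r) * ?F (ur n r)) =
  (\<Sum>k\<le>2 * n. (- 1) ^ k * of_real (real l powr (- real k / 2 - real k * (real (2 * n) - real k) / 2)) * (\<Sum>x\<in>HNk (2 * n) k. ?F x))"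
  by (rule H_sum[OF \<omega> FK FH, symmetric]) assumption+
 also have "\<dots> = (\<Sum>k\<le>2 * n. (- 1) ^ k * of_real (real l powr (- real k / 2 - real k * (real (2 * n) - real k) / 2)) *
   \<xi> (\<Sum>x\<in>HNk (2 * n) k. ?t x v))" by (simp only: X.sum)
 also have "\<dots> = inverse (L_factor l (2 * n) smul ?t (1 / 2)) * \<xi> v"
 proof (rule satake_L_factor)
  show "hecke_module l smul (2 * n) UNIV ?t" by (rule rep_module[OF trep smooth_rep_twist[OF rep \<omega> sm]])
  show "irreducible_rep smul (GL (2 * n)) ?t" by (rule irreducible_rep_twist[OF rep \<omega> irr])
  show "admissible_rep smul (GL (2 * n)) (GL_top (2 * n)) ?t" by (rule admissible_rep_twist[OF rep \<omega> adm])
  show "unramified_rep (2 * n) ?t" by (rule unramified_rep_twist[OF rep \<omega> unr])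
  show "?t k v = v" if "k \<in> KG (2 * n)" for k by (rule tv[OF that])
  show "\<xi> (smul c w) = c * \<xi> w" for c w by (rule X.scale)
 qed
 finally show ?thesis unfolding xr .
qed

end

theorem theorem4p1:
  fixes l n :: nat
    and smul :: "complex \<Rightarrow> 'v::ab_group_add \<Rightarrow> 'v"
    and \<sigma> :: "'a::{field_char_0, complete_space} mat \<Rightarrow> 'v \<Rightarrow> 'v"
    and \<mu> :: "(('a \<times> 'a mat) \<times> 'a) measure"
  assumes "padic_field TYPE('a) l"
    and "n \<ge> 1"
    and "group_rep smul (GL (2 * n)) \<sigma>"
    and "irreducible_rep smul (GL (2 * n)) \<sigma>"
    and "smooth_rep (GL (2 * n)) (GL_top (2 * n)) \<sigma>"
    and "admissible_rep smul (GL (2 * n)) (GL_top (2 * n)) \<sigma>"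
    and "unramified_rep (2 * n) \<sigma>"
    and "has_shalika_model l n smul \<sigma>"
    and "haar_measure (Gt n) (Gt_top n) (K_int n) \<mu>"
  shows "\<exists>(\<phi> :: ('a \<times> 'a mat) \<times> 'a \<Rightarrow> int) (b :: nat \<Rightarrow> int).
    loc_const_compact_supp (Gt_top n) \<phi> \<and>
    (\<forall>\<omega> :: 'a \<Rightarrow> complex. unramified_char \<omega> \<and> finite_order_char \<omega> \<longrightarrow>
      (let \<tau> = box_inv_char smul (triv_box \<sigma>) \<omega> in
        \<forall>\<xi> \<in> Hom_H n smul \<tau>. \<forall>v \<in> fixed_vectors \<tau> (K_int n).
          \<xi> (hecke_act smul \<mu> \<tau> \<phi> v) =
            of_nat l ^ (n ^ 2) / (of_nat l - 1) *
              inverse (L_factor l (2 * n) smul (twist smul \<sigma> \<omega>) (1 / 2)) * \<xi> v)) \<and>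
    (\<forall>g \<in> carrier (Gt n).
      \<phi> g = (\<Sum>r\<le>n. b r * indicator ((g_elt l n r, 1) <#\<^bsub>Gt n\<^esub> K_int n) g)) \<and>
    (\<forall>r\<le>n. (V1 l n r :: ('a \<times> 'a mat \<times> 'a mat) set) \<subseteq> H_int n \<and>
      (let index_set = rcosets\<^bsub>(H_grp n)\<lparr>carrier := H_int n\<rparr>\<^esub> (V1 l n r :: ('a \<times> 'a mat \<times> 'a mat) set) in
        finite index_set \<and>
        (real l - 1) * of_int (b r) * inverse (real (card index_set)) \<in> \<int>))"
proof -
 interpret padic_field "TYPE('a)" l by (rule assms(1))
 let ?q = "of_nat l :: complex"
 let ?M = "\<lambda>r. Nr n {..<n} {..<n} r"
 \<comment> \<open>The coefficients are read off from \<open>H_sum\<close>, multiplied by the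
   constant of the theorem. They depend on \<open>l\<close>, \<open>n\<close> and \<open>r\<close>
   alone, so one function serves all characters, functionals and spherical vectors.\<close>
 have "\<exists>b :: int. r \<le> n \<longrightarrow> ((of_int b :: complex) = ?q ^ (n\<^sup>2) / (?q - 1) * (co ?q (1 / ?q) r (n - r) * of_nat (?M r)) \<and>
  (\<forall>c. c = (if r < n then ?M r * (l - 1) else ?M r) \<longrightarrow> (real l - 1) * of_int b * inverse (real c) \<in> \<int>))" for r
  using coefficient_exists[OF assms(2), of r] by blast
 then obtain b :: "nat => int" where b:
  "\<And>r. r \<le> n ==> (of_int (b r) :: complex) = ?q ^ (n\<^sup>2) / (?q - 1) * (co ?q (1 / ?q) r (n - r) * of_nat (?M r))"
  "\<And>r c. r \<le> n ==> c = (if r < n then ?M r * (l - 1) else ?M r) ==> (real l - 1) * of_int (b r) * inverse (real c) \<in> \<int>"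
  by metis
 define \<phi> :: "('a \<times> 'a mat) \<times> 'a => int"
  where "\<phi> = (\<lambda>x. \<Sum>r\<in>{..n}. b r * indicator ((g_elt l n r, 1) <#\<^bsub>Gt n\<^esub> K_int n) x)"
 have vs: "vector_space smul" using assms(3) by (simp add: group_rep_def)
 have lc: "loc_const_compact_supp (Gt_top n) \<phi>"
  unfolding \<phi>_def g_elt_um
  by (rule clopen_step_loc_const_compact_supp[OF finite_atMost K_coset_top[OF um_GL(1)]]) simp
 have act: "\<xi> (hecke_act smul \<mu> \<tau> \<phi> v) =
   of_nat l ^ (n ^ 2) / (of_nat l - 1) * inverse (L_factor l (2 * n) smul (twist smul \<sigma> \<omega>) (1 / 2)) * \<xi> v"
  if \<omega>: "unramified_char \<omega>" and \<tau>: "\<tau> = box_inv_char smul (triv_box \<sigma>) \<omega>"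
   and \<xi>: "\<xi> \<in> Hom_H n smul \<tau>" and vf: "v \<in> fixed_vectors \<tau> (K_int n)" for \<omega> \<tau> \<xi> v
 proof -
  interpret X: Vector_Spaces.linear smul "(*)" \<xi> using \<xi> by (simp add: Hom_H_def)
  interpret VS: vector_space smul by (rule vs)
  have v: "\<sigma> k v = v" if k: "k \<in> KG (2 * n)" for k
  proof -
   have "((1, k), 1) \<in> K_int n" using k by (simp add: K_int_def GL1_int_iff)
   then have "\<tau> ((1, k), 1) v = v" using vf by (auto simp: fixed_vectors_def)
   then show ?thesis unfolding \<tau> box_inv_char_def triv_box_def using unram(3)[OF \<omega>, of 1] by simp
  qed
  have mult: "\<sigma> (g * h) v = \<sigma> g (\<sigma> h v)" if "g \<in> GLc (2 * n)" "h \<in> GLc (2 * n)" for g h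
   using assms(3) that unfolding group_rep_def by simp
  let ?x = "\<lambda>r. \<xi> (\<sigma> (ur n r) v)"
  have "\<xi> (hecke_act smul \<mu> \<tau> \<phi> v) = \<xi> (\<Sum>r\<in>{..n}. smul (of_int (b r)) (\<sigma> (ur n r) v))"
   unfolding \<tau> \<phi>_def by (subst hecke_act_phi[OF assms(9) vs mult v \<omega>]) auto
  also have "\<dots> = (\<Sum>r\<le>n. of_int (b r) * ?x r)" by (simp only: X.sum X.scale)
  also have "\<dots> = (\<Sum>r\<le>n. ?q ^ (n\<^sup>2) / (?q - 1) * (co ?q (1 / ?q) r (n - r) * of_nat (?M r) * ?x r))"
   by (intro sum.cong refl) (simp only: b(1) atMost_iff mult.assoc)
  also have "\<dots> = ?q ^ (n\<^sup>2) / (?q - 1) * (\<Sum>r\<le>n. co ?q (1 / ?q) r (n - r) * of_nat (?M r) * ?x r)"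
   by (simp only: sum_distrib_left)
  also have "(\<Sum>r\<le>n. co ?q (1 / ?q) r (n - r) * of_nat (?M r) * ?x r) =
   inverse (L_factor l (2 * n) smul (twist smul \<sigma> \<omega>) (1 / 2)) * \<xi> v"
   by (rule Hom_H_eigenvalue[OF assms(2-7) \<omega> \<xi>[unfolded \<tau>] v])
  finally show ?thesis by (simp only: mult.assoc)
 qed
 show ?thesis unfolding Let_def
 proof (intro exI[of _ \<phi>] exI[of _ b] conjI allI impI ballI)
  show "loc_const_compact_supp (Gt_top n) \<phi>" by (rule lc)
 next
  fix \<omega> :: "'a => complex" and \<xi> v
  assume "unramified_char \<omega> \<and> finite_order_char \<omega>" "\<xi> \<in> Hom_H n smul (box_inv_char smul (triv_box \<sigma>) \<omega>)"
   "v \<in> fixed_vectors (box_inv_char smul (triv_box \<sigma>) \<omega>) (K_int n)"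
  then show "\<xi> (hecke_act smul \<mu> (box_inv_char smul (triv_box \<sigma>) \<omega>) \<phi> v) =
   of_nat l ^ (n ^ 2) / (of_nat l - 1) * inverse (L_factor l (2 * n) smul (twist smul \<sigma> \<omega>) (1 / 2)) * \<xi> v"
   by (intro act) auto
 next
  fix g show "\<phi> g = (\<Sum>r\<le>n. b r * indicator ((g_elt l n r, 1) <#\<^bsub>Gt n\<^esub> K_int n) g)" by (simp only: \<phi>_def)
 next
  fix r assume r: "r \<le> n"
  show "V1 l n r \<subseteq> (H_int n :: ('a \<times> 'a mat \<times> 'a mat) set)" by (rule V1_subset)
  show "finite (rcosets\<^bsub>(H_grp n)\<lparr>carrier := H_int n\<rparr>\<^esub> (V1 l n r :: ('a \<times> 'a mat \<times> 'a mat) set))"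
   by (rule card_rcosets(1)[OF r])
  show "(real l - 1) * of_int (b r) *
   inverse (real (card (rcosets\<^bsub>(H_grp n)\<lparr>carrier := H_int n\<rparr>\<^esub> (V1 l n r :: ('a \<times> 'a mat \<times> 'a mat) set)))) \<in> \<int>"
   by (rule b(2)[OF r card_rcosets(2)[OF r]])
 qed
qed

end
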